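(* Let $k$ be a field with $\operatorname{char}(k)\neq 2$, let $G$ be a finite group and let $V$ be a finite dimensional $kG$-module. Let $S=T_k(V)/(R)$ be a Koszul algebra with subspace $R\subset V\otimes V$ closed under the action of $G$, and put $A=S\rtimes G$. Then a filtered algebra $\mathcal{H}$ is a PBW deformation of $S\rtimes G$ if and only if $$\mathcal{H}\cong \mathcal{H}_{\lambda,\alpha,\beta}$$ for some linear parameter functions $\alpha:R\to V\otimes kG$, $\beta:R\to kG$, $\lambda:kG\otimes V\to kG$ satisfying the following conditions, upon projection of images of the maps to $S\rtimes G$: (1) $1\otimes\lambda-\lambda(m\otimes 1)+(\lambda\otimes 1)(1\otimes\sigma)=0$; (2) $\lambda(\lambda\otimes 1)-\lambda(1\otimes\alpha)=(1\otimes\beta)-(\beta\otimes 1)(1\otimes\sigma)(\sigma\otimes 1)$; (3) $(1\otimes\alpha)-(\alpha\otimes 1)(1\otimes\sigma)(\sigma\otimes 1)=\lambda\otimes 1+(1\otimes\lambda)(\sigma\otimes 1)$; (4) $\alpha\big((1\otimes\sigma)(\alpha\otimes 1)-1\otimes\alpha\big)+\sum_{g\in G}\alpha_g\otimes\lambda(g\otimes -)=1\otimes\beta-\beta\otimes 1$; (5) $\beta\big((1\otimes\sigma)(\alpha\otimes 1)-1\otimes\alpha\big)=-\lambda(\beta\otimes 1)$; (6) $\alpha\otimes 1-1\otimes\alpha=0$. Here the map in (1) is defined on $kG\otimes kG\otimes V$, the maps in (2) and (3) are defined on $kG\otimes R$, the map in (6) is defined on $(V\otimes R)\cap(R\otimes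 V)\subset V\otimes V\otimes V$, and (6) implies that the maps in (4) and (5) are also defined on $(V\otimes R)\cap(R\otimes V)$.
   Context: All tensor products without subscript are over $k$. The action of $g\in G$ on $v\in V$ is written ${}^gv$, and $G$ acts diagonally on $V\otimes V$. **Skew group algebra.** $A=S\rtimes G$ is the $k$-algebra generated by $kG$ and $V$ with relations $R$ and $gv={}^gv\,g$; as a vector space it is $S\otimes kG$. It is graded with $G$ in degree $0$ and $V$ in degree $1$. As graded algebras $S\rtimes G\cong T_{kG}(kG\otimes V\otimes kG)/(R\cup R')$, where $$R'=\operatorname{Span}_k\{g\otimes v\otimes 1-1\otimes{}^gv\otimes g: g\in G,\ v\in V\}\subset kG\otimes V\otimes kG,$$ and $R\subset V\otimes V$ is viewed inside $k\otimes V\otimes k\otimes V\otimes k\subset kG\otimes V\otimes kG\otimes V\otimes kG\cong (kG\otimes V\otimes kG)\otimes_{kG}(kG\otimes V\otimes kG)$. **The algebra.** With $v\in V$ identified with $1\otimes v\otimes 1$, $$\mathcal{H}_{\lambda,\alpha,\beta}=T_{kG}(kG\otimes V\otimes kG)\big/\big(r-\alpha(r)-\beta(r),\ \ g\otimes v\otimes 1-1\otimes{}^gv\otimes g-\lambda(g\otimes v)\ :\ r\in R,\ g\in G,\ v\in V\big),$$ filtered with $kG$ in degree $0$ and $V$ in degree $1$. Here $V\otimes kG\cong k\otimes V\otimes kG\subset kG\otimes V\otimes kG$. (Linear functions $\lambda:R'\to kG$ are identified with functions $\lambda:kG\otimes V\to kG$ via $\lambda(g\otimes v)=\lambda(g\otimes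 v\otimes 1-1\otimes{}^gv\otimes g)$; these satisfy $\lambda(1_G\otimes v)=0$, which is also forced by condition (1).) **PBW deformation.** For a filtered algebra presented as $\mathcal{H}=T_{kG}(U)/(P)$, with $U=kG\otimes V\otimes kG$ in degree $1$, an element of $T_{kG}(U)$ has filtered degree $d$ if it lies in $\bigoplus_{i\le d}U^{\otimes_{kG}i}$ but not in $\bigoplus_{i\le d-1}U^{\otimes_{kG}i}$. The homogeneous version of the presentation is $T_{kG}(U)$ modulo the ideal generated by the degree-$d$ homogeneous components of the elements of $P$ of filtered degree $d$, for all $d$. $\mathcal{H}$ (with its presentation) is a PBW deformation of $S\rtimes G$ if its homogeneous version is $S\rtimes G=T_{kG}(U)/(R\cup R')$ and the associated graded algebra $\mathrm{Gr}(\mathcal{H})$ is isomorphic to $S\rtimes G$ as a graded algebra. The isomorphism $\mathcal H\cong\mathcal H_{\lambda,\alpha,\beta}$ is one of filtered algebras. **Notation in the conditions.** $m:kG\otimes kG\to kG$ is multiplication; $\sigma:kG\otimes V\to V\otimes kG$ is $\sigma(g\otimes v)={}^gv\otimes g$. Write $\alpha(r)=\sum_{g\in G}\alpha_g(r)\,g$ with $\alpha_g:R\to V$. $\lambda(g\otimes-):V\to kG$ is $v\mapsto\lambda(g\otimes v)$. The functions $\alpha,\beta$ are extended to right $kG$-module homomorphisms $R\otimes kG\to V\otimes kG$ and $R\otimes kG\to kG$; likewise $\lambda$ is extended right $kG$-linearly to $kG\otimes V\otimes kG$. "Projection to $S\rtimes G$" means applying multiplication in $A$ to the tensors obtained. Thus,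 for $g,h\in G$, $v\in V$, $r=\sum_i v_i\otimes w_i\in R$: - (1) reads $g\lambda(h\otimes v)-\lambda(gh\otimes v)+\lambda(g\otimes{}^hv)h=0$ in $kG$; - (2) reads $\sum_i\lambda(\lambda(g\otimes v_i)\otimes w_i)-\sum_{a\in G}\lambda(g\otimes\alpha_a(r))a=g\beta(r)-\beta({}^gr)g$; - (3) reads $g\alpha(r)-\alpha({}^gr)g=\sum_i\lambda(g\otimes v_i)w_i+\sum_i{}^gv_i\,\lambda(g\otimes w_i)$ in $A$. For $x\in(V\otimes R)\cap(R\otimes V)$, the maps $\alpha\otimes1,\ \beta\otimes 1,\ \alpha_g\otimes\lambda(g\otimes-)$ are evaluated by viewing $x\in R\otimes V$ and $1\otimes\alpha,\ 1\otimes\beta$ by viewing $x\in V\otimes R$. Condition (6) says $(\alpha\otimes1-1\otimes\alpha)(x)$ is $0$ in $A$, which is equivalent to $\big((1\otimes\sigma)(\alpha\otimes1)-1\otimes\alpha\big)(x)\in R\otimes kG\subset V\otimes V\otimes kG$, so that $\alpha$ and $\beta$ can be applied to it in (4) and (5). *)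

theory Defs
  imports "HOL-Algebra.Algebra" "HOL-Library.Poly_Mapping"
begin

section \<open>Associative algebras, filtrations and gradings\<close>

text \<open>
  The scalars are a type of class \<^class>\<open>field\<close>.  An associative unital algebra over it
  is a (not necessarily commutative) ring record together with \<open>smult\<close>, that is, the record
  \<open>module\<close> of HOL-Algebra.  (The locale \<open>algebra\<close> of HOL-Algebra demands commutativity.)
\<close>

locale k_algebra = ring A for A :: "('k::field, 'a, 'm) module_scheme" (structure) +
  assumes k_smult_closed: "x \<in> carrier A \<Longrightarrow> c \<odot> x \<in> carrier A"
    and k_smult_l_distr: "x \<in> carrier A \<Longrightarrow> (c + d) \<odot> x = c \<odot> x \<oplus> d \<odot> x"
    and k_smult_r_distr:
      "x \<in> carrier A \<Longrightarrow> y \<in> carrier A \<Longrightarrow> c \<odot> (x \<oplus> y) = c \<odot> x \<oplus> c \<odot> y"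
    and k_smult_assoc: "x \<in> carrier A \<Longrightarrow> (c * d) \<odot> x = c \<odot> (d \<odot> x)"
    and k_smult_one: "x \<in> carrier A \<Longrightarrow> 1 \<odot> x = x"
    and k_smult_mult_l:
      "x \<in> carrier A \<Longrightarrow> y \<in> carrier A \<Longrightarrow> (c \<odot> x) \<otimes> y = c \<odot> (x \<otimes> y)"
    and k_smult_mult_r:
      "x \<in> carrier A \<Longrightarrow> y \<in> carrier A \<Longrightarrow> x \<otimes> (c \<odot> y) = c \<odot> (x \<otimes> y)"

definition k_subspace :: "('k::field, 'a, 'm) module_scheme \<Rightarrow> 'a set \<Rightarrow> bool" where
  "k_subspace A W \<longleftrightarrow> W \<subseteq> carrier A \<and> \<zero>\<^bsub>A\<^esub> \<in> W
     \<and> (\<forall>x\<in>W. \<forall>y\<in>W. x \<oplus>\<^bsub>A\<^esub> y \<in> W) \<and> (\<forall>c. \<forall>x\<in>W. c \<odot>\<^bsub>A\<^esub> x \<in> W)"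

definition k_span :: "('k::field, 'a, 'm) module_scheme \<Rightarrow> 'a set \<Rightarrow> 'a set" where
  "k_span A Y = \<Inter>{W. k_subspace A W \<and> Y \<subseteq> W}"

definition alg_iso ::
    "('k::field, 'a, 'm) module_scheme \<Rightarrow> ('k, 'b, 'n) module_scheme \<Rightarrow> ('a \<Rightarrow> 'b) set" where
  "alg_iso A B =
     {f \<in> ring_iso A B. \<forall>c. \<forall>x\<in>carrier A. f (c \<odot>\<^bsub>A\<^esub> x) = c \<odot>\<^bsub>B\<^esub> f x}"

definition filtered_algebra ::
    "('k::field, 'a, 'm) module_scheme \<Rightarrow> (nat \<Rightarrow> 'a set) \<Rightarrow> bool" where
  "filtered_algebra A F \<longleftrightarrow> k_algebra A \<and> (\<forall>i. k_subspace A (F i)) \<and> (\<forall>i. F i \<subseteq> F (Suc i))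
     \<and> (\<Union>i. F i) = carrier A \<and> \<one>\<^bsub>A\<^esub> \<in> F 0
     \<and> (\<forall>i j. \<forall>x\<in>F i. \<forall>y\<in>F j. x \<otimes>\<^bsub>A\<^esub> y \<in> F (i + j))"

text \<open>
  In the first definition \<open>D\<close> and \<open>E\<close> are filtrations; in the second one they are the families of
  homogeneous components of gradings.
\<close>

definition filtered_isomorphic ::
    "('k::field, 'a, 'm) module_scheme \<Rightarrow> (nat \<Rightarrow> 'a set)
      \<Rightarrow> ('k, 'b, 'n) module_scheme \<Rightarrow> (nat \<Rightarrow> 'b set) \<Rightarrow> bool" where
  "filtered_isomorphic A D B E \<longleftrightarrow> (\<exists>f\<in>alg_iso A B. \<forall>i. f ` D i = E i)"

definition graded_isomorphic ::
    "('k::field, 'a, 'm) module_scheme \<Rightarrow> (nat \<Rightarrow> 'a set)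
      \<Rightarrow> ('k, 'b, 'n) module_scheme \<Rightarrow> (nat \<Rightarrow> 'b set) \<Rightarrow> bool" where
  "graded_isomorphic A D B E \<longleftrightarrow> (\<exists>f\<in>alg_iso A B. \<forall>i. f ` D i = E i)"

definition alg_quot ::
    "('k::field, 'a, 'm) module_scheme \<Rightarrow> 'a set \<Rightarrow> ('k, 'a set) module" where
  "alg_quot A I = ring.extend (A Quot I)
     (module.fields (\<lambda>c C. \<Union>x\<in>C. I +>\<^bsub>A\<^esub> (c \<odot>\<^bsub>A\<^esub> x)))"

text \<open>The image of a filtration or of a grading in the quotient by \<open>I\<close>.\<close>

definition quot_image ::
    "('k::field, 'a, 'm) module_scheme \<Rightarrow> 'a set \<Rightarrow> (nat \<Rightarrow> 'a set) \<Rightarrow> nat \<Rightarrow> 'a set set" where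
  "quot_image A I F i = (\<lambda>x. I +>\<^bsub>A\<^esub> x) ` F i"

subsection \<open>The associated graded algebra\<close>

text \<open>
  An element of \<open>Gr A = (\<Oplus>i. F i / F (i - 1))\<close>, with \<open>F (-1) = 0\<close>, is a family whose \<open>i\<close>-th
  member is a coset of \<open>F (i - 1)\<close> in \<open>F i\<close>, almost all members being zero.
\<close>

definition filt_below :: "('k::field, 'a, 'm) module_scheme \<Rightarrow> (nat \<Rightarrow> 'a set) \<Rightarrow> nat \<Rightarrow> 'a set" where
  "filt_below A F i = (case i of 0 \<Rightarrow> {\<zero>\<^bsub>A\<^esub>} | Suc j \<Rightarrow> F j)"

definition assoc_graded ::
    "('k::field, 'a, 'm) module_scheme \<Rightarrow> (nat \<Rightarrow> 'a set) \<Rightarrow> ('k, nat \<Rightarrow> 'a set) module" where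
  "assoc_graded A F = \<lparr>
     carrier = {x. (\<forall>i. x i \<in> (\<lambda>a. filt_below A F i +>\<^bsub>A\<^esub> a) ` F i)
                   \<and> finite {i. x i \<noteq> filt_below A F i}},
     monoid.mult = (\<lambda>x y n. \<Union>a\<in>{a. \<forall>i\<le>n. a i \<in> x i}. \<Union>b\<in>{b. \<forall>i\<le>n. b i \<in> y i}.
               filt_below A F n +>\<^bsub>A\<^esub> (\<Oplus>\<^bsub>A\<^esub>i\<in>{..n}. a i \<otimes>\<^bsub>A\<^esub> b (n - i))),
     one = (\<lambda>n. if n = 0 then {\<one>\<^bsub>A\<^esub>} else filt_below A F n),
     ring.zero = filt_below A F,
     ring.add = (\<lambda>x y n. x n <+>\<^bsub>A\<^esub> y n),
     smult = (\<lambda>c x n. \<Union>a\<in>x n. filt_below A F n +>\<^bsub>A\<^esub> (c \<odot>\<^bsub>A\<^esub> a)) \<rparr>"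

definition assoc_graded_comp ::
    "('k::field, 'a, 'm) module_scheme \<Rightarrow> (nat \<Rightarrow> 'a set) \<Rightarrow> nat \<Rightarrow> (nat \<Rightarrow> 'a set) set" where
  "assoc_graded_comp A F d =
     {x \<in> carrier (assoc_graded A F). \<forall>i. i \<noteq> d \<longrightarrow> x i = filt_below A F i}"

subsection \<open>Koszul algebras\<close>

text \<open>
  A graded algebra \<open>S = (\<Oplus>i. D i)\<close>, generated in degree 1 by finitely many elements and with
  \<open>D 0 = k\<close>, is Koszul if the trivial module \<open>k = S / (\<Oplus>i\<ge>1. D i)\<close> has a linear graded free
  resolution, i.e. an exact sequence of left modules
  \<open>\<dots> \<rightarrow> S\<^sup>b\<^sup>(\<^sup>2\<^sup>) \<rightarrow> S\<^sup>b\<^sup>(\<^sup>1\<^sup>) \<rightarrow> S \<rightarrow> k \<rightarrow> 0\<close> in which every map between free modules is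
  given by a matrix with entries in \<open>D 1\<close>.  (Such a resolution is automatically minimal, the
  generators of the \<open>n\<close>-th free module sitting in degree \<open>n\<close>.)  The elements of the free modules
  are row vectors, and \<open>M n\<close> is the \<open>b (n + 1) \<times> b n\<close> matrix of the map from the \<open>(n + 1)\<close>-st to
  the \<open>n\<close>-th module.
\<close>

definition row_times ::
    "('k::field, 'a, 'm) module_scheme \<Rightarrow> nat \<Rightarrow> (nat \<Rightarrow> 'a) \<Rightarrow> (nat \<Rightarrow> nat \<Rightarrow> 'a) \<Rightarrow> nat \<Rightarrow> 'a" where
  "row_times S p x M j = (\<Oplus>\<^bsub>S\<^esub>i\<in>{..<p}. x i \<otimes>\<^bsub>S\<^esub> M i j)"

definition koszul :: "('k::field, 'a, 'm) module_scheme \<Rightarrow> (nat \<Rightarrow> 'a set) \<Rightarrow> bool" where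
  "koszul S D \<longleftrightarrow> (\<exists>(b :: nat \<Rightarrow> nat) (M :: nat \<Rightarrow> nat \<Rightarrow> nat \<Rightarrow> 'a).
     b 0 = 1
     \<and> (\<forall>n. \<forall>i<b (Suc n). \<forall>j<b n. M n i j \<in> D 1)
     \<and> {row_times S (b 1) x (M 0) 0 | x. x \<in> {..<b 1} \<rightarrow> carrier S} = k_span S (\<Union>d\<in>{1..}. D d)
     \<and> (\<forall>n. \<forall>x\<in>{..<b (Suc n)} \<rightarrow> carrier S.
          (\<forall>j<b n. row_times S (b (Suc n)) x (M n) j = \<zero>\<^bsub>S\<^esub>) \<longleftrightarrow>
          (\<exists>y\<in>{..<b (Suc (Suc n))} \<rightarrow> carrier S. \<forall>i<b (Suc n).
             x i = row_times S (b (Suc (Suc n))) y (M (Suc n)) i)))"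

section \<open>Group algebras and tensor algebras\<close>

text \<open>The algebra with basis a monoid; for a group it is the group algebra.\<close>

definition monoid_alg :: "('w, 'z) monoid_scheme \<Rightarrow> ('k::field, 'w \<Rightarrow>\<^sub>0 'k) module" where
  "monoid_alg W = \<lparr>
     carrier = {p. Poly_Mapping.keys p \<subseteq> carrier W},
     monoid.mult = (\<lambda>p q. \<Sum>u\<in>Poly_Mapping.keys p. \<Sum>w\<in>Poly_Mapping.keys q.
        Poly_Mapping.single (u \<otimes>\<^bsub>W\<^esub> w) (Poly_Mapping.lookup p u * Poly_Mapping.lookup q w)),
     one = Poly_Mapping.single \<one>\<^bsub>W\<^esub> 1,
     ring.zero = 0,
     ring.add = (+),
     smult = (\<lambda>c. Poly_Mapping.map ((*) c)) \<rparr>"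

text \<open>
  For a vector space with basis \<open>B\<close> the tensor algebra \<open>T\<^sub>k(V)\<close> is the algebra with basis
  the words in \<open>B\<close>, a word \<open>[b\<^sub>1, \<dots>, b\<^sub>n]\<close> standing for \<open>b\<^sub>1 \<otimes> \<dots> \<otimes> b\<^sub>n\<close>.
\<close>

definition free_monoid :: "'v set \<Rightarrow> 'v list monoid" where
  "free_monoid B = \<lparr>carrier = lists B, monoid.mult = (@), one = []\<rparr>"

definition tensor_alg :: "'v set \<Rightarrow> ('k::field, 'v list \<Rightarrow>\<^sub>0 'k) module" where
  "tensor_alg B = monoid_alg (free_monoid B)"

definition tensor_power :: "'v set \<Rightarrow> nat \<Rightarrow> ('v list \<Rightarrow>\<^sub>0 'k::field) set" where
  "tensor_power B n =
     {p \<in> carrier (tensor_alg B). \<forall>w\<in>Poly_Mapping.keys p. length w = n}"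

text \<open>
  Put \<open>U = kG \<otimes> V \<otimes> kG\<close>.  The \<open>n\<close>-fold tensor power of \<open>U\<close> over \<open>kG\<close> is
  \<open>kG \<otimes> V \<otimes> kG \<otimes> \<dots> \<otimes> V \<otimes> kG\<close> (\<open>n\<close> factors \<open>V\<close>, tensor products over \<open>k\<close>) and has the
  basis \<open>g\<^sub>0 \<otimes> b\<^sub>1 \<otimes> g\<^sub>1 \<otimes> \<dots> \<otimes> b\<^sub>n \<otimes> g\<^sub>n\<close> with \<open>g\<^sub>i \<in> G\<close>, \<open>b\<^sub>i \<in> B\<close>; such a basis
  element is encoded as \<open>(g\<^sub>0, [(b\<^sub>1, g\<^sub>1), \<dots>, (b\<^sub>n, g\<^sub>n)])\<close>.  Multiplying two of them in
  \<open>T\<^sub>k\<^sub>G(U)\<close> multiplies the last group element of the first one with the first group element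
  of the second one, as the tensor product joining them is over \<open>kG\<close>.
\<close>

definition bimod_words ::
    "('g, 'z) monoid_scheme \<Rightarrow> 'v set \<Rightarrow> ('g \<times> ('v \<times> 'g) list) monoid" where
  "bimod_words G B = \<lparr>
     carrier = carrier G \<times> lists (B \<times> carrier G),
     monoid.mult = (\<lambda>(g, xs) (h, ys).
        if xs = [] then (g \<otimes>\<^bsub>G\<^esub> h, ys)
        else (g, butlast xs @ (fst (last xs), snd (last xs) \<otimes>\<^bsub>G\<^esub> h) # ys)),
     one = (\<one>\<^bsub>G\<^esub>, []) \<rparr>"

definition bimod_tensor_alg ::
    "('g, 'z) monoid_scheme \<Rightarrow> 'v set \<Rightarrow> ('k::field, ('g \<times> ('v \<times> 'g) list) \<Rightarrow>\<^sub>0 'k) module" where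
  "bimod_tensor_alg G B = monoid_alg (bimod_words G B)"

definition bimod_filt ::
    "('g, 'z) monoid_scheme \<Rightarrow> 'v set \<Rightarrow> nat \<Rightarrow> (('g \<times> ('v \<times> 'g) list) \<Rightarrow>\<^sub>0 'k::field) set" where
  "bimod_filt G B n =
     {p \<in> carrier (bimod_tensor_alg G B). \<forall>w\<in>Poly_Mapping.keys p. length (snd w) \<le> n}"

definition has_filt_degree ::
    "('g, 'z) monoid_scheme \<Rightarrow> 'v set \<Rightarrow> (('g \<times> ('v \<times> 'g) list) \<Rightarrow>\<^sub>0 'k::field) \<Rightarrow> nat \<Rightarrow> bool" where
  "has_filt_degree G B p d \<longleftrightarrow>
     p \<in> bimod_filt G B d \<and> p \<notin> filt_below (bimod_tensor_alg G B) (bimod_filt G B) d"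

definition hom_comp ::
    "nat \<Rightarrow> (('g \<times> ('v \<times> 'g) list) \<Rightarrow>\<^sub>0 'k::field) \<Rightarrow> (('g \<times> ('v \<times> 'g) list) \<Rightarrow>\<^sub>0 'k)" where
  "hom_comp d p = (\<Sum>w\<in>{w \<in> Poly_Mapping.keys p. length (snd w) = d}.
     Poly_Mapping.single w (Poly_Mapping.lookup p w))"

definition leading_comps ::
    "('g, 'z) monoid_scheme \<Rightarrow> 'v set \<Rightarrow> (('g \<times> ('v \<times> 'g) list) \<Rightarrow>\<^sub>0 'k::field) set
      \<Rightarrow> (('g \<times> ('v \<times> 'g) list) \<Rightarrow>\<^sub>0 'k) set" where
  "leading_comps G B P = {hom_comp d p | p d. p \<in> P \<and> has_filt_degree G B p d}"

section \<open>Skew group algebras\<close>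

text \<open>
  An element \<open>x\<close> of \<open>S \<rtimes> G\<close> is \<open>(\<Sum>g. x g \<cdot> g)\<close> with \<open>x g \<in> S\<close>; \<open>\<rho> g\<close> is the
  automorphism of \<open>S\<close> by which \<open>g\<close> acts.
\<close>

definition skew_alg ::
    "('k::field, 's, 'm) module_scheme \<Rightarrow> ('g, 'z) monoid_scheme \<Rightarrow> ('g \<Rightarrow> 's \<Rightarrow> 's)
      \<Rightarrow> ('k, 'g \<Rightarrow> 's) module" where
  "skew_alg S G \<rho> = \<lparr>
     carrier = {x. (\<forall>g\<in>carrier G. x g \<in> carrier S) \<and> (\<forall>g. g \<notin> carrier G \<longrightarrow> x g = \<zero>\<^bsub>S\<^esub>)},
     monoid.mult = (\<lambda>x y h. if h \<in> carrier G
        then \<Oplus>\<^bsub>S\<^esub>g\<in>carrier G. x g \<otimes>\<^bsub>S\<^esub> \<rho> g (y (inv\<^bsub>G\<^esub> g \<otimes>\<^bsub>G\<^esub> h)) else \<zero>\<^bsub>S\<^esub>),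
     one = (\<lambda>g. if g = \<one>\<^bsub>G\<^esub> then \<one>\<^bsub>S\<^esub> else \<zero>\<^bsub>S\<^esub>),
     ring.zero = (\<lambda>g. \<zero>\<^bsub>S\<^esub>),
     ring.add = (\<lambda>x y g. x g \<oplus>\<^bsub>S\<^esub> y g),
     smult = (\<lambda>c x g. c \<odot>\<^bsub>S\<^esub> x g) \<rparr>"

definition is_rep ::
    "('k::field \<Rightarrow> 'v::ab_group_add \<Rightarrow> 'v) \<Rightarrow> ('g, 'z) monoid_scheme \<Rightarrow> ('g \<Rightarrow> 'v \<Rightarrow> 'v) \<Rightarrow> bool" where
  "is_rep scale G act \<longleftrightarrow>
     (\<forall>g\<in>carrier G. Vector_Spaces.linear scale scale (act g))
     \<and> (\<forall>v. act \<one>\<^bsub>G\<^esub> v = v)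
     \<and> (\<forall>g\<in>carrier G. \<forall>h\<in>carrier G. \<forall>v. act (g \<otimes>\<^bsub>G\<^esub> h) v = act g (act h v))"

context
  fixes scale :: "'k::field \<Rightarrow> 'v::ab_group_add \<Rightarrow> 'v"
    and B :: "'v set"
    and G :: "('g, 'z) monoid_scheme"
    and act :: "'g \<Rightarrow> 'v \<Rightarrow> 'v"
    and R :: "('v list \<Rightarrow>\<^sub>0 'k) set"
begin

private abbreviation (input) coord :: "'v \<Rightarrow> 'v \<Rightarrow> 'k" where
  "coord v b \<equiv> Modules.module.representation scale B v b"

private abbreviation (input) TV :: "('k, 'v list \<Rightarrow>\<^sub>0 'k) module" where
  "TV \<equiv> tensor_alg B"

private abbreviation (input) kG :: "('k, 'g \<Rightarrow>\<^sub>0 'k) module" where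
  "kG \<equiv> monoid_alg G"

private abbreviation (input) TU :: "('k, ('g \<times> ('v \<times> 'g) list) \<Rightarrow>\<^sub>0 'k) module" where
  "TU \<equiv> bimod_tensor_alg G B"

private abbreviation (input) gr :: "'g \<Rightarrow> 'g \<Rightarrow>\<^sub>0 'k" where
  "gr g \<equiv> Poly_Mapping.single g 1"

subsection \<open>The algebras \<open>S = T\<^sub>k(V)/(R)\<close> and \<open>S \<rtimes> G\<close>\<close>

definition V_to_TV :: "'v \<Rightarrow> 'v list \<Rightarrow>\<^sub>0 'k" where
  "V_to_TV v = (\<Sum>b\<in>B. Poly_Mapping.single [b] (coord v b))"

text \<open>The diagonal action on tensor powers: \<open>b\<^sub>1 \<otimes> \<dots> \<otimes> b\<^sub>n\<close> goes to
  \<open>\<^sup>gb\<^sub>1 \<otimes> \<dots> \<otimes> \<^sup>gb\<^sub>n\<close>.\<close>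

definition act_tensor :: "'g \<Rightarrow> ('v list \<Rightarrow>\<^sub>0 'k) \<Rightarrow> ('v list \<Rightarrow>\<^sub>0 'k)" where
  "act_tensor g p = (\<Sum>w\<in>Poly_Mapping.keys p.
     Poly_Mapping.lookup p w \<odot>\<^bsub>TV\<^esub> foldr (\<lambda>b q. V_to_TV (act g b) \<otimes>\<^bsub>TV\<^esub> q) w \<one>\<^bsub>TV\<^esub>)"

definition quad_alg :: "('k, ('v list \<Rightarrow>\<^sub>0 'k) set) module" where
  "quad_alg = alg_quot TV (Idl\<^bsub>TV\<^esub> R)"

definition quad_comp :: "nat \<Rightarrow> ('v list \<Rightarrow>\<^sub>0 'k) set set" where
  "quad_comp = quot_image TV (Idl\<^bsub>TV\<^esub> R) (tensor_power B)"

definition skew_quad :: "('k, 'g \<Rightarrow> ('v list \<Rightarrow>\<^sub>0 'k) set) module" where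
  "skew_quad = skew_alg quad_alg G (\<lambda>g C. act_tensor g ` C)"

definition skew_quad_comp :: "nat \<Rightarrow> ('g \<Rightarrow> ('v list \<Rightarrow>\<^sub>0 'k) set) set" where
  "skew_quad_comp d = {x \<in> carrier skew_quad. \<forall>g\<in>carrier G. x g \<in> quad_comp d}"

subsection \<open>Elements of \<open>T\<^sub>k\<^sub>G(kG \<otimes> V \<otimes> kG)\<close>\<close>

text \<open>\<open>tri g v h\<close> is \<open>g \<otimes> v \<otimes> h\<close>.\<close>

definition tri :: "'g \<Rightarrow> 'v \<Rightarrow> 'g \<Rightarrow> ('g \<times> ('v \<times> 'g) list) \<Rightarrow>\<^sub>0 'k" where
  "tri g v h = (\<Sum>b\<in>B. Poly_Mapping.single (g, [(b, h)]) (coord v b))"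

definition kG_to_TU :: "('g \<Rightarrow>\<^sub>0 'k) \<Rightarrow> ('g \<times> ('v \<times> 'g) list) \<Rightarrow>\<^sub>0 'k" where
  "kG_to_TU a = (\<Sum>g\<in>Poly_Mapping.keys a. Poly_Mapping.single (g, []) (Poly_Mapping.lookup a g))"

text \<open>An element of \<open>V \<otimes> kG\<close> is a function \<open>f\<close> from \<open>G\<close> to \<open>V\<close>, standing for
  \<open>(\<Sum>g\<in>G. f g \<otimes> g)\<close>.\<close>

definition VkG_to_TU :: "('g \<Rightarrow> 'v) \<Rightarrow> ('g \<times> ('v \<times> 'g) list) \<Rightarrow>\<^sub>0 'k" where
  "VkG_to_TU f = (\<Sum>g\<in>carrier G. tri \<one>\<^bsub>G\<^esub> (f g) g)"

definition TV_to_TU :: "('v list \<Rightarrow>\<^sub>0 'k) \<Rightarrow> ('g \<times> ('v \<times> 'g) list) \<Rightarrow>\<^sub>0 'k" where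
  "TV_to_TU p = (\<Sum>w\<in>Poly_Mapping.keys p.
     Poly_Mapping.single (\<one>\<^bsub>G\<^esub>, map (\<lambda>b. (b, \<one>\<^bsub>G\<^esub>)) w) (Poly_Mapping.lookup p w))"

definition skew_rels :: "(('g \<times> ('v \<times> 'g) list) \<Rightarrow>\<^sub>0 'k) set" where
  "skew_rels = k_span TU {tri g v \<one>\<^bsub>G\<^esub> - tri \<one>\<^bsub>G\<^esub> (act g v) g | g v. g \<in> carrier G}"

subsection \<open>PBW deformations of \<open>S \<rtimes> G\<close>\<close>

definition pbw_deformation ::
    "('k, 'h, 'm) module_scheme \<Rightarrow> (nat \<Rightarrow> 'h set) \<Rightarrow> bool" where
  "pbw_deformation H F \<longleftrightarrow> (\<exists>P. P \<subseteq> carrier TU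
     \<and> filtered_isomorphic H F
         (alg_quot TU (Idl\<^bsub>TU\<^esub> P)) (quot_image TU (Idl\<^bsub>TU\<^esub> P) (bimod_filt G B))
     \<and> Idl\<^bsub>TU\<^esub> (leading_comps G B P) = Idl\<^bsub>TU\<^esub> (TV_to_TU ` R \<union> skew_rels)
     \<and> graded_isomorphic (assoc_graded H F) (assoc_graded_comp H F) skew_quad skew_quad_comp)"

subsection \<open>Parameter functions and the algebra they define\<close>

text \<open>
  The linear functions \<open>\<alpha> : R \<rightarrow> V \<otimes> kG\<close>, \<open>\<beta> : R \<rightarrow> kG\<close> and \<open>\<lambda> : kG \<otimes> V \<rightarrow> kG\<close>.  Here
  \<open>\<alpha> r g\<close> is \<open>\<alpha>\<^sub>g(r)\<close>, and \<open>lam g v\<close> is \<open>\<lambda>(g \<otimes> v)\<close> for \<open>g \<in> G\<close>.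
\<close>

definition is_alpha :: "(('v list \<Rightarrow>\<^sub>0 'k) \<Rightarrow> 'g \<Rightarrow> 'v) \<Rightarrow> bool" where
  "is_alpha \<alpha> \<longleftrightarrow> (\<forall>g\<in>carrier G.
     (\<forall>r\<in>R. \<forall>s\<in>R. \<alpha> (r + s) g = \<alpha> r g + \<alpha> s g)
     \<and> (\<forall>c. \<forall>r\<in>R. \<alpha> (c \<odot>\<^bsub>TV\<^esub> r) g = scale c (\<alpha> r g)))"

definition is_beta :: "(('v list \<Rightarrow>\<^sub>0 'k) \<Rightarrow> ('g \<Rightarrow>\<^sub>0 'k)) \<Rightarrow> bool" where
  "is_beta \<beta> \<longleftrightarrow> (\<forall>r\<in>R. \<beta> r \<in> carrier kG)
     \<and> (\<forall>r\<in>R. \<forall>s\<in>R. \<beta> (r + s) = \<beta> r + \<beta> s)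
     \<and> (\<forall>c. \<forall>r\<in>R. \<beta> (c \<odot>\<^bsub>TV\<^esub> r) = c \<odot>\<^bsub>kG\<^esub> \<beta> r)"

definition is_lam :: "('g \<Rightarrow> 'v \<Rightarrow> ('g \<Rightarrow>\<^sub>0 'k)) \<Rightarrow> bool" where
  "is_lam lam \<longleftrightarrow> (\<forall>g\<in>carrier G.
     (\<forall>v. lam g v \<in> carrier kG)
     \<and> (\<forall>v w. lam g (v + w) = lam g v + lam g w)
     \<and> (\<forall>c v. lam g (scale c v) = c \<odot>\<^bsub>kG\<^esub> lam g v))"

context
  fixes \<alpha> :: "('v list \<Rightarrow>\<^sub>0 'k) \<Rightarrow> 'g \<Rightarrow> 'v"
    and \<beta> :: "('v list \<Rightarrow>\<^sub>0 'k) \<Rightarrow> ('g \<Rightarrow>\<^sub>0 'k)"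
    and lam :: "'g \<Rightarrow> 'v \<Rightarrow> ('g \<Rightarrow>\<^sub>0 'k)"
begin

definition deform_rels :: "(('g \<times> ('v \<times> 'g) list) \<Rightarrow>\<^sub>0 'k) set" where
  "deform_rels =
     {TV_to_TU r - VkG_to_TU (\<alpha> r) - kG_to_TU (\<beta> r) | r. r \<in> R}
     \<union> {tri g v \<one>\<^bsub>G\<^esub> - tri \<one>\<^bsub>G\<^esub> (act g v) g - kG_to_TU (lam g v) | g v. g \<in> carrier G}"

definition deform_alg :: "('k, (('g \<times> ('v \<times> 'g) list) \<Rightarrow>\<^sub>0 'k) set) module" where
  "deform_alg = alg_quot TU (Idl\<^bsub>TU\<^esub> deform_rels)"

definition deform_filt :: "nat \<Rightarrow> (('g \<times> ('v \<times> 'g) list) \<Rightarrow>\<^sub>0 'k) set set" where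
  "deform_filt = quot_image TU (Idl\<^bsub>TU\<^esub> deform_rels) (bimod_filt G B)"

subsection \<open>The six conditions\<close>

text \<open>The element \<open>\<lambda>(a \<otimes> v)\<close> for \<open>a \<in> kG\<close>.\<close>

definition lam_ext :: "('g \<Rightarrow>\<^sub>0 'k) \<Rightarrow> 'v \<Rightarrow> ('g \<Rightarrow>\<^sub>0 'k)" where
  "lam_ext a v = (\<Sum>g\<in>Poly_Mapping.keys a. Poly_Mapping.lookup a g \<odot>\<^bsub>kG\<^esub> lam g v)"

text \<open>The inclusions of \<open>kG\<close>, \<open>V \<otimes> kG\<close> and \<open>V\<close> into \<open>A = S \<rtimes> G\<close>.\<close>

definition kG_to_A :: "('g \<Rightarrow>\<^sub>0 'k) \<Rightarrow> 'g \<Rightarrow> ('v list \<Rightarrow>\<^sub>0 'k) set" where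
  "kG_to_A a = (\<lambda>g. if g \<in> carrier G
     then Poly_Mapping.lookup a g \<odot>\<^bsub>quad_alg\<^esub> \<one>\<^bsub>quad_alg\<^esub> else \<zero>\<^bsub>quad_alg\<^esub>)"

definition VkG_to_A :: "('g \<Rightarrow> 'v) \<Rightarrow> 'g \<Rightarrow> ('v list \<Rightarrow>\<^sub>0 'k) set" where
  "VkG_to_A f = (\<lambda>g. if g \<in> carrier G
     then (Idl\<^bsub>TV\<^esub> R) +>\<^bsub>TV\<^esub> V_to_TV (f g) else \<zero>\<^bsub>quad_alg\<^esub>)"

definition V_to_A :: "'v \<Rightarrow> 'g \<Rightarrow> ('v list \<Rightarrow>\<^sub>0 'k) set" where
  "V_to_A v = VkG_to_A (\<lambda>g. if g = \<one>\<^bsub>G\<^esub> then v else 0)"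

private abbreviation (input) A :: "('k, 'g \<Rightarrow> ('v list \<Rightarrow>\<^sub>0 'k) set) module" where
  "A \<equiv> skew_quad"

text \<open>
  The maps in the conditions are evaluated on an arbitrary expression of the argument as a sum of
  elementary tensors.  \<open>tens2 n v w\<close> is \<open>(\<Sum>i<n. v\<^sub>i \<otimes> w\<^sub>i)\<close>.  An element of
  \<open>(V \<otimes> R) \<inter> (R \<otimes> V)\<close> is written in the two ways
  \<open>(\<Sum>i<n. r\<^sub>i \<otimes> v\<^sub>i) = (\<Sum>j<m. u\<^sub>j \<otimes> s\<^sub>j)\<close> with \<open>r\<^sub>i, s\<^sub>j \<in> R\<close>.
\<close>

definition tens2 :: "nat \<Rightarrow> (nat \<Rightarrow> 'v) \<Rightarrow> (nat \<Rightarrow> 'v) \<Rightarrow> 'v list \<Rightarrow>\<^sub>0 'k" where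
  "tens2 n v w = (\<Sum>i<n. V_to_TV (v i) \<otimes>\<^bsub>TV\<^esub> V_to_TV (w i))"

definition overlap ::
    "nat \<Rightarrow> (nat \<Rightarrow> 'v list \<Rightarrow>\<^sub>0 'k) \<Rightarrow> (nat \<Rightarrow> 'v) \<Rightarrow> nat \<Rightarrow> (nat \<Rightarrow> 'v) \<Rightarrow> (nat \<Rightarrow> 'v list \<Rightarrow>\<^sub>0 'k) \<Rightarrow> bool"
  where
  "overlap n r v m u s \<longleftrightarrow> (\<forall>i<n. r i \<in> R) \<and> (\<forall>j<m. s j \<in> R)
     \<and> (\<Sum>i<n. r i \<otimes>\<^bsub>TV\<^esub> V_to_TV (v i)) = (\<Sum>j<m. V_to_TV (u j) \<otimes>\<^bsub>TV\<^esub> s j)"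

text \<open>
  The coefficient in \<open>V \<otimes> V\<close> at \<open>h \<in> G\<close> of the element
  \<open>((1 \<otimes> \<sigma>)(\<alpha> \<otimes> 1) - 1 \<otimes> \<alpha>)(x)\<close> of \<open>V \<otimes> V \<otimes> kG\<close>.
\<close>

definition alpha_diff ::
    "nat \<Rightarrow> (nat \<Rightarrow> 'v list \<Rightarrow>\<^sub>0 'k) \<Rightarrow> (nat \<Rightarrow> 'v) \<Rightarrow> nat \<Rightarrow> (nat \<Rightarrow> 'v) \<Rightarrow> (nat \<Rightarrow> 'v list \<Rightarrow>\<^sub>0 'k)
      \<Rightarrow> 'g \<Rightarrow> 'v list \<Rightarrow>\<^sub>0 'k" where
  "alpha_diff n r v m u s h =
     (\<Sum>i<n. V_to_TV (\<alpha> (r i) h) \<otimes>\<^bsub>TV\<^esub> V_to_TV (act h (v i)))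
     - (\<Sum>j<m. V_to_TV (u j) \<otimes>\<^bsub>TV\<^esub> V_to_TV (\<alpha> (s j) h))"

definition cond1 :: bool where
  "cond1 \<longleftrightarrow> (\<forall>g\<in>carrier G. \<forall>h\<in>carrier G. \<forall>v.
     gr g \<otimes>\<^bsub>kG\<^esub> lam h v - lam (g \<otimes>\<^bsub>G\<^esub> h) v + lam g (act h v) \<otimes>\<^bsub>kG\<^esub> gr h = 0)"

definition cond2 :: bool where
  "cond2 \<longleftrightarrow> (\<forall>g\<in>carrier G. \<forall>n v w. let r = tens2 n v w in r \<in> R \<longrightarrow>
     (\<Sum>i<n. lam_ext (lam g (v i)) (w i)) - (\<Sum>a\<in>carrier G. lam g (\<alpha> r a) \<otimes>\<^bsub>kG\<^esub> gr a)
     = gr g \<otimes>\<^bsub>kG\<^esub> \<beta> r - \<beta> (act_tensor g r) \<otimes>\<^bsub>kG\<^esub> gr g)"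

definition cond3 :: bool where
  "cond3 \<longleftrightarrow> (\<forall>g\<in>carrier G. \<forall>n v w. let r = tens2 n v w in r \<in> R \<longrightarrow>
     kG_to_A (gr g) \<otimes>\<^bsub>A\<^esub> VkG_to_A (\<alpha> r) \<ominus>\<^bsub>A\<^esub> VkG_to_A (\<alpha> (act_tensor g r)) \<otimes>\<^bsub>A\<^esub> kG_to_A (gr g)
     = (\<Oplus>\<^bsub>A\<^esub>i\<in>{..<n}. kG_to_A (lam g (v i)) \<otimes>\<^bsub>A\<^esub> V_to_A (w i))
       \<oplus>\<^bsub>A\<^esub> (\<Oplus>\<^bsub>A\<^esub>i\<in>{..<n}. V_to_A (act g (v i)) \<otimes>\<^bsub>A\<^esub> kG_to_A (lam g (w i))))"

definition cond4 :: bool where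
  "cond4 \<longleftrightarrow> (\<forall>n r v m u s. overlap n r v m u s \<longrightarrow>
     (\<Oplus>\<^bsub>A\<^esub>h\<in>carrier G. VkG_to_A (\<alpha> (alpha_diff n r v m u s h)) \<otimes>\<^bsub>A\<^esub> kG_to_A (gr h))
     \<oplus>\<^bsub>A\<^esub> (\<Oplus>\<^bsub>A\<^esub>g\<in>carrier G. \<Oplus>\<^bsub>A\<^esub>i\<in>{..<n}. V_to_A (\<alpha> (r i) g) \<otimes>\<^bsub>A\<^esub> kG_to_A (lam g (v i)))
     = (\<Oplus>\<^bsub>A\<^esub>j\<in>{..<m}. V_to_A (u j) \<otimes>\<^bsub>A\<^esub> kG_to_A (\<beta> (s j)))
       \<ominus>\<^bsub>A\<^esub> (\<Oplus>\<^bsub>A\<^esub>i\<in>{..<n}. kG_to_A (\<beta> (r i)) \<otimes>\<^bsub>A\<^esub> V_to_A (v i)))"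

definition cond5 :: bool where
  "cond5 \<longleftrightarrow> (\<forall>n r v m u s. overlap n r v m u s \<longrightarrow>
     (\<Sum>h\<in>carrier G. \<beta> (alpha_diff n r v m u s h) \<otimes>\<^bsub>kG\<^esub> gr h)
     = - (\<Sum>i<n. lam_ext (\<beta> (r i)) (v i)))"

definition cond6 :: bool where
  "cond6 \<longleftrightarrow> (\<forall>n r v m u s. overlap n r v m u s \<longrightarrow>
     (\<Oplus>\<^bsub>A\<^esub>i\<in>{..<n}. VkG_to_A (\<alpha> (r i)) \<otimes>\<^bsub>A\<^esub> V_to_A (v i))
     \<ominus>\<^bsub>A\<^esub> (\<Oplus>\<^bsub>A\<^esub>j\<in>{..<m}. V_to_A (u j) \<otimes>\<^bsub>A\<^esub> VkG_to_A (\<alpha> (s j))) = \<zero>\<^bsub>A\<^esub>)"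

end

end

end

theory Submission
  imports Defs
begin

text \<open>
  Let \<open>T = T\<^sub>k\<^sub>G(kG \<otimes> V \<otimes> kG)\<close>, let \<open>K\<close> be the kernel of \<open>T \<rightarrow> S \<rtimes> G\<close>, and for an ideal \<open>I\<close> of \<open>T\<close>
  let \<open>gr I\<close> be the ideal of its leading forms, so that \<open>Gr (T/I) = T/gr I\<close>.  For the presentations at
  hand \<open>K \<subseteq> gr I\<close>, and as the graded components are finite-dimensional, \<open>T/I\<close> is a PBW deformation
  exactly if \<open>gr I = K\<close>.

  If \<open>gr I = K\<close>, then \<open>I\<close> meets \<open>V \<otimes> kG \<oplus> kG\<close> trivially.  Hence every relation of \<open>S \<rtimes> G\<close> has exactly one
  correction by terms of lower degree that lies in \<open>I\<close>, which gives \<open>\<lambda>\<close>, \<open>\<alpha>\<close> and \<open>\<beta>\<close>; the six conditions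
  say that the lower terms left over when \<open>g h v\<close>, \<open>g r\<close> and the elements of \<open>(V \<otimes> R) \<inter> (R \<otimes> V)\<close> are
  reduced in two ways vanish.

  Conversely, by condition (1) the algebra \<open>T\<close> acts on \<open>T(V) \<otimes> kG\<close> through the deformed skew relations.
  By the other conditions, the submodule generated by the deformed relations \<open>r - \<alpha>(r) - \<beta>(r)\<close> is filtered
  in such a way that overlapping relations, and clearly also disjoint ones, can be resolved in lower degree.  Since
  \<open>S\<close> is Koszul, all syzygies of \<open>R\<close> come from these two kinds, so the leading forms of that submodule,
  and therefore those of \<open>I\<close>, are the ones of the undeformed relations.
\<close>

section \<open>Linear algebra of finitely supported functions\<close>

text \<open>The obstacle is cancellation: an element of I of low degree may only be expressible
  through multiples of relations of high degree whose leading terms cancel. Working in T itself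
  would mix this with the reordering of group elements; on the module T(V) \<otimes> kG the
  reordering is built into the action, so only the relations coming from R have to be controlled.
  The resolution in \<open>koszul\<close> consists of left modules given by row vectors, hence it
  governs relations standing at the right end of a word. This is why the cancellation argument
  removes the last letter of a word, and why right multiplications commuting with the left action
  are needed. The identities for moving a group element past a relation and for resolving an overlap
  are proved modulo an arbitrary ideal containing skew relations for some \<lambda>. They are read
  in three ideals: the kernel K with \<lambda> = 0, which turns the conditions into equations
  between coefficients; the annihilator of the module, where they give the PBW property; and the
  ideal I of a given deformation, where they give the conditions.\<close>

abbreviation bvec :: "'a \<Rightarrow> ('a \<Rightarrow>\<^sub>0 'k::field)" where
  "bvec a \<equiv> Poly_Mapping.single a 1"

text \<open>This is the \<open>smult\<close> of every \<open>monoid_alg\<close>. The separate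
  constant allows an instance of \<open>vector_space\<close>, whose subspaces, spans and dimensions
  are used throughout as \<open>pv\<close>.\<close>

definition pscale :: "'k::field \<Rightarrow> ('a \<Rightarrow>\<^sub>0 'k) \<Rightarrow> ('a \<Rightarrow>\<^sub>0 'k)" where
  "pscale c p = Poly_Mapping.map ((*) c) p"

lemma lookup_pscale [simp]: "Poly_Mapping.lookup (pscale c p) a = c * Poly_Mapping.lookup p a"
  by (simp add: pscale_def Poly_Mapping.map.rep_eq when_def)

interpretation pv: vector_space pscale
  by unfold_locales (auto intro!: poly_mapping_eqI simp: lookup_add algebra_simps)

lemma pscale_single [simp]: "pscale c (Poly_Mapping.single a d) = Poly_Mapping.single a (c * d)"
  by (rule poly_mapping_eqI) (auto simp: lookup_single when_def)

definition lin_ext :: "('a \<Rightarrow> ('b \<Rightarrow>\<^sub>0 'k::field)) \<Rightarrow> ('a \<Rightarrow>\<^sub>0 'k) \<Rightarrow> ('b \<Rightarrow>\<^sub>0 'k)" where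
  "lin_ext f p = (\<Sum>a\<in>Poly_Mapping.keys p. pscale (Poly_Mapping.lookup p a) (f a))"

lemma lin_ext_superset:
  assumes "finite S" "Poly_Mapping.keys p \<subseteq> S"
  shows "lin_ext f p = (\<Sum>a\<in>S. pscale (Poly_Mapping.lookup p a) (f a))"
  unfolding lin_ext_def using assms
  by (intro sum.mono_neutral_left) (auto simp: in_keys_iff)

lemma lin_ext_0 [simp]: "lin_ext f 0 = 0"
  by (simp add: lin_ext_def)

lemma lin_ext_add: "lin_ext f (p + q) = lin_ext f p + lin_ext f q"
proof -
  let ?S = "Poly_Mapping.keys p \<union> Poly_Mapping.keys q"
  have "lin_ext f x = (\<Sum>a\<in>?S. pscale (Poly_Mapping.lookup x a) (f a))" if "x \<in> {p, q, p + q}" for x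
    using that keys_add[of p q] by (intro lin_ext_superset) auto
  then show ?thesis
    by (simp add: lookup_add pv.scale_left_distrib sum.distrib)
qed

lemma lin_ext_pscale: "lin_ext f (pscale c p) = pscale c (lin_ext f p)"
proof -
  have "lin_ext f (pscale c p)
      = (\<Sum>a\<in>Poly_Mapping.keys p. pscale (Poly_Mapping.lookup (pscale c p) a) (f a))"
    by (intro lin_ext_superset) (auto simp: in_keys_iff)
  then show ?thesis
    by (simp add: lin_ext_def pv.scale_sum_right)
qed

lemma lin_ext_single [simp]: "lin_ext f (Poly_Mapping.single a c) = pscale c (f a)"
  by (cases "c = 0") (auto simp: lin_ext_def)

text \<open>A plain predicate on functions, so that linearity of explicit lambda terms follows by
  applying the rules \<open>lin_intros\<close>.\<close>

definition lin_map :: "(('a \<Rightarrow>\<^sub>0 'k::field) \<Rightarrow> ('b \<Rightarrow>\<^sub>0 'k)) \<Rightarrow> bool" where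
  "lin_map T \<longleftrightarrow> (\<forall>p q. T (p + q) = T p + T q) \<and> (\<forall>c p. T (pscale c p) = pscale c (T p))"

lemma lin_mapI: "(\<And>p q. T (p + q) = T p + T q) \<Longrightarrow> (\<And>c p. T (pscale c p) = pscale c (T p)) \<Longrightarrow> lin_map T"
  by (simp add: lin_map_def)

lemma lin_map_add: "lin_map T \<Longrightarrow> T (p + q) = T p + T q"
  and lin_map_pscale: "lin_map T \<Longrightarrow> T (pscale c p) = pscale c (T p)"
  by (simp_all add: lin_map_def)

lemma lin_map_0: "lin_map T \<Longrightarrow> T 0 = 0"
  using lin_map_pscale[of T 0 0] by simp

lemma lin_map_uminus: "lin_map T \<Longrightarrow> T (- p) = - T p"
  using lin_map_pscale[of T "- 1" p] by simp

lemma lin_map_diff: "lin_map T \<Longrightarrow> T (p - q) = T p - T q"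
  using lin_map_add[of T p "- q"] lin_map_uminus[of T q] by simp

lemma lin_map_sum: "lin_map T \<Longrightarrow> T (\<Sum>i\<in>I. p i) = (\<Sum>i\<in>I. T (p i))"
  by (induction I rule: infinite_finite_induct) (simp_all add: lin_map_0 lin_map_add)

named_theorems lin_intros

lemma lin_map_lin_ext: "lin_map (lin_ext f)"
  by (simp add: lin_mapI lin_ext_add lin_ext_pscale)

lemma lin_map_id [lin_intros]: "lin_map (\<lambda>p. p)"
  and lin_map_zero [lin_intros]: "lin_map (\<lambda>p. 0)"
  by (simp_all add: lin_map_def)

lemma lin_map_comp: "lin_map S \<Longrightarrow> lin_map T \<Longrightarrow> lin_map (\<lambda>p. S (T p))"
  by (simp add: lin_map_def)

lemma lin_map_lin_ext_comp [lin_intros]: "lin_map T \<Longrightarrow> lin_map (\<lambda>p. lin_ext f (T p))"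
  using lin_map_comp[OF lin_map_lin_ext] .

lemma lin_map_plus [lin_intros]: "lin_map S \<Longrightarrow> lin_map T \<Longrightarrow> lin_map (\<lambda>p. S p + T p)"
  and lin_map_minus [lin_intros]: "lin_map S \<Longrightarrow> lin_map T \<Longrightarrow> lin_map (\<lambda>p. S p - T p)"
  and lin_map_scaled [lin_intros]: "lin_map S \<Longrightarrow> lin_map (\<lambda>p. pscale c (S p))"
  by (auto intro!: lin_mapI
      simp: lin_map_add lin_map_pscale pv.scale_right_distrib pv.scale_right_diff_distrib
        pv.scale_left_commute)

lemma lin_map_sums [lin_intros]: "(\<And>i. i \<in> I \<Longrightarrow> lin_map (T i)) \<Longrightarrow> lin_map (\<lambda>p. \<Sum>i\<in>I. T i p)"
  by (auto intro!: lin_mapI simp: lin_map_add lin_map_pscale sum.distrib pv.scale_sum_right)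

lemma lin_ext_bvec [simp]: "lin_ext bvec p = p"
  by (rule poly_mapping_eqI)
    (auto simp: lin_ext_def lookup_sum lookup_single when_def in_keys_iff sum.delta)

lemma lin_map_lin_ext_commute: "lin_map T \<Longrightarrow> T (lin_ext f p) = lin_ext (\<lambda>a. T (f a)) p"
  by (simp add: lin_ext_def lin_map_sum lin_map_pscale)

lemma lin_map_expand: "lin_map T \<Longrightarrow> T p = lin_ext (\<lambda>a. T (bvec a)) p"
  using lin_map_lin_ext_commute[of T bvec p] by simp

lemma lin_ext_cong: "(\<And>a. a \<in> Poly_Mapping.keys p \<Longrightarrow> f a = g a) \<Longrightarrow> lin_ext f p = lin_ext g p"
  by (simp add: lin_ext_def)

text \<open>Most identities between tensors below are checked on words through this rule; bilinear
  ones use it once for each argument.\<close>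

lemma lin_map_eqI:
  assumes "lin_map S" "lin_map T" "Poly_Mapping.keys p \<subseteq> Z" "\<And>a. a \<in> Z \<Longrightarrow> S (bvec a) = T (bvec a)"
  shows "S p = T p"
  unfolding lin_map_expand[OF assms(1), of p] lin_map_expand[OF assms(2), of p]
  using assms by (intro lin_ext_cong) auto

lemma lin_ext_fun_add: "lin_ext (\<lambda>a. f a + g a) p = lin_ext f p + lin_ext g p"
  and lin_ext_fun_pscale: "lin_ext (\<lambda>a. pscale c (f a)) p = pscale c (lin_ext f p)"
  by (simp_all add: lin_ext_def pv.scale_right_distrib pv.scale_right_diff_distrib sum.distrib
      sum_subtractf pv.scale_sum_right mult.commute)

lemma lin_ext_fun_0 [simp]: "lin_ext (\<lambda>a. 0) p = 0"
  by (simp add: lin_ext_def)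

lemma lin_ext_in_subspace:
  assumes "pv.subspace S" "\<And>a. a \<in> Poly_Mapping.keys p \<Longrightarrow> f a \<in> S"
  shows "lin_ext f p \<in> S"
  unfolding lin_ext_def by (intro pv.subspace_sum pv.subspace_scale assms)

lemma in_subspace_if_bvecs:
  assumes "pv.subspace S" "\<And>a. a \<in> Poly_Mapping.keys p \<Longrightarrow> bvec a \<in> S"
  shows "p \<in> S"
  using lin_ext_in_subspace[of S p bvec] assms by simp

lemma lin_map_vimage_subspace: "lin_map T \<Longrightarrow> pv.subspace S \<Longrightarrow> pv.subspace {p. T p \<in> S}"
  by (simp add: pv.subspace_def lin_map_add lin_map_pscale lin_map_0)

lemma lin_map_span_subset:
  assumes "lin_map T" "pv.subspace S" "\<And>x. x \<in> Z \<Longrightarrow> T x \<in> S" "y \<in> pv.span Z"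
  shows "T y \<in> S"
  using pv.span_minimal[of Z "{p. T p \<in> S}"] lin_map_vimage_subspace[OF assms(1,2)] assms(3,4) by blast

lemma subspace_keys: "pv.subspace {p. Poly_Mapping.keys p \<subseteq> Z}"
  by (auto simp: pv.subspace_def in_keys_iff lookup_add subset_iff) (metis add_0)

lemma subspace_uminus: "pv.subspace S \<Longrightarrow> x \<in> S \<Longrightarrow> - x \<in> S"
  using pv.subspace_scale[of S x "-1"] by simp

lemma subspace_mem_diff_iff:
  "pv.subspace S \<Longrightarrow> x - y \<in> S \<Longrightarrow> x \<in> S \<longleftrightarrow> y \<in> S"
  using pv.subspace_add[of S "x - y" y] pv.subspace_diff[of S x "x - y"] by auto

text \<open>With Q fixing the length of a word this is the homogeneous component, later abbreviated
  \<open>hT\<close> in T(V) and \<open>hU\<close> in T.\<close>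

definition restr_supp :: "('a \<Rightarrow> bool) \<Rightarrow> ('a \<Rightarrow>\<^sub>0 'k::field) \<Rightarrow> ('a \<Rightarrow>\<^sub>0 'k)" where
  "restr_supp Q = lin_ext (\<lambda>a. if Q a then bvec a else 0)"

lemma lin_map_restr_supp: "lin_map (restr_supp Q)"
  unfolding restr_supp_def by (rule lin_map_lin_ext)

lemma lin_map_restr_supp_comp [lin_intros]: "lin_map T \<Longrightarrow> lin_map (\<lambda>p. restr_supp Q (T p))"
  by (rule lin_map_comp[OF lin_map_restr_supp])

lemma lookup_restr_supp [simp]:
  "Poly_Mapping.lookup (restr_supp Q p) a = (if Q a then Poly_Mapping.lookup p a else 0)"
proof -
  have "Poly_Mapping.lookup (restr_supp Q p) a
      = (\<Sum>b\<in>Poly_Mapping.keys p. if b = a then (if Q b then Poly_Mapping.lookup p b else 0) else 0)"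
    unfolding restr_supp_def lin_ext_def lookup_sum
    by (rule sum.cong) (auto simp: lookup_single when_def)
  also have "\<dots> = (if Q a then Poly_Mapping.lookup p a else 0)"
    by (simp add: sum.delta in_keys_iff)
  finally show ?thesis .
qed

lemma restr_supp_bvec [simp]: "restr_supp Q (bvec a) = (if Q a then bvec a else 0)"
  by (simp add: restr_supp_def)

lemma keys_restr_supp: "Poly_Mapping.keys (restr_supp Q p) = {a \<in> Poly_Mapping.keys p. Q a}"
  by (auto simp: in_keys_iff split: if_splits)

lemma restr_supp_id: "(\<And>a. a \<in> Poly_Mapping.keys p \<Longrightarrow> Q a) \<Longrightarrow> restr_supp Q p = p"
  by (rule poly_mapping_eqI) (auto simp: in_keys_iff)

lemma restr_supp_0: "(\<And>a. a \<in> Poly_Mapping.keys p \<Longrightarrow> \<not> Q a) \<Longrightarrow> restr_supp Q p = 0"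
  by (rule poly_mapping_eqI) (auto simp: in_keys_iff)

lemma restr_supp_sum_layers:
  assumes "\<And>a. a \<in> Poly_Mapping.keys p \<Longrightarrow> wt a \<le> (n::nat)"
  shows "(\<Sum>i\<le>n. restr_supp (\<lambda>a. wt a = i) p) = p"
proof (rule poly_mapping_eqI)
  fix a
  show "Poly_Mapping.lookup (\<Sum>i\<le>n. restr_supp (\<lambda>a. wt a = i) p) a = Poly_Mapping.lookup p a"
    using assms[of a] by (cases "Poly_Mapping.lookup p a = 0") (auto simp: lookup_sum in_keys_iff sum.delta')
qed

section \<open>Monoid algebras, their ideals and quotients\<close>

lemma monoid_alg_simps [simp]:
  "p \<oplus>\<^bsub>monoid_alg W\<^esub> q = p + q" "\<zero>\<^bsub>monoid_alg W\<^esub> = 0"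
  "\<one>\<^bsub>monoid_alg W\<^esub> = bvec \<one>\<^bsub>W\<^esub>" "c \<odot>\<^bsub>monoid_alg W\<^esub> p = pscale c p"
  by (simp_all add: monoid_alg_def pscale_def)

lemma carrier_monoid_alg: "p \<in> carrier (monoid_alg W) \<longleftrightarrow> Poly_Mapping.keys p \<subseteq> carrier W"
  by (simp add: monoid_alg_def)

lemma subspace_carrier_monoid_alg: "pv.subspace (carrier (monoid_alg W))"
  using subspace_keys[of "carrier W"] by (simp add: monoid_alg_def)

lemma monoid_alg_carrier_closed [simp, intro]:
  "0 \<in> carrier (monoid_alg W)"
  "p \<in> carrier (monoid_alg W) \<Longrightarrow> pscale c p \<in> carrier (monoid_alg W)"
  "p \<in> carrier (monoid_alg W) \<Longrightarrow> q \<in> carrier (monoid_alg W) \<Longrightarrow> p + q \<in> carrier (monoid_alg W)"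
  "p \<in> carrier (monoid_alg W) \<Longrightarrow> q \<in> carrier (monoid_alg W) \<Longrightarrow> p - q \<in> carrier (monoid_alg W)"
  "p \<in> carrier (monoid_alg W) \<Longrightarrow> - p \<in> carrier (monoid_alg W)"
  by (intro pv.subspace_0 pv.subspace_scale pv.subspace_add pv.subspace_diff subspace_uminus
      subspace_carrier_monoid_alg; assumption)+

lemma monoid_alg_sum_closed [simp, intro]:
  "(\<And>i. i \<in> I \<Longrightarrow> f i \<in> carrier (monoid_alg W)) \<Longrightarrow> (\<Sum>i\<in>I. f i) \<in> carrier (monoid_alg W)"
  by (intro pv.subspace_sum subspace_carrier_monoid_alg)

lemma single_in_carrier [simp, intro]: "w \<in> carrier W \<Longrightarrow> Poly_Mapping.single w c \<in> carrier (monoid_alg W)"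
  by (auto simp: carrier_monoid_alg)

lemma monoid_alg_mult:
  "p \<otimes>\<^bsub>monoid_alg W\<^esub> q = lin_ext (\<lambda>u. lin_ext (\<lambda>w. bvec (u \<otimes>\<^bsub>W\<^esub> w)) q) p"
  by (simp add: monoid_alg_def lin_ext_def pv.scale_sum_right)

lemma lin_map_mult_left: "lin_map (\<lambda>p. p \<otimes>\<^bsub>monoid_alg W\<^esub> q)"
  unfolding monoid_alg_mult by (rule lin_map_lin_ext)

lemma lin_map_mult_right: "lin_map (\<lambda>q. p \<otimes>\<^bsub>monoid_alg W\<^esub> q)"
  unfolding monoid_alg_mult
  by (rule lin_mapI) (simp_all add: lin_ext_add lin_ext_pscale lin_ext_fun_add lin_ext_fun_pscale)

lemma lin_map_mult_left_comp [lin_intros]: "lin_map T \<Longrightarrow> lin_map (\<lambda>p. T p \<otimes>\<^bsub>monoid_alg W\<^esub> q)"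
  and lin_map_mult_right_comp [lin_intros]: "lin_map T \<Longrightarrow> lin_map (\<lambda>q. p \<otimes>\<^bsub>monoid_alg W\<^esub> T q)"
  by (rule lin_map_comp[OF lin_map_mult_left] lin_map_comp[OF lin_map_mult_right], assumption)+

lemmas mult_distribs =
  lin_map_add[OF lin_map_mult_left] lin_map_diff[OF lin_map_mult_left]
  lin_map_add[OF lin_map_mult_right] lin_map_diff[OF lin_map_mult_right]
lemmas mult_sums = lin_map_sum[OF lin_map_mult_left] lin_map_sum[OF lin_map_mult_right]
lemmas mult_pscales = lin_map_pscale[OF lin_map_mult_left] lin_map_pscale[OF lin_map_mult_right]
lemmas mult_zeros [simp] = lin_map_0[OF lin_map_mult_left] lin_map_0[OF lin_map_mult_right]
lemmas mult_uminus = lin_map_uminus[OF lin_map_mult_left] lin_map_uminus[OF lin_map_mult_right]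

lemma mult_singles [simp]:
  "Poly_Mapping.single u a \<otimes>\<^bsub>monoid_alg W\<^esub> Poly_Mapping.single w b
    = Poly_Mapping.single (u \<otimes>\<^bsub>W\<^esub> w) (a * b)"
  by (simp add: monoid_alg_mult)

lemma mult_in_subspace:
  assumes "pv.subspace S" "p \<in> carrier (monoid_alg W)" "q \<in> carrier (monoid_alg W)"
    "\<And>u w. u \<in> Poly_Mapping.keys p \<Longrightarrow> w \<in> Poly_Mapping.keys q \<Longrightarrow> bvec (u \<otimes>\<^bsub>W\<^esub> w) \<in> S"
  shows "p \<otimes>\<^bsub>monoid_alg W\<^esub> q \<in> S"
  unfolding monoid_alg_mult using assms
  by (intro lin_ext_in_subspace) auto

lemma (in Group.monoid) monoid_alg_closed:
  "p \<in> carrier (monoid_alg G) \<Longrightarrow> q \<in> carrier (monoid_alg G) \<Longrightarrow> p \<otimes>\<^bsub>monoid_alg G\<^esub> q \<in> carrier (monoid_alg G)"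
  by (rule mult_in_subspace) (auto simp: subspace_carrier_monoid_alg carrier_monoid_alg)

lemma (in Group.monoid) monoid_alg_assoc:
  assumes "p \<in> carrier (monoid_alg G)" "q \<in> carrier (monoid_alg G)" "r \<in> carrier (monoid_alg G)"
  shows "(p \<otimes>\<^bsub>monoid_alg G\<^esub> q) \<otimes>\<^bsub>monoid_alg G\<^esub> r = p \<otimes>\<^bsub>monoid_alg G\<^esub> (q \<otimes>\<^bsub>monoid_alg G\<^esub> r)"
proof (rule lin_map_eqI[of "\<lambda>p. (p \<otimes>\<^bsub>monoid_alg G\<^esub> q) \<otimes>\<^bsub>monoid_alg G\<^esub> r" _ p "carrier G"])
  fix u assume u: "u \<in> carrier G"
  show "(bvec u \<otimes>\<^bsub>monoid_alg G\<^esub> q) \<otimes>\<^bsub>monoid_alg G\<^esub> r = bvec u \<otimes>\<^bsub>monoid_alg G\<^esub> (q \<otimes>\<^bsub>monoid_alg G\<^esub> r)"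
  proof (rule lin_map_eqI[of "\<lambda>q. (bvec u \<otimes>\<^bsub>monoid_alg G\<^esub> q) \<otimes>\<^bsub>monoid_alg G\<^esub> r" _ q "carrier G"])
    fix v assume v: "v \<in> carrier G"
    show "(bvec u \<otimes>\<^bsub>monoid_alg G\<^esub> bvec v) \<otimes>\<^bsub>monoid_alg G\<^esub> r = bvec u \<otimes>\<^bsub>monoid_alg G\<^esub> (bvec v \<otimes>\<^bsub>monoid_alg G\<^esub> r)"
      by (rule lin_map_eqI[where Z = "carrier G" and p = r])
        (use assms u v in \<open>auto intro!: lin_intros simp: carrier_monoid_alg m_assoc\<close>)
  qed (use assms in \<open>auto intro!: lin_intros simp: carrier_monoid_alg\<close>)
qed (use assms in \<open>auto intro!: lin_intros simp: carrier_monoid_alg\<close>)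

lemma (in Group.monoid) monoid_alg_one_left:
  "p \<in> carrier (monoid_alg G) \<Longrightarrow> bvec \<one> \<otimes>\<^bsub>monoid_alg G\<^esub> p = p"
  by (rule lin_map_eqI[where Z = "carrier G" and p = p]) (auto intro!: lin_intros simp: carrier_monoid_alg)

lemma (in Group.monoid) monoid_alg_one_right:
  "p \<in> carrier (monoid_alg G) \<Longrightarrow> p \<otimes>\<^bsub>monoid_alg G\<^esub> bvec \<one> = p"
  by (rule lin_map_eqI[where Z = "carrier G" and p = p]) (auto intro!: lin_intros simp: carrier_monoid_alg)

lemma (in Group.monoid) ring_monoid_alg: "ring (monoid_alg G)"
proof (rule ringI)
  show "abelian_group (monoid_alg G)"
  proof (rule abelian_groupI)
    fix x assume "x \<in> carrier (monoid_alg G)"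
    then have "- x \<in> carrier (monoid_alg G)"
      by (rule subspace_uminus[OF subspace_carrier_monoid_alg])
    then show "\<exists>y\<in>carrier (monoid_alg G). y \<oplus>\<^bsub>monoid_alg G\<^esub> x = \<zero>\<^bsub>monoid_alg G\<^esub>"
      by force
  qed (use subspace_carrier_monoid_alg[of G] in
      \<open>auto simp: pv.subspace_def add.assoc add.commute\<close>)
  show "Group.monoid (monoid_alg G)"
    by (rule monoidI) (auto simp: monoid_alg_closed monoid_alg_assoc monoid_alg_one_left
        monoid_alg_one_right)
qed (simp_all add: mult_distribs)

lemma (in Group.monoid) monoid_alg_a_inv: "p \<in> carrier (monoid_alg G) \<Longrightarrow> \<ominus>\<^bsub>monoid_alg G\<^esub> p = - p"
proof -
  interpret R: ring "monoid_alg G" by (rule ring_monoid_alg)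
  assume p: "p \<in> carrier (monoid_alg G)"
  then have "- p \<in> carrier (monoid_alg G)" by (rule subspace_uminus[OF subspace_carrier_monoid_alg])
  then show ?thesis using p by (intro R.minus_equality) auto
qed

lemma (in Group.monoid) ideal_monoid_algI:
  assumes "pv.subspace I" "I \<subseteq> carrier (monoid_alg G)"
    "\<And>w x. w \<in> carrier G \<Longrightarrow> x \<in> I \<Longrightarrow> bvec w \<otimes>\<^bsub>monoid_alg G\<^esub> x \<in> I"
    "\<And>w x. w \<in> carrier G \<Longrightarrow> x \<in> I \<Longrightarrow> x \<otimes>\<^bsub>monoid_alg G\<^esub> bvec w \<in> I"
  shows "ideal I (monoid_alg G)"
proof (rule idealI)
  interpret R: ring "monoid_alg G" by (rule ring_monoid_alg)
  show "ring (monoid_alg G)" by (rule ring_monoid_alg)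
  show "subgroup I (add_monoid (monoid_alg G))"
  proof (rule group.subgroupI)
    show "Group.group (add_monoid (monoid_alg G))" by (rule R.add.group_axioms)
    show "I \<noteq> {}" using pv.subspace_0[OF assms(1)] by auto
    show "inv\<^bsub>add_monoid (monoid_alg G)\<^esub> a \<in> I" if "a \<in> I" for a
      using monoid_alg_a_inv[of a] subspace_uminus[OF assms(1) that] assms(2) that
      by (auto simp: a_inv_def)
  qed (use assms in \<open>auto simp: pv.subspace_add\<close>)
  show "x \<otimes>\<^bsub>monoid_alg G\<^esub> a \<in> I" if "a \<in> I" "x \<in> carrier (monoid_alg G)" for a x
    using that assms(3) by (subst lin_map_expand[OF lin_map_mult_left])
      (auto intro!: lin_ext_in_subspace assms(1) simp: carrier_monoid_alg)
  show "a \<otimes>\<^bsub>monoid_alg G\<^esub> x \<in> I" if "a \<in> I" "x \<in> carrier (monoid_alg G)" for a x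
    using that assms(4) by (subst lin_map_expand[OF lin_map_mult_right])
      (auto intro!: lin_ext_in_subspace assms(1) simp: carrier_monoid_alg)
qed

lemma (in Group.monoid) ideal_monoid_alg_subspace:
  assumes "ideal I (monoid_alg G)"
  shows "pv.subspace I"
proof -
  interpret I: ideal I "monoid_alg G" by fact
  have "pscale c x \<in> I" if "x \<in> I" for c x
  proof -
    have "x \<in> carrier (monoid_alg G)" using that by (rule I.Icarr)
    then have "pscale c x = pscale c (bvec \<one>) \<otimes>\<^bsub>monoid_alg G\<^esub> x"
      by (simp only: mult_pscales monoid_alg_one_left)
    also have "\<dots> \<in> I"
      using that by (intro I.I_l_closed) (auto simp: carrier_monoid_alg)
    finally show ?thesis .
  qed
  then show ?thesis
    using additive_subgroup.zero_closed[OF I.is_additive_subgroup]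
      additive_subgroup.a_closed[OF I.is_additive_subgroup] by (simp add: pv.subspace_def)
qed

lemma k_subspace_monoid_alg_iff:
  "k_subspace (monoid_alg W) S \<longleftrightarrow> S \<subseteq> carrier (monoid_alg W) \<and> pv.subspace S"
  by (auto simp: k_subspace_def pv.subspace_def)

lemma k_span_monoid_alg:
  assumes "Y \<subseteq> carrier (monoid_alg W)"
  shows "k_span (monoid_alg W) Y = pv.span Y"
proof
  have "k_subspace (monoid_alg W) (pv.span Y)"
    unfolding k_subspace_monoid_alg_iff
    by (intro conjI pv.span_minimal assms subspace_carrier_monoid_alg pv.subspace_span)
  then show "k_span (monoid_alg W) Y \<subseteq> pv.span Y"
    unfolding k_span_def using pv.span_superset[of Y] by blast
  show "pv.span Y \<subseteq> k_span (monoid_alg W) Y"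
    unfolding k_span_def k_subspace_monoid_alg_iff using pv.span_minimal by auto
qed

lemma (in Group.monoid) Idl_monoid_alg:
  assumes "Z \<subseteq> carrier (monoid_alg G)"
  shows "ideal (Idl\<^bsub>monoid_alg G\<^esub> Z) (monoid_alg G)" "Z \<subseteq> Idl\<^bsub>monoid_alg G\<^esub> Z"
    "pv.subspace (Idl\<^bsub>monoid_alg G\<^esub> Z)" "Idl\<^bsub>monoid_alg G\<^esub> Z \<subseteq> carrier (monoid_alg G)"
proof -
  interpret R: ring "monoid_alg G" by (rule ring_monoid_alg)
  show *: "ideal (Idl\<^bsub>monoid_alg G\<^esub> Z) (monoid_alg G)" by (rule R.genideal_ideal[OF assms])
  show "Z \<subseteq> Idl\<^bsub>monoid_alg G\<^esub> Z" by (rule R.genideal_self[OF assms])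
  show "pv.subspace (Idl\<^bsub>monoid_alg G\<^esub> Z)" by (rule ideal_monoid_alg_subspace[OF *])
  show "Idl\<^bsub>monoid_alg G\<^esub> Z \<subseteq> carrier (monoid_alg G)" using ideal.Icarr[OF *] by blast
qed

text \<open>Words span the algebra, so two-sided multiples of the generators by words already form
  an ideal. Membership in an ideal thus becomes membership in a span, to which linear maps can be
  applied generator by generator.\<close>

lemma (in Group.monoid) Idl_monoid_alg_span:
  fixes Z :: "('a \<Rightarrow>\<^sub>0 'k::field) set"
  assumes Z: "Z \<subseteq> carrier (monoid_alg G)"
  shows "Idl\<^bsub>monoid_alg G\<^esub> Z = pv.span {(bvec u \<otimes>\<^bsub>monoid_alg G\<^esub> x) \<otimes>\<^bsub>monoid_alg G\<^esub> bvec w | u x w.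
      u \<in> carrier G \<and> x \<in> Z \<and> w \<in> carrier G}" (is "_ = pv.span ?Y")
proof
  interpret R: ring "monoid_alg G" by (rule ring_monoid_alg)
  interpret I: ideal "Idl\<^bsub>monoid_alg G\<^esub> Z" "monoid_alg G" by (rule Idl_monoid_alg[OF Z])
  have bv: "(bvec u :: 'a \<Rightarrow>\<^sub>0 'k) \<in> carrier (monoid_alg G)" if "u \<in> carrier G" for u
    using that by (simp add: carrier_monoid_alg)
  show "pv.span ?Y \<subseteq> Idl\<^bsub>monoid_alg G\<^esub> Z"
    by (rule pv.span_minimal[OF _ Idl_monoid_alg(3)[OF Z]])
      (use Idl_monoid_alg(2)[OF Z] bv in \<open>blast intro: I.I_l_closed I.I_r_closed\<close>)
  have Y: "?Y \<subseteq> carrier (monoid_alg G)"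
    using Z bv by (auto intro!: monoid_alg_closed)
  have Yc: "pv.span ?Y \<subseteq> carrier (monoid_alg G)"
    by (rule pv.span_minimal[OF Y subspace_carrier_monoid_alg])
  have "ideal (pv.span ?Y) (monoid_alg G)"
  proof (rule ideal_monoid_algI[OF pv.subspace_span Yc])
    fix v :: "'a" and y :: "'a \<Rightarrow>\<^sub>0 'k" assume v: "v \<in> carrier G" and y: "y \<in> pv.span ?Y"
    show "bvec v \<otimes>\<^bsub>monoid_alg G\<^esub> y \<in> pv.span ?Y"
    proof (rule lin_map_span_subset[OF lin_map_mult_right pv.subspace_span _ y])
      fix z :: "'a \<Rightarrow>\<^sub>0 'k" assume "z \<in> ?Y"
      then obtain u x w where z: "z = (bvec u \<otimes>\<^bsub>monoid_alg G\<^esub> x) \<otimes>\<^bsub>monoid_alg G\<^esub> bvec w"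
        "u \<in> carrier G" "x \<in> Z" "w \<in> carrier G" by blast
      then have x: "x \<in> carrier (monoid_alg G)" using Z by blast
      then have ux: "bvec u \<otimes>\<^bsub>monoid_alg G\<^esub> x \<in> carrier (monoid_alg G)"
        by (intro monoid_alg_closed bv z)
      have "bvec v \<otimes>\<^bsub>monoid_alg G\<^esub> z = (bvec (v \<otimes> u) \<otimes>\<^bsub>monoid_alg G\<^esub> x) \<otimes>\<^bsub>monoid_alg G\<^esub> bvec w"
        using monoid_alg_assoc[of "bvec v" "bvec u \<otimes>\<^bsub>monoid_alg G\<^esub> x" "bvec w"]
          monoid_alg_assoc[of "bvec v" "bvec u" x] z v x ux bv[of u] bv[of v] bv[of w] by simp
      then show "bvec v \<otimes>\<^bsub>monoid_alg G\<^esub> z \<in> pv.span ?Y"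
        using z v by (intro pv.span_base) auto
    qed
    show "y \<otimes>\<^bsub>monoid_alg G\<^esub> bvec v \<in> pv.span ?Y"
    proof (rule lin_map_span_subset[OF lin_map_mult_left pv.subspace_span _ y])
      fix z :: "'a \<Rightarrow>\<^sub>0 'k" assume "z \<in> ?Y"
      then obtain u x w where z: "z = (bvec u \<otimes>\<^bsub>monoid_alg G\<^esub> x) \<otimes>\<^bsub>monoid_alg G\<^esub> bvec w"
        "u \<in> carrier G" "x \<in> Z" "w \<in> carrier G" by blast
      then have x: "x \<in> carrier (monoid_alg G)" using Z by blast
      then have ux: "bvec u \<otimes>\<^bsub>monoid_alg G\<^esub> x \<in> carrier (monoid_alg G)"
        by (intro monoid_alg_closed bv z)
      have "z \<otimes>\<^bsub>monoid_alg G\<^esub> bvec v = (bvec u \<otimes>\<^bsub>monoid_alg G\<^esub> x) \<otimes>\<^bsub>monoid_alg G\<^esub> bvec (w \<otimes> v)"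
        using monoid_alg_assoc[of "bvec u \<otimes>\<^bsub>monoid_alg G\<^esub> x" "bvec w" "bvec v"]
          z v x ux bv[of u] bv[of v] bv[of w] by simp
      then show "z \<otimes>\<^bsub>monoid_alg G\<^esub> bvec v \<in> pv.span ?Y"
        using z v by (intro pv.span_base) auto
    qed
  qed
  moreover have "Z \<subseteq> pv.span ?Y"
  proof
    fix x assume x: "x \<in> Z"
    then have "x = (bvec \<one> \<otimes>\<^bsub>monoid_alg G\<^esub> x) \<otimes>\<^bsub>monoid_alg G\<^esub> bvec \<one>"
      using Z by (simp add: subset_iff monoid_alg_one_left monoid_alg_one_right)
    then show "x \<in> pv.span ?Y" using x by (intro pv.span_base) blast
  qed
  ultimately show "Idl\<^bsub>monoid_alg G\<^esub> Z \<subseteq> pv.span ?Y" by (rule R.genideal_minimal)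
qed

locale monoid_alg_ideal = Group.monoid W for W :: "('w, 'z) monoid_scheme" (structure) +
  fixes I :: "('w \<Rightarrow>\<^sub>0 'k::field) set"
  assumes ideal: "ideal I (monoid_alg W)"
begin

sublocale I: ideal I "monoid_alg W" by (rule ideal)

abbreviation "MA \<equiv> monoid_alg W :: ('k, 'w \<Rightarrow>\<^sub>0 'k) module"
abbreviation "QA \<equiv> alg_quot MA I"

lemma subspace: "pv.subspace I" by (rule ideal_monoid_alg_subspace[OF ideal])

lemma coset_eq_iff:
  assumes "x \<in> carrier MA" "y \<in> carrier MA"
  shows "I +>\<^bsub>MA\<^esub> x = I +>\<^bsub>MA\<^esub> y \<longleftrightarrow> x - y \<in> I"
proof -
  have "x \<ominus>\<^bsub>MA\<^esub> y = x - y" using assms(2) by (simp add: a_minus_def monoid_alg_a_inv)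
  then show ?thesis
    using I.quotient_eq_iff_same_a_r_cos[OF ideal assms] by auto
qed

lemma coset_mem: "y \<in> I +>\<^bsub>MA\<^esub> x \<longleftrightarrow> y - x \<in> I"
proof
  assume "y - x \<in> I"
  then have "\<exists>h\<in>I. y = h + x" by (intro bexI[of _ "y - x"]) auto
  then show "y \<in> I +>\<^bsub>MA\<^esub> x" by (auto simp: a_r_coset_def')
qed (auto simp: a_r_coset_def')

lemma coset_zero [simp]: "I +>\<^bsub>MA\<^esub> 0 = I"
  by (auto simp: coset_mem)

lemma coset_eq_zero_iff: "x \<in> carrier MA \<Longrightarrow> I +>\<^bsub>MA\<^esub> x = I \<longleftrightarrow> x \<in> I"
  using coset_eq_iff[of x 0] by (simp add: carrier_monoid_alg)


lemma carrier_alg_quot: "carrier QA = (\<lambda>x. I +>\<^bsub>MA\<^esub> x) ` carrier MA"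
  by (auto simp: alg_quot_def FactRing_def ring.defs module.defs A_RCOSETS_def')

lemma alg_quot_ops:
  assumes "x \<in> carrier MA" "y \<in> carrier MA"
  shows "(I +>\<^bsub>MA\<^esub> x) \<otimes>\<^bsub>QA\<^esub> (I +>\<^bsub>MA\<^esub> y) = I +>\<^bsub>MA\<^esub> (x \<otimes>\<^bsub>MA\<^esub> y)"
    "(I +>\<^bsub>MA\<^esub> x) \<oplus>\<^bsub>QA\<^esub> (I +>\<^bsub>MA\<^esub> y) = I +>\<^bsub>MA\<^esub> (x + y)"
  using I.rcoset_mult_add[OF assms] I.a_rcos_sum[OF assms]
  by (auto simp: alg_quot_def FactRing_def ring.defs module.defs)

lemma alg_quot_one_zero: "\<one>\<^bsub>QA\<^esub> = I +>\<^bsub>MA\<^esub> bvec \<one>" "\<zero>\<^bsub>QA\<^esub> = I"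
  by (auto simp: alg_quot_def FactRing_def ring.defs module.defs)

lemma alg_quot_zero: "\<zero>\<^bsub>QA\<^esub> = I +>\<^bsub>MA\<^esub> 0"
  by (simp add: alg_quot_one_zero)

lemma alg_quot_smult:
  assumes "x \<in> carrier MA"
  shows "c \<odot>\<^bsub>QA\<^esub> (I +>\<^bsub>MA\<^esub> x) = I +>\<^bsub>MA\<^esub> pscale c x"
proof -
  \<comment> \<open>In \<open>alg_quot\<close> a scalar multiple is a union over all representatives
    of the coset; each of them contributes the same coset.\<close>
  have "I +>\<^bsub>MA\<^esub> pscale c y = I +>\<^bsub>MA\<^esub> pscale c x" if "y \<in> I +>\<^bsub>MA\<^esub> x" for y
  proof -
    have "y - x \<in> I" using that by (simp add: coset_mem)
    then have "pscale c (y - x) \<in> I" by (rule pv.subspace_scale[OF subspace])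
    moreover have "y \<in> carrier MA"
      using that assms by (rule I.a_elemrcos_carrier[rotated])
    ultimately show ?thesis
      using assms subspace_carrier_monoid_alg
      by (subst coset_eq_iff) (auto simp: pv.scale_right_diff_distrib)
  qed
  moreover have "x \<in> I +>\<^bsub>MA\<^esub> x" by (simp add: coset_mem pv.subspace_0[OF subspace])
  ultimately have "(\<Union>y\<in>I +>\<^bsub>MA\<^esub> x. I +>\<^bsub>MA\<^esub> pscale c y) = I +>\<^bsub>MA\<^esub> pscale c x"
    by blast
  moreover have "c \<odot>\<^bsub>QA\<^esub> (I +>\<^bsub>MA\<^esub> x) = (\<Union>y\<in>I +>\<^bsub>MA\<^esub> x. I +>\<^bsub>MA\<^esub> pscale c y)"
    by (simp add: alg_quot_def ring.defs module.defs)
  ultimately show ?thesis by simp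
qed

lemma alg_quot_ring: "ring QA"
proof (rule ringI)
  show "abelian_group QA"
  proof (rule abelian_groupI)
    fix x assume "x \<in> carrier QA"
    then obtain a where a: "x = I +>\<^bsub>MA\<^esub> a" "a \<in> carrier MA" unfolding carrier_alg_quot by blast
    have "(I +>\<^bsub>MA\<^esub> (- a)) \<oplus>\<^bsub>QA\<^esub> x = \<zero>\<^bsub>QA\<^esub>"
      using a by (simp add: alg_quot_ops alg_quot_one_zero)
    then show "\<exists>y\<in>carrier QA. y \<oplus>\<^bsub>QA\<^esub> x = \<zero>\<^bsub>QA\<^esub>"
      using a(2) unfolding carrier_alg_quot by (intro bexI[of _ "I +>\<^bsub>MA\<^esub> (- a)"]) auto
  qed (auto simp: carrier_alg_quot alg_quot_ops alg_quot_zero add_ac simp del: coset_zero)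
  show "Group.monoid QA"
    by (rule monoidI)
      (auto simp: carrier_alg_quot alg_quot_ops alg_quot_one_zero monoid_alg_closed monoid_alg_assoc
        monoid_alg_one_left monoid_alg_one_right)
qed (auto simp: carrier_alg_quot alg_quot_ops monoid_alg_closed mult_distribs)

sublocale Q: ring QA by (rule alg_quot_ring)

lemma alg_quot_finsum:
  assumes "\<And>i. i \<in> J \<Longrightarrow> f i \<in> carrier MA"
  shows "(\<Oplus>\<^bsub>QA\<^esub>i\<in>J. I +>\<^bsub>MA\<^esub> f i) = I +>\<^bsub>MA\<^esub> (\<Sum>i\<in>J. f i)"
  using assms
  by (induction J rule: infinite_finite_induct)
    (auto simp: Q.finsum_infinite alg_quot_one_zero carrier_alg_quot alg_quot_ops)

end

section \<open>Words and normal forms\<close>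

lemma free_monoid_simps [simp]:
  "carrier (free_monoid B) = lists B" "u \<otimes>\<^bsub>free_monoid B\<^esub> w = u @ w" "\<one>\<^bsub>free_monoid B\<^esub> = []"
  by (simp_all add: free_monoid_def)

lemma monoid_free_monoid: "Group.monoid (free_monoid B)"
  by (rule monoidI) auto

lemma bimod_words_mult_Nil [simp]:
  "(g, []) \<otimes>\<^bsub>bimod_words G B\<^esub> (h, ys) = (g \<otimes>\<^bsub>G\<^esub> h, ys)"
  by (simp add: bimod_words_def)

text \<open>Recursion on the left factor replaces the \<open>butlast\<close> and \<open>last\<close>
  of the definition; all inductions over products of words rest on it.\<close>

lemma bimod_words_mult_Cons:
  "(g, (b, h) # xs) \<otimes>\<^bsub>bimod_words G B\<^esub> u =
    (g, (b, fst ((h, xs) \<otimes>\<^bsub>bimod_words G B\<^esub> u)) # snd ((h, xs) \<otimes>\<^bsub>bimod_words G B\<^esub> u))"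
  by (cases u) (simp add: bimod_words_def)

lemma bimod_words_carrier [simp]:
  "carrier (bimod_words G B) = carrier G \<times> lists (B \<times> carrier G)"
  "\<one>\<^bsub>bimod_words G B\<^esub> = (\<one>\<^bsub>G\<^esub>, [])"
  by (simp_all add: bimod_words_def)

lemma length_bimod_words_mult [simp]:
  "length (snd (u \<otimes>\<^bsub>bimod_words G B\<^esub> w)) = length (snd u) + length (snd w)"
  by (cases u; cases w) (auto simp: bimod_words_def)

declare tensor_alg_def [simp] bimod_tensor_alg_def [simp]

context Group.group
begin

lemma bimod_words_closed:
  assumes "u \<in> carrier (bimod_words G B)" "w \<in> carrier (bimod_words G B)"
  shows "u \<otimes>\<^bsub>bimod_words G B\<^esub> w \<in> carrier (bimod_words G B)"
proof -
  have "(g, xs) \<otimes>\<^bsub>bimod_words G B\<^esub> w \<in> carrier (bimod_words G B)"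
    if "g \<in> carrier G" "xs \<in> lists (B \<times> carrier G)" for g xs
    using that
  proof (induction xs arbitrary: g)
    case Nil
    then show ?case using assms(2) by (cases w) auto
  next
    case (Cons x xs)
    obtain b h where x: "x = (b, h)" by (cases x)
    then have "(h, xs) \<otimes>\<^bsub>bimod_words G B\<^esub> w \<in> carrier (bimod_words G B)" using Cons by auto
    then show ?case using Cons.prems x by (auto simp: bimod_words_mult_Cons mem_Times_iff)
  qed
  then show ?thesis using assms(1) by (cases u) auto
qed

lemma bimod_words_assoc:
  assumes "u \<in> carrier (bimod_words G B)" "v \<in> carrier (bimod_words G B)" "w \<in> carrier (bimod_words G B)"
  shows "(u \<otimes>\<^bsub>bimod_words G B\<^esub> v) \<otimes>\<^bsub>bimod_words G B\<^esub> w
    = u \<otimes>\<^bsub>bimod_words G B\<^esub> (v \<otimes>\<^bsub>bimod_words G B\<^esub> w)"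
proof -
  \<comment> \<open>A left factor without letters only changes the first group element of what
    follows. This settles the base case of the induction below, for either form of the middle
    factor.\<close>
  have shift: "(g \<otimes> h, ys) \<otimes>\<^bsub>bimod_words G B\<^esub> w = (g, []) \<otimes>\<^bsub>bimod_words G B\<^esub> ((h, ys) \<otimes>\<^bsub>bimod_words G B\<^esub> w)"
    if "g \<in> carrier G" "h \<in> carrier G" for g h ys
    using that assms(3) by (cases w; cases ys) (auto simp: m_assoc bimod_words_mult_Cons)
  have "((g, xs) \<otimes>\<^bsub>bimod_words G B\<^esub> v) \<otimes>\<^bsub>bimod_words G B\<^esub> w
      = (g, xs) \<otimes>\<^bsub>bimod_words G B\<^esub> (v \<otimes>\<^bsub>bimod_words G B\<^esub> w)"
    if "g \<in> carrier G" "xs \<in> lists (B \<times> carrier G)" for g xs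
    using that
  proof (induction xs arbitrary: g)
    case Nil
    then show ?case using assms(2) by (cases v) (auto simp: shift)
  next
    case (Cons x xs)
    obtain b h where x: "x = (b, h)" by (cases x)
    then have "((h, xs) \<otimes>\<^bsub>bimod_words G B\<^esub> v) \<otimes>\<^bsub>bimod_words G B\<^esub> w
      = (h, xs) \<otimes>\<^bsub>bimod_words G B\<^esub> (v \<otimes>\<^bsub>bimod_words G B\<^esub> w)"
      using Cons by auto
    then show ?case by (simp add: x bimod_words_mult_Cons)
  qed
  then show ?thesis using assms(1) by (cases u) auto
qed

lemma monoid_bimod_words: "Group.monoid (bimod_words G (B :: 'c set))"
proof (rule monoidI)
  show "u \<otimes>\<^bsub>bimod_words G B\<^esub> \<one>\<^bsub>bimod_words G B\<^esub> = u" if u: "u \<in> carrier (bimod_words G B)" for u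
  proof -
    have "(g, xs) \<otimes>\<^bsub>bimod_words G B\<^esub> (\<one>, []) = (g, xs)"
      if "g \<in> carrier G" "xs \<in> lists (B \<times> carrier G)" for g xs
      using that
    proof (induction xs arbitrary: g)
      case (Cons x xs)
      then show ?case by (cases x) (auto simp: bimod_words_mult_Cons)
    qed auto
    then show ?thesis using u by (cases u) auto
  qed
next
  fix u v w :: "'a \<times> ('c \<times> 'a) list"
  assume "u \<in> carrier (bimod_words G B)" "v \<in> carrier (bimod_words G B)"
  then show "u \<otimes>\<^bsub>bimod_words G B\<^esub> v \<in> carrier (bimod_words G B)"
    by (rule bimod_words_closed)
  assume "w \<in> carrier (bimod_words G B)"
  with \<open>u \<in> _\<close> \<open>v \<in> _\<close> show "u \<otimes>\<^bsub>bimod_words G B\<^esub> v \<otimes>\<^bsub>bimod_words G B\<^esub> w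
    = u \<otimes>\<^bsub>bimod_words G B\<^esub> (v \<otimes>\<^bsub>bimod_words G B\<^esub> w)"
    by (rule bimod_words_assoc)
qed auto

end

section \<open>The action of G on tensors over a basis of V\<close>

locale skew_setup = Group.group G + V: finite_dimensional_vector_space scale B
  for scale :: "'k::field \<Rightarrow> 'v::ab_group_add \<Rightarrow> 'v" and B :: "'v set"
    and G :: "('g, 'z) monoid_scheme" (structure) +
  fixes act :: "'g \<Rightarrow> 'v \<Rightarrow> 'v"
  assumes fin_G: "finite (carrier G)"
    and rep: "is_rep scale G act"
begin

abbreviation "TV \<equiv> monoid_alg (free_monoid B) :: ('k, 'v list \<Rightarrow>\<^sub>0 'k) module"
abbreviation "TU \<equiv> monoid_alg (bimod_words G B) :: ('k, 'g \<times> ('v \<times> 'g) list \<Rightarrow>\<^sub>0 'k) module"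
abbreviation "kG \<equiv> monoid_alg G :: ('k, 'g \<Rightarrow>\<^sub>0 'k) module"
abbreviation "coord v b \<equiv> V.representation B v b"
abbreviation "vT \<equiv> V_to_TV scale B"
abbreviation "aT \<equiv> act_tensor scale B act"
abbreviation "trip \<equiv> tri scale B"

sublocale FM: Group.monoid "free_monoid B" by (rule monoid_free_monoid)
sublocale BM: Group.monoid "bimod_words G B" by (rule monoid_bimod_words)
sublocale TVR: ring TV by (rule FM.ring_monoid_alg)
sublocale TUR: ring TU by (rule BM.ring_monoid_alg)

lemma act_linear: "g \<in> carrier G \<Longrightarrow> Vector_Spaces.linear scale scale (act g)"
  and act_one [simp]: "act \<one> v = v"
  and act_mult: "g \<in> carrier G \<Longrightarrow> h \<in> carrier G \<Longrightarrow> act (g \<otimes> h) v = act g (act h v)"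
  using rep by (auto simp: is_rep_def)

lemma act_add: "g \<in> carrier G \<Longrightarrow> act g (v + w) = act g v + act g w"
  and act_scale: "g \<in> carrier G \<Longrightarrow> act g (scale c v) = scale c (act g v)"
  and act_zero [simp]: "g \<in> carrier G \<Longrightarrow> act g 0 = 0"
  and act_sum: "g \<in> carrier G \<Longrightarrow> act g (\<Sum>i\<in>I. f i) = (\<Sum>i\<in>I. act g (f i))"
proof -
  assume "g \<in> carrier G"
  then interpret L: Vector_Spaces.linear scale scale "act g" by (rule act_linear)
  show "act g (v + w) = act g v + act g w" "act g (scale c v) = scale c (act g v)" "act g 0 = 0"
    "act g (\<Sum>i\<in>I. f i) = (\<Sum>i\<in>I. act g (f i))"
    by (fact L.add L.scale L.zero L.sum)+
qed

lemma coord_add: "coord (v + w) b = coord v b + coord w b"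
  and coord_scale: "coord (scale c v) b = c * coord v b"
  and coord_zero [simp]: "coord 0 b = 0"
  by (simp_all add: V.representation_add V.representation_scale V.representation_zero
      V.independent_Basis V.span_Basis)

lemma coord_sum: "coord (\<Sum>i\<in>I. f i) b = (\<Sum>i\<in>I. coord (f i) b)"
  by (induction I rule: infinite_finite_induct) (simp_all add: coord_add)

lemma coord_Basis: "a \<in> B \<Longrightarrow> coord a b = (if b = a then 1 else 0)"
  by (simp add: V.representation_basis V.independent_Basis)

lemma coord_not_Basis: "b \<notin> B \<Longrightarrow> coord v b = 0"
  using V.representation_ne_zero by blast

lemma sum_coord: "(\<Sum>b\<in>B. scale (coord v b) b) = v"
  using V.sum_representation_eq[OF V.independent_Basis, of v B] V.finite_Basis V.span_Basis by simp

lemma vT_lookup: "Poly_Mapping.lookup (vT v) w = (if \<exists>b. w = [b] then coord v (hd w) else 0)"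
proof -
  have "Poly_Mapping.lookup (vT v) w = (\<Sum>b\<in>B. if [b] = w then coord v b else 0)"
    by (simp add: V_to_TV_def lookup_sum lookup_single when_def)
  also have "\<dots> = (if \<exists>b. w = [b] then coord v (hd w) else 0)"
  proof (cases "\<exists>b. w = [b]")
    case True
    then obtain b where "w = [b]" by blast
    then show ?thesis using V.finite_Basis by (auto simp: sum.delta coord_not_Basis eq_commute[of _ b])
  qed (auto intro!: sum.neutral)
  finally show ?thesis .
qed

lemma vT_add: "vT (v + w) = vT v + vT w"
  and vT_scale: "vT (scale c v) = pscale c (vT v)"
  and vT_zero [simp]: "vT 0 = 0"
  by (auto intro!: poly_mapping_eqI simp: vT_lookup lookup_add coord_add coord_scale)

lemma vT_sum: "vT (\<Sum>i\<in>I. f i) = (\<Sum>i\<in>I. vT (f i))"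
  by (induction I rule: infinite_finite_induct) (simp_all add: vT_add)

lemma vT_uminus: "vT (- v) = - vT v"
  using vT_scale[of "-1" v] by simp

lemma vT_diff: "vT (v - w) = vT v - vT w"
  using vT_add[of v "- w"] by (simp add: vT_uminus)

lemma vT_Basis: "b \<in> B \<Longrightarrow> vT b = bvec [b]"
proof (rule poly_mapping_eqI)
  fix w assume "b \<in> B"
  then show "Poly_Mapping.lookup (vT b) w = Poly_Mapping.lookup (bvec [b]) w"
    by (cases "\<exists>a. w = [a]") (auto simp: vT_lookup lookup_single coord_Basis when_def)
qed

lemma vT_carrier [simp, intro]: "vT v \<in> carrier TV"
  unfolding V_to_TV_def by (intro monoid_alg_sum_closed single_in_carrier) auto

lemma vT_eq_0_iff [simp]: "vT v = 0 \<longleftrightarrow> v = 0"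
proof
  assume v: "vT v = 0"
  have "coord v b = 0" for b
    using arg_cong[OF v, of "\<lambda>p. Poly_Mapping.lookup p [b]"] by (simp add: vT_lookup)
  then show "v = 0" using sum_coord[of v] by simp
qed simp

lemma vT_expand: "vT v = (\<Sum>b\<in>B. pscale (coord v b) (bvec [b]))"
  by (simp add: V_to_TV_def)

lemma keys_vT: "w \<in> Poly_Mapping.keys (vT v) \<Longrightarrow> length w = 1"
  by (auto simp: in_keys_iff vT_lookup split: if_splits)

lemma vT_surj:
  assumes "p \<in> tensor_power B 1"
  obtains v where "vT v = p"
proof
  have keys: "\<exists>b\<in>B. w = [b]" if "w \<in> Poly_Mapping.keys p" for w
    using assms that by (cases w) (fastforce simp: tensor_power_def carrier_monoid_alg)+
  have c: "coord (\<Sum>b\<in>B. scale (Poly_Mapping.lookup p [b]) b) a = Poly_Mapping.lookup p [a]" for a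
    using keys[of "[a]"] V.finite_Basis
    by (auto simp: coord_sum coord_scale coord_Basis sum.delta' in_keys_iff if_distrib cong: if_cong sum.cong)
  show "vT (\<Sum>b\<in>B. scale (Poly_Mapping.lookup p [b]) b) = p"
    using keys by (intro poly_mapping_eqI) (auto simp: vT_lookup c in_keys_iff)
qed

abbreviation "hT n \<equiv> restr_supp (\<lambda>w::'v list. length w = n) :: ('v list \<Rightarrow>\<^sub>0 'k) \<Rightarrow> _"
abbreviation "hU n \<equiv> restr_supp (\<lambda>u::'g \<times> ('v \<times> 'g) list. length (snd u) = n) :: (_ \<Rightarrow>\<^sub>0 'k) \<Rightarrow> _"

lemma hom_comp_eq: "hom_comp n p = hU n p"
proof -
  have "hom_comp n p = lin_ext bvec (hU n p)"
    unfolding hom_comp_def lin_ext_def by (rule sum.cong) (auto simp: keys_restr_supp)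
  then show ?thesis by simp
qed

lemma tensor_power_iff: "p \<in> tensor_power B n \<longleftrightarrow> p \<in> carrier TV \<and> hT n p = p"
proof
  assume "p \<in> carrier TV \<and> hT n p = p"
  then show "p \<in> tensor_power B n"
    using keys_restr_supp[of "\<lambda>w. length w = n" p] by (auto simp: tensor_power_def)
qed (auto simp: tensor_power_def intro: restr_supp_id)

lemma hT_carrier [simp, intro]: "p \<in> carrier TV \<Longrightarrow> hT n p \<in> carrier TV"
  and hU_carrier [simp, intro]: "q \<in> carrier TU \<Longrightarrow> hU n q \<in> carrier TU"
  by (auto simp: carrier_monoid_alg keys_restr_supp)

lemma hT_hT [simp]: "hT n (hT m p) = (if n = m then hT n p else 0)"
  by (auto intro!: poly_mapping_eqI)

lemma hU_hU [simp]: "hU n (hU m p) = (if n = m then hU n p else 0)"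
  by (auto intro!: poly_mapping_eqI)

lemma tensor_power_subspace: "pv.subspace (tensor_power B n :: ('v list \<Rightarrow>\<^sub>0 'k) set)"
  unfolding pv.subspace_def
  by (auto simp: tensor_power_iff lin_map_add[OF lin_map_restr_supp] lin_map_pscale[OF lin_map_restr_supp]
      lin_map_0[OF lin_map_restr_supp])

lemma hT_in_tensor_power: "p \<in> carrier TV \<Longrightarrow> hT n p \<in> tensor_power B n"
  by (simp add: tensor_power_iff)



lemma hT_mult:
  assumes "q \<in> tensor_power B m"
  shows "hT n (p \<otimes>\<^bsub>TV\<^esub> q) = (if m \<le> n then hT (n - m) p \<otimes>\<^bsub>TV\<^esub> q else 0)"
proof -
  have *: "hT n (p \<otimes>\<^bsub>TV\<^esub> bvec w) = (if m \<le> n then hT (n - m) p \<otimes>\<^bsub>TV\<^esub> bvec w else 0)"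
    if "length w = m" for w
    by (cases "m \<le> n"; rule lin_map_eqI[where Z = UNIV and p = p])
      (use that in \<open>auto intro!: lin_intros simp:\<close>)
  show ?thesis
    by (cases "m \<le> n"; rule lin_map_eqI[where Z = "{w. length w = m}" and p = q])
      (use * assms in \<open>auto intro!: lin_intros simp: tensor_power_def\<close>)
qed

lemma hT_mult_left:
  assumes "q \<in> tensor_power B m"
  shows "hT n (q \<otimes>\<^bsub>TV\<^esub> p) = (if m \<le> n then q \<otimes>\<^bsub>TV\<^esub> hT (n - m) p else 0)"
proof -
  have *: "hT n (bvec w \<otimes>\<^bsub>TV\<^esub> p) = (if m \<le> n then bvec w \<otimes>\<^bsub>TV\<^esub> hT (n - m) p else 0)"
    if "length w = m" for w
    by (cases "m \<le> n"; rule lin_map_eqI[where Z = UNIV and p = p])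
      (use that in \<open>auto intro!: lin_intros simp:\<close>)
  show ?thesis
    by (cases "m \<le> n"; rule lin_map_eqI[where Z = "{w. length w = m}" and p = q])
      (use * assms in \<open>auto intro!: lin_intros simp: tensor_power_def\<close>)
qed

lemma hU_mult_bvec:
  assumes "length (snd w) = m"
  shows "hU n (p \<otimes>\<^bsub>TU\<^esub> bvec w) = (if m \<le> n then hU (n - m) p \<otimes>\<^bsub>TU\<^esub> bvec w else 0)"
    "hU n (bvec w \<otimes>\<^bsub>TU\<^esub> p) = (if m \<le> n then bvec w \<otimes>\<^bsub>TU\<^esub> hU (n - m) p else 0)"
  by (cases "m \<le> n"; rule lin_map_eqI[where Z = UNIV and p = p];
      use assms in \<open>auto intro!: lin_intros\<close>)+

lemma vT_tensor_power: "vT v \<in> tensor_power B 1"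
  using keys_vT vT_carrier by (auto simp: tensor_power_def)

subsection \<open>The action on tensors\<close>

lemma act_tensor_eq: "aT g = lin_ext (\<lambda>w. foldr (\<lambda>b q. vT (act g b) \<otimes>\<^bsub>TV\<^esub> q) w (bvec []))"
  by (rule ext) (simp add: act_tensor_def lin_ext_def)

lemma lin_map_aT: "lin_map (aT g)"
  unfolding act_tensor_eq by (rule lin_map_lin_ext)

lemma lin_map_aT_comp [lin_intros]: "lin_map T \<Longrightarrow> lin_map (\<lambda>p. aT g (T p))"
  by (rule lin_map_comp[OF lin_map_aT])

lemma aT_Nil [simp]: "aT g (bvec []) = bvec []"
  and aT_Cons: "aT g (bvec (b # w)) = vT (act g b) \<otimes>\<^bsub>TV\<^esub> aT g (bvec w)"
  by (simp_all add: act_tensor_eq)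

lemma aT_bvec_carrier: "aT g (bvec w) \<in> carrier TV"
  by (induction w) (auto simp: aT_Cons intro!: FM.monoid_alg_closed)

lemma aT_carrier [simp, intro]: "aT g p \<in> carrier TV"
  unfolding lin_map_expand[OF lin_map_aT, of _ p]
  by (intro lin_ext_in_subspace subspace_carrier_monoid_alg aT_bvec_carrier)

lemma aT_append: "aT g (bvec (u @ w)) = aT g (bvec u) \<otimes>\<^bsub>TV\<^esub> aT g (bvec w)"
  by (induction u)
    (auto simp: aT_Cons FM.monoid_alg_one_left[simplified] FM.monoid_alg_assoc)

lemma aT_mult: "aT g (p \<otimes>\<^bsub>TV\<^esub> q) = aT g p \<otimes>\<^bsub>TV\<^esub> aT g q"
proof (rule lin_map_eqI[where Z = UNIV and p = p])
  show "aT g (bvec u \<otimes>\<^bsub>TV\<^esub> q) = aT g (bvec u) \<otimes>\<^bsub>TV\<^esub> aT g q" for u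
    by (rule lin_map_eqI[where Z = UNIV and p = q]) (auto intro!: lin_intros simp: aT_append)
qed (auto intro!: lin_intros)

lemma aT_vT: "g \<in> carrier G \<Longrightarrow> aT g (vT v) = vT (act g v)"
proof -
  assume g: "g \<in> carrier G"
  have "aT g (vT v) = (\<Sum>b\<in>B. pscale (coord v b) (vT (act g b)))"
    by (simp add: vT_expand[of v] lin_map_sum[OF lin_map_aT] lin_map_pscale[OF lin_map_aT] aT_Cons
        FM.monoid_alg_one_right[simplified] del: pscale_single)
  also have "\<dots> = vT (act g (\<Sum>b\<in>B. scale (coord v b) b))"
    using g by (simp add: act_sum act_scale vT_sum vT_scale)
  finally show ?thesis by (simp add: sum_coord)
qed

lemma aT_aT: "g \<in> carrier G \<Longrightarrow> h \<in> carrier G \<Longrightarrow> p \<in> carrier TV \<Longrightarrow> aT g (aT h p) = aT (g \<otimes> h) p"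
proof (rule lin_map_eqI[where Z = "lists B" and p = p])
  fix w assume "g \<in> carrier G" "h \<in> carrier G"
  then show "aT g (aT h (bvec w)) = aT (g \<otimes> h) (bvec w)"
    by (induction w) (auto simp: aT_Cons aT_mult aT_vT act_mult)
qed (auto intro!: lin_intros simp: carrier_monoid_alg)

lemma aT_one: "p \<in> carrier TV \<Longrightarrow> aT \<one> p = p"
proof (rule lin_map_eqI[where Z = "lists B" and p = p])
  fix w assume "w \<in> lists B"
  then show "aT \<one> (bvec w) = bvec w"
    by (induction w) (auto simp: aT_Cons vT_Basis)
qed (auto intro!: lin_intros simp: carrier_monoid_alg)

subsection \<open>Normal forms\<close>

text \<open>Moving all group elements of a word to the right by \<open>g v = \<^sup>gv g\<close> gives
  \<open>word_tens\<close> followed by \<open>word_grp\<close>.\<close>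

primrec word_grp :: "'g \<Rightarrow> ('v \<times> 'g) list \<Rightarrow> 'g" where
  "word_grp g [] = g"
| "word_grp g (x # xs) = word_grp (g \<otimes> snd x) xs"

primrec word_tens :: "'g \<Rightarrow> ('v \<times> 'g) list \<Rightarrow> 'v list \<Rightarrow>\<^sub>0 'k" where
  "word_tens g [] = bvec []"
| "word_tens g (x # xs) = vT (act g (fst x)) \<otimes>\<^bsub>TV\<^esub> word_tens (g \<otimes> snd x) xs"

lemma word_grp_closed: "g \<in> carrier G \<Longrightarrow> xs \<in> lists (B \<times> carrier G) \<Longrightarrow> word_grp g xs \<in> carrier G"
  by (induction xs arbitrary: g) auto

lemma word_grp_left:
  "g \<in> carrier G \<Longrightarrow> h \<in> carrier G \<Longrightarrow> xs \<in> lists (B \<times> carrier G) \<Longrightarrow>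
    word_grp (g \<otimes> h) xs = g \<otimes> word_grp h xs"
  by (induction xs arbitrary: h) (auto simp: m_assoc)

lemma word_tens_carrier [simp, intro]: "word_tens g xs \<in> carrier TV"
  by (induction xs arbitrary: g) (auto intro!: FM.monoid_alg_closed)

lemma word_tens_power: "word_tens g xs \<in> tensor_power B (length xs)"
proof (induction xs arbitrary: g)
  case (Cons x xs)
  show ?case using Cons[of "g \<otimes> snd x"]
    by (auto simp: tensor_power_iff FM.monoid_alg_closed hT_mult_left[OF vT_tensor_power])
qed (auto simp: tensor_power_iff)

lemma word_tens_left:
  "g \<in> carrier G \<Longrightarrow> h \<in> carrier G \<Longrightarrow> xs \<in> lists (B \<times> carrier G) \<Longrightarrow>
    word_tens (g \<otimes> h) xs = aT g (word_tens h xs)"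
  by (induction xs arbitrary: h) (auto simp: m_assoc aT_mult aT_vT act_mult)

text \<open>This is the product rule (p g)(q h) = p (\<open>aT g q\<close>) (gh) of the skew group
  algebra of T(V), for normal forms of words. Both components are treated in one recursion on the
  left factor.\<close>

lemma word_mult:
  assumes "g \<in> carrier G" "xs \<in> lists (B \<times> carrier G)" "u \<in> carrier (bimod_words G B)"
  shows "case_prod word_grp ((g, xs) \<otimes>\<^bsub>bimod_words G B\<^esub> u) = word_grp g xs \<otimes> case_prod word_grp u
    \<and> case_prod word_tens ((g, xs) \<otimes>\<^bsub>bimod_words G B\<^esub> u)
      = word_tens g xs \<otimes>\<^bsub>TV\<^esub> aT (word_grp g xs) (case_prod word_tens u)"
  using assms(1,2)
proof (induction xs arbitrary: g)
  case Nil
  then show ?case using assms(3)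
    by (cases u) (auto simp: word_grp_left word_tens_left FM.monoid_alg_one_left[simplified])
next
  case (Cons x xs)
  obtain b h where x: "x = (b, h)" by (cases x)
  then have h: "h \<in> carrier G" "b \<in> B" "xs \<in> lists (B \<times> carrier G)" using Cons.prems by auto
  obtain k zs where kz: "(h, xs) \<otimes>\<^bsub>bimod_words G B\<^esub> u = (k, zs)" by fastforce
  have "(k, zs) \<in> carrier (bimod_words G B)"
    using bimod_words_closed[of "(h, xs)" B u] kz h assms(3) by auto
  then have k: "k \<in> carrier G" "zs \<in> lists (B \<times> carrier G)" by auto
  have IH: "word_grp k zs = word_grp h xs \<otimes> case_prod word_grp u"
    "word_tens k zs = word_tens h xs \<otimes>\<^bsub>TV\<^esub> aT (word_grp h xs) (case_prod word_tens u)"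
    using Cons.IH[OF h(1,3)] kz by auto
  have u: "case_prod word_grp u \<in> carrier G" "case_prod word_tens u \<in> carrier TV"
    using assms(3) by (auto simp: word_grp_closed in_lists_conv_set)
  show ?case
    using Cons.prems(1) k h u
    by (auto simp: x kz bimod_words_mult_Cons word_grp_left word_tens_left IH aT_mult m_assoc
        word_grp_closed aT_aT FM.monoid_alg_assoc FM.monoid_alg_closed)
qed

text \<open>The coefficient at the group element h of the image of an element of T in T(V) \<rtimes>
  G.\<close>

definition nform :: "'g \<Rightarrow> ('g \<times> ('v \<times> 'g) list \<Rightarrow>\<^sub>0 'k) \<Rightarrow> ('v list \<Rightarrow>\<^sub>0 'k)" where
  "nform h = lin_ext (\<lambda>u. if case_prod word_grp u = h then case_prod word_tens u else 0)"

lemma lin_map_nform: "lin_map (nform h)"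
  unfolding nform_def by (rule lin_map_lin_ext)

lemma lin_map_nform_comp [lin_intros]: "lin_map T \<Longrightarrow> lin_map (\<lambda>p. nform h (T p))"
  by (rule lin_map_comp[OF lin_map_nform])

lemma nform_bvec: "nform h (bvec (g, xs)) = (if word_grp g xs = h then word_tens g xs else 0)"
  by (simp add: nform_def)

lemma nform_carrier [simp, intro]: "nform h x \<in> carrier TV"
  unfolding nform_def
  by (intro lin_ext_in_subspace subspace_carrier_monoid_alg) auto

lemma nform_outside: "x \<in> carrier TU \<Longrightarrow> h \<notin> carrier G \<Longrightarrow> nform h x = 0"
  by (rule lin_map_eqI[where Z = "carrier (bimod_words G B)" and p = x and T = "\<lambda>p. 0"])
    (auto intro!: lin_intros simp: carrier_monoid_alg nform_bvec word_grp_closed in_lists_conv_set)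

text \<open>The sum has the shape of the multiplication in \<open>skew_alg\<close>, which is what
  makes the projection to \<open>S \<rtimes> G\<close> multiplicative.\<close>

lemma nform_mult:
  assumes "x \<in> carrier TU" "y \<in> carrier TU" "h \<in> carrier G"
  shows "nform h (x \<otimes>\<^bsub>TU\<^esub> y) = (\<Sum>g\<in>carrier G. nform g x \<otimes>\<^bsub>TV\<^esub> aT g (nform (inv g \<otimes> h) y))"
proof (rule lin_map_eqI[where Z = "carrier (bimod_words G B)" and p = x])
  fix u assume u: "u \<in> carrier (bimod_words G B)"
  show "nform h (bvec u \<otimes>\<^bsub>TU\<^esub> y) = (\<Sum>g\<in>carrier G. nform g (bvec u) \<otimes>\<^bsub>TV\<^esub> aT g (nform (inv g \<otimes> h) y))"
  proof (rule lin_map_eqI[where Z = "carrier (bimod_words G B)" and p = y])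
    fix w assume w: "w \<in> carrier (bimod_words G B)"
    obtain g xs where g: "u = (g, xs)" "g \<in> carrier G" "xs \<in> lists (B \<times> carrier G)" using u by auto
    define a where "a = word_grp g xs"
    have a: "a \<in> carrier G" using g by (simp add: a_def word_grp_closed)
    have wg: "case_prod word_grp w \<in> carrier G"
      using w by (auto simp: word_grp_closed in_lists_conv_set)
    have "(\<Sum>g\<in>carrier G. nform g (bvec u) \<otimes>\<^bsub>TV\<^esub> aT g (nform (inv g \<otimes> h) (bvec w)))
        = (\<Sum>g\<in>carrier G. if g = a then word_tens (fst u) (snd u) \<otimes>\<^bsub>TV\<^esub> aT a (nform (inv a \<otimes> h) (bvec w)) else 0)"
      by (rule sum.cong) (auto simp: g nform_bvec a_def)
    also have "\<dots> = word_tens g xs \<otimes>\<^bsub>TV\<^esub> aT a (nform (inv a \<otimes> h) (bvec w))"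
      using a fin_G g by simp
    also have "\<dots> = (if a \<otimes> case_prod word_grp w = h
        then word_tens g xs \<otimes>\<^bsub>TV\<^esub> aT a (case_prod word_tens w) else 0)"
      using a wg assms(3) by (auto simp: nform_def lin_map_0[OF lin_map_aT] m_assoc[symmetric])
    also have "\<dots> = nform h (bvec u \<otimes>\<^bsub>TU\<^esub> bvec w)"
      using word_mult[OF g(2,3) w] by (simp add: nform_def g(1) a_def)
    finally show "nform h (bvec u \<otimes>\<^bsub>TU\<^esub> bvec w)
      = (\<Sum>g\<in>carrier G. nform g (bvec u) \<otimes>\<^bsub>TV\<^esub> aT g (nform (inv g \<otimes> h) (bvec w)))" by simp
  qed (use assms in \<open>auto intro!: lin_intros simp: carrier_monoid_alg\<close>)
qed (use assms in \<open>auto intro!: lin_intros simp: carrier_monoid_alg\<close>)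

text \<open>The undeformed skew relations are homogeneous, so moving group elements to the right
  preserves the degree.\<close>

lemma nform_hU: "nform h (hU n x) = hT n (nform h x)"
proof (rule lin_map_eqI[where Z = UNIV and p = x])
  fix u :: "'g \<times> ('v \<times> 'g) list"
  show "nform h (hU n (bvec u)) = hT n (nform h (bvec u))"
    using word_tens_power[of "fst u" "snd u"] hT_hT[of n "length (snd u)" "word_tens (fst u) (snd u)"]
    by (cases u) (auto simp: nform_bvec lin_map_0[OF lin_map_nform] lin_map_0[OF lin_map_restr_supp]
        tensor_power_iff)
qed (auto intro!: lin_intros)

end

context skew_setup
begin

subsection \<open>Elements of the tensor algebra of the bimodule\<close>

abbreviation "iG \<equiv> kG_to_TU :: ('g \<Rightarrow>\<^sub>0 'k) \<Rightarrow> ('g \<times> ('v \<times> 'g) list \<Rightarrow>\<^sub>0 'k)"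
abbreviation "iV \<equiv> VkG_to_TU scale B G"
abbreviation "iT \<equiv> TV_to_TU G :: ('v list \<Rightarrow>\<^sub>0 'k) \<Rightarrow> ('g \<times> ('v \<times> 'g) list \<Rightarrow>\<^sub>0 'k)"

lemma kG_to_TU_eq: "iG = lin_ext (\<lambda>g. bvec (g, []))"
  by (rule ext) (simp add: kG_to_TU_def lin_ext_def)

lemma TV_to_TU_eq: "iT = lin_ext (\<lambda>w. bvec (\<one>, map (\<lambda>b. (b, \<one>)) w))"
  by (rule ext) (simp add: TV_to_TU_def lin_ext_def)

lemma lin_map_iG: "lin_map iG" and lin_map_iT: "lin_map iT"
  unfolding kG_to_TU_eq TV_to_TU_eq by (rule lin_map_lin_ext)+

lemma lin_map_iG_comp [lin_intros]: "lin_map T \<Longrightarrow> lin_map (\<lambda>p. iG (T p))"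
  and lin_map_iT_comp [lin_intros]: "lin_map S \<Longrightarrow> lin_map (\<lambda>p. iT (S p))"
  by (rule lin_map_comp[OF lin_map_iG] lin_map_comp[OF lin_map_iT], assumption)+

lemma iG_bvec [simp]: "iG (bvec g) = bvec (g, [])"
  and iT_bvec: "iT (bvec w) = bvec (\<one>, map (\<lambda>b. (b, \<one>)) w)"
  by (simp_all add: kG_to_TU_eq TV_to_TU_eq)

lemma iG_carrier [simp, intro]: "a \<in> carrier kG \<Longrightarrow> iG a \<in> carrier TU"
  unfolding kG_to_TU_eq
  by (intro lin_ext_in_subspace subspace_carrier_monoid_alg) (auto simp: carrier_monoid_alg)

lemma iT_carrier [simp, intro]: "p \<in> carrier TV \<Longrightarrow> iT p \<in> carrier TU"
  unfolding TV_to_TU_eq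
  by (intro lin_ext_in_subspace subspace_carrier_monoid_alg)
    (auto simp: carrier_monoid_alg subset_iff in_lists_conv_set)

lemma trip_carrier [simp, intro]: "g \<in> carrier G \<Longrightarrow> h \<in> carrier G \<Longrightarrow> trip g v h \<in> carrier TU"
  unfolding tri_def by (intro monoid_alg_sum_closed single_in_carrier) auto

lemma iV_carrier [simp, intro]: "iV f \<in> carrier TU"
  unfolding VkG_to_TU_def by (intro monoid_alg_sum_closed) auto

lemma trip_add: "trip g (v + w) h = trip g v h + trip g w h"
  and trip_scale: "trip g (scale c v) h = pscale c (trip g v h)"
  and trip_zero [simp]: "trip g 0 h = 0"
  by (simp_all add: tri_def coord_add coord_scale single_add sum.distrib pv.scale_sum_right)

lemma trip_uminus: "trip g (- v) h = - trip g v h"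
  using trip_scale[of g "-1" v h] by simp

lemma trip_diff: "trip g (v - w) h = trip g v h - trip g w h"
  using trip_add[of g v "- w" h] by (simp add: trip_uminus)

lemma trip_expand: "trip g v h = (\<Sum>b\<in>B. pscale (coord v b) (bvec (g, [(b, h)])))"
  by (simp add: tri_def)

lemma trip_Basis: "b \<in> B \<Longrightarrow> trip g b h = bvec (g, [(b, h)])"
proof -
  assume b: "b \<in> B"
  have "trip g b h = (\<Sum>a\<in>B. if a = b then bvec (g, [(b, h)]) else 0)"
    unfolding tri_def by (rule sum.cong) (auto simp: coord_Basis[OF b])
  then show ?thesis using b V.finite_Basis by simp
qed

lemma trip_factor:
  assumes "g \<in> carrier G" "h \<in> carrier G" "k \<in> carrier G"
  shows "bvec (g, []) \<otimes>\<^bsub>TU\<^esub> trip k v h = trip (g \<otimes> k) v h"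
    "trip k v h \<otimes>\<^bsub>TU\<^esub> bvec (g, []) = trip k v (h \<otimes> g)"
  using assms
  by (simp_all add: tri_def mult_sums bimod_words_mult_Cons)

lemma iT_vT: "iT (vT v) = trip \<one> v \<one>"
  by (simp add: vT_expand trip_expand lin_map_sum[OF lin_map_iT] lin_map_pscale[OF lin_map_iT] iT_bvec
      del: pscale_single)

lemma iT_one: "iT (bvec []) = bvec (\<one>, [])"
  by (simp add: iT_bvec)

lemma iT_mult: "iT (p \<otimes>\<^bsub>TV\<^esub> q) = iT p \<otimes>\<^bsub>TU\<^esub> iT q"
proof (rule lin_map_eqI[where Z = UNIV and p = p])
  fix u
  have *: "(\<one>, map (\<lambda>b. (b, \<one>)) (u @ w)) = (\<one>, map (\<lambda>b. (b, \<one>)) u) \<otimes>\<^bsub>bimod_words G B\<^esub> (\<one>, map (\<lambda>b. (b, \<one>)) w)"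
    for w by (induction u) (auto simp: bimod_words_mult_Cons prod_eq_iff)
  show "iT (bvec u \<otimes>\<^bsub>TV\<^esub> q) = iT (bvec u) \<otimes>\<^bsub>TU\<^esub> iT q"
    by (rule lin_map_eqI[where Z = UNIV and p = q]) (use * in \<open>auto intro!: lin_intros simp: iT_bvec\<close>)
qed (auto intro!: lin_intros)

lemma iG_mult: "iG (a \<otimes>\<^bsub>kG\<^esub> c) = iG a \<otimes>\<^bsub>TU\<^esub> iG c"
proof (rule lin_map_eqI[where Z = UNIV and p = a])
  show "iG (bvec g \<otimes>\<^bsub>kG\<^esub> c) = iG (bvec g) \<otimes>\<^bsub>TU\<^esub> iG c" for g
    by (rule lin_map_eqI[where Z = UNIV and p = c]) (auto intro!: lin_intros)
qed (auto intro!: lin_intros)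

lemma iV_add: "iV (\<lambda>a. f a + f' a) = iV f + iV f'"
  and iV_scale: "iV (\<lambda>a. scale c (f a)) = pscale c (iV f)"
  and iV_diff: "iV (\<lambda>a. f a - f' a) = iV f - iV f'"
  and iV_zero [simp]: "iV (\<lambda>a. 0) = 0"
  by (simp_all add: VkG_to_TU_def trip_add trip_scale trip_diff sum.distrib sum_subtractf pv.scale_sum_right)

lemma iV_sum: "iV (\<lambda>a. \<Sum>i\<in>I. f i a) = (\<Sum>i\<in>I. iV (f i))"
  by (induction I rule: infinite_finite_induct) (simp_all add: iV_add)

lemma iV_cong: "(\<And>a. a \<in> carrier G \<Longrightarrow> f a = f' a) \<Longrightarrow> iV f = iV f'"
  by (simp add: VkG_to_TU_def)

lemma iV_single: "g \<in> carrier G \<Longrightarrow> iV (\<lambda>a. if a = g then v else 0) = trip \<one> v g"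
proof -
  assume g: "g \<in> carrier G"
  have "iV (\<lambda>a. if a = g then v else 0) = (\<Sum>a\<in>carrier G. if a = g then trip \<one> v g else 0)"
    unfolding VkG_to_TU_def by (rule sum.cong) auto
  then show ?thesis using g fin_G by simp
qed

lemma iV_right:
  assumes "g \<in> carrier G"
  shows "iV f \<otimes>\<^bsub>TU\<^esub> bvec (g, []) = iV (\<lambda>a. f (a \<otimes> inv g))"
proof -
  have "iV f \<otimes>\<^bsub>TU\<^esub> bvec (g, []) = (\<Sum>a\<in>carrier G. trip \<one> (f a) (a \<otimes> g))"
    unfolding VkG_to_TU_def mult_sums using assms by (intro sum.cong) (auto simp: trip_factor)
  also have "\<dots> = (\<Sum>a\<in>carrier G. trip \<one> (f (a \<otimes> inv g)) a)"
    by (rule sum.reindex_bij_witness[of _ "\<lambda>a. a \<otimes> inv g" "\<lambda>a. a \<otimes> g"])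
      (use assms in \<open>auto simp: m_assoc\<close>)
  finally show ?thesis by (simp add: VkG_to_TU_def)
qed

lemma kG_expand: "c \<in> carrier kG \<Longrightarrow> c = (\<Sum>g\<in>carrier G. pscale (Poly_Mapping.lookup c g) (bvec g))"
  using lin_ext_superset[OF fin_G, of c bvec] by (simp add: carrier_monoid_alg)

lemma kG_lookup: "c \<in> carrier kG \<Longrightarrow> g \<notin> carrier G \<Longrightarrow> Poly_Mapping.lookup c g = 0"
  by (auto simp: carrier_monoid_alg in_keys_iff)

lemma trip_iG:
  assumes "c \<in> carrier kG"
  shows "trip \<one> v \<one> \<otimes>\<^bsub>TU\<^esub> iG c = iV (\<lambda>a. scale (Poly_Mapping.lookup c a) v)"
  by (subst (1) kG_expand[OF assms])
    (simp add: VkG_to_TU_def lin_map_sum[OF lin_map_iG] lin_map_pscale[OF lin_map_iG] mult_sums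
      mult_pscales trip_factor trip_scale del: pscale_single)

lemma nform_trip:
  assumes "g \<in> carrier G" "k \<in> carrier G"
  shows "nform h (trip g v k) = (if g \<otimes> k = h then vT (act g v) else 0)"
proof -
  have "nform h (trip g v k) = (\<Sum>b\<in>B. pscale (coord v b) (if g \<otimes> k = h then vT (act g b) else 0))"
    by (simp add: trip_expand lin_map_sum[OF lin_map_nform] lin_map_pscale[OF lin_map_nform]
        nform_bvec FM.monoid_alg_one_right[simplified] del: pscale_single cong: if_cong)
  also have "\<dots> = (if g \<otimes> k = h then vT (act g (\<Sum>b\<in>B. scale (coord v b) b)) else 0)"
    using assms by (simp add: act_sum act_scale vT_sum vT_scale)
  finally show ?thesis by (simp add: sum_coord)
qed

lemma nform_iG: "nform h (iG c) = pscale (Poly_Mapping.lookup c h) (bvec [])"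
proof (rule lin_map_eqI[where Z = UNIV and p = c])
  show "lin_map (\<lambda>c. pscale (Poly_Mapping.lookup c h) (bvec [] :: 'v list \<Rightarrow>\<^sub>0 'k))"
    by (rule lin_mapI) (simp_all add: lookup_add single_add)
qed (auto intro!: lin_intros simp: nform_bvec lookup_single when_def)

lemma nform_iV: "h \<in> carrier G \<Longrightarrow> nform h (iV f) = vT (f h)"
proof -
  assume h: "h \<in> carrier G"
  have "nform h (iV f) = (\<Sum>a\<in>carrier G. if a = h then vT (f h) else 0)"
    unfolding VkG_to_TU_def lin_map_sum[OF lin_map_nform]
    by (rule sum.cong) (auto simp: nform_trip)
  then show ?thesis using h fin_G by simp
qed

lemma nform_iT: "p \<in> carrier TV \<Longrightarrow> nform h (iT p) = (if h = \<one> then p else 0)"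
proof -
  assume p: "p \<in> carrier TV"
  have *: "word_grp \<one> (map (\<lambda>b. (b, \<one>)) w) = \<one> \<and> word_tens \<one> (map (\<lambda>b. (b, \<one>)) w) = bvec w"
    if "w \<in> lists B" for w using that by (induction w) (auto simp: vT_Basis)
  show ?thesis
  proof (cases "h = \<one>")
    case True
    then show ?thesis
      by simp (rule lin_map_eqI[where Z = "lists B" and p = p],
        use p * in \<open>auto intro!: lin_intros simp: carrier_monoid_alg iT_bvec nform_bvec\<close>)
  next
    case False
    then show ?thesis
      by simp (rule lin_map_eqI[where Z = "lists B" and p = p and T = "\<lambda>p. 0"],
        use p * in \<open>auto intro!: lin_intros simp: carrier_monoid_alg iT_bvec nform_bvec\<close>)
  qed
qed

subsection \<open>Commuting group elements to the right\<close>

text \<open>The function l is a parameter because three ideals are used: the kernel of the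
  projection to \<open>S \<rtimes> G\<close> with l = 0, the annihilator of the word module with l =
  \<lambda>, and the ideal of a given deformation with the function l read off from it.\<close>

definition skew_in :: "('g \<times> ('v \<times> 'g) list \<Rightarrow>\<^sub>0 'k) set \<Rightarrow> ('g \<Rightarrow> 'v \<Rightarrow> ('g \<Rightarrow>\<^sub>0 'k)) \<Rightarrow> bool" where
  "skew_in N l \<longleftrightarrow> ideal N TU \<and> (\<forall>g\<in>carrier G. \<forall>v. l g v \<in> carrier kG
    \<and> trip g v \<one> - trip \<one> (act g v) g - iG (l g v) \<in> N)"

lemma ideal_TU:
  assumes "ideal N TU"
  shows "pv.subspace N" "x \<in> N \<Longrightarrow> y \<in> carrier TU \<Longrightarrow> x \<otimes>\<^bsub>TU\<^esub> y \<in> N"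
    "x \<in> N \<Longrightarrow> y \<in> carrier TU \<Longrightarrow> y \<otimes>\<^bsub>TU\<^esub> x \<in> N" "x \<in> N \<Longrightarrow> x \<in> carrier TU"
  using BM.ideal_monoid_alg_subspace[OF assms] ideal.I_l_closed[OF assms] ideal.I_r_closed[OF assms]
    ideal.Icarr[OF assms] by auto

lemma lam_ext_eq: "lam_ext G l c v = lin_ext (\<lambda>g. l g v) c"
  by (simp add: lam_ext_def lin_ext_def)

text \<open>The expression is linear in c, and for a single group element it is the skew relation
  itself.\<close>

lemma kG_move:
  assumes N: "skew_in N l" and c: "c \<in> carrier kG"
  shows "iG c \<otimes>\<^bsub>TU\<^esub> trip \<one> v \<one> - iV (\<lambda>a. scale (Poly_Mapping.lookup c a) (act a v))
    - iG (lam_ext G l c v) \<in> N"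
proof -
  have sub: "pv.subspace N" using N by (auto simp: skew_in_def intro: ideal_TU)
  define T where "T c = iG c \<otimes>\<^bsub>TU\<^esub> trip \<one> v \<one> - iV (\<lambda>a. scale (Poly_Mapping.lookup c a) (act a v))
    - iG (lam_ext G l c v)" for c
  have "lin_map (\<lambda>c. iV (\<lambda>a. scale (Poly_Mapping.lookup c a) (act a v)))"
    by (rule lin_mapI)
      (simp_all add: lookup_add V.scale_left_distrib iV_add iV_scale flip: V.scale_scale)
  then have T: "lin_map T"
    unfolding T_def lam_ext_eq by (intro lin_intros)
  have "T c \<in> N"
    unfolding lin_map_expand[OF T, of c]
  proof (rule lin_ext_in_subspace[OF sub])
    fix g assume "g \<in> Poly_Mapping.keys c"
    then have g: "g \<in> carrier G" using c by (auto simp: carrier_monoid_alg)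
    have "iV (\<lambda>a. scale (Poly_Mapping.lookup (bvec g) a) (act a v)) = iV (\<lambda>a. if a = g then act g v else 0)"
      by (rule iV_cong) (auto simp: lookup_single when_def)
    then have "T (bvec g) = trip g v \<one> - trip \<one> (act g v) g - iG (l g v)"
      using g by (simp add: T_def trip_factor iV_single lam_ext_eq)
    then show "T (bvec g) \<in> N" using N g by (auto simp: skew_in_def)
  qed
  then show ?thesis by (simp add: T_def)
qed

text \<open>Take the skew relations of g with each \<open>f a\<close>, multiply on the right by a
  and add. Reindexing by a -> g a explains the argument \<open>inv g \<otimes> a\<close>.\<close>

lemma VkG_move:
  assumes N: "skew_in N l" and g: "g \<in> carrier G"
  shows "bvec (g, []) \<otimes>\<^bsub>TU\<^esub> iV f - iV (\<lambda>a. act g (f (inv g \<otimes> a)))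
    - iG (\<Sum>a\<in>carrier G. l g (f a) \<otimes>\<^bsub>kG\<^esub> bvec a) \<in> N"
proof -
  have sub: "pv.subspace N" and ideal: "ideal N TU" using N by (auto simp: skew_in_def intro: ideal_TU)
  have "(\<Sum>a\<in>carrier G. (trip g (f a) \<one> - trip \<one> (act g (f a)) g - iG (l g (f a))) \<otimes>\<^bsub>TU\<^esub> bvec (a, [])) \<in> N"
    using N g by (intro pv.subspace_sum[OF sub] ideal_TU(2)[OF ideal]) (auto simp: skew_in_def)
  moreover have "(\<Sum>a\<in>carrier G. trip g (f a) \<one> \<otimes>\<^bsub>TU\<^esub> bvec (a, [])) = bvec (g, []) \<otimes>\<^bsub>TU\<^esub> iV f"
    unfolding VkG_to_TU_def mult_sums using g by (intro sum.cong) (auto simp: trip_factor)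
  moreover have "(\<Sum>a\<in>carrier G. trip \<one> (act g (f a)) g \<otimes>\<^bsub>TU\<^esub> bvec (a, [])) = iV (\<lambda>a. act g (f (inv g \<otimes> a)))"
    unfolding VkG_to_TU_def
    by (rule sum.reindex_bij_witness[of _ "\<lambda>a. inv g \<otimes> a" "\<lambda>a. g \<otimes> a"])
      (use g in \<open>auto simp: m_assoc[symmetric] trip_factor\<close>)
  moreover have "(\<Sum>a\<in>carrier G. iG (l g (f a)) \<otimes>\<^bsub>TU\<^esub> bvec (a, [])) = iG (\<Sum>a\<in>carrier G. l g (f a) \<otimes>\<^bsub>kG\<^esub> bvec a)"
    by (simp add: lin_map_sum[OF lin_map_iG] iG_mult)
  ultimately show ?thesis
    by (simp add: mult_distribs sum_subtractf)
qed

text \<open>One skew relation takes the leading group element past the first letter, where it is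
  absorbed by the next group element; induction treats the rest of the word.\<close>

lemma word_normal_form:
  assumes N: "skew_in N (\<lambda>g v. 0)" and "g \<in> carrier G" "xs \<in> lists (B \<times> carrier G)"
  shows "bvec (g, xs) - iT (word_tens g xs) \<otimes>\<^bsub>TU\<^esub> bvec (word_grp g xs, []) \<in> N"
  using assms(2,3)
proof (induction xs arbitrary: g)
  case Nil
  have "pv.subspace N" using N by (auto simp: skew_in_def intro: ideal_TU)
  then show ?case using Nil by (simp add: iT_one pv.subspace_0)
next
  case (Cons x xs)
  have sub: "pv.subspace N" and ideal: "ideal N TU" using N by (auto simp: skew_in_def intro: ideal_TU)
  obtain b h where x: "x = (b, h)" by (cases x)
  then have h: "h \<in> carrier G" "b \<in> B" "xs \<in> lists (B \<times> carrier G)" using Cons.prems by auto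
  have "(trip g b \<one> - trip \<one> (act g b) g) \<otimes>\<^bsub>TU\<^esub> bvec (h, xs) \<in> N"
    using N Cons.prems(1) h
    by (intro ideal_TU(2)[OF ideal]) (auto simp: skew_in_def lin_map_0[OF lin_map_iG])
  moreover have "trip g b \<one> \<otimes>\<^bsub>TU\<^esub> bvec (h, xs) = bvec (g, x # xs)"
    using h by (simp add: trip_Basis bimod_words_mult_Cons x)
  moreover have "trip \<one> (act g b) g \<otimes>\<^bsub>TU\<^esub> bvec (h, xs) = trip \<one> (act g b) \<one> \<otimes>\<^bsub>TU\<^esub> bvec (g \<otimes> h, xs)"
    using Cons.prems(1) h by (simp add: tri_def mult_sums bimod_words_mult_Cons)
  moreover have "trip \<one> (act g b) \<one> \<otimes>\<^bsub>TU\<^esub> (bvec (g \<otimes> h, xs)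
      - iT (word_tens (g \<otimes> h) xs) \<otimes>\<^bsub>TU\<^esub> bvec (word_grp (g \<otimes> h) xs, [])) \<in> N"
    using Cons.IH[of "g \<otimes> h"] Cons.prems(1) h by (intro ideal_TU(3)[OF ideal]) auto
  moreover have "trip \<one> (act g b) \<one> \<otimes>\<^bsub>TU\<^esub> (iT (word_tens (g \<otimes> h) xs) \<otimes>\<^bsub>TU\<^esub> bvec (word_grp (g \<otimes> h) xs, []))
      = iT (word_tens g (x # xs)) \<otimes>\<^bsub>TU\<^esub> bvec (word_grp g (x # xs), [])"
    using Cons.prems(1) h word_grp_closed[of "g \<otimes> h" xs]
    by (simp add: x iT_mult iT_vT BM.monoid_alg_assoc)
  ultimately show ?case
    using pv.subspace_add[OF sub] by (fastforce simp: mult_distribs)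
qed

text \<open>The skew relations alone bring every element into normal form. Therefore only
  coefficients in T(V) remain to be considered when the kernel of the projection is shown to be
  generated by the relations.\<close>

lemma nform_normal_form:
  assumes N: "skew_in N (\<lambda>g v. 0)" and x: "x \<in> carrier TU"
  shows "x - (\<Sum>h\<in>carrier G. iT (nform h x) \<otimes>\<^bsub>TU\<^esub> bvec (h, [])) \<in> N"
proof -
  have sub: "pv.subspace N" using N by (auto simp: skew_in_def intro: ideal_TU)
  define T where "T x = x - (\<Sum>h\<in>carrier G. iT (nform h x) \<otimes>\<^bsub>TU\<^esub> bvec (h, []))" for x
  have T: "lin_map T" unfolding T_def by (intro lin_intros)
  have "T x \<in> N"
    unfolding lin_map_expand[OF T, of x]
  proof (rule lin_ext_in_subspace[OF sub])
    fix u assume "u \<in> Poly_Mapping.keys x"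
    then have "u \<in> carrier (bimod_words G B)"
      using x unfolding carrier_monoid_alg by blast
    then obtain g xs where u: "u = (g, xs)" "g \<in> carrier G" "xs \<in> lists (B \<times> carrier G)"
      by (cases u) auto
    have "(\<Sum>h\<in>carrier G. iT (nform h (bvec u)) \<otimes>\<^bsub>TU\<^esub> bvec (h, []))
      = (\<Sum>h\<in>carrier G. if h = word_grp g xs then iT (word_tens g xs) \<otimes>\<^bsub>TU\<^esub> bvec (word_grp g xs, []) else 0)"
      by (rule sum.cong) (auto simp: u nform_bvec lin_map_0[OF lin_map_iT])
    then show "T (bvec u) \<in> N"
      using word_normal_form[OF N u(2,3)] word_grp_closed[OF u(2,3)] fin_G by (simp add: T_def u(1))
  qed
  then show ?thesis by (simp add: T_def)
qed

end

section \<open>The ideal generated by R in T(V) and the kernel of the projection to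
  \<open>S \<rtimes> G\<close>\<close>

locale quad_setup = skew_setup scale B G act
  for scale :: "'k::field \<Rightarrow> 'v::ab_group_add \<Rightarrow> 'v" and B :: "'v set"
    and G :: "('g, 'z) monoid_scheme" (structure) and act :: "'g \<Rightarrow> 'v \<Rightarrow> 'v" +
  fixes R :: "('v list \<Rightarrow>\<^sub>0 'k) set"
  assumes R_sub: "k_subspace TV R"
    and R_deg: "R \<subseteq> tensor_power B 2"
    and R_act: "\<And>g. g \<in> carrier G \<Longrightarrow> aT g ` R \<subseteq> R"
begin

abbreviation "IT \<equiv> Idl\<^bsub>TV\<^esub> R"

lemma R_subspace: "pv.subspace R" and R_carrier: "r \<in> R \<Longrightarrow> r \<in> carrier TV"
  using R_sub unfolding k_subspace_monoid_alg_iff by auto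

lemma R_subset: "R \<subseteq> carrier TV" using R_carrier by blast

sublocale S: monoid_alg_ideal "free_monoid B" IT
  by (intro monoid_alg_ideal.intro monoid_alg_ideal_axioms.intro FM.Idl_monoid_alg(1)[OF R_subset]
      monoid_free_monoid)

lemma R_subset_IT: "R \<subseteq> IT" by (rule FM.Idl_monoid_alg[OF R_subset])

lemma IT_span: "IT = pv.span {(bvec u \<otimes>\<^bsub>TV\<^esub> r) \<otimes>\<^bsub>TV\<^esub> bvec w | u r w.
    u \<in> lists B \<and> r \<in> R \<and> w \<in> lists B}"
  using FM.Idl_monoid_alg_span[OF R_subset] by simp

text \<open>The spanning elements of \<open>IT\<close> are homogeneous of degree at least two. Hence
  \<open>IT\<close> is a graded ideal, zero in degrees below two and equal to R in degree
  two.\<close>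

lemma IT_gen_hom:
  assumes "r \<in> R"
  shows "hT n ((bvec u \<otimes>\<^bsub>TV\<^esub> r) \<otimes>\<^bsub>TV\<^esub> bvec w)
    = (if length u + 2 + length w = n then (bvec u \<otimes>\<^bsub>TV\<^esub> r) \<otimes>\<^bsub>TV\<^esub> bvec w else 0)"
proof -
  have r: "hT 2 r = r" using assms R_deg by (auto simp: tensor_power_iff)
  have "hT m r = (if m = 2 then r else 0)" for m
    using hT_hT[of m 2 r] unfolding r by (auto simp: r)
  moreover have "hT m (bvec u \<otimes>\<^bsub>TV\<^esub> r) = (if length u \<le> m then bvec u \<otimes>\<^bsub>TV\<^esub> hT (m - length u) r else 0)" for m
    by (cases "length u \<le> m"; rule lin_map_eqI[where Z = UNIV and p = r]) (auto intro!: lin_intros)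
  moreover have "hT m (q \<otimes>\<^bsub>TV\<^esub> bvec w) = (if length w \<le> m then hT (m - length w) q \<otimes>\<^bsub>TV\<^esub> bvec w else 0)" for m q
    by (cases "length w \<le> m"; rule lin_map_eqI[where Z = UNIV and p = q]) (auto intro!: lin_intros)
  ultimately show ?thesis by auto
qed



lemma IT_low:
  assumes p: "p \<in> IT" and n: "n < 2"
  shows "hT n p = 0"
proof -
  have "hT n p \<in> {0}"
    by (rule lin_map_span_subset[OF lin_map_restr_supp pv.subspace_single_0 _ p[unfolded IT_span]])
      (use n in \<open>auto simp only: IT_gen_hom mem_Collect_eq split: if_splits\<close>)
  then show ?thesis by simp
qed

lemma IT_two:
  assumes p: "p \<in> IT"
  shows "hT 2 p \<in> R"
proof (rule lin_map_span_subset[OF lin_map_restr_supp R_subspace _ p[unfolded IT_span]])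
  fix q assume "q \<in> {(bvec u \<otimes>\<^bsub>TV\<^esub> r) \<otimes>\<^bsub>TV\<^esub> bvec w | u r w. u \<in> lists B \<and> r \<in> R \<and> w \<in> lists B}"
  then obtain u r w where "q = (bvec u \<otimes>\<^bsub>TV\<^esub> r) \<otimes>\<^bsub>TV\<^esub> bvec w" "r \<in> R"
    by blast
  then show "hT 2 q \<in> R"
    using pv.subspace_0[OF R_subspace] FM.monoid_alg_one_left[OF R_carrier]
      FM.monoid_alg_one_right[OF R_carrier] by (simp add: IT_gen_hom)
qed

lemma IT_carrier: "p \<in> IT \<Longrightarrow> p \<in> carrier TV"
  by (rule S.I.Icarr)

lemma IT_mult: "p \<in> IT \<Longrightarrow> q \<in> carrier TV \<Longrightarrow> p \<otimes>\<^bsub>TV\<^esub> q \<in> IT" "p \<in> IT \<Longrightarrow> q \<in> carrier TV \<Longrightarrow> q \<otimes>\<^bsub>TV\<^esub> p \<in> IT"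
  by (auto intro: S.I.I_l_closed S.I.I_r_closed)

lemma IT_hT: "p \<in> IT \<Longrightarrow> hT n p \<in> IT"
proof -
  assume p: "p \<in> IT"
  show "hT n p \<in> IT"
  proof (rule lin_map_span_subset[OF lin_map_restr_supp S.subspace _ p[unfolded IT_span]])
    fix q assume "q \<in> {(bvec u \<otimes>\<^bsub>TV\<^esub> r) \<otimes>\<^bsub>TV\<^esub> bvec w | u r w. u \<in> lists B \<and> r \<in> R \<and> w \<in> lists B}"
    then obtain u r w where q: "q = (bvec u \<otimes>\<^bsub>TV\<^esub> r) \<otimes>\<^bsub>TV\<^esub> bvec w"
      and urw: "u \<in> lists B" "r \<in> R" "w \<in> lists B" by blast
    have "q \<in> IT"
      unfolding q using urw R_subset_IT by (intro IT_mult(1)[OF IT_mult(2)] single_in_carrier) auto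
    then show "hT n q \<in> IT"
      using pv.subspace_0[OF S.subspace] IT_gen_hom[OF urw(2), of n u w] by (auto simp: q)
  qed
qed

lemma IT_act: "g \<in> carrier G \<Longrightarrow> p \<in> IT \<Longrightarrow> aT g p \<in> IT"
proof -
  assume g: "g \<in> carrier G" and p: "p \<in> IT"
  have "aT g r \<in> IT" if "r \<in> R" for r using that R_act[OF g] R_subset_IT by blast
  then show "aT g p \<in> IT"
    by (intro lin_map_span_subset[OF lin_map_aT S.subspace, OF _ p[unfolded IT_span]])
      (auto simp: aT_mult intro!: IT_mult(1)[OF IT_mult(2)])
qed

text \<open>The kernel of the projection of the tensor algebra to \<open>S \<rtimes> G\<close>.\<close>

definition KU :: "('g \<times> ('v \<times> 'g) list \<Rightarrow>\<^sub>0 'k) set" where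
  "KU = {x \<in> carrier TU. \<forall>h\<in>carrier G. nform h x \<in> IT}"

lemma ideal_KU: "ideal KU TU"
proof (rule BM.ideal_monoid_algI)
  show "pv.subspace KU"
    using S.subspace subspace_carrier_monoid_alg[of "bimod_words G B"]
    by (auto simp: KU_def pv.subspace_def lin_map_add[OF lin_map_nform] lin_map_pscale[OF lin_map_nform]
        lin_map_0[OF lin_map_nform])
  show "KU \<subseteq> carrier TU" by (auto simp: KU_def)
  fix w x assume w: "w \<in> carrier (bimod_words G B)" and x: "x \<in> KU"
  have x': "x \<in> carrier TU" "\<And>h. h \<in> carrier G \<Longrightarrow> nform h x \<in> IT" using x by (auto simp: KU_def)
  have bw: "bvec w \<in> carrier TU" using w by (rule single_in_carrier)
  have "nform h (bvec w \<otimes>\<^bsub>TU\<^esub> x) \<in> IT" if "h \<in> carrier G" for h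
    unfolding nform_mult[OF bw x'(1) that]
    by (intro pv.subspace_sum[OF S.subspace] IT_mult(2)[OF IT_act] x' nform_carrier) (use that in auto)
  moreover have "nform h (x \<otimes>\<^bsub>TU\<^esub> bvec w) \<in> IT" if "h \<in> carrier G" for h
    unfolding nform_mult[OF x'(1) bw that]
    by (intro pv.subspace_sum[OF S.subspace] IT_mult(1) x' aT_carrier)
  ultimately show "bvec w \<otimes>\<^bsub>TU\<^esub> x \<in> KU" "x \<otimes>\<^bsub>TU\<^esub> bvec w \<in> KU"
    using x' bw by (auto simp: KU_def BM.monoid_alg_closed)
qed

definition skew_gens :: "('g \<times> ('v \<times> 'g) list \<Rightarrow>\<^sub>0 'k) set" where
  "skew_gens = {trip g v \<one> - trip \<one> (act g v) g | g v. g \<in> carrier G}"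

lemma skew_gens_carrier: "skew_gens \<subseteq> carrier TU"
  by (auto simp: skew_gens_def)

lemma skew_rels_eq: "skew_rels scale B G act = pv.span skew_gens"
  unfolding skew_rels_def
  using k_span_monoid_alg[OF skew_gens_carrier] by (simp add: skew_gens_def)

lemma skew_gens_KU: "skew_gens \<subseteq> KU"
  by (auto simp: skew_gens_def KU_def lin_map_diff[OF lin_map_nform] nform_trip S.subspace pv.subspace_0)

lemma skew_in_KU: "skew_in KU (\<lambda>g v. 0)"
  using ideal_KU skew_gens_KU by (auto simp: skew_in_def lin_map_0[OF lin_map_iG] skew_gens_def)

lemma iT_R_KU: "iT ` R \<subseteq> KU"
  using R_subset_IT R_carrier
  by (auto simp: KU_def nform_iT S.subspace pv.subspace_0)

lemma rels_carrier: "iT ` R \<union> skew_rels scale B G act \<subseteq> carrier TU"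
  unfolding skew_rels_eq using R_carrier
  by (auto intro: subsetD[OF pv.span_minimal[OF skew_gens_carrier subspace_carrier_monoid_alg]])

text \<open>This is the presentation of \<open>S \<rtimes> G\<close> by R and R'. Modulo N an
  element may be replaced by its normal form; if it lies in \<open>KU\<close>, the coefficients lie
  in \<open>IT\<close>, and the multiplicative map \<open>iT\<close> sends \<open>IT\<close> into
  N.\<close>

lemma KU_minimal:
  assumes N: "ideal N TU" and "iT ` R \<subseteq> N" "skew_gens \<subseteq> N"
  shows "KU \<subseteq> N"
proof
  fix x assume x: "x \<in> KU"
  have sub: "pv.subspace N" by (rule ideal_TU(1)[OF N])
  have "skew_in N (\<lambda>g v. 0)"
    using N assms(3) by (auto simp: skew_in_def lin_map_0[OF lin_map_iG] skew_gens_def)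
  then have *: "x - (\<Sum>h\<in>carrier G. iT (nform h x) \<otimes>\<^bsub>TU\<^esub> bvec (h, [])) \<in> N"
    by (rule nform_normal_form) (use x in \<open>auto simp: KU_def\<close>)
  have "iT p \<in> N" if "p \<in> IT" for p
  proof (rule lin_map_span_subset[OF lin_map_iT sub _ that[unfolded IT_span]])
    fix q assume "q \<in> {(bvec u \<otimes>\<^bsub>TV\<^esub> r) \<otimes>\<^bsub>TV\<^esub> bvec w | u r w. u \<in> lists B \<and> r \<in> R \<and> w \<in> lists B}"
    then obtain u r w where "q = (bvec u \<otimes>\<^bsub>TV\<^esub> r) \<otimes>\<^bsub>TV\<^esub> bvec w" "u \<in> lists B" "r \<in> R" "w \<in> lists B"
      by blast
    then show "iT q \<in> N"
      using assms(2) by (simp only: iT_mult)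
        (intro ideal_TU(2)[OF N ideal_TU(3)[OF N]] iT_carrier single_in_carrier; auto)
  qed
  then have "(\<Sum>h\<in>carrier G. iT (nform h x) \<otimes>\<^bsub>TU\<^esub> bvec (h, [])) \<in> N"
    using x by (intro pv.subspace_sum[OF sub] ideal_TU(2)[OF N]) (auto simp: KU_def)
  then show "x \<in> N" using * subspace_mem_diff_iff[OF sub *] by simp
qed

lemma KU_eq_Idl: "Idl\<^bsub>TU\<^esub> (iT ` R \<union> skew_rels scale B G act) = KU"
proof
  note Idl = BM.Idl_monoid_alg[OF rels_carrier]
  have "skew_rels scale B G act \<subseteq> KU"
    unfolding skew_rels_eq by (intro pv.span_minimal skew_gens_KU ideal_TU(1)[OF ideal_KU])
  then show "Idl\<^bsub>TU\<^esub> (iT ` R \<union> skew_rels scale B G act) \<subseteq> KU"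
    using iT_R_KU by (intro TUR.genideal_minimal[OF ideal_KU]) auto
  have "skew_gens \<subseteq> skew_rels scale B G act" unfolding skew_rels_eq by (rule pv.span_superset)
  then show "KU \<subseteq> Idl\<^bsub>TU\<^esub> (iT ` R \<union> skew_rels scale B G act)"
    using Idl(2) by (intro KU_minimal[OF Idl(1)]) auto
qed

end

lemma bvec_neq_0 [simp]: "bvec a \<noteq> (0 :: 'a \<Rightarrow>\<^sub>0 'k::field)"
  by (metis lookup_single_eq lookup_zero zero_neq_one)

context quad_setup
begin

subsection \<open>The skew group algebra as a quotient\<close>

abbreviation "AA \<equiv> skew_quad scale B G act R"

lemma quad_alg_eq: "quad_alg B R = S.QA"
  by (simp add: quad_alg_def)

text \<open>The algebra homomorphism from T onto \<open>S \<rtimes> G\<close>; by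
  \<open>proj_eq_iff\<close> its kernel is \<open>KU\<close>.\<close>

definition proj :: "('g \<times> ('v \<times> 'g) list \<Rightarrow>\<^sub>0 'k) \<Rightarrow> 'g \<Rightarrow> ('v list \<Rightarrow>\<^sub>0 'k) set" where
  "proj x = (\<lambda>h. IT +>\<^bsub>TV\<^esub> nform h x)"

text \<open>In \<open>skew_quad\<close> a group element acts on a coset by its image set. This is a
  full coset because the inverse of g acts as well and also preserves \<open>IT\<close>.\<close>

lemma aT_coset:
  assumes g: "g \<in> carrier G" and p: "p \<in> carrier TV"
  shows "aT g ` (IT +>\<^bsub>TV\<^esub> p) = IT +>\<^bsub>TV\<^esub> aT g p"
proof
  show "aT g ` (IT +>\<^bsub>TV\<^esub> p) \<subseteq> IT +>\<^bsub>TV\<^esub> aT g p"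
    using IT_act[OF g] by (auto simp: S.coset_mem lin_map_diff[OF lin_map_aT, symmetric])
  show "IT +>\<^bsub>TV\<^esub> aT g p \<subseteq> aT g ` (IT +>\<^bsub>TV\<^esub> p)"
  proof
    fix q assume q: "q \<in> IT +>\<^bsub>TV\<^esub> aT g p"
    then have d: "q - aT g p \<in> IT" by (simp add: S.coset_mem)
    then have qc: "q \<in> carrier TV"
      using monoid_alg_carrier_closed(3)[OF IT_carrier[OF d] aT_carrier[of g p]] by simp
    have "aT (inv g) (q - aT g p) \<in> IT" using g d by (intro IT_act) auto
    then have "aT (inv g) q - p \<in> IT"
      using g p by (simp add: lin_map_diff[OF lin_map_aT] aT_aT aT_one)
    then have "aT (inv g) q \<in> IT +>\<^bsub>TV\<^esub> p" by (simp add: S.coset_mem)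
    moreover have "q = aT g (aT (inv g) q)" using g qc by (simp add: aT_aT aT_one)
    ultimately show "q \<in> aT g ` (IT +>\<^bsub>TV\<^esub> p)" by blast
  qed
qed

lemma AA_simps:
  "carrier AA = {x. (\<forall>g\<in>carrier G. x g \<in> carrier S.QA) \<and> (\<forall>g. g \<notin> carrier G \<longrightarrow> x g = IT)}"
  "\<zero>\<^bsub>AA\<^esub> = (\<lambda>g. IT)"
  "x \<oplus>\<^bsub>AA\<^esub> y = (\<lambda>g. x g \<oplus>\<^bsub>S.QA\<^esub> y g)"
  "c \<odot>\<^bsub>AA\<^esub> x = (\<lambda>g. c \<odot>\<^bsub>S.QA\<^esub> x g)"
  by (simp_all add: skew_quad_def skew_alg_def quad_alg_eq S.alg_quot_one_zero)

lemma proj_carrier: "x \<in> carrier TU \<Longrightarrow> proj x \<in> carrier AA"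
  by (auto simp: AA_simps proj_def S.carrier_alg_quot nform_outside)

lemma proj_add: "proj x \<oplus>\<^bsub>AA\<^esub> proj y = proj (x + y)"
  by (simp add: AA_simps proj_def S.alg_quot_ops lin_map_add[OF lin_map_nform])

lemma proj_zero: "proj 0 = \<zero>\<^bsub>AA\<^esub>"
  by (simp add: AA_simps proj_def lin_map_0[OF lin_map_nform])

lemma proj_smult: "c \<odot>\<^bsub>AA\<^esub> proj x = proj (pscale c x)"
  by (simp add: AA_simps proj_def S.alg_quot_smult lin_map_pscale[OF lin_map_nform])

lemma proj_one: "proj (bvec (\<one>, [])) = \<one>\<^bsub>AA\<^esub>"
  by (rule ext) (auto simp: skew_quad_def skew_alg_def quad_alg_eq S.alg_quot_one_zero proj_def nform_bvec)

lemma proj_mult: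
  assumes x: "x \<in> carrier TU" and y: "y \<in> carrier TU"
  shows "proj x \<otimes>\<^bsub>AA\<^esub> proj y = proj (x \<otimes>\<^bsub>TU\<^esub> y)"
proof
  fix h
  show "(proj x \<otimes>\<^bsub>AA\<^esub> proj y) h = proj (x \<otimes>\<^bsub>TU\<^esub> y) h"
  proof (cases "h \<in> carrier G")
    case True
    have "(proj x \<otimes>\<^bsub>AA\<^esub> proj y) h
        = (\<Oplus>\<^bsub>S.QA\<^esub>g\<in>carrier G. proj x g \<otimes>\<^bsub>S.QA\<^esub> aT g ` proj y (inv g \<otimes> h))"
      using True by (simp add: skew_quad_def skew_alg_def quad_alg_eq)
    also have "\<dots> = (\<Oplus>\<^bsub>S.QA\<^esub>g\<in>carrier G. IT +>\<^bsub>TV\<^esub> (nform g x \<otimes>\<^bsub>TV\<^esub> aT g (nform (inv g \<otimes> h) y)))"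
      by (rule S.Q.finsum_cong') 
        (auto simp: proj_def aT_coset S.alg_quot_ops S.carrier_alg_quot FM.monoid_alg_closed)
    also have "\<dots> = proj (x \<otimes>\<^bsub>TU\<^esub> y) h"
      by (simp add: S.alg_quot_finsum FM.monoid_alg_closed proj_def nform_mult[OF x y True])
    finally show ?thesis .
  next
    case False
    then show ?thesis
      using nform_outside[OF BM.monoid_alg_closed[OF x y] False]
      by (simp add: proj_def skew_quad_def skew_alg_def quad_alg_eq S.alg_quot_one_zero)
  qed
qed

lemma proj_eq_iff:
  assumes "x \<in> carrier TU" "y \<in> carrier TU"
  shows "proj x = proj y \<longleftrightarrow> x - y \<in> KU"
proof -
  have "proj x = proj y \<longleftrightarrow> (\<forall>h. nform h (x - y) \<in> IT)"
    by (simp add: fun_eq_iff proj_def S.coset_eq_iff lin_map_diff[OF lin_map_nform])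
  also have "\<dots> \<longleftrightarrow> x - y \<in> KU"
    using assms nform_outside[of "x - y"] pv.subspace_0[OF S.subspace] by (auto simp: KU_def)
  finally show ?thesis .
qed

text \<open>A section of \<open>nform\<close>: the element of T in normal form with prescribed
  coefficients.\<close>

definition of_comps :: "('g \<Rightarrow> 'v list \<Rightarrow>\<^sub>0 'k) \<Rightarrow> ('g \<times> ('v \<times> 'g) list \<Rightarrow>\<^sub>0 'k)" where
  "of_comps p = (\<Sum>h\<in>carrier G. iT (p h) \<otimes>\<^bsub>TU\<^esub> bvec (h, []))"

lemma nform_iT_right:
  assumes "p \<in> carrier TV" "a \<in> carrier G" "h \<in> carrier G"
  shows "nform h (iT p \<otimes>\<^bsub>TU\<^esub> bvec (a, [])) = (if h = a then p else 0)"
proof -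
  have "nform h (iT p \<otimes>\<^bsub>TU\<^esub> bvec (a, []))
    = (\<Sum>g\<in>carrier G. nform g (iT p) \<otimes>\<^bsub>TV\<^esub> aT g (nform (inv g \<otimes> h) (bvec (a, []))))"
    using assms by (intro nform_mult) auto
  also have "\<dots> = (\<Sum>g\<in>carrier G. if g = \<one> then p \<otimes>\<^bsub>TV\<^esub> nform h (bvec (a, [])) else 0)"
    using assms by (intro sum.cong) (auto simp: nform_iT aT_one)
  also have "\<dots> = (if h = a then p else 0)"
    using assms FM.monoid_alg_one_right[OF assms(1)] fin_G by (auto simp: nform_bvec)
  finally show ?thesis .
qed

lemma nform_of_comps:
  assumes "\<And>h. h \<in> carrier G \<Longrightarrow> p h \<in> carrier TV" "h \<in> carrier G"
  shows "nform h (of_comps p) = p h"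
proof -
  have "nform h (of_comps p) = (\<Sum>a\<in>carrier G. if a = h then p h else 0)"
    unfolding of_comps_def lin_map_sum[OF lin_map_nform]
    using assms by (intro sum.cong) (auto simp: nform_iT_right)
  then show ?thesis using assms fin_G by simp
qed

lemma of_comps_carrier:
  "(\<And>h. h \<in> carrier G \<Longrightarrow> p h \<in> carrier TV) \<Longrightarrow> of_comps p \<in> carrier TU"
  unfolding of_comps_def by (intro monoid_alg_sum_closed BM.monoid_alg_closed) auto

lemma proj_surj_comp:
  assumes "\<And>h. h \<in> carrier G \<Longrightarrow> y h \<in> (\<lambda>p. IT +>\<^bsub>TV\<^esub> p) ` Y" "\<And>h. h \<notin> carrier G \<Longrightarrow> y h = IT" "Y \<subseteq> carrier TV"
  obtains x where "x \<in> carrier TU" "proj x = y" "\<And>h. h \<in> carrier G \<Longrightarrow> nform h x \<in> Y"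
proof -
  have "\<forall>h. \<exists>p. h \<in> carrier G \<longrightarrow> p \<in> Y \<and> y h = IT +>\<^bsub>TV\<^esub> p" using assms(1) by blast
  then obtain p where p: "\<And>h. h \<in> carrier G \<Longrightarrow> p h \<in> Y \<and> y h = IT +>\<^bsub>TV\<^esub> p h" by metis
  then have pc: "p h \<in> carrier TV" if "h \<in> carrier G" for h using that assms(3) by blast
  show ?thesis
  proof
    show c: "of_comps p \<in> carrier TU" using pc by (rule of_comps_carrier)
    show "nform h (of_comps p) \<in> Y" if "h \<in> carrier G" for h
      using nform_of_comps[of p h, OF pc that] p[OF that] by simp
    show "proj (of_comps p) = y"
    proof
      fix h show "proj (of_comps p) h = y h"
        using nform_of_comps[of p h, OF pc] p[of h] assms(2)[of h] nform_outside[OF c, of h]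
        by (cases "h \<in> carrier G") (simp_all add: proj_def)
    qed
  qed
qed

lemma carrier_AA: "carrier AA = proj ` carrier TU"
proof
  show "carrier AA \<subseteq> proj ` carrier TU"
  proof
    fix y assume y: "y \<in> carrier AA"
    then have 1: "h \<in> carrier G \<Longrightarrow> y h \<in> (\<lambda>p. IT +>\<^bsub>TV\<^esub> p) ` carrier TV" "h \<notin> carrier G \<Longrightarrow> y h = IT" for h
      by (auto simp: AA_simps S.carrier_alg_quot)
    obtain x where "x \<in> carrier TU" "proj x = y"
      using 1 by (rule proj_surj_comp[of y "carrier TV"]) auto
    then show "y \<in> proj ` carrier TU" by blast
  qed
qed (auto simp: proj_carrier)

lemma skew_quad_comp_eq: "skew_quad_comp scale B G act R d = proj ` {x \<in> carrier TU. hU d x = x}"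
proof
  show "skew_quad_comp scale B G act R d \<subseteq> proj ` {x \<in> carrier TU. hU d x = x}"
  proof
    fix y assume y: "y \<in> skew_quad_comp scale B G act R d"
    then have 1: "h \<in> carrier G \<Longrightarrow> y h \<in> (\<lambda>p. IT +>\<^bsub>TV\<^esub> p) ` tensor_power B d" "h \<notin> carrier G \<Longrightarrow> y h = IT" for h
      by (auto simp: skew_quad_comp_def quad_comp_def quot_image_def AA_simps)
    have 2: "tensor_power B d \<subseteq> carrier TV" by (auto simp: tensor_power_def)
    obtain x where x: "x \<in> carrier TU" "proj x = y" "\<And>h. h \<in> carrier G \<Longrightarrow> nform h x \<in> tensor_power B d"
      using 1 2 by (rule proj_surj_comp[of y "tensor_power B d"]) auto
    \<comment> \<open>The preimage x has homogeneous coefficients but may itself contain terms of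
      other degrees. Discarding them does not change the image, as \<open>nform\<close> commutes
      with taking components.\<close>
    have "proj (hU d x) = proj x"
    proof
      fix h show "proj (hU d x) h = proj x h"
        using x(3)[of h] nform_outside[OF x(1), of h] nform_outside[OF hU_carrier[OF x(1)], of h d]
        by (cases "h \<in> carrier G") (auto simp: proj_def nform_hU tensor_power_iff)
    qed
    then show "y \<in> proj ` {x \<in> carrier TU. hU d x = x}"
      using x by (intro image_eqI[of _ _ "hU d x"]) auto
  qed
  show "proj ` {x \<in> carrier TU. hU d x = x} \<subseteq> skew_quad_comp scale B G act R d"
  proof clarify
    fix x assume x: "x \<in> carrier TU" "hU d x = x"
    have "nform h x \<in> tensor_power B d" for h
      using nform_hU[of h d x] x by (auto simp: tensor_power_iff)
    then show "proj x \<in> skew_quad_comp scale B G act R d"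
      using proj_carrier[OF x(1)] by (auto simp: skew_quad_comp_def quad_comp_def quot_image_def proj_def)
  qed
qed

lemma abelian_group_AA: "abelian_group AA"
proof (rule abelian_groupI)
  fix x assume "x \<in> carrier AA"
  then obtain a where a: "x = proj a" "a \<in> carrier TU" unfolding carrier_AA by blast
  then show "\<exists>y\<in>carrier AA. y \<oplus>\<^bsub>AA\<^esub> x = \<zero>\<^bsub>AA\<^esub>"
    by (intro bexI[of _ "proj (- a)"]) (auto simp: carrier_AA proj_add proj_zero)
qed (auto simp: carrier_AA proj_add proj_zero[symmetric] add_ac)

sublocale AG: abelian_group AA by (rule abelian_group_AA)

lemma proj_finsum:
  assumes "\<And>i. i \<in> J \<Longrightarrow> f i \<in> carrier TU"
  shows "(\<Oplus>\<^bsub>AA\<^esub>i\<in>J. proj (f i)) = proj (\<Sum>i\<in>J. f i)"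
  using assms
  by (induction J rule: infinite_finite_induct)
    (auto simp: AG.finsum_infinite proj_zero carrier_AA proj_add)

lemma proj_minus:
  assumes "x \<in> carrier TU" "y \<in> carrier TU"
  shows "proj x \<ominus>\<^bsub>AA\<^esub> proj y = proj (x - y)"
proof -
  have "\<ominus>\<^bsub>AA\<^esub> proj y = proj (- y)"
    using assms by (intro AG.minus_equality) (auto simp: proj_add proj_zero carrier_AA)
  then show ?thesis by (simp add: a_minus_def proj_add)
qed

lemma kG_to_A_eq: "a \<in> carrier kG \<Longrightarrow> kG_to_A B G R a = proj (iG a)"
  by (rule ext)
    (simp add: kG_to_A_def quad_alg_eq S.alg_quot_one_zero S.alg_quot_smult proj_def nform_iG kG_lookup)

lemma VkG_to_A_eq: "VkG_to_A scale B G R f = proj (iV f)"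
proof
  fix h show "VkG_to_A scale B G R f h = proj (iV f) h"
    using nform_outside[OF iV_carrier, of h f]
    by (simp add: VkG_to_A_def quad_alg_eq S.alg_quot_one_zero proj_def nform_iV)
qed

lemma V_to_A_eq: "V_to_A scale B G R v = proj (trip \<one> v \<one>)"
  by (simp add: V_to_A_def VkG_to_A_eq iV_single)

text \<open>\<open>IT\<close> vanishes in degree one, so V \<otimes> kG embeds into
  \<open>S \<rtimes> G\<close>.\<close>

lemma iV_KU_iff: "iV f \<in> KU \<longleftrightarrow> (\<forall>h\<in>carrier G. f h = 0)"
proof -
  have "vT v \<in> IT \<longleftrightarrow> v = 0" for v
    using IT_low[of "vT v" 1] vT_tensor_power[of v] pv.subspace_0[OF S.subspace]
    by (auto simp: tensor_power_iff)
  then show ?thesis by (simp add: KU_def nform_iV)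
qed

lemma iG_KU: "c \<in> carrier kG \<Longrightarrow> iG c \<in> KU \<Longrightarrow> c = 0"
proof -
  assume c: "c \<in> carrier kG" "iG c \<in> KU"
  have "Poly_Mapping.lookup c h = 0" for h
  proof (cases "h \<in> carrier G")
    case True
    then have "nform h (iG c) \<in> IT" using c by (auto simp: KU_def)
    then have "hT 0 (pscale (Poly_Mapping.lookup c h) (bvec [])) = 0"
      unfolding nform_iG by (intro IT_low) auto
    then show ?thesis
      by (simp add: lin_map_pscale[OF lin_map_restr_supp] del: pscale_single)
  qed (use kG_lookup c in auto)
  then show "c = 0" by (intro poly_mapping_eqI) simp
qed

lemma hU_trip: "hU n (trip g v h) = (if n = 1 then trip g v h else 0)"
  and hU_iG: "hU n (iG c) = (if n = 0 then iG c else 0)"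
proof -
  have "hU n (bvec (g, [(b, h)])) = (if n = 1 then bvec (g, [(b, h)]) else 0)" for b by simp
  then show "hU n (trip g v h) = (if n = 1 then trip g v h else 0)"
    unfolding trip_expand lin_map_sum[OF lin_map_restr_supp] lin_map_pscale[OF lin_map_restr_supp]
    by (simp del: pscale_single restr_supp_bvec)
  show "hU n (iG c) = (if n = 0 then iG c else 0)"
    by (cases "n = 0"; simp; rule lin_map_eqI[where Z = UNIV and p = c]) (auto intro!: lin_intros)
qed

lemma hU_iV: "hU n (iV f) = (if n = 1 then iV f else 0)"
  by (simp add: VkG_to_TU_def lin_map_sum[OF lin_map_restr_supp] hU_trip)

lemma hU_iT: "hU n (iT p) = iT (hT n p)"
  by (rule lin_map_eqI[where Z = UNIV and p = p])
    (auto intro!: lin_intros simp: iT_bvec lin_map_0[OF lin_map_iT])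

subsection \<open>The conditions as congruences\<close>

context
  fixes \<alpha> :: "('v list \<Rightarrow>\<^sub>0 'k) \<Rightarrow> 'g \<Rightarrow> 'v"
    and \<beta> :: "('v list \<Rightarrow>\<^sub>0 'k) \<Rightarrow> ('g \<Rightarrow>\<^sub>0 'k)"
    and lam :: "'g \<Rightarrow> 'v \<Rightarrow> ('g \<Rightarrow>\<^sub>0 'k)"
begin

definition rel :: "('v list \<Rightarrow>\<^sub>0 'k) \<Rightarrow> ('g \<times> ('v \<times> 'g) list \<Rightarrow>\<^sub>0 'k)" where
  "rel r = iT r - iV (\<alpha> r) - iG (\<beta> r)"

text \<open>The difference of the two sides of \<open>cond3\<close>, lifted from
  \<open>S \<rtimes> G\<close> to T. Likewise \<open>elt4\<close> and \<open>elt6\<close> below are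
  lifts for \<open>cond4\<close> and \<open>cond6\<close>.\<close>

definition elt3 :: "'g \<Rightarrow> nat \<Rightarrow> (nat \<Rightarrow> 'v) \<Rightarrow> (nat \<Rightarrow> 'v) \<Rightarrow> ('g \<times> ('v \<times> 'g) list \<Rightarrow>\<^sub>0 'k)" where
  "elt3 g n v w = bvec (g, []) \<otimes>\<^bsub>TU\<^esub> iV (\<alpha> (tens2 scale B n v w))
    - iV (\<alpha> (aT g (tens2 scale B n v w))) \<otimes>\<^bsub>TU\<^esub> bvec (g, [])
    - (\<Sum>i<n. iG (lam g (v i)) \<otimes>\<^bsub>TU\<^esub> trip \<one> (w i) \<one>)
    - (\<Sum>i<n. trip \<one> (act g (v i)) \<one> \<otimes>\<^bsub>TU\<^esub> iG (lam g (w i)))"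

text \<open>The V-coefficient at the group element a that \<open>elt3\<close> has once all group
  elements are moved to the right.\<close>

definition coeff3 :: "'g \<Rightarrow> nat \<Rightarrow> (nat \<Rightarrow> 'v) \<Rightarrow> (nat \<Rightarrow> 'v) \<Rightarrow> 'g \<Rightarrow> 'v" where
  "coeff3 g n v w a = act g (\<alpha> (tens2 scale B n v w) (inv g \<otimes> a))
    - \<alpha> (aT g (tens2 scale B n v w)) (a \<otimes> inv g)
    - (\<Sum>i<n. scale (Poly_Mapping.lookup (lam g (v i)) a) (act a (w i)))
    - (\<Sum>i<n. scale (Poly_Mapping.lookup (lam g (w i)) a) (act g (v i)))"

definition elt4 ::
  "nat \<Rightarrow> (nat \<Rightarrow> 'v list \<Rightarrow>\<^sub>0 'k) \<Rightarrow> (nat \<Rightarrow> 'v) \<Rightarrow> nat \<Rightarrow> (nat \<Rightarrow> 'v) \<Rightarrow> (nat \<Rightarrow> 'v list \<Rightarrow>\<^sub>0 'k)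
    \<Rightarrow> ('g \<times> ('v \<times> 'g) list \<Rightarrow>\<^sub>0 'k)" where
  "elt4 n r v m u s = (\<Sum>h\<in>carrier G. iV (\<alpha> (alpha_diff scale B act \<alpha> n r v m u s h)) \<otimes>\<^bsub>TU\<^esub> bvec (h, []))
    + (\<Sum>g\<in>carrier G. \<Sum>i<n. trip \<one> (\<alpha> (r i) g) \<one> \<otimes>\<^bsub>TU\<^esub> iG (lam g (v i)))
    - (\<Sum>j<m. trip \<one> (u j) \<one> \<otimes>\<^bsub>TU\<^esub> iG (\<beta> (s j)))
    + (\<Sum>i<n. iG (\<beta> (r i)) \<otimes>\<^bsub>TU\<^esub> trip \<one> (v i) \<one>)"

definition coeff4 ::
  "nat \<Rightarrow> (nat \<Rightarrow> 'v list \<Rightarrow>\<^sub>0 'k) \<Rightarrow> (nat \<Rightarrow> 'v) \<Rightarrow> nat \<Rightarrow> (nat \<Rightarrow> 'v) \<Rightarrow> (nat \<Rightarrow> 'v list \<Rightarrow>\<^sub>0 'k)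
    \<Rightarrow> 'g \<Rightarrow> 'v" where
  "coeff4 n r v m u s a = (\<Sum>h\<in>carrier G. \<alpha> (alpha_diff scale B act \<alpha> n r v m u s h) (a \<otimes> inv h))
    + (\<Sum>g\<in>carrier G. \<Sum>i<n. scale (Poly_Mapping.lookup (lam g (v i)) a) (\<alpha> (r i) g))
    - (\<Sum>j<m. scale (Poly_Mapping.lookup (\<beta> (s j)) a) (u j))
    + (\<Sum>i<n. scale (Poly_Mapping.lookup (\<beta> (r i)) a) (act a (v i)))"

definition elt6 ::
  "nat \<Rightarrow> (nat \<Rightarrow> 'v list \<Rightarrow>\<^sub>0 'k) \<Rightarrow> (nat \<Rightarrow> 'v) \<Rightarrow> nat \<Rightarrow> (nat \<Rightarrow> 'v) \<Rightarrow> (nat \<Rightarrow> 'v list \<Rightarrow>\<^sub>0 'k)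
    \<Rightarrow> ('g \<times> ('v \<times> 'g) list \<Rightarrow>\<^sub>0 'k)" where
  "elt6 n r v m u s = (\<Sum>i<n. iV (\<alpha> (r i)) \<otimes>\<^bsub>TU\<^esub> trip \<one> (v i) \<one>)
    - (\<Sum>j<m. trip \<one> (u j) \<one> \<otimes>\<^bsub>TU\<^esub> iV (\<alpha> (s j)))"

end

lemma in_KU_iff_proj: "x \<in> carrier TU \<Longrightarrow> x \<in> KU \<longleftrightarrow> proj x = proj 0"
  using proj_eq_iff[of x 0] by simp

context
  fixes \<alpha> \<beta> lam
  assumes \<alpha>: "is_alpha scale B G R \<alpha>" and \<beta>: "is_beta B G R \<beta>" and lam: "is_lam scale G lam"
begin

lemma lam_carrier: "g \<in> carrier G \<Longrightarrow> lam g v \<in> carrier kG"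
  and beta_carrier: "r \<in> R \<Longrightarrow> \<beta> r \<in> carrier kG"
  using lam \<beta> by (auto simp: is_lam_def is_beta_def)

lemma tens2_eq_iT: "iT (tens2 scale B n v w) = (\<Sum>i<n. trip \<one> (v i) \<one> \<otimes>\<^bsub>TU\<^esub> trip \<one> (w i) \<one>)"
  by (simp add: tens2_def lin_map_sum[OF lin_map_iT] iT_mult iT_vT)

text \<open>\<open>proj\<close> respects the operations of \<open>S \<rtimes> G\<close> and has
  kernel \<open>KU\<close>, so an equation there is membership of the difference of two lifts in
  \<open>KU\<close>. The same argument serves \<open>cond4\<close> and \<open>cond6\<close>.\<close>

lemma cond3_iff:
  "cond3 scale B G act R \<alpha> lam \<longleftrightarrow>
    (\<forall>g\<in>carrier G. \<forall>n v w. tens2 scale B n v w \<in> R \<longrightarrow> elt3 \<alpha> lam g n v w \<in> KU)"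
proof -
  have "(kG_to_A B G R (bvec g) \<otimes>\<^bsub>AA\<^esub> VkG_to_A scale B G R (\<alpha> r)
        \<ominus>\<^bsub>AA\<^esub> VkG_to_A scale B G R (\<alpha> (aT g r)) \<otimes>\<^bsub>AA\<^esub> kG_to_A B G R (bvec g)
      = (\<Oplus>\<^bsub>AA\<^esub>i\<in>{..<n}. kG_to_A B G R (lam g (v i)) \<otimes>\<^bsub>AA\<^esub> V_to_A scale B G R (w i))
       \<oplus>\<^bsub>AA\<^esub> (\<Oplus>\<^bsub>AA\<^esub>i\<in>{..<n}. V_to_A scale B G R (act g (v i)) \<otimes>\<^bsub>AA\<^esub> kG_to_A B G R (lam g (w i))))
      \<longleftrightarrow> elt3 \<alpha> lam g n v w \<in> KU" (is "?l = ?r \<longleftrightarrow> _")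
    if g: "g \<in> carrier G" and r: "r = tens2 scale B n v w" for g n v w r
  proof -
    let ?L = "bvec (g, []) \<otimes>\<^bsub>TU\<^esub> iV (\<alpha> r) - iV (\<alpha> (aT g r)) \<otimes>\<^bsub>TU\<^esub> bvec (g, [])"
    let ?Z = "(\<Sum>i<n. iG (lam g (v i)) \<otimes>\<^bsub>TU\<^esub> trip \<one> (w i) \<one>)
      + (\<Sum>i<n. trip \<one> (act g (v i)) \<one> \<otimes>\<^bsub>TU\<^esub> iG (lam g (w i)))"
    have "?l = proj ?L" "?r = proj ?Z" "?L \<in> carrier TU" "?Z \<in> carrier TU"
      using g lam_carrier[OF g]
      by (simp_all add: kG_to_A_eq VkG_to_A_eq V_to_A_eq proj_mult proj_finsum proj_minus proj_add
          BM.monoid_alg_closed)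
    then have "?l = ?r \<longleftrightarrow> ?L - ?Z \<in> KU" by (simp add: proj_eq_iff)
    also have "?L - ?Z = elt3 \<alpha> lam g n v w" by (simp add: elt3_def r diff_diff_eq)
    finally show ?thesis .
  qed
  then show ?thesis unfolding cond3_def Let_def by blast
qed

lemma overlap_R: "overlap scale B R n r v m u s \<Longrightarrow> i < n \<Longrightarrow> r i \<in> R"
  "overlap scale B R n r v m u s \<Longrightarrow> j < m \<Longrightarrow> s j \<in> R"
  by (auto simp: overlap_def)

lemma cond4_iff:
  "cond4 scale B G act R \<alpha> \<beta> lam \<longleftrightarrow>
    (\<forall>n r v m u s. overlap scale B R n r v m u s \<longrightarrow> elt4 \<alpha> \<beta> lam n r v m u s \<in> KU)"
proof -
  have "((\<Oplus>\<^bsub>AA\<^esub>h\<in>carrier G. VkG_to_A scale B G R (\<alpha> (alpha_diff scale B act \<alpha> n r v m u s h)) \<otimes>\<^bsub>AA\<^esub> kG_to_A B G R (bvec h))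
     \<oplus>\<^bsub>AA\<^esub> (\<Oplus>\<^bsub>AA\<^esub>g\<in>carrier G. \<Oplus>\<^bsub>AA\<^esub>i\<in>{..<n}. V_to_A scale B G R (\<alpha> (r i) g) \<otimes>\<^bsub>AA\<^esub> kG_to_A B G R (lam g (v i)))
     = (\<Oplus>\<^bsub>AA\<^esub>j\<in>{..<m}. V_to_A scale B G R (u j) \<otimes>\<^bsub>AA\<^esub> kG_to_A B G R (\<beta> (s j)))
       \<ominus>\<^bsub>AA\<^esub> (\<Oplus>\<^bsub>AA\<^esub>i\<in>{..<n}. kG_to_A B G R (\<beta> (r i)) \<otimes>\<^bsub>AA\<^esub> V_to_A scale B G R (v i)))
      \<longleftrightarrow> elt4 \<alpha> \<beta> lam n r v m u s \<in> KU" (is "?l = ?r \<longleftrightarrow> _")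
    if o: "overlap scale B R n r v m u s" for n r v m u s
  proof -
    let ?L = "(\<Sum>h\<in>carrier G. iV (\<alpha> (alpha_diff scale B act \<alpha> n r v m u s h)) \<otimes>\<^bsub>TU\<^esub> bvec (h, []))
      + (\<Sum>g\<in>carrier G. \<Sum>i<n. trip \<one> (\<alpha> (r i) g) \<one> \<otimes>\<^bsub>TU\<^esub> iG (lam g (v i)))"
    let ?Z = "(\<Sum>j<m. trip \<one> (u j) \<one> \<otimes>\<^bsub>TU\<^esub> iG (\<beta> (s j)))
      - (\<Sum>i<n. iG (\<beta> (r i)) \<otimes>\<^bsub>TU\<^esub> trip \<one> (v i) \<one>)"
    have c: "\<beta> (r i) \<in> carrier kG" if "i < n" for i using overlap_R(1)[OF o that] by (rule beta_carrier)
    have d: "\<beta> (s j) \<in> carrier kG" if "j < m" for j using overlap_R(2)[OF o that] by (rule beta_carrier)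
    have l1: "(\<Oplus>\<^bsub>AA\<^esub>h\<in>carrier G. VkG_to_A scale B G R (\<alpha> (alpha_diff scale B act \<alpha> n r v m u s h)) \<otimes>\<^bsub>AA\<^esub> kG_to_A B G R (bvec h))
      = (\<Oplus>\<^bsub>AA\<^esub>h\<in>carrier G. proj (iV (\<alpha> (alpha_diff scale B act \<alpha> n r v m u s h)) \<otimes>\<^bsub>TU\<^esub> bvec (h, [])))"
      by (rule AG.finsum_cong') (auto simp: kG_to_A_eq VkG_to_A_eq proj_mult carrier_AA BM.monoid_alg_closed)
    have l2: "(\<Oplus>\<^bsub>AA\<^esub>g\<in>carrier G. \<Oplus>\<^bsub>AA\<^esub>i\<in>{..<n}. V_to_A scale B G R (\<alpha> (r i) g) \<otimes>\<^bsub>AA\<^esub> kG_to_A B G R (lam g (v i)))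
      = (\<Oplus>\<^bsub>AA\<^esub>g\<in>carrier G. proj (\<Sum>i<n. trip \<one> (\<alpha> (r i) g) \<one> \<otimes>\<^bsub>TU\<^esub> iG (lam g (v i))))"
      using lam_carrier by (intro AG.finsum_cong')
        (auto simp: kG_to_A_eq V_to_A_eq proj_mult proj_finsum carrier_AA BM.monoid_alg_closed)
    have l3: "(\<Oplus>\<^bsub>AA\<^esub>j\<in>{..<m}. V_to_A scale B G R (u j) \<otimes>\<^bsub>AA\<^esub> kG_to_A B G R (\<beta> (s j)))
      = (\<Oplus>\<^bsub>AA\<^esub>j\<in>{..<m}. proj (trip \<one> (u j) \<one> \<otimes>\<^bsub>TU\<^esub> iG (\<beta> (s j))))"
      using d by (intro AG.finsum_cong')
        (auto simp: kG_to_A_eq V_to_A_eq proj_mult carrier_AA BM.monoid_alg_closed)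
    have l4: "(\<Oplus>\<^bsub>AA\<^esub>i\<in>{..<n}. kG_to_A B G R (\<beta> (r i)) \<otimes>\<^bsub>AA\<^esub> V_to_A scale B G R (v i))
      = (\<Oplus>\<^bsub>AA\<^esub>i\<in>{..<n}. proj (iG (\<beta> (r i)) \<otimes>\<^bsub>TU\<^esub> trip \<one> (v i) \<one>))"
      using c by (intro AG.finsum_cong')
        (auto simp: kG_to_A_eq V_to_A_eq proj_mult carrier_AA BM.monoid_alg_closed)
    have c': "(\<Sum>i<n. iG (\<beta> (r i)) \<otimes>\<^bsub>TU\<^esub> trip \<one> (v i) \<one>) \<in> carrier TU"
      "(\<Oplus>\<^bsub>AA\<^esub>i\<in>{..<n}. proj (iG (\<beta> (r i)) \<otimes>\<^bsub>TU\<^esub> trip \<one> (v i) \<one>))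
        = proj (\<Sum>i<n. iG (\<beta> (r i)) \<otimes>\<^bsub>TU\<^esub> trip \<one> (v i) \<one>)"
      using c by (intro monoid_alg_sum_closed proj_finsum BM.monoid_alg_closed; auto)+
    have d': "(\<Sum>j<m. trip \<one> (u j) \<one> \<otimes>\<^bsub>TU\<^esub> iG (\<beta> (s j))) \<in> carrier TU"
      "(\<Oplus>\<^bsub>AA\<^esub>j\<in>{..<m}. proj (trip \<one> (u j) \<one> \<otimes>\<^bsub>TU\<^esub> iG (\<beta> (s j))))
        = proj (\<Sum>j<m. trip \<one> (u j) \<one> \<otimes>\<^bsub>TU\<^esub> iG (\<beta> (s j)))"
      using d by (intro monoid_alg_sum_closed proj_finsum BM.monoid_alg_closed; auto)+
    have "?l = proj ?L" "?r = proj ?Z" "?L \<in> carrier TU" "?Z \<in> carrier TU"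
      unfolding l1 l2 l3 l4 c' d'
      using c'(1) d'(1) lam_carrier
      by (simp_all add: proj_finsum proj_minus proj_add BM.monoid_alg_closed)
    then have "?l = ?r \<longleftrightarrow> ?L - ?Z \<in> KU" by (simp add: proj_eq_iff)
    also have "?L - ?Z = elt4 \<alpha> \<beta> lam n r v m u s" by (simp add: elt4_def algebra_simps)
    finally show ?thesis .
  qed
  then show ?thesis unfolding cond4_def by blast
qed

lemma cond6_iff:
  "cond6 scale B G act R \<alpha> \<longleftrightarrow>
    (\<forall>n r v m u s. overlap scale B R n r v m u s \<longrightarrow> elt6 \<alpha> n r v m u s \<in> KU)"
proof -
  have "((\<Oplus>\<^bsub>AA\<^esub>i\<in>{..<n}. VkG_to_A scale B G R (\<alpha> (r i)) \<otimes>\<^bsub>AA\<^esub> V_to_A scale B G R (v i))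
     \<ominus>\<^bsub>AA\<^esub> (\<Oplus>\<^bsub>AA\<^esub>j\<in>{..<m}. V_to_A scale B G R (u j) \<otimes>\<^bsub>AA\<^esub> VkG_to_A scale B G R (\<alpha> (s j))) = \<zero>\<^bsub>AA\<^esub>)
      \<longleftrightarrow> elt6 \<alpha> n r v m u s \<in> KU" for n r v m u and s :: "nat \<Rightarrow> 'v list \<Rightarrow>\<^sub>0 'k"
  proof -
    have "((\<Oplus>\<^bsub>AA\<^esub>i\<in>{..<n}. VkG_to_A scale B G R (\<alpha> (r i)) \<otimes>\<^bsub>AA\<^esub> V_to_A scale B G R (v i))
     \<ominus>\<^bsub>AA\<^esub> (\<Oplus>\<^bsub>AA\<^esub>j\<in>{..<m}. V_to_A scale B G R (u j) \<otimes>\<^bsub>AA\<^esub> VkG_to_A scale B G R (\<alpha> (s j)))) = proj (elt6 \<alpha> n r v m u s)"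
      by (simp add: VkG_to_A_eq V_to_A_eq proj_mult proj_finsum proj_minus elt6_def BM.monoid_alg_closed)
    moreover have "elt6 \<alpha> n r v m u s \<in> carrier TU"
      by (auto simp: elt6_def BM.monoid_alg_closed)
    ultimately show ?thesis by (simp add: in_KU_iff_proj proj_zero)
  qed
  then show ?thesis unfolding cond6_def by blast
qed

end

end

section \<open>Straightening identities as congruences modulo an ideal of T\<close>

context quad_setup
begin

definition cong_mod :: "('g \<times> ('v \<times> 'g) list \<Rightarrow>\<^sub>0 'k) set \<Rightarrow> ('g \<times> ('v \<times> 'g) list \<Rightarrow>\<^sub>0 'k)
    \<Rightarrow> ('g \<times> ('v \<times> 'g) list \<Rightarrow>\<^sub>0 'k) \<Rightarrow> bool" where
  "cong_mod N x y \<longleftrightarrow> x - y \<in> N"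

context
  fixes N assumes N: "ideal N TU"
begin

lemma cong_refl: "cong_mod N x x"
  using pv.subspace_0[OF ideal_TU(1)[OF N]] by (simp add: cong_mod_def)

lemma cong_trans: "cong_mod N x y \<Longrightarrow> cong_mod N y z \<Longrightarrow> cong_mod N x z"
  using pv.subspace_add[OF ideal_TU(1)[OF N], of "x - y" "y - z"] by (simp add: cong_mod_def)

lemma cong_add: "cong_mod N x y \<Longrightarrow> cong_mod N x' y' \<Longrightarrow> cong_mod N (x + x') (y + y')"
  using pv.subspace_add[OF ideal_TU(1)[OF N], of "x - y" "x' - y'"] by (simp add: cong_mod_def algebra_simps)

lemma cong_diff: "cong_mod N x y \<Longrightarrow> cong_mod N x' y' \<Longrightarrow> cong_mod N (x - x') (y - y')"
  using pv.subspace_diff[OF ideal_TU(1)[OF N], of "x - y" "x' - y'"] by (simp add: cong_mod_def algebra_simps)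

lemma cong_sum: "(\<And>i. i \<in> I \<Longrightarrow> cong_mod N (f i) (f' i)) \<Longrightarrow> cong_mod N (\<Sum>i\<in>I. f i) (\<Sum>i\<in>I. f' i)"
  using pv.subspace_sum[OF ideal_TU(1)[OF N], of I "\<lambda>i. f i - f' i"] by (simp add: cong_mod_def sum_subtractf)

lemma cong_mult_left: "cong_mod N x y \<Longrightarrow> z \<in> carrier TU \<Longrightarrow> cong_mod N (z \<otimes>\<^bsub>TU\<^esub> x) (z \<otimes>\<^bsub>TU\<^esub> y)"
  and cong_mult_right: "cong_mod N x y \<Longrightarrow> z \<in> carrier TU \<Longrightarrow> cong_mod N (x \<otimes>\<^bsub>TU\<^esub> z) (y \<otimes>\<^bsub>TU\<^esub> z)"
  using ideal_TU(2,3)[OF N] by (simp_all add: cong_mod_def flip: mult_distribs)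

lemma cong_mem_iff: "cong_mod N x y \<Longrightarrow> x \<in> N \<longleftrightarrow> y \<in> N"
  using subspace_mem_diff_iff[OF ideal_TU(1)[OF N]] by (simp add: cong_mod_def)

end

lemma skew_in_ideal: "skew_in N l \<Longrightarrow> ideal N TU"
  by (simp add: skew_in_def)

lemma trip_cong:
  assumes "skew_in N l" "g \<in> carrier G"
  shows "cong_mod N (trip g v \<one>) (trip \<one> (act g v) g + iG (l g v))"
  using assms by (simp add: skew_in_def cong_mod_def diff_diff_eq)

lemma kG_cong:
  assumes "skew_in N l" "c \<in> carrier kG"
  shows "cong_mod N (iG c \<otimes>\<^bsub>TU\<^esub> trip \<one> v \<one>)
    (iV (\<lambda>a. scale (Poly_Mapping.lookup c a) (act a v)) + iG (lam_ext G l c v))"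
  using kG_move[OF assms] by (simp add: cong_mod_def diff_diff_eq)

lemma VkG_cong:
  assumes "skew_in N l" "g \<in> carrier G"
  shows "cong_mod N (bvec (g, []) \<otimes>\<^bsub>TU\<^esub> iV f)
    (iV (\<lambda>a. act g (f (inv g \<otimes> a))) + iG (\<Sum>a\<in>carrier G. l g (f a) \<otimes>\<^bsub>kG\<^esub> bvec a))"
  using VkG_move[OF assms] by (simp add: cong_mod_def diff_diff_eq)

lemma trip_mult_trip:
  assumes h: "h \<in> carrier G"
  shows "trip \<one> x h \<otimes>\<^bsub>TU\<^esub> trip \<one> y \<one> = trip \<one> x \<one> \<otimes>\<^bsub>TU\<^esub> trip h y \<one>"
proof -
  have "trip \<one> x h = trip \<one> x \<one> \<otimes>\<^bsub>TU\<^esub> bvec (h, [])" "trip h y \<one> = bvec (h, []) \<otimes>\<^bsub>TU\<^esub> trip \<one> y \<one>"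
    using h by (simp_all add: trip_factor)
  then show ?thesis using h by (simp add: BM.monoid_alg_assoc)
qed

lemma iT_vT_mult:
  assumes "h \<in> carrier G"
  shows "trip \<one> x \<one> \<otimes>\<^bsub>TU\<^esub> trip \<one> y h = iT (vT x \<otimes>\<^bsub>TV\<^esub> vT y) \<otimes>\<^bsub>TU\<^esub> bvec (h, [])"
  using assms by (simp add: iT_mult iT_vT BM.monoid_alg_assoc trip_factor)

text \<open>For l = 0 only the part in V \<otimes> kG is left, which gives
  \<open>cond3_coeff\<close>. For l equal to \<open>lam\<close> the part in kG is the left side of
  \<open>cond2\<close> with opposite sign.\<close>

lemma elt3_cong:
  assumes N: "skew_in N l" and g: "g \<in> carrier G" and lam: "is_lam scale G lam"
  shows "cong_mod N (elt3 \<alpha> lam g n v w) (iV (coeff3 \<alpha> lam g n v w)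
    + iG ((\<Sum>a\<in>carrier G. l g (\<alpha> (tens2 scale B n v w) a) \<otimes>\<^bsub>kG\<^esub> bvec a)
      - (\<Sum>i<n. lam_ext G l (lam g (v i)) (w i))))"
proof -
  note N' = skew_in_ideal[OF N]
  let ?r = "tens2 scale B n v w"
  have c: "lam g x \<in> carrier kG" for x using lam g by (auto simp: is_lam_def)
  have "cong_mod N (elt3 \<alpha> lam g n v w)
    ((iV (\<lambda>a. act g (\<alpha> ?r (inv g \<otimes> a))) + iG (\<Sum>a\<in>carrier G. l g (\<alpha> ?r a) \<otimes>\<^bsub>kG\<^esub> bvec a))
     - iV (\<lambda>a. \<alpha> (aT g ?r) (a \<otimes> inv g))
     - (\<Sum>i<n. iV (\<lambda>a. scale (Poly_Mapping.lookup (lam g (v i)) a) (act a (w i))) + iG (lam_ext G l (lam g (v i)) (w i)))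
     - (\<Sum>i<n. iV (\<lambda>a. scale (Poly_Mapping.lookup (lam g (w i)) a) (act g (v i)))))"
    unfolding elt3_def iV_right[OF g] trip_iG[OF c]
    by (intro cong_diff[OF N'] cong_sum[OF N'] cong_refl[OF N'] VkG_cong[OF N] kG_cong[OF N] g c)
  then show ?thesis
    unfolding coeff3_def[abs_def] iV_diff iV_sum
    by (simp add: lin_map_diff[OF lin_map_iG] lin_map_sum[OF lin_map_iG] sum.distrib algebra_simps)
qed

text \<open>Only the products of \<beta>(r) with a vector have a group element to the left of a
  letter. They contribute the sum of \<open>lam_ext\<close> terms, which for l equal to
  \<open>lam\<close> is the right side of \<open>cond5\<close> up to sign.\<close>

lemma elt4_cong:
  assumes N: "skew_in N l" and lam: "is_lam scale G lam" and \<beta>: "is_beta B G R \<beta>"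
    and o: "overlap scale B R n r v m u s"
  shows "cong_mod N (elt4 \<alpha> \<beta> lam n r v m u s) (iV (coeff4 \<alpha> \<beta> lam n r v m u s)
    + iG (\<Sum>i<n. lam_ext G l (\<beta> (r i)) (v i)))"
proof -
  note N' = skew_in_ideal[OF N]
  let ?d = "alpha_diff scale B act \<alpha> n r v m u s"
  have c: "lam g x \<in> carrier kG" if "g \<in> carrier G" for g x using lam that by (auto simp: is_lam_def)
  have br: "\<beta> (r i) \<in> carrier kG" if "i < n" for i
    using o \<beta> that by (auto simp: overlap_def is_beta_def)
  have bs: "\<beta> (s i) \<in> carrier kG" if "i < m" for i
    using o \<beta> that by (auto simp: overlap_def is_beta_def)
  have 1: "(\<Sum>h\<in>carrier G. iV (\<alpha> (?d h)) \<otimes>\<^bsub>TU\<^esub> bvec (h, [])) = iV (\<lambda>a. \<Sum>h\<in>carrier G. \<alpha> (?d h) (a \<otimes> inv h))"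
    unfolding iV_sum by (rule sum.cong) (auto simp: iV_right)
  have 2: "(\<Sum>g\<in>carrier G. \<Sum>i<n. trip \<one> (\<alpha> (r i) g) \<one> \<otimes>\<^bsub>TU\<^esub> iG (lam g (v i)))
    = iV (\<lambda>a. \<Sum>g\<in>carrier G. \<Sum>i<n. scale (Poly_Mapping.lookup (lam g (v i)) a) (\<alpha> (r i) g))"
    unfolding iV_sum using c by (intro sum.cong) (auto simp: trip_iG)
  have 3: "(\<Sum>j<m. trip \<one> (u j) \<one> \<otimes>\<^bsub>TU\<^esub> iG (\<beta> (s j)))
    = iV (\<lambda>a. \<Sum>j<m. scale (Poly_Mapping.lookup (\<beta> (s j)) a) (u j))"
    unfolding iV_sum using bs by (intro sum.cong) (auto simp: trip_iG)
  have "cong_mod N (\<Sum>i<n. iG (\<beta> (r i)) \<otimes>\<^bsub>TU\<^esub> trip \<one> (v i) \<one>)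
     (\<Sum>i<n. iV (\<lambda>a. scale (Poly_Mapping.lookup (\<beta> (r i)) a) (act a (v i))) + iG (lam_ext G l (\<beta> (r i)) (v i)))"
    using br by (intro cong_sum[OF N'] kG_cong[OF N]) auto
  then have "cong_mod N (elt4 \<alpha> \<beta> lam n r v m u s)
    (iV (\<lambda>a. \<Sum>h\<in>carrier G. \<alpha> (?d h) (a \<otimes> inv h))
     + iV (\<lambda>a. \<Sum>g\<in>carrier G. \<Sum>i<n. scale (Poly_Mapping.lookup (lam g (v i)) a) (\<alpha> (r i) g))
     - iV (\<lambda>a. \<Sum>j<m. scale (Poly_Mapping.lookup (\<beta> (s j)) a) (u j))
     + (\<Sum>i<n. iV (\<lambda>a. scale (Poly_Mapping.lookup (\<beta> (r i)) a) (act a (v i))) + iG (lam_ext G l (\<beta> (r i)) (v i))))"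
    unfolding elt4_def 1 2 3 by (intro cong_add[OF N'] cong_refl[OF N'])
  then show ?thesis
    unfolding coeff4_def[abs_def] iV_diff iV_add iV_sum
    by (simp add: lin_map_sum[OF lin_map_iG] sum.distrib algebra_simps)
qed

text \<open>The group elements produced by \<alpha> have to pass the vectors \<open>v i\<close>. For
  l equal to \<open>lam\<close> this leaves the second sum of \<open>cond4\<close>; for l = 0 it
  leaves nothing but the coefficients \<open>alpha_diff\<close>.\<close>

lemma elt6_cong:
  assumes N: "skew_in N l"
  shows "cong_mod N (elt6 \<alpha> n r v m u s) (of_comps (alpha_diff scale B act \<alpha> n r v m u s)
    + (\<Sum>h\<in>carrier G. \<Sum>i<n. trip \<one> (\<alpha> (r i) h) \<one> \<otimes>\<^bsub>TU\<^esub> iG (l h (v i))))"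
proof -
  note N' = skew_in_ideal[OF N]
  have 1: "cong_mod N (iV (\<alpha> (r i)) \<otimes>\<^bsub>TU\<^esub> trip \<one> (v i) \<one>)
    (\<Sum>h\<in>carrier G. iT (vT (\<alpha> (r i) h) \<otimes>\<^bsub>TV\<^esub> vT (act h (v i))) \<otimes>\<^bsub>TU\<^esub> bvec (h, [])
      + trip \<one> (\<alpha> (r i) h) \<one> \<otimes>\<^bsub>TU\<^esub> iG (l h (v i)))" for i
  proof -
    have "iV (\<alpha> (r i)) \<otimes>\<^bsub>TU\<^esub> trip \<one> (v i) \<one>
      = (\<Sum>h\<in>carrier G. trip \<one> (\<alpha> (r i) h) \<one> \<otimes>\<^bsub>TU\<^esub> trip h (v i) \<one>)"
      unfolding VkG_to_TU_def mult_sums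
      by (rule sum.cong) (simp_all add: trip_mult_trip)
    also have "cong_mod N \<dots> (\<Sum>h\<in>carrier G. trip \<one> (\<alpha> (r i) h) \<one> \<otimes>\<^bsub>TU\<^esub> (trip \<one> (act h (v i)) h + iG (l h (v i))))"
      by (intro cong_sum[OF N'] cong_mult_left[OF N'] trip_cong[OF N]) auto
    also have "\<dots> = (\<Sum>h\<in>carrier G. iT (vT (\<alpha> (r i) h) \<otimes>\<^bsub>TV\<^esub> vT (act h (v i))) \<otimes>\<^bsub>TU\<^esub> bvec (h, [])
      + trip \<one> (\<alpha> (r i) h) \<one> \<otimes>\<^bsub>TU\<^esub> iG (l h (v i)))"
      by (rule sum.cong) (auto simp: mult_distribs iT_vT_mult)
    finally show ?thesis .
  qed
  have 2: "trip \<one> (u j) \<one> \<otimes>\<^bsub>TU\<^esub> iV (\<alpha> (s j))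
    = (\<Sum>h\<in>carrier G. iT (vT (u j) \<otimes>\<^bsub>TV\<^esub> vT (\<alpha> (s j) h)) \<otimes>\<^bsub>TU\<^esub> bvec (h, []))" for j
    unfolding VkG_to_TU_def mult_sums by (rule sum.cong) (auto simp: iT_vT_mult)
  have "cong_mod N (elt6 \<alpha> n r v m u s)
    ((\<Sum>i<n. \<Sum>h\<in>carrier G. iT (vT (\<alpha> (r i) h) \<otimes>\<^bsub>TV\<^esub> vT (act h (v i))) \<otimes>\<^bsub>TU\<^esub> bvec (h, [])
      + trip \<one> (\<alpha> (r i) h) \<one> \<otimes>\<^bsub>TU\<^esub> iG (l h (v i)))
     - (\<Sum>j<m. \<Sum>h\<in>carrier G. iT (vT (u j) \<otimes>\<^bsub>TV\<^esub> vT (\<alpha> (s j) h)) \<otimes>\<^bsub>TU\<^esub> bvec (h, [])))"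
    unfolding elt6_def 2 by (intro cong_diff[OF N'] cong_sum[OF N'] cong_refl[OF N'] 1)
  also have "\<dots> = of_comps (alpha_diff scale B act \<alpha> n r v m u s)
    + (\<Sum>h\<in>carrier G. \<Sum>i<n. trip \<one> (\<alpha> (r i) h) \<one> \<otimes>\<^bsub>TU\<^esub> iG (l h (v i)))"
    unfolding of_comps_def alpha_diff_def
    by (simp add: lin_map_diff[OF lin_map_iT] lin_map_sum[OF lin_map_iT] mult_distribs mult_sums
        sum.distrib sum_subtractf sum.swap[of _ "carrier G"])
  finally show ?thesis .
qed

lemma alpha_diff_power: "alpha_diff scale B act \<alpha> n r v m u s h \<in> tensor_power B 2"
proof -
  have "vT x \<otimes>\<^bsub>TV\<^esub> vT y \<in> tensor_power B 2" for x y
    using vT_tensor_power[of x] vT_tensor_power[of y]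
    by (auto simp: tensor_power_iff FM.monoid_alg_closed hT_mult_left[OF vT_tensor_power])
  then show ?thesis
    unfolding alpha_diff_def
    by (intro pv.subspace_diff pv.subspace_sum tensor_power_subspace) auto
qed

lemma IT_two_iff: "p \<in> tensor_power B 2 \<Longrightarrow> p \<in> IT \<longleftrightarrow> p \<in> R"
  using IT_two[of p] R_subset_IT by (auto simp: tensor_power_iff)

context
  fixes \<alpha> \<beta> lam
  assumes \<alpha>: "is_alpha scale B G R \<alpha>" and \<beta>: "is_beta B G R \<beta>" and lam: "is_lam scale G lam"
begin

lemma lam_ext_zero: "lam_ext G (\<lambda>g v. 0) c v = 0"
  by (simp add: lam_ext_eq)

text \<open>In this form the condition no longer refers to \<open>S \<rtimes> G\<close>, so it can
  be combined with congruences modulo ideals other than \<open>KU\<close>.\<close>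

lemma cond3_coeff:
  "cond3 scale B G act R \<alpha> lam \<longleftrightarrow>
    (\<forall>g\<in>carrier G. \<forall>n v w. tens2 scale B n v w \<in> R \<longrightarrow> (\<forall>a\<in>carrier G. coeff3 \<alpha> lam g n v w a = 0))"
  unfolding cond3_iff[OF \<alpha> \<beta> lam]
  using cong_mem_iff[OF ideal_KU elt3_cong[OF skew_in_KU _ lam]]
  by (simp add: lam_ext_zero lin_map_0[OF lin_map_iG] iV_KU_iff)

lemma cond4_coeff:
  "cond4 scale B G act R \<alpha> \<beta> lam \<longleftrightarrow>
    (\<forall>n r v m u s. overlap scale B R n r v m u s \<longrightarrow> (\<forall>a\<in>carrier G. coeff4 \<alpha> \<beta> lam n r v m u s a = 0))"
  unfolding cond4_iff[OF \<alpha> \<beta> lam]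
  using cong_mem_iff[OF ideal_KU elt4_cong[OF skew_in_KU lam \<beta>]]
  by (simp add: lam_ext_zero lin_map_0[OF lin_map_iG] iV_KU_iff)

lemma of_comps_KU_iff:
  assumes "\<And>h. h \<in> carrier G \<Longrightarrow> p h \<in> carrier TV"
  shows "of_comps p \<in> KU \<longleftrightarrow> (\<forall>h\<in>carrier G. p h \<in> IT)"
  using assms by (simp add: KU_def of_comps_carrier nform_of_comps)

text \<open>The components of \<open>alpha_diff\<close> have degree two, where \<open>IT\<close> is
  R. This is why \<open>cond6\<close> makes \<alpha> and \<beta> applicable to them in
  \<open>cond4\<close> and \<open>cond5\<close>.\<close>

lemma cond6_coeff:
  "cond6 scale B G act R \<alpha> \<longleftrightarrow>
    (\<forall>n r v m u s. overlap scale B R n r v m u s \<longrightarrow> (\<forall>h\<in>carrier G. alpha_diff scale B act \<alpha> n r v m u s h \<in> R))"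
proof -
  have "elt6 \<alpha> n r v m u s \<in> KU \<longleftrightarrow> (\<forall>h\<in>carrier G. alpha_diff scale B act \<alpha> n r v m u s h \<in> R)" for n r v m u s
  proof -
    have "alpha_diff scale B act \<alpha> n r v m u s h \<in> carrier TV" for h
      using alpha_diff_power[of \<alpha> n r v m u s h] by (simp only: tensor_power_iff)
    then have "of_comps (alpha_diff scale B act \<alpha> n r v m u s) \<in> KU
      \<longleftrightarrow> (\<forall>h\<in>carrier G. alpha_diff scale B act \<alpha> n r v m u s h \<in> IT)"
      by (rule of_comps_KU_iff)
    then show ?thesis
      using cong_mem_iff[OF ideal_KU elt6_cong[OF skew_in_KU], of \<alpha> n r v m u s]
      by (simp add: lin_map_0[OF lin_map_iG] IT_two_iff[OF alpha_diff_power])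
  qed
  then show ?thesis unfolding cond6_iff[OF \<alpha> \<beta> lam] by simp
qed

text \<open>The remainder has its V \<otimes> kG part governed by \<open>cond3\<close> and its kG
  part by \<open>cond2\<close>. So the conditions let group elements pass deformed relations;
  conversely, the remainder lies in N whenever the relations do.\<close>

lemma rel_group:
  assumes N: "skew_in N lam" and g: "g \<in> carrier G" and r: "r = tens2 scale B n v w"
  shows "cong_mod N (bvec (g, []) \<otimes>\<^bsub>TU\<^esub> rel \<alpha> \<beta> r) (rel \<alpha> \<beta> (aT g r) \<otimes>\<^bsub>TU\<^esub> bvec (g, [])
    - iV (coeff3 \<alpha> lam g n v w)
    - iG ((\<Sum>a\<in>carrier G. lam g (\<alpha> r a) \<otimes>\<^bsub>kG\<^esub> bvec a) - (\<Sum>i<n. lam_ext G lam (lam g (v i)) (w i))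
      + bvec g \<otimes>\<^bsub>kG\<^esub> \<beta> r - \<beta> (aT g r) \<otimes>\<^bsub>kG\<^esub> bvec g))"
proof -
  note N' = skew_in_ideal[OF N]
  have c: "lam g x \<in> carrier kG" for x using lam g by (auto simp: is_lam_def)
  have 1: "cong_mod N (bvec (g, []) \<otimes>\<^bsub>TU\<^esub> (trip \<one> x \<one> \<otimes>\<^bsub>TU\<^esub> trip \<one> y \<one>))
    (iT (vT (act g x) \<otimes>\<^bsub>TV\<^esub> vT (act g y)) \<otimes>\<^bsub>TU\<^esub> bvec (g, [])
      + trip \<one> (act g x) \<one> \<otimes>\<^bsub>TU\<^esub> iG (lam g y) + iG (lam g x) \<otimes>\<^bsub>TU\<^esub> trip \<one> y \<one>)" for x y
  proof -
    have "bvec (g, []) \<otimes>\<^bsub>TU\<^esub> (trip \<one> x \<one> \<otimes>\<^bsub>TU\<^esub> trip \<one> y \<one>) = trip g x \<one> \<otimes>\<^bsub>TU\<^esub> trip \<one> y \<one>"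
      using g by (simp add: BM.monoid_alg_assoc[symmetric] trip_factor)
    also have "cong_mod N \<dots> ((trip \<one> (act g x) g + iG (lam g x)) \<otimes>\<^bsub>TU\<^esub> trip \<one> y \<one>)"
      by (intro cong_mult_right[OF N'] trip_cong[OF N g]) auto
    also have "(trip \<one> (act g x) g + iG (lam g x)) \<otimes>\<^bsub>TU\<^esub> trip \<one> y \<one>
      = trip \<one> (act g x) \<one> \<otimes>\<^bsub>TU\<^esub> trip g y \<one> + iG (lam g x) \<otimes>\<^bsub>TU\<^esub> trip \<one> y \<one>"
      by (simp add: mult_distribs trip_mult_trip[OF g])
    finally have "cong_mod N (bvec (g, []) \<otimes>\<^bsub>TU\<^esub> (trip \<one> x \<one> \<otimes>\<^bsub>TU\<^esub> trip \<one> y \<one>))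
       (trip \<one> (act g x) \<one> \<otimes>\<^bsub>TU\<^esub> trip g y \<one> + iG (lam g x) \<otimes>\<^bsub>TU\<^esub> trip \<one> y \<one>)" .
    moreover have "cong_mod N (trip \<one> (act g x) \<one> \<otimes>\<^bsub>TU\<^esub> trip g y \<one> + iG (lam g x) \<otimes>\<^bsub>TU\<^esub> trip \<one> y \<one>)
      (trip \<one> (act g x) \<one> \<otimes>\<^bsub>TU\<^esub> (trip \<one> (act g y) g + iG (lam g y)) + iG (lam g x) \<otimes>\<^bsub>TU\<^esub> trip \<one> y \<one>)"
      using g by (intro cong_add[OF N'] cong_refl[OF N'] cong_mult_left[OF N'] trip_cong[OF N g]) auto
    ultimately show ?thesis
      using g cong_trans[OF N'] by (simp add: mult_distribs iT_vT_mult)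
  qed
  have "cong_mod N (bvec (g, []) \<otimes>\<^bsub>TU\<^esub> iT r)
    (\<Sum>i<n. iT (vT (act g (v i)) \<otimes>\<^bsub>TV\<^esub> vT (act g (w i))) \<otimes>\<^bsub>TU\<^esub> bvec (g, [])
      + trip \<one> (act g (v i)) \<one> \<otimes>\<^bsub>TU\<^esub> iG (lam g (w i)) + iG (lam g (v i)) \<otimes>\<^bsub>TU\<^esub> trip \<one> (w i) \<one>)"
    unfolding r tens2_eq_iT[OF \<alpha> \<beta> lam] mult_sums by (intro cong_sum[OF N'] 1)
  also have "\<dots> = iT (aT g r) \<otimes>\<^bsub>TU\<^esub> bvec (g, [])
      + (\<Sum>i<n. trip \<one> (act g (v i)) \<one> \<otimes>\<^bsub>TU\<^esub> iG (lam g (w i))) + (\<Sum>i<n. iG (lam g (v i)) \<otimes>\<^bsub>TU\<^esub> trip \<one> (w i) \<one>)"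
    using g by (simp add: r sum.distrib tens2_def lin_map_sum[OF lin_map_iT] lin_map_sum[OF lin_map_aT]
        aT_mult aT_vT mult_sums)
  finally have 2: "cong_mod N (bvec (g, []) \<otimes>\<^bsub>TU\<^esub> iT r) (iT (aT g r) \<otimes>\<^bsub>TU\<^esub> bvec (g, [])
      + (\<Sum>i<n. trip \<one> (act g (v i)) \<one> \<otimes>\<^bsub>TU\<^esub> iG (lam g (w i))) + (\<Sum>i<n. iG (lam g (v i)) \<otimes>\<^bsub>TU\<^esub> trip \<one> (w i) \<one>))" .
  have b: "bvec (g, []) \<otimes>\<^bsub>TU\<^esub> iG c = iG (bvec g \<otimes>\<^bsub>kG\<^esub> c)" "iG c \<otimes>\<^bsub>TU\<^esub> bvec (g, []) = iG (c \<otimes>\<^bsub>kG\<^esub> bvec g)" for c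
    by (simp_all add: iG_mult)
  have "cong_mod N (bvec (g, []) \<otimes>\<^bsub>TU\<^esub> rel \<alpha> \<beta> r) ((iT (aT g r) \<otimes>\<^bsub>TU\<^esub> bvec (g, [])
      + (\<Sum>i<n. trip \<one> (act g (v i)) \<one> \<otimes>\<^bsub>TU\<^esub> iG (lam g (w i))) + (\<Sum>i<n. iG (lam g (v i)) \<otimes>\<^bsub>TU\<^esub> trip \<one> (w i) \<one>))
      - bvec (g, []) \<otimes>\<^bsub>TU\<^esub> iV (\<alpha> r) - iG (bvec g \<otimes>\<^bsub>kG\<^esub> \<beta> r))"
    unfolding rel_def mult_distribs b by (intro cong_diff[OF N'] cong_refl[OF N'] 2)
  also have "\<dots> = rel \<alpha> \<beta> (aT g r) \<otimes>\<^bsub>TU\<^esub> bvec (g, []) - elt3 \<alpha> lam g n v w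
      - (iG (bvec g \<otimes>\<^bsub>kG\<^esub> \<beta> r) - iG (\<beta> (aT g r) \<otimes>\<^bsub>kG\<^esub> bvec g))"
    unfolding rel_def mult_distribs b elt3_def r by (simp add: algebra_simps)
  finally have 3: "cong_mod N (bvec (g, []) \<otimes>\<^bsub>TU\<^esub> rel \<alpha> \<beta> r) \<dots>" .
  have "cong_mod N (rel \<alpha> \<beta> (aT g r) \<otimes>\<^bsub>TU\<^esub> bvec (g, []) - elt3 \<alpha> lam g n v w
      - (iG (bvec g \<otimes>\<^bsub>kG\<^esub> \<beta> r) - iG (\<beta> (aT g r) \<otimes>\<^bsub>kG\<^esub> bvec g)))
    (rel \<alpha> \<beta> (aT g r) \<otimes>\<^bsub>TU\<^esub> bvec (g, []) - (iV (coeff3 \<alpha> lam g n v w)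
    + iG ((\<Sum>a\<in>carrier G. lam g (\<alpha> r a) \<otimes>\<^bsub>kG\<^esub> bvec a) - (\<Sum>i<n. lam_ext G lam (lam g (v i)) (w i))))
      - (iG (bvec g \<otimes>\<^bsub>kG\<^esub> \<beta> r) - iG (\<beta> (aT g r) \<otimes>\<^bsub>kG\<^esub> bvec g)))"
    unfolding r by (intro cong_diff[OF N'] cong_refl[OF N'] elt3_cong[OF N g lam])
  from cong_trans[OF N' 3 this] show ?thesis
    by (simp add: lin_map_diff[OF lin_map_iG] lin_map_add[OF lin_map_iG] algebra_simps)
qed

text \<open>Reducing an element of (V \<otimes> R) \<inter> (R \<otimes> V) from both sides cancels
  degree three. The degree two rest is completed to deformed relations for
  \<open>alpha_diff\<close>, and what is then left over is governed by \<open>cond4\<close> and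
  \<open>cond5\<close>.\<close>

lemma rel_overlap:
  assumes N: "skew_in N lam" and o: "overlap scale B R n r v m u s"
  shows "cong_mod N ((\<Sum>j<m. trip \<one> (u j) \<one> \<otimes>\<^bsub>TU\<^esub> rel \<alpha> \<beta> (s j)) - (\<Sum>i<n. rel \<alpha> \<beta> (r i) \<otimes>\<^bsub>TU\<^esub> trip \<one> (v i) \<one>))
    ((\<Sum>h\<in>carrier G. rel \<alpha> \<beta> (alpha_diff scale B act \<alpha> n r v m u s h) \<otimes>\<^bsub>TU\<^esub> bvec (h, []))
     + iV (coeff4 \<alpha> \<beta> lam n r v m u s)
     + iG ((\<Sum>h\<in>carrier G. \<beta> (alpha_diff scale B act \<alpha> n r v m u s h) \<otimes>\<^bsub>kG\<^esub> bvec h)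
       + (\<Sum>i<n. lam_ext G lam (\<beta> (r i)) (v i))))"
proof -
  note N' = skew_in_ideal[OF N]
  let ?d = "alpha_diff scale B act \<alpha> n r v m u s"
  have regroup: "x + y - c + e = x - a + (a + y - c + e)"
    for x y c e a :: "'g \<times> ('v \<times> 'g) list \<Rightarrow>\<^sub>0 'k" by simp
  have "iT (\<Sum>i<n. r i \<otimes>\<^bsub>TV\<^esub> vT (v i)) = iT (\<Sum>j<m. vT (u j) \<otimes>\<^bsub>TV\<^esub> s j)"
    using o by (simp add: overlap_def)
  then have top: "(\<Sum>j<m. trip \<one> (u j) \<one> \<otimes>\<^bsub>TU\<^esub> iT (s j)) = (\<Sum>i<n. iT (r i) \<otimes>\<^bsub>TU\<^esub> trip \<one> (v i) \<one>)"
    by (simp add: lin_map_sum[OF lin_map_iT] iT_mult iT_vT)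
  \<comment> \<open>The terms of degree three cancel by \<open>top\<close>; \<open>elt6\<close> is
    the part of degree two.\<close>
  have e1: "(\<Sum>j<m. trip \<one> (u j) \<one> \<otimes>\<^bsub>TU\<^esub> rel \<alpha> \<beta> (s j)) - (\<Sum>i<n. rel \<alpha> \<beta> (r i) \<otimes>\<^bsub>TU\<^esub> trip \<one> (v i) \<one>)
    = elt6 \<alpha> n r v m u s - (\<Sum>j<m. trip \<one> (u j) \<one> \<otimes>\<^bsub>TU\<^esub> iG (\<beta> (s j)))
      + (\<Sum>i<n. iG (\<beta> (r i)) \<otimes>\<^bsub>TU\<^esub> trip \<one> (v i) \<one>)"
    by (simp add: rel_def elt6_def mult_distribs sum_subtractf top)
  have c: "cong_mod N (elt6 \<alpha> n r v m u s - (\<Sum>j<m. trip \<one> (u j) \<one> \<otimes>\<^bsub>TU\<^esub> iG (\<beta> (s j)))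
      + (\<Sum>i<n. iG (\<beta> (r i)) \<otimes>\<^bsub>TU\<^esub> trip \<one> (v i) \<one>)) ((of_comps ?d
    + (\<Sum>h\<in>carrier G. \<Sum>i<n. trip \<one> (\<alpha> (r i) h) \<one> \<otimes>\<^bsub>TU\<^esub> iG (lam h (v i)))) - (\<Sum>j<m. trip \<one> (u j) \<one> \<otimes>\<^bsub>TU\<^esub> iG (\<beta> (s j)))
      + (\<Sum>i<n. iG (\<beta> (r i)) \<otimes>\<^bsub>TU\<^esub> trip \<one> (v i) \<one>))"
    by (intro cong_add[OF N'] cong_diff[OF N'] cong_refl[OF N'] elt6_cong[OF N])
  \<comment> \<open>The \<alpha>-parts of the relations for \<open>alpha_diff\<close> are subtracted
    and added again: with the minus sign they belong to the relations, with the plus sign to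
    \<open>elt4\<close>.\<close>
  have e2: "(of_comps ?d
    + (\<Sum>h\<in>carrier G. \<Sum>i<n. trip \<one> (\<alpha> (r i) h) \<one> \<otimes>\<^bsub>TU\<^esub> iG (lam h (v i)))) - (\<Sum>j<m. trip \<one> (u j) \<one> \<otimes>\<^bsub>TU\<^esub> iG (\<beta> (s j)))
      + (\<Sum>i<n. iG (\<beta> (r i)) \<otimes>\<^bsub>TU\<^esub> trip \<one> (v i) \<one>) = of_comps ?d - (\<Sum>h\<in>carrier G. iV (\<alpha> (?d h)) \<otimes>\<^bsub>TU\<^esub> bvec (h, [])) + elt4 \<alpha> \<beta> lam n r v m u s"
    unfolding elt4_def by (rule regroup)
  have e3: "of_comps ?d - (\<Sum>h\<in>carrier G. iV (\<alpha> (?d h)) \<otimes>\<^bsub>TU\<^esub> bvec (h, []))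
    = (\<Sum>h\<in>carrier G. rel \<alpha> \<beta> (?d h) \<otimes>\<^bsub>TU\<^esub> bvec (h, []))
    + iG (\<Sum>h\<in>carrier G. \<beta> (?d h) \<otimes>\<^bsub>kG\<^esub> bvec h)"
    by (simp add: of_comps_def rel_def mult_distribs sum_subtractf lin_map_sum[OF lin_map_iG] iG_mult)
  have 1: "cong_mod N ((\<Sum>j<m. trip \<one> (u j) \<one> \<otimes>\<^bsub>TU\<^esub> rel \<alpha> \<beta> (s j)) - (\<Sum>i<n. rel \<alpha> \<beta> (r i) \<otimes>\<^bsub>TU\<^esub> trip \<one> (v i) \<one>))
    ((\<Sum>h\<in>carrier G. rel \<alpha> \<beta> (?d h) \<otimes>\<^bsub>TU\<^esub> bvec (h, []))
    + iG (\<Sum>h\<in>carrier G. \<beta> (?d h) \<otimes>\<^bsub>kG\<^esub> bvec h) + elt4 \<alpha> \<beta> lam n r v m u s)"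
    using c unfolding e1[symmetric] e2 e3 .
  have "cong_mod N ((\<Sum>h\<in>carrier G. rel \<alpha> \<beta> (?d h) \<otimes>\<^bsub>TU\<^esub> bvec (h, []))
    + iG (\<Sum>h\<in>carrier G. \<beta> (?d h) \<otimes>\<^bsub>kG\<^esub> bvec h) + elt4 \<alpha> \<beta> lam n r v m u s)
    ((\<Sum>h\<in>carrier G. rel \<alpha> \<beta> (?d h) \<otimes>\<^bsub>TU\<^esub> bvec (h, []))
    + iG (\<Sum>h\<in>carrier G. \<beta> (?d h) \<otimes>\<^bsub>kG\<^esub> bvec h) + (iV (coeff4 \<alpha> \<beta> lam n r v m u s)
    + iG (\<Sum>i<n. lam_ext G lam (\<beta> (r i)) (v i))))"
    by (intro cong_add[OF N'] cong_refl[OF N'] elt4_cong[OF N lam \<beta> o])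
  from cong_trans[OF N' 1 this] show ?thesis
    by (simp add: lin_map_add[OF lin_map_iG] algebra_simps)
qed

end

end

context quad_setup
begin

subsection \<open>Linear syzygies of a Koszul algebra\<close>

lemma hT_mult_vT: "hT n (p \<otimes>\<^bsub>TV\<^esub> vT v) = (if n = 0 then 0 else hT (n - 1) p \<otimes>\<^bsub>TV\<^esub> vT v)"
  using hT_mult[OF vT_tensor_power, of n p v] by (cases n) auto

lemma hT_0_eq: "hT 0 p = pscale (Poly_Mapping.lookup p []) (bvec [])"
  by (rule poly_mapping_eqI) (auto simp: lookup_single when_def)

lemma hT_0_mult_vT: "hT 0 p \<otimes>\<^bsub>TV\<^esub> vT v = pscale (Poly_Mapping.lookup p []) (vT v)"
  unfolding hT_0_eq mult_pscales FM.monoid_alg_one_left[OF vT_carrier, simplified] ..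

lemma lookup_mult_vT:
  "Poly_Mapping.lookup (p \<otimes>\<^bsub>TV\<^esub> vT v) (w @ [b]) = Poly_Mapping.lookup p w * coord v b"
proof -
  have 1: "Poly_Mapping.lookup (p \<otimes>\<^bsub>TV\<^esub> bvec [a]) (w @ [b]) = (if a = b then Poly_Mapping.lookup p w else 0)" for a
  proof -
    have "Poly_Mapping.lookup (p \<otimes>\<^bsub>TV\<^esub> bvec [a]) (w @ [b])
        = (\<Sum>u\<in>Poly_Mapping.keys p. if u = w then (if a = b then Poly_Mapping.lookup p w else 0) else 0)"
      unfolding monoid_alg_mult lin_ext_def[of _ p] lookup_sum
      by (rule sum.cong) (auto simp: lookup_single when_def)
    then show ?thesis by (simp add: sum.delta in_keys_iff)
  qed
  have "Poly_Mapping.lookup (p \<otimes>\<^bsub>TV\<^esub> vT v) (w @ [b])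
      = (\<Sum>a\<in>B. coord v a * (if a = b then Poly_Mapping.lookup p w else 0))"
    by (simp add: vT_expand[of v] mult_sums mult_pscales lookup_sum 1 del: pscale_single)
  also have "\<dots> = (\<Sum>a\<in>B. if a = b then Poly_Mapping.lookup p w * coord v b else 0)"
    by (rule sum.cong) auto
  also have "\<dots> = Poly_Mapping.lookup p w * coord v b"
    using V.finite_Basis coord_not_Basis[of b v] by (cases "b \<in> B") auto
  finally show ?thesis .
qed

lemma tensor_power_last:
  assumes "p \<in> tensor_power B (Suc n)"
  obtains f where "\<And>b. b \<in> B \<Longrightarrow> f b \<in> tensor_power B n" "p = (\<Sum>b\<in>B. f b \<otimes>\<^bsub>TV\<^esub> vT b)"
proof -
  have "p \<in> {p. \<exists>f. (\<forall>b\<in>B. f b \<in> tensor_power B n) \<and> p = (\<Sum>b\<in>B. f b \<otimes>\<^bsub>TV\<^esub> vT b)}" (is "p \<in> ?S")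
  proof (rule in_subspace_if_bvecs)
    show "pv.subspace ?S"
    proof (rule pv.subspaceI)
      show "0 \<in> ?S" using pv.subspace_0[OF tensor_power_subspace[of n]]
        by (auto intro!: exI[of _ "\<lambda>b. 0"])
      show "x + y \<in> ?S" if xy: "x \<in> ?S" "y \<in> ?S" for x y
      proof -
        obtain f g where "\<forall>b\<in>B. f b \<in> tensor_power B n" "x = (\<Sum>b\<in>B. f b \<otimes>\<^bsub>TV\<^esub> vT b)"
          "\<forall>b\<in>B. g b \<in> tensor_power B n" "y = (\<Sum>b\<in>B. g b \<otimes>\<^bsub>TV\<^esub> vT b)" using xy by blast
        then show ?thesis using pv.subspace_add[OF tensor_power_subspace[of n]]
          by (auto intro!: exI[of _ "\<lambda>b. f b + g b"] simp: mult_distribs sum.distrib)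
      qed
      show "pscale c x \<in> ?S" if x: "x \<in> ?S" for c x
      proof -
        obtain f where "\<forall>b\<in>B. f b \<in> tensor_power B n" "x = (\<Sum>b\<in>B. f b \<otimes>\<^bsub>TV\<^esub> vT b)" using x by blast
        then show ?thesis using pv.subspace_scale[OF tensor_power_subspace[of n]]
          by (auto intro!: exI[of _ "\<lambda>b. pscale c (f b)"] simp: mult_pscales pv.scale_sum_right)
      qed
    qed
    fix w assume "w \<in> Poly_Mapping.keys p"
    then have w: "length w = Suc n" "w \<in> lists B" using assms by (auto simp: tensor_power_def carrier_monoid_alg)
    then obtain u b where u: "w = u @ [b]" by (cases w rule: rev_cases) auto
    then have ub: "length u = n" "u \<in> lists B" "b \<in> B" using w by auto
    define g where "g a = (if a = b then bvec u else 0 :: 'v list \<Rightarrow>\<^sub>0 'k)" for a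
    have "(\<Sum>a\<in>B. g a \<otimes>\<^bsub>TV\<^esub> vT a) = (\<Sum>a\<in>B. if a = b then bvec u \<otimes>\<^bsub>TV\<^esub> vT a else 0)"
      by (rule sum.cong) (auto simp: g_def)
    then have "bvec w = (\<Sum>a\<in>B. g a \<otimes>\<^bsub>TV\<^esub> vT a)"
      using ub V.finite_Basis by (simp add: u vT_Basis)
    moreover have "\<forall>a\<in>B. g a \<in> tensor_power B n"
      using ub pv.subspace_0[OF tensor_power_subspace[of n]]
      by (auto simp: g_def tensor_power_def carrier_monoid_alg)
    ultimately show "bvec w \<in> ?S" by blast
  qed
  then show ?thesis using that by blast
qed

lemma hT_sum: "hT n (\<Sum>i\<in>I. f i) = (\<Sum>i\<in>I. hT n (f i))"
  by (rule lin_map_sum[OF lin_map_restr_supp])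

lemma hT_diff: "hT n (p - q) = hT n p - hT n q"
  by (rule lin_map_diff[OF lin_map_restr_supp])

text \<open>The first four terms of the resolution, with the matrix entries lifted to \<open>V\<close>.\<close>

lemma koszul_lift:
  assumes "koszul (quad_alg B R) (quad_comp B R)"
  obtains b :: "nat \<Rightarrow> nat" and e :: "nat \<Rightarrow> nat \<Rightarrow> nat \<Rightarrow> 'v"
  where "b 0 = 1"
    "\<And>v. \<exists>p. (\<forall>i. p i \<in> carrier TV) \<and> vT v - (\<Sum>i<b 1. p i \<otimes>\<^bsub>TV\<^esub> vT (e 0 i 0)) \<in> IT"
    "\<And>n p. (\<And>i. i < b (Suc n) \<Longrightarrow> p i \<in> carrier TV) \<Longrightarrow>
      (\<And>j. j < b n \<Longrightarrow> (\<Sum>i<b (Suc n). p i \<otimes>\<^bsub>TV\<^esub> vT (e n i j)) \<in> IT) \<Longrightarrow>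
      \<exists>y. (\<forall>l. y l \<in> carrier TV) \<and>
        (\<forall>i<b (Suc n). p i - (\<Sum>l<b (Suc (Suc n)). y l \<otimes>\<^bsub>TV\<^esub> vT (e (Suc n) l i)) \<in> IT)"
    "\<And>n l j. l < b (Suc (Suc n)) \<Longrightarrow> j < b n \<Longrightarrow>
      (\<Sum>i<b (Suc n). vT (e (Suc n) l i) \<otimes>\<^bsub>TV\<^esub> vT (e n i j)) \<in> IT"
proof -
  let ?c = "\<lambda>x. IT +>\<^bsub>TV\<^esub> x"
  obtain b M where b0: "b 0 = 1"
    and M1: "\<forall>n. \<forall>i<b (Suc n). \<forall>j<b n. M n i j \<in> quad_comp B R 1"
    and K0: "{row_times S.QA (b 1) x (M 0) 0 | x. x \<in> {..<b 1} \<rightarrow> carrier S.QA}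
      = k_span S.QA (\<Union>d\<in>{1..}. quad_comp B R d)"
    and K: "\<forall>n. \<forall>x\<in>{..<b (Suc n)} \<rightarrow> carrier S.QA.
          (\<forall>j<b n. row_times S.QA (b (Suc n)) x (M n) j = \<zero>\<^bsub>S.QA\<^esub>) \<longleftrightarrow>
          (\<exists>y\<in>{..<b (Suc (Suc n))} \<rightarrow> carrier S.QA. \<forall>i<b (Suc n).
             x i = row_times S.QA (b (Suc (Suc n))) y (M (Suc n)) i)"
    using assms unfolding koszul_def quad_alg_eq by (elim exE conjE) (rule that)
  have "\<forall>n i j. \<exists>v. i < b (Suc n) \<and> j < b n \<longrightarrow> M n i j = ?c (vT v)"
  proof (intro allI)
    fix n i j
    show "\<exists>v. i < b (Suc n) \<and> j < b n \<longrightarrow> M n i j = ?c (vT v)"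
    proof (cases "i < b (Suc n) \<and> j < b n")
      case True
      then have "M n i j \<in> quad_comp B R 1" using M1 by blast
      then obtain p where "p \<in> tensor_power B 1" "M n i j = ?c p"
        by (auto simp: quad_comp_def quot_image_def)
      then show ?thesis using vT_surj[of p] by metis
    qed auto
  qed
  then obtain e where e: "\<And>n i j. i < b (Suc n) \<Longrightarrow> j < b n \<Longrightarrow> M n i j = ?c (vT (e n i j))" by metis
  have row: "row_times S.QA (b (Suc n)) x (M n) j = ?c (\<Sum>i<b (Suc n). p i \<otimes>\<^bsub>TV\<^esub> vT (e n i j))"
    if "j < b n" "\<And>i. i < b (Suc n) \<Longrightarrow> p i \<in> carrier TV \<and> x i = ?c (p i)" for n j p x
  proof -
    have "row_times S.QA (b (Suc n)) x (M n) j = (\<Oplus>\<^bsub>S.QA\<^esub>i\<in>{..<b (Suc n)}. ?c (p i \<otimes>\<^bsub>TV\<^esub> vT (e n i j)))"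
      unfolding row_times_def using that
      by (intro S.Q.finsum_cong') (auto simp: e S.alg_quot_ops S.carrier_alg_quot FM.monoid_alg_closed)
    also have "\<dots> = ?c (\<Sum>i<b (Suc n). p i \<otimes>\<^bsub>TV\<^esub> vT (e n i j))"
      using that by (intro S.alg_quot_finsum FM.monoid_alg_closed) auto
    finally show ?thesis .
  qed
  have lift: "\<exists>p. (\<forall>i. p i \<in> carrier TV) \<and> (\<forall>i<m. x i = ?c (p i))"
    if "x \<in> {..<m} \<rightarrow> carrier S.QA" for x and m :: nat
  proof -
    have "\<forall>i. \<exists>p. p \<in> carrier TV \<and> (i < m \<longrightarrow> x i = ?c p)"
    proof
      fix i show "\<exists>p. p \<in> carrier TV \<and> (i < m \<longrightarrow> x i = ?c p)"
        using that by (cases "i < m") (auto simp: S.carrier_alg_quot Pi_iff)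
    qed
    then show ?thesis by metis
  qed
  show ?thesis
  proof (rule that[of b e])
    show "b 0 = 1" by (rule b0)
    show "\<exists>p. (\<forall>i. p i \<in> carrier TV) \<and> vT v - (\<Sum>i<b 1. p i \<otimes>\<^bsub>TV\<^esub> vT (e 0 i 0)) \<in> IT" for v
    proof -
      have "?c (vT v) \<in> quad_comp B R 1"
        using vT_tensor_power by (auto simp: quad_comp_def quot_image_def)
      then have "?c (vT v) \<in> k_span S.QA (\<Union>d\<in>{1..}. quad_comp B R d)"
        unfolding k_span_def by auto
      then obtain x where x: "x \<in> {..<b 1} \<rightarrow> carrier S.QA" "?c (vT v) = row_times S.QA (b 1) x (M 0) 0"
        unfolding K0[symmetric] by blast
      obtain p where p: "\<forall>i. p i \<in> carrier TV" "\<forall>i<b 1. x i = ?c (p i)" using lift[OF x(1)] by blast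
      have "?c (vT v) = ?c (\<Sum>i<b 1. p i \<otimes>\<^bsub>TV\<^esub> vT (e 0 i 0))"
        unfolding x(2) using row[of 0 0 p x] p b0 by simp
      then show ?thesis using p by (subst (asm) S.coset_eq_iff) (auto intro: FM.monoid_alg_closed)
    qed
    show "\<exists>y. (\<forall>l. y l \<in> carrier TV) \<and>
        (\<forall>i<b (Suc n). p i - (\<Sum>l<b (Suc (Suc n)). y l \<otimes>\<^bsub>TV\<^esub> vT (e (Suc n) l i)) \<in> IT)"
      if p: "\<And>i. i < b (Suc n) \<Longrightarrow> p i \<in> carrier TV"
        and z: "\<And>j. j < b n \<Longrightarrow> (\<Sum>i<b (Suc n). p i \<otimes>\<^bsub>TV\<^esub> vT (e n i j)) \<in> IT" for n p
    proof -
      have x: "(\<lambda>i. ?c (p i)) \<in> {..<b (Suc n)} \<rightarrow> carrier S.QA" using p by (auto simp: S.carrier_alg_quot)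
      have "row_times S.QA (b (Suc n)) (\<lambda>i. ?c (p i)) (M n) j = \<zero>\<^bsub>S.QA\<^esub>" if "j < b n" for j
      proof -
        have "row_times S.QA (b (Suc n)) (\<lambda>i. ?c (p i)) (M n) j = ?c (\<Sum>i<b (Suc n). p i \<otimes>\<^bsub>TV\<^esub> vT (e n i j))"
          by (rule row[OF that]) (use p in auto)
        also have "\<dots> = IT"
          using z[OF that] IT_carrier[OF z[OF that]] by (simp add: S.coset_eq_zero_iff)
        finally show ?thesis by (simp add: S.alg_quot_one_zero)
      qed
      then obtain y where y: "y \<in> {..<b (Suc (Suc n))} \<rightarrow> carrier S.QA"
        "\<forall>i<b (Suc n). ?c (p i) = row_times S.QA (b (Suc (Suc n))) y (M (Suc n)) i"
        using K[rule_format, OF x] by blast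
      obtain q where q: "\<forall>i. q i \<in> carrier TV" "\<forall>i<b (Suc (Suc n)). y i = ?c (q i)" using lift[OF y(1)] by blast
      have "p i - (\<Sum>l<b (Suc (Suc n)). q l \<otimes>\<^bsub>TV\<^esub> vT (e (Suc n) l i)) \<in> IT" if i: "i < b (Suc n)" for i
      proof -
        have "?c (p i) = ?c (\<Sum>l<b (Suc (Suc n)). q l \<otimes>\<^bsub>TV\<^esub> vT (e (Suc n) l i))"
          using y(2) i row[of i "Suc n" q y] q by simp
        then show ?thesis using p[OF i] q by (subst (asm) S.coset_eq_iff) (auto intro: FM.monoid_alg_closed)
      qed
      then show ?thesis using q by blast
    qed
    show "(\<Sum>i<b (Suc n). vT (e (Suc n) l i) \<otimes>\<^bsub>TV\<^esub> vT (e n i j)) \<in> IT"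
      if l: "l < b (Suc (Suc n))" and j: "j < b n" for n l j
    proof -
      \<comment> \<open>The unit vector at l is mapped to row l of the matrix, so exactness says
        that this row is a syzygy of the preceding matrix.\<close>
      let ?y = "\<lambda>i. ?c (if i = l then bvec [] else 0)" and ?x = "\<lambda>i. ?c (vT (e (Suc n) l i))"
      have "row_times S.QA (b (Suc (Suc n))) ?y (M (Suc n)) i = ?x i" if "i < b (Suc n)" for i
      proof -
        have "(\<Sum>k<b (Suc (Suc n)). (if k = l then bvec [] else 0) \<otimes>\<^bsub>TV\<^esub> vT (e (Suc n) k i))
          = (\<Sum>k<b (Suc (Suc n)). if k = l then vT (e (Suc n) l i) else 0)"
          by (rule sum.cong) (auto simp: FM.monoid_alg_one_left[simplified])
        then show ?thesis
          using l that by (subst row[of i "Suc n" "\<lambda>i. if i = l then bvec [] else 0"]) auto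
      qed
      moreover have "?y \<in> {..<b (Suc (Suc n))} \<rightarrow> carrier S.QA" by (auto simp: S.carrier_alg_quot)
      ultimately have ex: "\<exists>y\<in>{..<b (Suc (Suc n))} \<rightarrow> carrier S.QA. \<forall>i<b (Suc n).
             ?x i = row_times S.QA (b (Suc (Suc n))) y (M (Suc n)) i" by (intro bexI[of _ ?y]) auto
      have "?x \<in> {..<b (Suc n)} \<rightarrow> carrier S.QA" by (auto simp: S.carrier_alg_quot)
      then have "row_times S.QA (b (Suc n)) ?x (M n) j = \<zero>\<^bsub>S.QA\<^esub>" using K ex j by blast
      moreover have "row_times S.QA (b (Suc n)) ?x (M n) j = ?c (\<Sum>i<b (Suc n). vT (e (Suc n) l i) \<otimes>\<^bsub>TV\<^esub> vT (e n i j))"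
        by (rule row) (use j in auto)
      ultimately show ?thesis
        using S.coset_eq_zero_iff[of "\<Sum>i<b (Suc n). vT (e (Suc n) l i) \<otimes>\<^bsub>TV\<^esub> vT (e n i j)"]
        by (simp add: S.alg_quot_one_zero FM.monoid_alg_closed)
    qed
  qed
qed

text \<open>Koszulness enters only through this consequence of exactness in homological degrees at most
  two: the syzygies of \<open>R\<close> are generated by \<open>(V \<otimes> R) \<inter> (R \<otimes> V)\<close>.\<close>

lemma koszul_syzygies:
  assumes "koszul (quad_alg B R) (quad_comp B R)"
  obtains p q :: nat and s :: "nat \<Rightarrow> 'v list \<Rightarrow>\<^sub>0 'k" and c :: "nat \<Rightarrow> nat \<Rightarrow> 'v"
  where "\<And>i. i < p \<Longrightarrow> s i \<in> R"
    "\<And>l. l < q \<Longrightarrow> \<exists>n r v. overlap scale B R n r v p (c l) s"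
    "\<And>k z f. z \<in> pv.span {a \<otimes>\<^bsub>TV\<^esub> r | a r. a \<in> tensor_power B k \<and> r \<in> R} \<Longrightarrow>
      z = (\<Sum>b\<in>B. f b \<otimes>\<^bsub>TV\<^esub> vT b) \<Longrightarrow> (\<And>b. b \<in> B \<Longrightarrow> f b \<in> IT) \<Longrightarrow>
      \<exists>x y. (\<forall>i<p. x i \<in> IT \<inter> tensor_power B k)
        \<and> (\<forall>l<q. y l \<in> tensor_power B (k - 1) \<and> (k = 0 \<longrightarrow> y l = 0))
        \<and> z = (\<Sum>i<p. (x i + (\<Sum>l<q. y l \<otimes>\<^bsub>TV\<^esub> vT (c l i))) \<otimes>\<^bsub>TV\<^esub> s i)"
proof (rule koszul_lift[OF assms])
  fix b :: "nat \<Rightarrow> nat" and e :: "nat \<Rightarrow> nat \<Rightarrow> nat \<Rightarrow> 'v"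
  assume b0: "b 0 = 1"
    and E0: "\<And>v. \<exists>p. (\<forall>i. p i \<in> carrier TV) \<and> vT v - (\<Sum>i<b 1. p i \<otimes>\<^bsub>TV\<^esub> vT (e 0 i 0)) \<in> IT"
    and E: "\<And>n p. (\<And>i. i < b (Suc n) \<Longrightarrow> p i \<in> carrier TV) \<Longrightarrow>
      (\<And>j. j < b n \<Longrightarrow> (\<Sum>i<b (Suc n). p i \<otimes>\<^bsub>TV\<^esub> vT (e n i j)) \<in> IT) \<Longrightarrow>
      \<exists>y. (\<forall>l. y l \<in> carrier TV) \<and>
        (\<forall>i<b (Suc n). p i - (\<Sum>l<b (Suc (Suc n)). y l \<otimes>\<^bsub>TV\<^esub> vT (e (Suc n) l i)) \<in> IT)"
    and Z: "\<And>n l j. l < b (Suc (Suc n)) \<Longrightarrow> j < b n \<Longrightarrow>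
      (\<Sum>i<b (Suc n). vT (e (Suc n) l i) \<otimes>\<^bsub>TV\<^esub> vT (e n i j)) \<in> IT"
  \<comment> \<open>The entries of the first matrix, which has one column as \<open>b 0 = 1\<close>.
    They turn out to form a basis of V, adapted to the resolution.\<close>
  define m where "m i = e 0 i 0" for i
  have gen: "\<exists>c. v = (\<Sum>i<b 1. scale (c i) (m i))" for v
  proof -
    obtain p where p: "vT v - (\<Sum>i<b 1. p i \<otimes>\<^bsub>TV\<^esub> vT (m i)) \<in> IT" using E0 by (auto simp: m_def)
    have "hT 1 (vT v) = (\<Sum>i<b 1. hT 0 (p i) \<otimes>\<^bsub>TV\<^esub> vT (m i))"
      using IT_low[OF p, of 1] unfolding hT_diff hT_sum hT_mult_vT by simp
    also have "\<dots> = vT (\<Sum>i<b 1. scale (Poly_Mapping.lookup (p i) []) (m i))"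
      unfolding hT_0_mult_vT vT_sum vT_scale ..
    finally have "vT (v - (\<Sum>i<b 1. scale (Poly_Mapping.lookup (p i) []) (m i))) = 0"
      using vT_tensor_power[of v] by (simp add: tensor_power_iff vT_diff)
    then show ?thesis by (auto simp del: vT_diff)
  qed
  \<comment> \<open>Scalars annihilating the m i form a syzygy, hence a combination of rows with
    entries in V modulo \<open>IT\<close>; its part of degree zero is zero.\<close>
  have indep: "c i = 0" if "(\<Sum>i<b 1. scale (c i) (m i)) = 0" "i < b 1" for c i
  proof -
    have "(\<Sum>i<b 1. pscale (c i) (bvec []) \<otimes>\<^bsub>TV\<^esub> vT (m i)) = vT (\<Sum>i<b 1. scale (c i) (m i))"
      by (simp add: mult_pscales FM.monoid_alg_one_left[simplified] vT_sum vT_scale del: pscale_single)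
    then have "(\<Sum>i<b (Suc 0). pscale (c i) (bvec []) \<otimes>\<^bsub>TV\<^esub> vT (e 0 i j)) \<in> IT" if "j < b 0" for j
      using that b0 \<open>(\<Sum>i<b 1. scale (c i) (m i)) = 0\<close> pv.subspace_0[OF S.subspace]
      by (simp add: m_def del: pscale_single)
    then obtain y where y: "\<forall>i<b (Suc 0). pscale (c i) (bvec []) - (\<Sum>l<b (Suc (Suc 0)). y l \<otimes>\<^bsub>TV\<^esub> vT (e (Suc 0) l i)) \<in> IT"
      using E[of 0 "\<lambda>i. pscale (c i) (bvec [])"] by auto
    have "hT 0 (pscale (c i) (bvec [])) = 0"
      using IT_low[of _ 0, OF y[rule_format, of i]] that(2) unfolding hT_diff hT_sum hT_mult_vT by simp
    then show ?thesis by (simp add: lin_map_pscale[OF lin_map_restr_supp] del: pscale_single)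
  qed
  obtain C where C: "\<And>v. v = (\<Sum>i<b 1. scale (C v i) (m i))" using gen by metis
  \<comment> \<open>Coefficients in T(V) in front of the m i are unique as well: fixing the word
    before the last letter reduces this to scalars.\<close>
  have uniq0: "d i = 0" if "(\<Sum>i<b 1. d i \<otimes>\<^bsub>TV\<^esub> vT (m i)) = 0" "i < b 1" for d i
  proof (rule poly_mapping_eqI)
    fix w
    have "coord (\<Sum>i<b 1. scale (Poly_Mapping.lookup (d i) w) (m i)) a = 0" for a
      using arg_cong[OF that(1), of "\<lambda>p. Poly_Mapping.lookup p (w @ [a])"]
      by (simp add: lookup_sum lookup_mult_vT coord_sum coord_scale)
    then have "(\<Sum>i<b 1. scale (Poly_Mapping.lookup (d i) w) (m i)) = 0"
      using sum_coord[of "\<Sum>i<b 1. scale (Poly_Mapping.lookup (d i) w) (m i)"] by simp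
    then show "Poly_Mapping.lookup (d i) w = Poly_Mapping.lookup 0 w" using indep that(2) by simp
  qed
  have change: "(\<Sum>a\<in>B. f a \<otimes>\<^bsub>TV\<^esub> vT a) = (\<Sum>i<b 1. (\<Sum>a\<in>B. pscale (C a i) (f a)) \<otimes>\<^bsub>TV\<^esub> vT (m i))" for f
  proof -
    have "(\<Sum>a\<in>B. f a \<otimes>\<^bsub>TV\<^esub> vT a) = (\<Sum>a\<in>B. \<Sum>i<b 1. pscale (C a i) (f a) \<otimes>\<^bsub>TV\<^esub> vT (m i))"
    proof (rule sum.cong[OF refl])
      fix a
      have "vT a = (\<Sum>i<b 1. pscale (C a i) (vT (m i)))"
        using arg_cong[OF C[of a], of vT] by (simp only: vT_sum vT_scale)
      then show "f a \<otimes>\<^bsub>TV\<^esub> vT a = (\<Sum>i<b 1. pscale (C a i) (f a) \<otimes>\<^bsub>TV\<^esub> vT (m i))"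
        by (simp add: mult_sums mult_pscales)
    qed
    then show ?thesis by (simp add: mult_sums sum.swap[of _ B])
  qed
  \<comment> \<open>The product of the second matrix with the first. It vanishes in S, so its
    entries are relations; by \<open>R_span\<close> they span R.\<close>
  define s where "s l = (\<Sum>i<b 1. vT (e 1 l i) \<otimes>\<^bsub>TV\<^esub> vT (m i))" for l
  have vv: "vT x \<otimes>\<^bsub>TV\<^esub> vT y \<in> tensor_power B 2" for x y
    using vT_tensor_power[of x] vT_tensor_power[of y]
    by (auto simp: tensor_power_iff FM.monoid_alg_closed hT_mult_left[OF vT_tensor_power])
  have s_R: "s l \<in> R" if "l < b 2" for l
  proof -
    have "s l \<in> IT" using Z[of l 0 0] that b0 by (simp add: s_def m_def numeral_2_eq_2)
    moreover have "s l \<in> tensor_power B 2" unfolding s_def by (intro pv.subspace_sum tensor_power_subspace vv)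
    ultimately show ?thesis by (simp add: IT_two_iff)
  qed
  have R_span: "\<exists>g. r = (\<Sum>l<b 2. pscale (g l) (s l))" if r: "r \<in> R" for r
  proof -
    have "r \<in> tensor_power B (Suc 1)" using r R_deg by (auto simp: numeral_2_eq_2)
    then obtain f where f: "\<And>b. b \<in> B \<Longrightarrow> f b \<in> tensor_power B 1" "r = (\<Sum>b\<in>B. f b \<otimes>\<^bsub>TV\<^esub> vT b)"
      by (rule tensor_power_last) auto
    define g where "g i = (\<Sum>a\<in>B. pscale (C a i) (f a))" for i
    have g1: "g i \<in> tensor_power B 1" for i
      unfolding g_def by (intro pv.subspace_sum pv.subspace_scale tensor_power_subspace f)
    have rg: "r = (\<Sum>i<b 1. g i \<otimes>\<^bsub>TV\<^esub> vT (m i))" using f(2) change[of f] by (simp add: g_def)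
    then have "(\<Sum>i<b (Suc 0). g i \<otimes>\<^bsub>TV\<^esub> vT (e 0 i j)) \<in> IT" if "j < b 0" for j
      using that b0 r R_subset_IT by (auto simp: m_def)
    then obtain y where y: "\<forall>i<b (Suc 0). g i - (\<Sum>l<b (Suc (Suc 0)). y l \<otimes>\<^bsub>TV\<^esub> vT (e (Suc 0) l i)) \<in> IT"
      using E[of 0 g] g1 by (auto simp: tensor_power_def)
    \<comment> \<open>The congruence is compared in degree one, where \<open>IT\<close> is zero and
      only the constant terms of the coefficients y contribute.\<close>
    have gi: "g i = (\<Sum>l<b 2. pscale (Poly_Mapping.lookup (y l) []) (vT (e 1 l i)))" if "i < b 1" for i
    proof -
      have "hT 1 (g i) = (\<Sum>l<b 2. pscale (Poly_Mapping.lookup (y l) []) (vT (e 1 l i)))"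
        using IT_low[of _ 1, OF y[rule_format, of i]] that unfolding hT_diff hT_sum hT_mult_vT diff_self_eq_0 hT_0_mult_vT
        by (simp add: numeral_2_eq_2)
      then show ?thesis using g1[of i] by (simp add: tensor_power_iff)
    qed
    have "r = (\<Sum>i<b 1. \<Sum>l<b 2. pscale (Poly_Mapping.lookup (y l) []) (vT (e 1 l i) \<otimes>\<^bsub>TV\<^esub> vT (m i)))"
      unfolding rg by (rule sum.cong) (auto simp: gi mult_sums mult_pscales)
    also have "\<dots> = (\<Sum>l<b 2. pscale (Poly_Mapping.lookup (y l) []) (s l))"
      by (subst sum.swap) (simp add: s_def pv.scale_sum_right)
    finally show ?thesis by (rule exI[of _ "\<lambda>l. Poly_Mapping.lookup (y l) []"])
  qed
  show ?thesis
  proof (rule that[of "b 2" s "b 3" "e 2"])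
    show "s i \<in> R" if "i < b 2" for i by (rule s_R[OF that])
    show "\<exists>n r v. overlap scale B R n r v (b 2) (e 2 l) s" if l: "l < b 3" for l
    proof -
      \<comment> \<open>A row of the product of the first three matrices can be bracketed in two
        ways: one puts it into R \<otimes> V, the other into V \<otimes> R.\<close>
      define r where "r i = (\<Sum>j<b 2. vT (e 2 l j) \<otimes>\<^bsub>TV\<^esub> vT (e 1 j i))" for i
      have "r i \<in> R" if "i < b 1" for i
      proof -
        have "r i \<in> IT" using Z[of l 1 i] l that by (simp add: r_def numeral_2_eq_2 numeral_3_eq_3)
        moreover have "r i \<in> tensor_power B 2" unfolding r_def by (intro pv.subspace_sum tensor_power_subspace vv)
        ultimately show ?thesis by (simp add: IT_two_iff)
      qed
      moreover have "(\<Sum>i<b 1. r i \<otimes>\<^bsub>TV\<^esub> vT (m i)) = (\<Sum>j<b 2. vT (e 2 l j) \<otimes>\<^bsub>TV\<^esub> s j)"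
        unfolding r_def s_def mult_sums by (subst sum.swap) (simp add: FM.monoid_alg_assoc)
      ultimately have "overlap scale B R (b 1) r m (b 2) (e 2 l) s"
        using s_R by (simp add: overlap_def)
      then show ?thesis by blast
    qed
    fix k z f
    assume z: "z \<in> pv.span {a \<otimes>\<^bsub>TV\<^esub> r | a r. a \<in> tensor_power B k \<and> r \<in> R}"
      and zf: "z = (\<Sum>b\<in>B. f b \<otimes>\<^bsub>TV\<^esub> vT b)" and f: "\<And>b. b \<in> B \<Longrightarrow> f b \<in> IT"
    let ?S = "{z. \<exists>x. (\<forall>i. x i \<in> tensor_power B k) \<and> z = (\<Sum>i<b 2. x i \<otimes>\<^bsub>TV\<^esub> s i)}"
    have "pv.span {a \<otimes>\<^bsub>TV\<^esub> r | a r. a \<in> tensor_power B k \<and> r \<in> R} \<subseteq> ?S"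
    proof (rule pv.span_minimal)
      show "pv.subspace ?S"
      proof (rule pv.subspaceI)
        show "0 \<in> ?S" using pv.subspace_0[OF tensor_power_subspace[of k]]
          by (auto intro!: exI[of _ "\<lambda>b. 0"])
        show "x + y \<in> ?S" if xy: "x \<in> ?S" "y \<in> ?S" for x y
        proof -
          obtain f g where "\<forall>i. f i \<in> tensor_power B k" "x = (\<Sum>i<b 2. f i \<otimes>\<^bsub>TV\<^esub> s i)"
            "\<forall>i. g i \<in> tensor_power B k" "y = (\<Sum>i<b 2. g i \<otimes>\<^bsub>TV\<^esub> s i)" using xy by blast
          then show ?thesis using pv.subspace_add[OF tensor_power_subspace[of k]]
            by (auto intro!: exI[of _ "\<lambda>i. f i + g i"] simp: mult_distribs sum.distrib)
        qed
        show "pscale c x \<in> ?S" if x: "x \<in> ?S" for c x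
        proof -
          obtain f where "\<forall>i. f i \<in> tensor_power B k" "x = (\<Sum>i<b 2. f i \<otimes>\<^bsub>TV\<^esub> s i)" using x by blast
          then show ?thesis using pv.subspace_scale[OF tensor_power_subspace[of k]]
            by (auto intro!: exI[of _ "\<lambda>i. pscale c (f i)"] simp: mult_pscales pv.scale_sum_right)
        qed
      qed
      show "{a \<otimes>\<^bsub>TV\<^esub> r | a r. a \<in> tensor_power B k \<and> r \<in> R} \<subseteq> ?S"
      proof clarify
        fix a r :: "'v list \<Rightarrow>\<^sub>0 'k" assume a: "a \<in> tensor_power B k" and "r \<in> R"
        then obtain g where "r = (\<Sum>l<b 2. pscale (g l) (s l))" using R_span by blast
        then show "\<exists>x. (\<forall>i. x i \<in> tensor_power B k) \<and> a \<otimes>\<^bsub>TV\<^esub> r = (\<Sum>i<b 2. x i \<otimes>\<^bsub>TV\<^esub> s i)"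
          using pv.subspace_scale[OF tensor_power_subspace a]
          by (intro exI[of _ "\<lambda>l. pscale (g l) a"]) (auto simp: mult_sums mult_pscales)
      qed
    qed
    then obtain x where x: "\<And>i. x i \<in> tensor_power B k" "z = (\<Sum>i<b 2. x i \<otimes>\<^bsub>TV\<^esub> s i)" using z by blast
    have xc: "x i \<in> carrier TV" for i using x(1)[of i] by (simp add: tensor_power_def)
    have "z = (\<Sum>j<b 1. (\<Sum>i<b 2. x i \<otimes>\<^bsub>TV\<^esub> vT (e 1 i j)) \<otimes>\<^bsub>TV\<^esub> vT (m j))"
      unfolding x(2) s_def mult_sums by (subst sum.swap) (simp add: FM.monoid_alg_assoc xc)
    then have "(\<Sum>j<b 1. ((\<Sum>i<b 2. x i \<otimes>\<^bsub>TV\<^esub> vT (e 1 i j)) - (\<Sum>a\<in>B. pscale (C a j) (f a))) \<otimes>\<^bsub>TV\<^esub> vT (m j)) = 0"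
      using zf change[of f] by (simp add: mult_distribs sum_subtractf)
    then have "(\<Sum>i<b 2. x i \<otimes>\<^bsub>TV\<^esub> vT (e 1 i j)) = (\<Sum>a\<in>B. pscale (C a j) (f a))" if "j < b 1" for j
      using uniq0[OF _ that] by fastforce
    \<comment> \<open>With respect to the basis m the coefficients of z lie in \<open>IT\<close>, so
      over S the row x is annihilated by the second matrix and exactness at the next place
      applies.\<close>
    then have "(\<Sum>i<b (Suc 1). x i \<otimes>\<^bsub>TV\<^esub> vT (e 1 i j)) \<in> IT" if "j < b 1" for j
      using that f by (auto simp: numeral_2_eq_2 intro!: pv.subspace_sum[OF S.subspace] pv.subspace_scale[OF S.subspace])
    then obtain y where y: "\<forall>l. y l \<in> carrier TV"
      "\<forall>i<b (Suc 1). x i - (\<Sum>l<b (Suc (Suc 1)). y l \<otimes>\<^bsub>TV\<^esub> vT (e (Suc 1) l i)) \<in> IT"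
      using E[of 1 x] xc by blast
    \<comment> \<open>Everything is cut to degree k. The third matrix has entries of degree one, so
      y contributes in degree k - 1, and not at all for k = 0.\<close>
    define y' where "y' l = (if k = 0 then 0 else hT (k - 1) (y l))" for l
    define x' where "x' i = hT k (x i - (\<Sum>l<b 3. y l \<otimes>\<^bsub>TV\<^esub> vT (e 2 l i)))" for i
    have "x i - (\<Sum>l<b 3. y l \<otimes>\<^bsub>TV\<^esub> vT (e 2 l i)) \<in> IT" if "i < b 2" for i
      using y(2) that by (simp add: numeral_2_eq_2 numeral_3_eq_3)
    then have "x' i \<in> IT \<inter> tensor_power B k" if "i < b 2" for i
      using that xc y(1) by (auto simp: x'_def intro!: IT_hT hT_in_tensor_power FM.monoid_alg_closed)
    moreover have "y' l \<in> tensor_power B (k - 1) \<and> (k = 0 \<longrightarrow> y' l = 0)" for l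
      using y(1) pv.subspace_0[OF tensor_power_subspace[of "k - 1"]] by (auto simp: y'_def intro: hT_in_tensor_power)
    moreover have "x i = x' i + (\<Sum>l<b 3. y' l \<otimes>\<^bsub>TV\<^esub> vT (e 2 l i))" for i
      using x(1)[of i] unfolding x'_def y'_def hT_diff hT_sum hT_mult_vT
      by (cases "k = 0") (simp_all add: tensor_power_iff)
    ultimately show "\<exists>x y. (\<forall>i<b 2. x i \<in> IT \<inter> tensor_power B k)
        \<and> (\<forall>l<b 3. y l \<in> tensor_power B (k - 1) \<and> (k = 0 \<longrightarrow> y l = 0))
        \<and> z = (\<Sum>i<b 2. (x i + (\<Sum>l<b 3. y l \<otimes>\<^bsub>TV\<^esub> vT (e 2 l i))) \<otimes>\<^bsub>TV\<^esub> s i)"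
      using x(2) by (intro exI[of _ x'] exI[of _ y']) auto
  qed
qed

end

context quad_setup
begin

subsection \<open>The filtration by degree\<close>

abbreviation TUf :: "nat \<Rightarrow> ('g \<times> ('v \<times> 'g) list \<Rightarrow>\<^sub>0 'k) set" where
  "TUf \<equiv> bimod_filt G B"

lemma bimod_filt_iff:
  "x \<in> TUf n \<longleftrightarrow> x \<in> carrier TU \<and> (\<forall>i>n. hU i x = 0)"
proof
  assume "x \<in> TUf n"
  then show "x \<in> carrier TU \<and> (\<forall>i>n. hU i x = 0)"
    by (auto simp: bimod_filt_def intro!: restr_supp_0)
next
  assume x: "x \<in> carrier TU \<and> (\<forall>i>n. hU i x = 0)"
  have "length (snd w) \<le> n" if "w \<in> Poly_Mapping.keys x" for w
  proof (rule ccontr)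
    assume "\<not> length (snd w) \<le> n"
    then have "hU (length (snd w)) x = 0" using x by auto
    then have "Poly_Mapping.lookup (hU (length (snd w)) x) w = 0" by simp
    then show False using that by (simp add: in_keys_iff)
  qed
  then show "x \<in> TUf n" using x by (auto simp: bimod_filt_def)
qed

lemma bimod_filt_exists: "x \<in> carrier TU \<Longrightarrow> \<exists>n. x \<in> TUf n"
  using finite_nat_set_iff_bounded_le[of "(length \<circ> snd) ` Poly_Mapping.keys x"]
  by (auto simp: bimod_filt_def)

lemma bimod_filt_carrier: "x \<in> TUf n \<Longrightarrow> x \<in> carrier TU"
  by (simp add: bimod_filt_def)

lemma subspace_bimod_filt: "pv.subspace (TUf n)"
  unfolding pv.subspace_def
  by (auto simp: bimod_filt_iff lin_map_add[OF lin_map_restr_supp] lin_map_pscale[OF lin_map_restr_supp]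
      lin_map_0[OF lin_map_restr_supp])

lemma hU_filt: "x \<in> carrier TU \<Longrightarrow> hU n x \<in> TUf n"
  by (auto simp: bimod_filt_iff)

lemma bimod_filt_mono: "x \<in> TUf n \<Longrightarrow> n \<le> m \<Longrightarrow> x \<in> TUf m"
  by (auto simp: bimod_filt_iff)

lemma bimod_filt_Suc: "x \<in> TUf (Suc n) \<Longrightarrow> hU (Suc n) x = 0 \<Longrightarrow> x \<in> TUf n"
  by (auto simp: bimod_filt_iff) (metis Suc_lessI)

lemma sum_hU: "x \<in> TUf n \<Longrightarrow> (\<Sum>i\<le>n. hU i x) = x"
  by (rule restr_supp_sum_layers) (auto simp: bimod_filt_def)

lemma filt_zero_hU: "x \<in> TUf 0 \<Longrightarrow> hU 0 x = x"
  using sum_hU[of x 0] by simp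

lemma hU_mult_right:
  assumes "hU m q = q"
  shows "hU n (p \<otimes>\<^bsub>TU\<^esub> q) = (if m \<le> n then hU (n - m) p \<otimes>\<^bsub>TU\<^esub> q else 0)"
proof -
  have k: "length (snd w) = m" if "w \<in> Poly_Mapping.keys q" for w
    using that keys_restr_supp[of "\<lambda>u. length (snd u) = m" q] assms by auto
  show ?thesis
    by (cases "m \<le> n"; rule lin_map_eqI[where Z = "{w. length (snd w) = m}" and p = q])
      (use k in \<open>auto intro!: lin_intros simp: hU_mult_bvec\<close>)
qed

lemma R_hT: "r \<in> R \<Longrightarrow> hT n r = (if n = 2 then r else 0)"
proof -
  assume "r \<in> R"
  then have r: "hT 2 r = r" using R_deg tensor_power_iff by blast
  have "hT n (hT 2 r) = (if n = 2 then hT n r else 0)" by (rule hT_hT)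
  then show ?thesis using r by auto
qed

lemma rel_lead: "r \<in> R \<Longrightarrow> \<beta> r \<in> carrier kG \<Longrightarrow> rel \<alpha> \<beta> r \<in> TUf 2 \<and> hU 2 (rel \<alpha> \<beta> r) = iT r"
  by (auto simp: bimod_filt_iff rel_def lin_map_diff[OF lin_map_restr_supp] hU_iT hU_iV hU_iG R_hT R_carrier
      lin_map_0[OF lin_map_iT])

lemma skew_lead:
  assumes "g \<in> carrier G" "c \<in> carrier kG"
  shows "trip g v \<one> - trip \<one> (act g v) g - iG c \<in> TUf 1
    \<and> hU 1 (trip g v \<one> - trip \<one> (act g v) g - iG c) = trip g v \<one> - trip \<one> (act g v) g"
  using assms by (auto simp: bimod_filt_iff lin_map_diff[OF lin_map_restr_supp] hU_trip hU_iG)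

end

section \<open>A faithful module over the deformed skew algebra\<close>

text \<open>By \<open>cond1\<close> the space \<open>T(V) \<otimes> kG\<close>, with basis the pairs of a word and a group element, is a left
  module over \<open>TU\<close> on which \<open>g v\<close> acts as \<open>\<^sup>gv g + \<lambda>(g \<otimes> v)\<close>.\<close>

type_synonym ('c, 'b, 'a) word_mod = "('b list \<times> 'a) \<Rightarrow>\<^sub>0 'c"

locale module_setup = quad_setup scale B G act R
  for scale :: "'k::field \<Rightarrow> 'v::ab_group_add \<Rightarrow> 'v" and B :: "'v set"
    and G :: "('g, 'z) monoid_scheme" (structure) and act :: "'g \<Rightarrow> 'v \<Rightarrow> 'v"
    and R :: "('v list \<Rightarrow>\<^sub>0 'k) set" +
  fixes lam :: "'g \<Rightarrow> 'v \<Rightarrow> ('g \<Rightarrow>\<^sub>0 'k)"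
  assumes lam: "is_lam scale G lam" and cond1: "cond1 G act lam"
begin

lemma lam_kG: "g \<in> carrier G \<Longrightarrow> lam g v \<in> carrier kG"
  and lam_add: "g \<in> carrier G \<Longrightarrow> lam g (v + w) = lam g v + lam g w"
  and lam_scale: "g \<in> carrier G \<Longrightarrow> lam g (scale c v) = pscale c (lam g v)"
  using lam by (auto simp: is_lam_def)

lemma lam_zero: "g \<in> carrier G \<Longrightarrow> lam g 0 = 0"
  using lam_scale[of g 0 0] by simp

lemma lam_sum: "g \<in> carrier G \<Longrightarrow> lam g (\<Sum>i\<in>I. f i) = (\<Sum>i\<in>I. lam g (f i))"
  by (induction I rule: infinite_finite_induct) (simp_all add: lam_add lam_zero)

lemma lam_mult:
  "g \<in> carrier G \<Longrightarrow> h \<in> carrier G \<Longrightarrow>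
    lam (g \<otimes> h) v = bvec g \<otimes>\<^bsub>kG\<^esub> lam h v + lam g (act h v) \<otimes>\<^bsub>kG\<^esub> bvec h"
  using cond1 by (auto simp: cond1_def algebra_simps)

text \<open>For g = h = 1 the identity \<open>lam_mult\<close> reads x = x + x.\<close>

lemma lam_one: "lam \<one> v = 0"
  using lam_mult[of \<one> \<one> v] lam_kG[of \<one> v] monoid_alg_one_left[of "lam \<one> v"] monoid_alg_one_right[of "lam \<one> v"]
  by simp

definition lmul_b :: "'v \<Rightarrow> ('k, 'v, 'g) word_mod \<Rightarrow> ('k, 'v, 'g) word_mod" where
  "lmul_b b = lin_ext (\<lambda>u. bvec (b # fst u, snd u))"

definition lmul_v :: "'v \<Rightarrow> ('k, 'v, 'g) word_mod \<Rightarrow> ('k, 'v, 'g) word_mod" where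
  "lmul_v v m = (\<Sum>b\<in>B. pscale (coord v b) (lmul_b b m))"

text \<open>Moving g past a letter b produces the letters of \<open>act g b\<close> followed by g,
  and in addition the group elements of \<lambda>(g \<otimes> b), which must themselves be moved
  past the rest of the word. Hence the recursion on the word with g varying.\<close>

primrec gact :: "'v list \<Rightarrow> 'g \<Rightarrow> 'g \<Rightarrow> ('k, 'v, 'g) word_mod" where
  "gact [] g h = bvec ([], g \<otimes> h)"
| "gact (b # w) g h = lmul_v (act g b) (gact w g h) + lin_ext (\<lambda>a. gact w a h) (lam g b)"

definition lmul_g :: "'g \<Rightarrow> ('k, 'v, 'g) word_mod \<Rightarrow> ('k, 'v, 'g) word_mod" where
  "lmul_g g = lin_ext (\<lambda>u. gact (fst u) g (snd u))"

definition lmul_kG :: "('g \<Rightarrow>\<^sub>0 'k) \<Rightarrow> ('k, 'v, 'g) word_mod \<Rightarrow> ('k, 'v, 'g) word_mod" where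
  "lmul_kG a m = lin_ext (\<lambda>g. lmul_g g m) a"

primrec lmul_word :: "('v \<times> 'g) list \<Rightarrow> 'g \<Rightarrow> ('k, 'v, 'g) word_mod \<Rightarrow> ('k, 'v, 'g) word_mod" where
  "lmul_word [] g m = lmul_g g m"
| "lmul_word (x # xs) g m = lmul_g g (lmul_b (fst x) (lmul_word xs (snd x) m))"

definition lmul :: "('g \<times> ('v \<times> 'g) list \<Rightarrow>\<^sub>0 'k) \<Rightarrow> ('k, 'v, 'g) word_mod \<Rightarrow> ('k, 'v, 'g) word_mod" where
  "lmul x m = lin_ext (\<lambda>u. lmul_word (snd u) (fst u) m) x"

definition MC :: "('k, 'v, 'g) word_mod set" where
  "MC = {m. Poly_Mapping.keys m \<subseteq> lists B \<times> carrier G}"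

definition Mfilt :: "nat \<Rightarrow> ('k, 'v, 'g) word_mod set" where
  "Mfilt n = {m. Poly_Mapping.keys m \<subseteq> {u \<in> lists B \<times> carrier G. length (fst u) \<le> n}}"

lemma lin_map_lmul_b: "lin_map (lmul_b b)" and lin_map_lmul_g: "lin_map (lmul_g g)"
  unfolding lmul_b_def lmul_g_def by (rule lin_map_lin_ext)+

lemma lin_map_lmul_comps [lin_intros]:
  "lin_map T \<Longrightarrow> lin_map (\<lambda>m. lmul_b b (T m))" "lin_map T \<Longrightarrow> lin_map (\<lambda>m. lmul_g g (T m))"
  by (rule lin_map_comp[OF lin_map_lmul_b] lin_map_comp[OF lin_map_lmul_g], assumption)+

lemma lin_map_lmul_v: "lin_map (lmul_v v)"
  unfolding lmul_v_def[abs_def] by (intro lin_intros)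

lemma lin_map_lin_ext_param: "(\<And>a. lin_map (f a)) \<Longrightarrow> lin_map (\<lambda>m. lin_ext (\<lambda>a. f a m) c)"
  by (rule lin_mapI) (simp_all add: lin_map_add lin_map_pscale lin_ext_fun_add lin_ext_fun_pscale)

lemma lin_map_lmul_kG: "lin_map (lmul_kG a)"
  unfolding lmul_kG_def[abs_def] by (rule lin_map_lin_ext_param) (rule lin_map_lmul_g)

lemma lin_map_lmul_word: "lin_map (lmul_word xs g)"
proof (induction xs arbitrary: g)
  case Nil
  have "lmul_word [] g = lmul_g g" by (rule ext) simp
  then show ?case by (simp add: lin_map_lmul_g)
next
  case (Cons x xs)
  have "lmul_word (x # xs) g = (\<lambda>m. lmul_g g (lmul_b (fst x) (lmul_word xs (snd x) m)))"
    by (rule ext) simp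
  then show ?case
    using lin_map_comp[OF lin_map_lmul_g lin_map_comp[OF lin_map_lmul_b Cons[of "snd x"]]] by simp
qed

lemma lin_map_lmul: "lin_map (lmul x)"
  unfolding lmul_def[abs_def] by (rule lin_map_lin_ext_param) (rule lin_map_lmul_word)

lemma lin_map_lmul_more [lin_intros]:
  "lin_map T \<Longrightarrow> lin_map (\<lambda>m. lmul_v v (T m))" "lin_map T \<Longrightarrow> lin_map (\<lambda>m. lmul_kG a (T m))"
  "lin_map T \<Longrightarrow> lin_map (\<lambda>m. lmul_word xs g (T m))" "lin_map T \<Longrightarrow> lin_map (\<lambda>m. lmul x (T m))"
  by (rule lin_map_comp[OF lin_map_lmul_v] lin_map_comp[OF lin_map_lmul_kG]
      lin_map_comp[OF lin_map_lmul_word] lin_map_comp[OF lin_map_lmul], assumption)+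

lemma lin_map_lmul_left: "lin_map (\<lambda>x. lmul x m)"
  unfolding lmul_def by (rule lin_map_lin_ext)

lemma lin_map_lmul_left_comp [lin_intros]: "lin_map T \<Longrightarrow> lin_map (\<lambda>x. lmul (T x) m)"
  by (rule lin_map_comp[OF lin_map_lmul_left])

lemma lmul_bvec: "lmul (bvec (g, xs)) m = lmul_word xs g m"
  by (simp add: lmul_def)

lemma lmul_b_bvec: "lmul_b b (bvec (w, h)) = bvec (b # w, h)"
  and lmul_g_bvec: "lmul_g g (bvec (w, h)) = gact w g h"
  by (simp_all add: lmul_b_def lmul_g_def)

lemma lmul_v_Basis: "b \<in> B \<Longrightarrow> lmul_v b m = lmul_b b m"
proof -
  assume b: "b \<in> B"
  have "lmul_v b m = (\<Sum>a\<in>B. if a = b then lmul_b b m else 0)"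
    unfolding lmul_v_def by (rule sum.cong) (auto simp: coord_Basis[OF b])
  then show ?thesis using b V.finite_Basis by simp
qed

lemma lmul_v_add: "lmul_v (v + w) m = lmul_v v m + lmul_v w m"
  and lmul_v_scale: "lmul_v (scale c v) m = pscale c (lmul_v v m)"
  by (simp_all add: lmul_v_def coord_add coord_scale pv.scale_left_distrib sum.distrib pv.scale_sum_right)

lemma lmul_v_sum: "lmul_v (\<Sum>i\<in>I. f i) m = (\<Sum>i\<in>I. lmul_v (f i) m)"
  by (induction I rule: infinite_finite_induct) (simp_all add: lmul_v_add, simp_all add: lmul_v_def)

lemma subspace_MC: "pv.subspace MC" and subspace_Mfilt: "pv.subspace (Mfilt n)"
  unfolding MC_def Mfilt_def by (rule subspace_keys)+

lemma Mfilt_MC: "m \<in> Mfilt n \<Longrightarrow> m \<in> MC"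
  and Mfilt_mono: "m \<in> Mfilt k \<Longrightarrow> k \<le> n \<Longrightarrow> m \<in> Mfilt n"
  by (auto simp: Mfilt_def MC_def)

lemma MC_Mfilt: "m \<in> MC \<Longrightarrow> \<exists>n. m \<in> Mfilt n"
proof -
  assume m: "m \<in> MC"
  obtain n where "\<forall>u\<in>Poly_Mapping.keys m. length (fst u) \<le> n"
    using finite_nat_set_iff_bounded_le[of "(length \<circ> fst) ` Poly_Mapping.keys m"] by auto
  then show ?thesis using m by (auto simp: Mfilt_def MC_def intro!: exI[of _ n])
qed

lemma bvec_Mfilt: "w \<in> lists B \<Longrightarrow> h \<in> carrier G \<Longrightarrow> length w \<le> n \<Longrightarrow> (bvec (w, h) :: ('k, 'v, 'g) word_mod) \<in> Mfilt n"
  and bvec_MC: "w \<in> lists B \<Longrightarrow> h \<in> carrier G \<Longrightarrow> (bvec (w, h) :: ('k, 'v, 'g) word_mod) \<in> MC"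
  by (auto simp: Mfilt_def MC_def)

lemma lin_map_Mfilt:
  assumes "lin_map T" "pv.subspace S" "m \<in> Mfilt n"
    "\<And>w h. w \<in> lists B \<Longrightarrow> h \<in> carrier G \<Longrightarrow> length w \<le> n \<Longrightarrow> T (bvec (w, h)) \<in> S"
  shows "T m \<in> S"
  unfolding lin_map_expand[OF assms(1), of m]
proof (rule lin_ext_in_subspace[OF assms(2)])
  fix u assume "u \<in> Poly_Mapping.keys m"
  then have "u \<in> {u \<in> lists B \<times> carrier G. length (fst u) \<le> n}" using assms(3) unfolding Mfilt_def by blast
  then show "T (bvec u) \<in> S" using assms(4)[of "fst u" "snd u"] by (cases u) auto
qed

lemma lin_map_MC_eqI:
  assumes "lin_map S" "lin_map T" "m \<in> MC"
    "\<And>w h. w \<in> lists B \<Longrightarrow> h \<in> carrier G \<Longrightarrow> S (bvec (w, h)) = T (bvec (w, h))"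
  shows "S m = T m"
  using assms by (intro lin_map_eqI[OF assms(1,2), of m "lists B \<times> carrier G"]) (auto simp: MC_def)

lemma lmul_b_Mfilt: "b \<in> B \<Longrightarrow> m \<in> Mfilt n \<Longrightarrow> lmul_b b m \<in> Mfilt (Suc n)"
  by (rule lin_map_Mfilt[OF lin_map_lmul_b subspace_Mfilt]) (auto simp: lmul_b_bvec intro!: bvec_Mfilt)

lemma lmul_v_Mfilt: "m \<in> Mfilt n \<Longrightarrow> lmul_v v m \<in> Mfilt (Suc n)"
  unfolding lmul_v_def by (intro pv.subspace_sum pv.subspace_scale subspace_Mfilt lmul_b_Mfilt)

lemma gact_Mfilt:
  "w \<in> lists B \<Longrightarrow> g \<in> carrier G \<Longrightarrow> h \<in> carrier G \<Longrightarrow> gact w g h \<in> Mfilt (length w)"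
proof (induction w arbitrary: g)
  case (Cons b w)
  have "lin_ext (\<lambda>a. gact w a h) (lam g b) \<in> Mfilt (length (b # w))"
  proof (rule lin_ext_in_subspace[OF subspace_Mfilt])
    fix a assume "a \<in> Poly_Mapping.keys (lam g b)"
    then have "a \<in> carrier G" using lam_kG[OF Cons.prems(2), of b] by (auto simp: carrier_monoid_alg)
    then have "gact w a h \<in> Mfilt (length w)" using Cons by auto
    then show "gact w a h \<in> Mfilt (length (b # w))" by (rule Mfilt_mono) simp
  qed
  moreover have "lmul_v (act g b) (gact w g h) \<in> Mfilt (length (b # w))"
    using Cons by (simp add: lmul_v_Mfilt)
  ultimately show ?case using pv.subspace_add[OF subspace_Mfilt] by simp
qed (auto intro!: bvec_Mfilt)

lemma lmul_g_Mfilt: "g \<in> carrier G \<Longrightarrow> m \<in> Mfilt n \<Longrightarrow> lmul_g g m \<in> Mfilt n"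
  by (rule lin_map_Mfilt[OF lin_map_lmul_g subspace_Mfilt])
    (auto simp: lmul_g_bvec intro: Mfilt_mono[OF gact_Mfilt])

lemma lmul_kG_Mfilt: "a \<in> carrier kG \<Longrightarrow> m \<in> Mfilt n \<Longrightarrow> lmul_kG a m \<in> Mfilt n"
  unfolding lmul_kG_def
  by (intro lin_ext_in_subspace subspace_Mfilt lmul_g_Mfilt) (auto simp: carrier_monoid_alg)

lemma lmul_word_Mfilt:
  "g \<in> carrier G \<Longrightarrow> xs \<in> lists (B \<times> carrier G) \<Longrightarrow> m \<in> Mfilt n \<Longrightarrow> lmul_word xs g m \<in> Mfilt (length xs + n)"
  by (induction xs arbitrary: g) (auto intro!: lmul_g_Mfilt lmul_b_Mfilt)

lemma lmul_MC:
  assumes x: "x \<in> carrier TU" and m: "m \<in> MC"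
  shows "lmul x m \<in> MC"
proof -
  obtain n where n: "m \<in> Mfilt n" using MC_Mfilt[OF m] by blast
  show ?thesis
    unfolding lmul_def
  proof (rule lin_ext_in_subspace[OF subspace_MC])
    fix u assume "u \<in> Poly_Mapping.keys x"
    then have "u \<in> carrier (bimod_words G B)" using x unfolding carrier_monoid_alg by blast
    then show "lmul_word (snd u) (fst u) m \<in> MC"
      using Mfilt_MC[OF lmul_word_Mfilt[OF _ _ n]] by (cases u) auto
  qed
qed

lemma MC_closed:
  assumes "m \<in> MC"
  shows "b \<in> B \<Longrightarrow> lmul_b b m \<in> MC" "lmul_v v m \<in> MC" "g \<in> carrier G \<Longrightarrow> lmul_g g m \<in> MC"
    "a \<in> carrier kG \<Longrightarrow> lmul_kG a m \<in> MC"
    "g \<in> carrier G \<Longrightarrow> xs \<in> lists (B \<times> carrier G) \<Longrightarrow> lmul_word xs g m \<in> MC"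
  using MC_Mfilt[OF assms]
  by (auto intro: Mfilt_MC lmul_b_Mfilt lmul_v_Mfilt lmul_g_Mfilt lmul_kG_Mfilt lmul_word_Mfilt)

subsection \<open>The module axioms\<close>

lemma lmul_g_lmul_b: "lmul_g g (lmul_b b m) = lmul_v (act g b) (lmul_g g m) + lmul_kG (lam g b) m"
proof (rule lin_map_eqI[where Z = UNIV and p = m])
  fix u :: "'v list \<times> 'g"
  show "lmul_g g (lmul_b b (bvec u)) = lmul_v (act g b) (lmul_g g (bvec u)) + lmul_kG (lam g b) (bvec u)"
    by (cases u) (simp add: lmul_b_bvec lmul_g_bvec lmul_kG_def)
qed (auto intro!: lin_intros)

lemma lmul_kG_add: "lmul_kG (a + c) m = lmul_kG a m + lmul_kG c m"
  and lmul_kG_pscale: "lmul_kG (pscale d a) m = pscale d (lmul_kG a m)"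
  and lmul_kG_zero: "lmul_kG 0 m = 0"
  by (simp_all add: lmul_kG_def lin_ext_add lin_ext_pscale)

lemma lmul_kG_sum: "lmul_kG (\<Sum>i\<in>I. a i) m = (\<Sum>i\<in>I. lmul_kG (a i) m)"
  by (induction I rule: infinite_finite_induct) (simp_all add: lmul_kG_add lmul_kG_zero)

lemma lmul_g_lmul_v:
  assumes g: "g \<in> carrier G"
  shows "lmul_g g (lmul_v v m) = lmul_v (act g v) (lmul_g g m) + lmul_kG (lam g v) m"
proof -
  have "lmul_g g (lmul_v v m) = (\<Sum>b\<in>B. pscale (coord v b) (lmul_v (act g b) (lmul_g g m) + lmul_kG (lam g b) m))"
    by (simp add: lmul_v_def[of v] lin_map_sum[OF lin_map_lmul_g] lin_map_pscale[OF lin_map_lmul_g] lmul_g_lmul_b)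
  also have "\<dots> = lmul_v (act g (\<Sum>b\<in>B. scale (coord v b) b)) (lmul_g g m)
      + lmul_kG (lam g (\<Sum>b\<in>B. scale (coord v b) b)) m"
    using g by (simp add: act_sum act_scale lmul_v_sum lmul_v_scale lam_sum lam_scale lmul_kG_sum lmul_kG_pscale
        pv.scale_right_distrib sum.distrib)
  finally show ?thesis by (simp add: sum_coord)
qed

text \<open>Moving h and then g past a letter leaves two \<lambda>-terms, moving g h leaves one;
  \<open>lam_mult\<close>, which is \<open>cond1\<close>, says that they agree. The induction is
  over the word with g and h arbitrary, as \<lambda> introduces new group elements.\<close>

lemma lmul_g_lmul_g:
  assumes "g \<in> carrier G" "h \<in> carrier G" "m \<in> MC"
  shows "lmul_g g (lmul_g h m) = lmul_g (g \<otimes> h) m"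
proof (rule lin_map_MC_eqI[OF _ _ assms(3)])
  fix w k assume "w \<in> lists B" and k: "k \<in> carrier G"
  then show "lmul_g g (lmul_g h (bvec (w, k))) = lmul_g (g \<otimes> h) (bvec (w, k))"
    using assms(1,2)
  proof (induction w arbitrary: g h)
    case Nil
    then show ?case by (simp add: lmul_g_bvec m_assoc)
  next
    case (Cons b w)
    then have IH: "lmul_g g (lmul_g h (bvec (w, k))) = lmul_g (g \<otimes> h) (bvec (w, k))"
      if "g \<in> carrier G" "h \<in> carrier G" for g h using that by auto
    have gh: "g \<in> carrier G" "h \<in> carrier G" using Cons.prems by auto
    have 1: "lmul_kG a (lmul_g h (bvec (w, k))) = lmul_kG (a \<otimes>\<^bsub>kG\<^esub> bvec h) (bvec (w, k))"
      if "a \<in> carrier kG" for a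
      unfolding lmul_kG_def
      by (rule lin_map_eqI[where Z = "carrier G" and p = a])
        (use that IH gh in \<open>auto intro!: lin_intros simp: carrier_monoid_alg\<close>)
    have 2: "lmul_g g (lmul_kG a (bvec (w, k))) = lmul_kG (bvec g \<otimes>\<^bsub>kG\<^esub> a) (bvec (w, k))"
      if "a \<in> carrier kG" for a
      unfolding lmul_kG_def
      by (rule lin_map_eqI[where Z = "carrier G" and p = a])
        (use that IH gh in \<open>auto intro!: lin_intros simp: carrier_monoid_alg\<close>)
    have "lmul_g g (lmul_g h (bvec (b # w, k))) = lmul_g g (lmul_g h (lmul_b b (bvec (w, k))))"
      by (simp add: lmul_b_bvec)
    also have "\<dots> = lmul_v (act (g \<otimes> h) b) (lmul_g (g \<otimes> h) (bvec (w, k)))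
       + lmul_kG (lam g (act h b)) (lmul_g h (bvec (w, k))) + lmul_g g (lmul_kG (lam h b) (bvec (w, k)))"
      using gh IH[OF gh] by (simp add: lmul_g_lmul_b lin_map_add[OF lin_map_lmul_g] lmul_g_lmul_v act_mult)
    also have "\<dots> = lmul_v (act (g \<otimes> h) b) (lmul_g (g \<otimes> h) (bvec (w, k))) + lmul_kG (lam (g \<otimes> h) b) (bvec (w, k))"
      using gh lam_kG by (simp add: 1 2 lam_mult lmul_kG_add add.commute)
    also have "\<dots> = lmul_g (g \<otimes> h) (bvec (b # w, k))"
      using lmul_g_lmul_b[of "g \<otimes> h" b "bvec (w, k)"] by (simp add: lmul_b_bvec)
    finally show ?case .
  qed
qed (auto intro!: lin_intros)

lemma lmul_g_one:
  assumes "m \<in> MC"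
  shows "lmul_g \<one> m = m"
proof (rule lin_map_MC_eqI[OF _ _ assms])
  fix w k assume "w \<in> lists B" and k: "k \<in> carrier G"
  then show "lmul_g \<one> (bvec (w, k)) = bvec (w, k)"
    by (induction w) (auto simp: lmul_g_bvec lam_one lmul_v_Basis lmul_b_bvec)
qed (auto intro!: lin_intros)

lemma lmul_word_left:
  "g \<in> carrier G \<Longrightarrow> h \<in> carrier G \<Longrightarrow> xs \<in> lists (B \<times> carrier G) \<Longrightarrow> m \<in> MC \<Longrightarrow>
    lmul_word xs (g \<otimes> h) m = lmul_g g (lmul_word xs h m)"
proof (cases xs)
  case (Cons x ys)
  assume "g \<in> carrier G" "h \<in> carrier G" "xs \<in> lists (B \<times> carrier G)" "m \<in> MC"
  then show ?thesis
    using Cons MC_closed(1)[OF MC_closed(5)[of m "snd x" ys], of "fst x"]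
    by (auto simp: lmul_g_lmul_g mem_Times_iff in_lists_conv_set)
qed (simp add: lmul_g_lmul_g)

lemma lmul_mult:
  assumes x: "x \<in> carrier TU" and y: "y \<in> carrier TU" and m: "m \<in> MC"
  shows "lmul (x \<otimes>\<^bsub>TU\<^esub> y) m = lmul x (lmul y m)"
proof (rule lin_map_eqI[where Z = "carrier (bimod_words G B)" and p = x])
  fix u assume u: "u \<in> carrier (bimod_words G B)"
  show "lmul (bvec u \<otimes>\<^bsub>TU\<^esub> y) m = lmul (bvec u) (lmul y m)"
  proof (rule lin_map_eqI[where Z = "carrier (bimod_words G B)" and p = y])
    fix w assume w: "w \<in> carrier (bimod_words G B)"
    obtain g xs where g: "u = (g, xs)" "g \<in> carrier G" "xs \<in> lists (B \<times> carrier G)" using u by auto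
    obtain h ys where h: "w = (h, ys)" "h \<in> carrier G" "ys \<in> lists (B \<times> carrier G)" using w by auto
    have "lmul (bvec ((g, xs) \<otimes>\<^bsub>bimod_words G B\<^esub> w)) m = lmul_word xs g (lmul (bvec w) m)"
      using g(2,3)
    proof (induction xs arbitrary: g)
      case Nil
      then show ?case using h m by (simp add: lmul_bvec lmul_word_left)
    next
      case (Cons x xs)
      obtain b a where x: "x = (b, a)" by (cases x)
      then have "a \<in> carrier G" "xs \<in> lists (B \<times> carrier G)" using Cons.prems by auto
      from Cons.IH[OF this] show ?case
        by (cases "(a, xs) \<otimes>\<^bsub>bimod_words G B\<^esub> w") (simp add: x bimod_words_mult_Cons lmul_bvec)
    qed
    then show "lmul (bvec u \<otimes>\<^bsub>TU\<^esub> bvec w) m = lmul (bvec u) (lmul (bvec w) m)"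
      by (simp add: g(1) lmul_bvec)
  qed (use y in \<open>auto intro!: lin_intros simp: carrier_monoid_alg\<close>)
qed (use x in \<open>auto intro!: lin_intros simp: carrier_monoid_alg\<close>)

lemma lmul_iG: "lmul (iG a) m = lmul_kG a m"
  by (simp add: kG_to_TU_eq lmul_def lmul_kG_def lin_map_lin_ext_commute[OF lin_map_lin_ext])

lemma lmul_trip: "lmul (trip g v h) m = lmul_g g (lmul_v v (lmul_g h m))"
  by (simp add: trip_expand lin_map_sum[OF lin_map_lmul_left] lin_map_pscale[OF lin_map_lmul_left] lmul_bvec
      lmul_v_def lin_map_sum[OF lin_map_lmul_g] lin_map_pscale[OF lin_map_lmul_g] del: pscale_single)

lemma lmul_trip_one: "m \<in> MC \<Longrightarrow> lmul (trip \<one> v \<one>) m = lmul_v v m"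
  by (simp add: lmul_trip lmul_g_one MC_closed)

text \<open>The annihilator of the module contains the deformed skew relations, so the congruences of the previous
  section hold for the operators.\<close>

definition ann :: "('g \<times> ('v \<times> 'g) list \<Rightarrow>\<^sub>0 'k) set" where
  "ann = {x \<in> carrier TU. \<forall>m\<in>MC. lmul x m = 0}"

lemma skew_in_ann: "skew_in ann lam"
  unfolding skew_in_def
proof (intro conjI ballI allI)
  show "ideal ann TU"
  proof (rule BM.ideal_monoid_algI)
    show "pv.subspace ann"
      using subspace_carrier_monoid_alg[of "bimod_words G B"]
      by (auto simp: ann_def pv.subspace_def lin_map_add[OF lin_map_lmul_left] lin_map_pscale[OF lin_map_lmul_left]
          lin_map_0[OF lin_map_lmul_left])
    show "ann \<subseteq> carrier TU" by (auto simp: ann_def)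
    fix w x assume w: "w \<in> carrier (bimod_words G B)" and x: "x \<in> ann"
    then have xc: "x \<in> carrier TU" by (simp add: ann_def)
    have bw: "bvec w \<in> carrier TU" using w by (rule single_in_carrier)
    show "bvec w \<otimes>\<^bsub>TU\<^esub> x \<in> ann"
      using x bw xc lmul_mult[OF bw xc] by (auto simp: ann_def BM.monoid_alg_closed lin_map_0[OF lin_map_lmul])
    show "x \<otimes>\<^bsub>TU\<^esub> bvec w \<in> ann"
      using x bw xc lmul_mult[OF xc bw] lmul_MC[OF bw] by (auto simp: ann_def BM.monoid_alg_closed)
  qed
  fix g v assume g: "g \<in> carrier G"
  show "lam g v \<in> carrier kG" by (rule lam_kG[OF g])
  show "trip g v \<one> - trip \<one> (act g v) g - iG (lam g v) \<in> ann"
    using g lam_kG[OF g]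
    by (auto simp: ann_def lin_map_diff[OF lin_map_lmul_left] lmul_trip lmul_iG lmul_g_one lmul_g_lmul_v MC_closed lam_one lmul_kG_zero)
qed

lemma ann_cong: "cong_mod ann x y \<Longrightarrow> m \<in> MC \<Longrightarrow> lmul x m = lmul y m"
  by (simp add: cong_mod_def ann_def lin_map_diff[OF lin_map_lmul_left])

subsection \<open>Right multiplication\<close>

definition lmul_w :: "'v list \<Rightarrow> ('k, 'v, 'g) word_mod \<Rightarrow> ('k, 'v, 'g) word_mod" where
  "lmul_w w m = foldr lmul_b w m"

lemma lmul_w_simps [simp]: "lmul_w [] m = m" "lmul_w (b # w) m = lmul_b b (lmul_w w m)"
  by (simp_all add: lmul_w_def)

lemma lin_map_lmul_w: "lin_map (lmul_w w)"
  by (induction w) (auto simp: lin_map_def lin_map_add[OF lin_map_lmul_b] lin_map_pscale[OF lin_map_lmul_b])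

lemma lin_map_lmul_w_comp [lin_intros]: "lin_map T \<Longrightarrow> lin_map (\<lambda>m. lmul_w w (T m))"
  by (rule lin_map_comp[OF lin_map_lmul_w])

lemma lmul_w_bvec: "lmul_w u (bvec (w, h)) = bvec (u @ w, h)"
  by (induction u) (auto simp: lmul_b_bvec)

lemma lmul_w_Mfilt: "u \<in> lists B \<Longrightarrow> m \<in> Mfilt n \<Longrightarrow> lmul_w u m \<in> Mfilt (length u + n)"
  by (induction u) (auto intro: lmul_b_Mfilt)

lemma lmul_iT_bvec: "w \<in> lists B \<Longrightarrow> m \<in> MC \<Longrightarrow> lmul (iT (bvec w)) m = lmul_w w m"
proof (induction w)
  case Nil
  then show ?case by (simp add: iT_one lmul_bvec lmul_g_one)
next
  case (Cons b w)
  have "iT (bvec (b # w)) = iT (bvec [b] \<otimes>\<^bsub>TV\<^esub> bvec w)" by simp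
  also have "\<dots> = trip \<one> b \<one> \<otimes>\<^bsub>TU\<^esub> iT (bvec w)"
    unfolding iT_mult using Cons.prems(1) by (simp add: iT_bvec trip_Basis)
  finally show ?case
    using Cons lmul_MC[of "iT (bvec w)" m] by (simp add: lmul_mult lmul_trip_one lmul_v_Basis)
qed

definition rmul_g :: "'g \<Rightarrow> ('k, 'v, 'g) word_mod \<Rightarrow> ('k, 'v, 'g) word_mod" where
  "rmul_g g = lin_ext (\<lambda>u. bvec (fst u, snd u \<otimes> g))"

text \<open>The product (w h) b is computed as w (h b), the left action supplying the normal form of
  h b.\<close>

definition rmul_b :: "'v \<Rightarrow> ('k, 'v, 'g) word_mod \<Rightarrow> ('k, 'v, 'g) word_mod" where
  "rmul_b b = lin_ext (\<lambda>u. lmul_w (fst u) (lmul_g (snd u) (bvec ([b], \<one>))))"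

lemma lin_map_rmul_g: "lin_map (rmul_g g)" and lin_map_rmul_b: "lin_map (rmul_b b)"
  unfolding rmul_g_def rmul_b_def by (rule lin_map_lin_ext)+

lemma lin_map_rmul_comps [lin_intros]:
  "lin_map T \<Longrightarrow> lin_map (\<lambda>m. rmul_g g (T m))" "lin_map T \<Longrightarrow> lin_map (\<lambda>m. rmul_b b (T m))"
  by (rule lin_map_comp[OF lin_map_rmul_g] lin_map_comp[OF lin_map_rmul_b], assumption)+

lemma rmul_g_bvec: "rmul_g g (bvec (w, h)) = bvec (w, h \<otimes> g)"
  and rmul_b_bvec: "rmul_b b (bvec (w, h)) = lmul_w w (lmul_g h (bvec ([b], \<one>)))"
  by (simp_all add: rmul_g_def rmul_b_def)

lemma rmul_lmul_b: "rmul_g g (lmul_b b m) = lmul_b b (rmul_g g m)" "rmul_b a (lmul_b b m) = lmul_b b (rmul_b a m)"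
proof -
  show "rmul_g g (lmul_b b m) = lmul_b b (rmul_g g m)"
    by (rule lin_map_eqI[where Z = UNIV and p = m]) (auto intro!: lin_intros simp: lmul_b_bvec rmul_g_bvec)
  show "rmul_b a (lmul_b b m) = lmul_b b (rmul_b a m)"
    by (rule lin_map_eqI[where Z = UNIV and p = m]) (auto intro!: lin_intros simp: lmul_b_bvec rmul_b_bvec)
qed

text \<open>The left action of g on a word is built from letters and from group elements acting on
  shorter words, so it is enough to check commutation on the empty word.\<close>

lemma commute_lmul_g:
  assumes T: "lin_map T" and Tb: "\<And>b m. T (lmul_b b m) = lmul_b b (T m)"
    and T0: "\<And>g h. g \<in> carrier G \<Longrightarrow> h \<in> carrier G \<Longrightarrow> T (lmul_g g (bvec ([], h))) = lmul_g g (T (bvec ([], h)))"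
    and g: "g \<in> carrier G" and m: "m \<in> MC"
  shows "T (lmul_g g m) = lmul_g g (T m)"
proof (rule lin_map_MC_eqI[OF _ _ m])
  have Tv: "T (lmul_v v m) = lmul_v v (T m)" for v m
    by (simp add: lmul_v_def lin_map_sum[OF T] lin_map_pscale[OF T] Tb)
  fix w k assume "w \<in> lists B" and k: "k \<in> carrier G"
  then show "T (lmul_g g (bvec (w, k))) = lmul_g g (T (bvec (w, k)))"
    using g
  proof (induction w arbitrary: g)
    case Nil
    then show ?case using T0 by simp
  next
    case (Cons b w)
    then have IH: "T (lmul_g g (bvec (w, k))) = lmul_g g (T (bvec (w, k)))" if "g \<in> carrier G" for g
      using that by auto
    have kG: "T (lmul_kG a (bvec (w, k))) = lmul_kG a (T (bvec (w, k)))" if "a \<in> carrier kG" for a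
      unfolding lmul_kG_def lin_map_lin_ext_commute[OF T]
      using that by (intro lin_ext_cong IH) (auto simp: carrier_monoid_alg)
    have "T (lmul_g g (lmul_b b (bvec (w, k)))) = lmul_g g (lmul_b b (T (bvec (w, k))))"
      unfolding lmul_g_lmul_b lin_map_add[OF T] Tv using Cons.prems by (simp add: IH kG lam_kG)
    then show ?case unfolding Tb[symmetric] by (simp add: lmul_b_bvec)
  qed
qed (use T in \<open>auto intro!: lin_intros lin_map_comp[OF T]\<close>)

lemma commute_lmul:
  assumes T: "lin_map T" and Tb: "\<And>b m. T (lmul_b b m) = lmul_b b (T m)"
    and Tg: "\<And>g m. g \<in> carrier G \<Longrightarrow> m \<in> MC \<Longrightarrow> T (lmul_g g m) = lmul_g g (T m)"
    and x: "x \<in> carrier TU" and m: "m \<in> MC"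
  shows "T (lmul x m) = lmul x (T m)"
proof -
  have "T (lmul_word xs g m) = lmul_word xs g (T m)" if "g \<in> carrier G" "xs \<in> lists (B \<times> carrier G)" for g xs
    using that
  proof (induction xs arbitrary: g)
    case (Cons y ys)
    then have y: "fst y \<in> B" "snd y \<in> carrier G" "ys \<in> lists (B \<times> carrier G)" by (auto simp: mem_Times_iff)
    have "lmul_b (fst y) (lmul_word ys (snd y) m) \<in> MC"
      using y m by (intro MC_closed)
    then show ?case using Cons.IH[OF y(2,3)] Cons.prems(1) by (simp add: Tg Tb)
  qed (simp add: Tg m)
  then show ?thesis
    unfolding lmul_def lin_map_lin_ext_commute[OF T] using x
    by (intro lin_ext_cong) (auto simp: carrier_monoid_alg subset_iff in_lists_conv_set)
qed

lemma rmul_g_lmul: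
  assumes k: "k \<in> carrier G" and x: "x \<in> carrier TU" and m: "m \<in> MC"
  shows "rmul_g k (lmul x m) = lmul x (rmul_g k m)"
proof (rule commute_lmul[OF lin_map_rmul_g rmul_lmul_b(1) _ x m])
  fix g m assume "g \<in> carrier G" "m \<in> MC"
  then show "rmul_g k (lmul_g g m) = lmul_g g (rmul_g k m)"
    by (rule commute_lmul_g[OF lin_map_rmul_g rmul_lmul_b(1), rotated])
      (simp add: k lmul_g_bvec rmul_g_bvec m_assoc)
qed

text \<open>This is the bimodule law that allows a letter to be appended after a relation has been
  applied. On the empty word both sides carry g h past b, which agrees by
  \<open>lmul_g_lmul_g\<close>.\<close>

lemma rmul_b_lmul:
  assumes b: "b \<in> B" and x: "x \<in> carrier TU" and m: "m \<in> MC"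
  shows "rmul_b b (lmul x m) = lmul x (rmul_b b m)"
proof (rule commute_lmul[OF lin_map_rmul_b rmul_lmul_b(2) _ x m])
  fix g m assume g: "g \<in> carrier G" and m: "m \<in> MC"
  show "rmul_b b (lmul_g g m) = lmul_g g (rmul_b b m)"
  proof (rule commute_lmul_g[OF lin_map_rmul_b rmul_lmul_b(2) _ g m])
    fix g h assume gh: "g \<in> carrier G" "h \<in> carrier G"
    have "(bvec ([b], \<one>) :: ('k, 'v, 'g) word_mod) \<in> MC" using b by (auto intro: bvec_MC)
    then show "rmul_b b (lmul_g g (bvec ([], h))) = lmul_g g (rmul_b b (bvec ([], h)))"
      using gh by (simp add: lmul_g_bvec[of g "[]"] rmul_b_bvec lmul_g_lmul_g)
  qed
qed

lemma rmul_lmul_w: "rmul_g g (lmul_w w m) = lmul_w w (rmul_g g m)" "rmul_b a (lmul_w w m) = lmul_w w (rmul_b a m)"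
  by (induction w) (simp_all add: rmul_lmul_b)

lemma rmul_b_Mfilt:
  assumes b: "b \<in> B" and m: "m \<in> Mfilt n"
  shows "rmul_b b m \<in> Mfilt (Suc n)"
proof (rule lin_map_Mfilt[OF lin_map_rmul_b subspace_Mfilt m])
  fix w h assume w: "w \<in> lists B" "h \<in> carrier G" "length w \<le> n"
  have "lmul_g h (bvec ([b], \<one>)) \<in> Mfilt 1"
    using w b by (intro lmul_g_Mfilt bvec_Mfilt) auto
  then have "lmul_w w (lmul_g h (bvec ([b], \<one>))) \<in> Mfilt (length w + 1)"
    using w by (intro lmul_w_Mfilt)
  then show "rmul_b b (bvec (w, h)) \<in> Mfilt (Suc n)"
    unfolding rmul_b_bvec by (rule Mfilt_mono) (use w in auto)
qed

subsection \<open>Leading terms\<close>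

text \<open>The degree n part of the coefficient at g; for members of \<open>Mfilt n\<close> this is
  the leading term.\<close>

definition lead :: "nat \<Rightarrow> 'g \<Rightarrow> ('k, 'v, 'g) word_mod \<Rightarrow> ('v list \<Rightarrow>\<^sub>0 'k)" where
  "lead n g = lin_ext (\<lambda>u. if snd u = g \<and> length (fst u) = n then bvec (fst u) else 0)"

lemma lin_map_lead: "lin_map (lead n g)"
  unfolding lead_def by (rule lin_map_lin_ext)

lemma lin_map_lead_comp [lin_intros]: "lin_map T \<Longrightarrow> lin_map (\<lambda>m. lead n g (T m))"
  by (rule lin_map_comp[OF lin_map_lead])

lemma lead_bvec: "lead n g (bvec (w, h)) = (if h = g \<and> length w = n then bvec w else 0)"
  by (simp add: lead_def)

lemma lead_high: "m \<in> Mfilt k \<Longrightarrow> k < n \<Longrightarrow> lead n g m = 0"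
  using lin_map_Mfilt[OF lin_map_lead pv.subspace_single_0, of m k n g] by (auto simp: lead_bvec)

lemma lead_lmul_b: "b \<in> B \<Longrightarrow> lead (Suc n) g (lmul_b b m) = vT b \<otimes>\<^bsub>TV\<^esub> lead n g m"
  by (rule lin_map_eqI[where Z = UNIV and p = m]) (auto intro!: lin_intros simp: lmul_b_bvec lead_bvec vT_Basis)

lemma lead_lmul_v: "lead (Suc n) g (lmul_v v m) = vT v \<otimes>\<^bsub>TV\<^esub> lead n g m"
proof -
  have "lead (Suc n) g (lmul_v v m) = (\<Sum>b\<in>B. pscale (coord v b) (vT b \<otimes>\<^bsub>TV\<^esub> lead n g m))"
    by (simp add: lmul_v_def lin_map_sum[OF lin_map_lead] lin_map_pscale[OF lin_map_lead] lead_lmul_b)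
  also have "\<dots> = vT (\<Sum>b\<in>B. scale (coord v b) b) \<otimes>\<^bsub>TV\<^esub> lead n g m"
    by (simp add: vT_sum vT_scale mult_sums mult_pscales)
  finally show ?thesis by (simp add: sum_coord)
qed

lemma lead_lmul_w: "w \<in> lists B \<Longrightarrow> lead (length w + n) g (lmul_w w m) = bvec w \<otimes>\<^bsub>TV\<^esub> lead n g m"
  by (rule lin_map_eqI[where Z = UNIV and p = m]) (auto intro!: lin_intros simp: lmul_w_bvec lead_bvec)

text \<open>Every \<lambda>-term shortens the word, so in top degree the deformed action shows the
  undeformed normal form.\<close>

lemma lead_lmul_word:
  assumes "g \<in> carrier G" "xs \<in> lists (B \<times> carrier G)" 
  shows "lead (length xs) h (lmul_word xs g (bvec ([], \<one>))) = (if word_grp g xs = h then word_tens g xs else 0)"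
  using assms
proof (induction xs arbitrary: g)
  case Nil
  then show ?case by (simp add: lmul_g_bvec lead_bvec)
next
  case (Cons x xs)
  then have x: "fst x \<in> B" "snd x \<in> carrier G" "xs \<in> lists (B \<times> carrier G)" by (auto simp: mem_Times_iff)
  have e: "(bvec ([], \<one>) :: ('k, 'v, 'g) word_mod) \<in> Mfilt 0" by (rule bvec_Mfilt) auto
  have "lmul_word xs (snd x) (bvec ([], \<one>)) \<in> Mfilt (length xs + 0)"
    using x e by (intro lmul_word_Mfilt)
  then have "lead (Suc (length xs)) h (lmul_kG (lam g (fst x)) (lmul_word xs (snd x) (bvec ([], \<one>)))) = 0"
    using Cons.prems(1) by (intro lead_high[OF lmul_kG_Mfilt[OF lam_kG]]) auto
  then have "lead (length (x # xs)) h (lmul_word (x # xs) g (bvec ([], \<one>)))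
    = vT (act g (fst x)) \<otimes>\<^bsub>TV\<^esub> lead (length xs) h (lmul_word xs (g \<otimes> snd x) (bvec ([], \<one>)))"
    using Cons.prems(1) x Mfilt_MC[OF e]
    by (simp add: lmul_g_lmul_b lin_map_add[OF lin_map_lead] lead_lmul_v lmul_word_left)
  then show ?case using Cons.IH[of "g \<otimes> snd x"] Cons.prems(1) x by simp
qed

text \<open>Acting on the generator of the module translates leading forms in T into leading terms
  in the module, which is how statements on the module return to the ideal.\<close>

lemma lmul_one_lead:
  assumes x: "x \<in> bimod_filt G B n"
  shows "lmul x (bvec ([], \<one>)) \<in> Mfilt n" "lead n h (lmul x (bvec ([], \<one>))) = nform h (hU n x)"
proof -
  have e: "(bvec ([], \<one>) :: ('k, 'v, 'g) word_mod) \<in> Mfilt 0" by (rule bvec_Mfilt) auto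
  have keys: "g \<in> carrier G \<and> xs \<in> lists (B \<times> carrier G) \<and> length xs \<le> n" if "(g, xs) \<in> Poly_Mapping.keys x" for g xs
    using x that by (auto simp: bimod_filt_def carrier_monoid_alg)
  have word: "lmul_word xs g (bvec ([], \<one>)) \<in> Mfilt (length xs)" if "(g, xs) \<in> Poly_Mapping.keys x" for g xs
    using keys[OF that] lmul_word_Mfilt[OF _ _ e, of g xs] by simp
  show "lmul x (bvec ([], \<one>)) \<in> Mfilt n"
    unfolding lmul_def using word keys
    by (intro lin_ext_in_subspace subspace_Mfilt) (auto intro: Mfilt_mono[OF word])
  show "lead n h (lmul x (bvec ([], \<one>))) = nform h (hU n x)"
  proof (rule lin_map_eqI[where Z = "Poly_Mapping.keys x" and p = x])
    fix u assume u: "u \<in> Poly_Mapping.keys x"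
    obtain g xs where u': "u = (g, xs)" by (cases u)
    show "lead n h (lmul (bvec u) (bvec ([], \<one>))) = nform h (hU n (bvec u))"
    proof (cases "length xs = n")
      case True
      then show ?thesis using lead_lmul_word[of g xs h] keys[of g xs] u u' by (simp add: lmul_bvec nform_bvec)
    next
      case False
      then have "lead n h (lmul_word xs g (bvec ([], \<one>))) = 0"
        using keys[of g xs] word[of g xs] u u' by (intro lead_high) auto
      then show ?thesis using False by (simp add: u' lmul_bvec lin_map_0[OF lin_map_nform])
    qed
  qed (auto intro!: lin_intros)
qed

text \<open>Moving the final group element past b gives its image of b in top degree and a
  \<lambda>-term of lower degree. Words shorter than n stay below the degree that is looked
  at.\<close>

lemma lead_rmul_b:
  assumes b: "b \<in> B" and g: "g \<in> carrier G" and m: "m \<in> Mfilt n"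
  shows "lead (Suc n) g (rmul_b b m) = lead n g m \<otimes>\<^bsub>TV\<^esub> vT (act g b)"
proof -
  let ?T = "\<lambda>m. lead (Suc n) g (rmul_b b m) - lead n g m \<otimes>\<^bsub>TV\<^esub> vT (act g b)"
  have "?T m \<in> {0}"
  proof (rule lin_map_Mfilt[OF _ pv.subspace_single_0 m])
    show "lin_map ?T" by (intro lin_intros)
    fix w h assume w: "w \<in> lists B" "h \<in> carrier G" "length w \<le> n"
    have e: "(bvec ([], h) :: ('k, 'v, 'g) word_mod) \<in> Mfilt 0" "(bvec ([], \<one>) :: ('k, 'v, 'g) word_mod) \<in> Mfilt 0"
      using w by (auto intro: bvec_Mfilt)
    have c: "lmul_kG (lam h b) (bvec ([], \<one>)) \<in> Mfilt 0" using w e by (intro lmul_kG_Mfilt lam_kG)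
    have "bvec ([b], \<one>) = lmul_b b (bvec ([], \<one>))" by (simp add: lmul_b_bvec)
    then have h: "lmul_g h (bvec ([b], \<one>)) = lmul_v (act h b) (bvec ([], h)) + lmul_kG (lam h b) (bvec ([], \<one>))"
      using w by (simp add: lmul_g_lmul_b lmul_g_bvec)
    show "?T (bvec (w, h)) \<in> {0}"
    proof (cases "length w = n")
      case True
      have "lead (Suc n) g (rmul_b b (bvec (w, h))) = bvec w \<otimes>\<^bsub>TV\<^esub> lead 1 g (lmul_g h (bvec ([b], \<one>)))"
        using True w lead_lmul_w[of w 1 g] by (simp add: rmul_b_bvec)
      also have "lead 1 g (lmul_g h (bvec ([b], \<one>))) = vT (act h b) \<otimes>\<^bsub>TV\<^esub> lead 0 g (bvec ([], h))"
        using lead_high[OF c, of 1 g] by (simp add: h lin_map_add[OF lin_map_lead] lead_lmul_v)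
      finally show ?thesis
        using True by (auto simp: lead_bvec FM.monoid_alg_one_right[simplified])
    next
      case False
      have "lmul_w w (lmul_g h (bvec ([b], \<one>))) \<in> Mfilt (length w + 1)"
        using w b by (intro lmul_w_Mfilt lmul_g_Mfilt bvec_Mfilt) auto
      then show ?thesis
        using False w lead_high[of "lmul_w w (lmul_g h (bvec ([b], \<one>)))" "length w + 1" "Suc n" g]
        by (simp add: rmul_b_bvec lead_bvec)
    qed
  qed
  then show ?thesis by simp
qed

lemma lead_rmul_g:
  assumes "k \<in> carrier G" "g \<in> carrier G" "m \<in> MC"
  shows "lead n g (rmul_g k m) = lead n (g \<otimes> inv k) m"
proof (rule lin_map_MC_eqI[OF _ _ assms(3)])
  fix w h assume "w \<in> lists B" "h \<in> carrier G"
  then show "lead n g (rmul_g k (bvec (w, h))) = lead n (g \<otimes> inv k) (bvec (w, h))"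
    using assms(1,2) inv_solve_right[of g h k] by (auto simp: rmul_g_bvec lead_bvec m_assoc)
qed (auto intro!: lin_intros)

end

section \<open>The PBW theorem\<close>

locale pbw_setup = module_setup scale B G act R lam
  for scale :: "'k::field \<Rightarrow> 'v::ab_group_add \<Rightarrow> 'v" and B :: "'v set"
    and G :: "('g, 'z) monoid_scheme" (structure) and act :: "'g \<Rightarrow> 'v \<Rightarrow> 'v"
    and R :: "('v list \<Rightarrow>\<^sub>0 'k) set" and lam :: "'g \<Rightarrow> 'v \<Rightarrow> ('g \<Rightarrow>\<^sub>0 'k)" +
  fixes \<alpha> :: "('v list \<Rightarrow>\<^sub>0 'k) \<Rightarrow> 'g \<Rightarrow> 'v" and \<beta> :: "('v list \<Rightarrow>\<^sub>0 'k) \<Rightarrow> ('g \<Rightarrow>\<^sub>0 'k)"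
  assumes \<alpha>: "is_alpha scale B G R \<alpha>" and \<beta>: "is_beta B G R \<beta>"
    and cond2: "cond2 scale B G act R \<alpha> \<beta> lam"
    and cond3: "cond3 scale B G act R \<alpha> lam"
    and cond4: "cond4 scale B G act R \<alpha> \<beta> lam"
    and cond5: "cond5 scale B G act R \<alpha> \<beta> lam"
    and cond6: "cond6 scale B G act R \<alpha>"
    and koszul: "koszul (quad_alg B R) (quad_comp B R)"
begin

abbreviation "rl \<equiv> rel \<alpha> \<beta>"
abbreviation "low r \<equiv> iV (\<alpha> r) + iG (\<beta> r)"
abbreviation (input) e0 :: "('k, 'v, 'g) word_mod" where "e0 \<equiv> bvec ([], \<one>)"

lemma beta_kG: "r \<in> R \<Longrightarrow> \<beta> r \<in> carrier kG"
  using \<beta> by (auto simp: is_beta_def)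

lemma rel_carrier: "r \<in> R \<Longrightarrow> rl r \<in> carrier TU" and low_carrier: "r \<in> R \<Longrightarrow> low r \<in> carrier TU"
  by (auto simp: rel_def R_carrier beta_kG)

lemma iT_eq_rel_low: "iT r = rl r + low r"
  by (simp add: rel_def)

lemma rel_add: "r \<in> R \<Longrightarrow> s \<in> R \<Longrightarrow> rl (r + s) = rl r + rl s"
proof -
  assume rs: "r \<in> R" "s \<in> R"
  have "iV (\<alpha> (r + s)) = iV (\<lambda>a. \<alpha> r a + \<alpha> s a)"
    using \<alpha> rs by (intro iV_cong) (auto simp: is_alpha_def)
  moreover have "\<beta> (r + s) = \<beta> r + \<beta> s" using \<beta> rs by (auto simp: is_beta_def)
  ultimately show ?thesis
    by (simp add: rel_def iV_add lin_map_add[OF lin_map_iT] lin_map_add[OF lin_map_iG])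
qed

lemma rel_pscale: "r \<in> R \<Longrightarrow> rl (pscale c r) = pscale c (rl r)"
proof -
  assume r: "r \<in> R"
  have "iV (\<alpha> (pscale c r)) = iV (\<lambda>a. scale c (\<alpha> r a))"
    using \<alpha> r by (intro iV_cong) (auto simp: is_alpha_def)
  moreover have "\<beta> (pscale c r) = pscale c (\<beta> r)" using \<beta> r by (auto simp: is_beta_def)
  ultimately show ?thesis
    by (simp add: rel_def iV_scale lin_map_pscale[OF lin_map_iT] lin_map_pscale[OF lin_map_iG]
        pv.scale_right_diff_distrib)
qed

lemma rel_zero: "rl 0 = 0"
  using rel_pscale[OF pv.subspace_0[OF R_subspace], of 0] by simp

lemma rel_sum: "(\<And>i. i \<in> I \<Longrightarrow> f i \<in> R) \<Longrightarrow> rl (\<Sum>i\<in>I. f i) = (\<Sum>i\<in>I. rl (f i))"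
  by (induction I rule: infinite_finite_induct)
    (simp_all add: rel_zero rel_add pv.subspace_sum[OF R_subspace])

text \<open>The second and third conditions are stated for sums of elementary tensors, so every
  relation must be written as one.\<close>

lemma R_tens2:
  assumes "r \<in> R"
  obtains n v w where "r = tens2 scale B n v w"
proof -
  have "r \<in> tensor_power B (Suc 1)" using assms R_deg by (auto simp: numeral_2_eq_2)
  then obtain f where f: "\<And>b. b \<in> B \<Longrightarrow> f b \<in> tensor_power B 1" "r = (\<Sum>b\<in>B. f b \<otimes>\<^bsub>TV\<^esub> vT b)"
    by (rule tensor_power_last) auto
  have "\<forall>b. \<exists>x. b \<in> B \<longrightarrow> vT x = f b" using f(1) vT_surj by metis
  then obtain x where x: "\<And>b. b \<in> B \<Longrightarrow> vT (x b) = f b" by metis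
  obtain h where h: "bij_betw h {0..<card B} B" using ex_bij_betw_nat_finite[OF V.finite_Basis] by blast
  have "tens2 scale B (card B) (\<lambda>i. x (h i)) h = (\<Sum>i\<in>{0..<card B}. f (h i) \<otimes>\<^bsub>TV\<^esub> vT (h i))"
    unfolding tens2_def using bij_betwE[OF h] by (intro sum.cong) (auto simp: x)
  also have "\<dots> = r" unfolding f(2) by (rule sum.reindex_bij_betw[OF h])
  finally show ?thesis using that by metis
qed

lemma R_aT: "g \<in> carrier G \<Longrightarrow> r \<in> R \<Longrightarrow> aT g r \<in> R"
  using R_act by blast

text \<open>The remainder in \<open>rel_group\<close>, taken modulo the annihilator, vanishes by
  \<open>cond2\<close> and \<open>cond3\<close>.\<close>

lemma lmul_g_rel:
  assumes g: "g \<in> carrier G" and r: "r \<in> R" and m: "m \<in> MC"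
  shows "lmul_g g (lmul (rl r) m) = lmul (rl (aT g r)) (lmul_g g m)"
proof -
  obtain n v w where t: "r = tens2 scale B n v w" using R_tens2[OF r] .
  have "iV (coeff3 \<alpha> lam g n v w) = iV (\<lambda>a. 0)"
    using cond3[unfolded cond3_coeff[OF \<alpha> \<beta> lam]] g r t by (intro iV_cong) auto
  moreover have "(\<Sum>a\<in>carrier G. lam g (\<alpha> r a) \<otimes>\<^bsub>kG\<^esub> bvec a) - (\<Sum>i<n. lam_ext G lam (lam g (v i)) (w i))
      + bvec g \<otimes>\<^bsub>kG\<^esub> \<beta> r - \<beta> (aT g r) \<otimes>\<^bsub>kG\<^esub> bvec g = 0"
    using cond2 g r t by (auto simp: cond2_def Let_def algebra_simps)
  ultimately have "cong_mod ann (bvec (g, []) \<otimes>\<^bsub>TU\<^esub> rl r) (rl (aT g r) \<otimes>\<^bsub>TU\<^esub> bvec (g, []))"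
    using rel_group[OF \<alpha> \<beta> lam skew_in_ann g t] by (simp add: lin_map_0[OF lin_map_iG])
  then have "lmul (bvec (g, []) \<otimes>\<^bsub>TU\<^esub> rl r) m = lmul (rl (aT g r) \<otimes>\<^bsub>TU\<^esub> bvec (g, [])) m"
    using m by (rule ann_cong)
  then show ?thesis
    using g r m rel_carrier[OF r] rel_carrier[OF R_aT[OF g r]] by (simp add: lmul_mult lmul_bvec)
qed

text \<open>\<open>cond6\<close> puts \<open>alpha_diff\<close> into R, while \<open>cond4\<close>
  and \<open>cond5\<close> remove the remainder in \<open>rel_overlap\<close>. Relations behind a
  letter are thereby traded for relations in front of a letter and relations of lower
  degree.\<close>

lemma lmul_rel_overlap:
  assumes o: "overlap scale B R n r v p u s" and m: "m \<in> MC"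
  shows "(\<Sum>j<p. lmul_v (u j) (lmul (rl (s j)) m)) = (\<Sum>i<n. lmul (rl (r i)) (lmul_v (v i) m))
    + (\<Sum>h\<in>carrier G. lmul (rl (alpha_diff scale B act \<alpha> n r v p u s h)) (lmul_g h m))"
    and "\<And>h. h \<in> carrier G \<Longrightarrow> alpha_diff scale B act \<alpha> n r v p u s h \<in> R"
proof -
  let ?d = "alpha_diff scale B act \<alpha> n r v p u s"
  show d: "\<And>h. h \<in> carrier G \<Longrightarrow> ?d h \<in> R"
    using cond6[unfolded cond6_coeff[OF \<alpha> \<beta> lam]] o by blast
  have "iV (coeff4 \<alpha> \<beta> lam n r v p u s) = iV (\<lambda>a. 0)"
    using cond4[unfolded cond4_coeff[OF \<alpha> \<beta> lam]] o by (intro iV_cong) blast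
  moreover have "(\<Sum>h\<in>carrier G. \<beta> (?d h) \<otimes>\<^bsub>kG\<^esub> bvec h) + (\<Sum>i<n. lam_ext G lam (\<beta> (r i)) (v i)) = 0"
    using cond5 o unfolding cond5_def by fastforce
  ultimately have "cong_mod ann ((\<Sum>j<p. trip \<one> (u j) \<one> \<otimes>\<^bsub>TU\<^esub> rl (s j)) - (\<Sum>i<n. rl (r i) \<otimes>\<^bsub>TU\<^esub> trip \<one> (v i) \<one>))
    (\<Sum>h\<in>carrier G. rl (?d h) \<otimes>\<^bsub>TU\<^esub> bvec (h, []))"
    using rel_overlap[OF \<alpha> \<beta> lam skew_in_ann o] by (simp add: lin_map_0[OF lin_map_iG])
  from ann_cong[OF this m]
  have eq: "(\<Sum>j<p. lmul (trip \<one> (u j) \<one> \<otimes>\<^bsub>TU\<^esub> rl (s j)) m) - (\<Sum>i<n. lmul (rl (r i) \<otimes>\<^bsub>TU\<^esub> trip \<one> (v i) \<one>) m)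
    = (\<Sum>h\<in>carrier G. lmul (rl (?d h) \<otimes>\<^bsub>TU\<^esub> bvec (h, [])) m)"
    by (simp add: lin_map_diff[OF lin_map_lmul_left] lin_map_sum[OF lin_map_lmul_left])
  have r: "r i \<in> R" if "i < n" for i using o that by (simp add: overlap_def)
  have s: "s i \<in> R" if "i < p" for i using o that by (simp add: overlap_def)
  have 1: "(\<Sum>j<p. lmul (trip \<one> (u j) \<one> \<otimes>\<^bsub>TU\<^esub> rl (s j)) m) = (\<Sum>j<p. lmul_v (u j) (lmul (rl (s j)) m))"
    using s m by (intro sum.cong) (auto simp: lmul_mult rel_carrier lmul_trip_one lmul_MC)
  have 2: "(\<Sum>i<n. lmul (rl (r i) \<otimes>\<^bsub>TU\<^esub> trip \<one> (v i) \<one>) m) = (\<Sum>i<n. lmul (rl (r i)) (lmul_v (v i) m))"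
    using r m by (intro sum.cong) (auto simp: lmul_mult rel_carrier lmul_trip_one)
  have 3: "(\<Sum>h\<in>carrier G. lmul (rl (?d h) \<otimes>\<^bsub>TU\<^esub> bvec (h, [])) m) = (\<Sum>h\<in>carrier G. lmul (rl (?d h)) (lmul_g h m))"
    using d m by (intro sum.cong) (auto simp: lmul_mult rel_carrier lmul_bvec)
  show "(\<Sum>j<p. lmul_v (u j) (lmul (rl (s j)) m)) = (\<Sum>i<n. lmul (rl (r i)) (lmul_v (v i) m))
    + (\<Sum>h\<in>carrier G. lmul (rl (?d h)) (lmul_g h m))"
    using eq unfolding 1 2 3 by (simp add: algebra_simps)
qed

lemma lmul_Mfilt:
  assumes "x \<in> bimod_filt G B n" "m \<in> Mfilt k"
  shows "lmul x m \<in> Mfilt (n + k)"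
  unfolding lmul_def
proof (rule lin_ext_in_subspace[OF subspace_Mfilt])
  fix u assume u: "u \<in> Poly_Mapping.keys x"
  obtain g xs where u': "u = (g, xs)" by (cases u)
  have "g \<in> carrier G \<and> xs \<in> lists (B \<times> carrier G) \<and> length xs \<le> n"
    using assms(1) u u' by (auto simp: bimod_filt_def carrier_monoid_alg)
  then show "lmul_word (snd u) (fst u) m \<in> Mfilt (n + k)"
    using Mfilt_mono[OF lmul_word_Mfilt[OF _ _ assms(2), of g xs], of "n + k"] by (simp add: u')
qed

lemma low_filt: "r \<in> R \<Longrightarrow> low r \<in> TUf 1"
  using low_carrier by (auto simp: bimod_filt_iff lin_map_add[OF lin_map_restr_supp] hU_iV hU_iG)

lemma rel_filt: "r \<in> R \<Longrightarrow> rl r \<in> TUf 2"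
  using rel_lead[of r \<beta> \<alpha>] beta_kG by simp

subsection \<open>Filtering the submodule generated by the relations\<close>

text \<open>The index n bounds the degree of the multiples that are added, not the degree of the
  sum; that both bounds amount to the same is the aim (\<open>J_strict\<close>). The set Q holds the
  group elements allowed at the end: all of G, or only 1, where leading terms can be read off in
  T(V).\<close>

definition JG :: "nat \<Rightarrow> 'g set \<Rightarrow> ('k, 'v, 'g) word_mod set" where
  "JG n Q = pv.span {lmul_w u (lmul (rl r) (bvec (v, g))) | u r v g.
    u \<in> lists B \<and> r \<in> R \<and> v \<in> lists B \<and> g \<in> Q \<and> length u + length v + 2 \<le> n}"

abbreviation "J n \<equiv> JG n (carrier G)"
abbreviation "J1 n \<equiv> JG n {\<one>}"

lemma subspace_JG: "pv.subspace (JG n Q)"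
  unfolding JG_def by (rule pv.subspace_span)

lemma JG_gen:
  "u \<in> lists B \<Longrightarrow> r \<in> R \<Longrightarrow> v \<in> lists B \<Longrightarrow> g \<in> Q \<Longrightarrow> length u + length v + 2 \<le> n \<Longrightarrow>
    lmul_w u (lmul (rl r) (bvec (v, g))) \<in> JG n Q"
  unfolding JG_def by (rule pv.span_base) blast

lemma JG_lin_map:
  assumes "lin_map T" "pv.subspace S" "x \<in> JG n Q"
    "\<And>u r v g. u \<in> lists B \<Longrightarrow> r \<in> R \<Longrightarrow> v \<in> lists B \<Longrightarrow> g \<in> Q \<Longrightarrow> length u + length v + 2 \<le> n \<Longrightarrow>
      T (lmul_w u (lmul (rl r) (bvec (v, g)))) \<in> S"
  shows "T x \<in> S"
  using assms(3) unfolding JG_def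
  by (rule lin_map_span_subset[OF assms(1,2), rotated]) (use assms(4) in blast)

lemma JG_mono:
  assumes "x \<in> JG n Q" "n \<le> n'" "Q \<subseteq> Q'"
  shows "x \<in> JG n' Q'"
  by (rule JG_lin_map[OF lin_map_id subspace_JG assms(1)], rule JG_gen) (use assms in auto)

lemma J1_J: "x \<in> J1 n \<Longrightarrow> x \<in> J n"
  by (rule JG_mono) auto

lemma lmul_rel_J:
  assumes "u \<in> lists B" "r \<in> R" "m \<in> Mfilt k" "length u + k + 2 \<le> n"
  shows "lmul_w u (lmul (rl r) m) \<in> J n"
proof (rule lin_map_Mfilt[OF _ subspace_JG assms(3)])
  show "lin_map (\<lambda>m. lmul_w u (lmul (rl r) m))" by (intro lin_intros)
qed (use assms in \<open>auto intro!: JG_gen\<close>)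

lemma lmul_rel_Mfilt: "r \<in> R \<Longrightarrow> m \<in> Mfilt k \<Longrightarrow> lmul (rl r) m \<in> Mfilt (k + 2)"
  using lmul_Mfilt[OF rel_filt, of r m k] by (simp add: add.commute)

lemma J_Mfilt: "x \<in> J n \<Longrightarrow> x \<in> Mfilt n"
proof (rule JG_lin_map[OF lin_map_id subspace_Mfilt])
  fix u r v g assume a: "u \<in> lists B" "r \<in> R" "v \<in> lists B" "g \<in> carrier G" "length u + length v + 2 \<le> n"
  then have "lmul_w u (lmul (rl r) (bvec (v, g))) \<in> Mfilt (length u + (length v + 2))"
    by (intro lmul_w_Mfilt lmul_rel_Mfilt bvec_Mfilt) auto
  then show "lmul_w u (lmul (rl r) (bvec (v, g))) \<in> Mfilt n" by (rule Mfilt_mono) (use a in auto)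
qed

lemma J_MC: "x \<in> J n \<Longrightarrow> x \<in> MC"
  using J_Mfilt Mfilt_MC by blast

lemma J_lmul_b: "b \<in> B \<Longrightarrow> x \<in> J n \<Longrightarrow> lmul_b b x \<in> J (Suc n)"
  by (rule JG_lin_map[OF lin_map_lmul_b subspace_JG])
    (simp_all flip: lmul_w_simps(2), auto intro!: JG_gen simp del: lmul_w_simps)

lemma J_lmul_v: "x \<in> J n \<Longrightarrow> lmul_v v x \<in> J (Suc n)"
  unfolding lmul_v_def by (intro pv.subspace_sum pv.subspace_scale subspace_JG J_lmul_b)

lemma J_lmul_w: "u \<in> lists B \<Longrightarrow> x \<in> J n \<Longrightarrow> lmul_w u x \<in> J (length u + n)"
  by (induction u) (auto intro: J_lmul_b)

text \<open>The group element is moved through the prefix letter by letter, the \<lambda>-terms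
  shortening the prefix, and finally passes the relation by \<open>lmul_g_rel\<close>.\<close>

lemma J_lmul_g:
  assumes "g \<in> carrier G" "x \<in> J n"
  shows "lmul_g g x \<in> J n"
proof (rule JG_lin_map[OF lin_map_lmul_g subspace_JG assms(2)])
  fix u r v h assume a: "u \<in> lists B" "r \<in> R" "v \<in> lists B" "h \<in> carrier G" "length u + length v + 2 \<le> n"
  have m: "(bvec (v, h) :: ('k, 'v, 'g) word_mod) \<in> Mfilt (length v)" using a by (intro bvec_Mfilt) auto
  have "lmul_g g (lmul_w u (lmul (rl r) (bvec (v, h)))) \<in> J (length u + (length v + 2))"
    using a(1) assms(1)
  proof (induction u arbitrary: g)
    case Nil
    have "lmul_w [] (lmul (rl (aT g r)) (lmul_g g (bvec (v, h)))) \<in> J (length v + 2)"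
      using Nil a m by (intro lmul_rel_J[of _ _ _ "length v"] R_aT lmul_g_Mfilt) auto
    then show ?case using Nil a Mfilt_MC[OF m] by (simp add: lmul_g_rel)
  next
    case (Cons b u)
    let ?x = "lmul_w u (lmul (rl r) (bvec (v, h)))"
    have IH: "lmul_g g ?x \<in> J (length u + (length v + 2))" if "g \<in> carrier G" for g
      using Cons that by auto
    have g: "g \<in> carrier G" using Cons.prems by auto
    have "lmul_v (act g b) (lmul_g g ?x) \<in> J (Suc (length u + (length v + 2)))"
      by (intro J_lmul_v IH g)
    moreover have "lmul_kG (lam g b) ?x \<in> J (length u + (length v + 2))"
      unfolding lmul_kG_def using lam_kG[OF g, of b]
      by (intro lin_ext_in_subspace[OF subspace_JG] IH) (auto simp: carrier_monoid_alg)
    then have "lmul_kG (lam g b) ?x \<in> J (Suc (length u + (length v + 2)))"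
      by (rule JG_mono) auto
    ultimately show ?case by (simp add: lmul_g_lmul_b pv.subspace_add[OF subspace_JG])
  qed
  then show "lmul_g g (lmul_w u (lmul (rl r) (bvec (v, h)))) \<in> J n" by (rule JG_mono) (use a in auto)
qed

lemma J_lmul_kG: "c \<in> carrier kG \<Longrightarrow> x \<in> J n \<Longrightarrow> lmul_kG c x \<in> J n"
  unfolding lmul_kG_def by (intro lin_ext_in_subspace[OF subspace_JG] J_lmul_g) (auto simp: carrier_monoid_alg)

lemma J_low: "r \<in> R \<Longrightarrow> x \<in> J n \<Longrightarrow> lmul (low r) x \<in> J (Suc n)"
proof -
  assume r: "r \<in> R" and x: "x \<in> J n"
  have "lmul (iV (\<alpha> r)) x \<in> J (Suc n)"
    unfolding VkG_to_TU_def lin_map_sum[OF lin_map_lmul_left] lmul_trip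
    using x by (intro pv.subspace_sum[OF subspace_JG] J_lmul_g J_lmul_v) auto
  moreover have "lmul_kG (\<beta> r) x \<in> J n" using r x by (intro J_lmul_kG beta_kG)
  then have "lmul (iG (\<beta> r)) x \<in> J (Suc n)" unfolding lmul_iG by (rule JG_mono) auto
  ultimately show ?thesis
    unfolding lin_map_add[OF lin_map_lmul_left] by (rule pv.subspace_add[OF subspace_JG])
qed

lemma J_rmul_b: "b \<in> B \<Longrightarrow> x \<in> J n \<Longrightarrow> rmul_b b x \<in> J (Suc n)"
proof (rule JG_lin_map[OF lin_map_rmul_b subspace_JG])
  fix u r v g assume b: "b \<in> B"
    and a: "u \<in> lists B" "r \<in> R" "v \<in> lists B" "g \<in> carrier G" "length u + length v + 2 \<le> n"
  have m: "(bvec (v, g) :: ('k, 'v, 'g) word_mod) \<in> Mfilt (length v)" using a by (intro bvec_Mfilt) auto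
  have "lmul_w u (lmul (rl r) (rmul_b b (bvec (v, g)))) \<in> J (Suc n)"
    using a b m by (intro lmul_rel_J[of _ _ _ "Suc (length v)"] rmul_b_Mfilt) auto
  then show "rmul_b b (lmul_w u (lmul (rl r) (bvec (v, g)))) \<in> J (Suc n)"
    using a b Mfilt_MC[OF m] by (simp add: rmul_lmul_w rmul_b_lmul rel_carrier)
qed

lemma J_rmul_g: "h \<in> carrier G \<Longrightarrow> x \<in> J n \<Longrightarrow> rmul_g h x \<in> J n"
proof (rule JG_lin_map[OF lin_map_rmul_g subspace_JG])
  fix u r v g assume h: "h \<in> carrier G"
    and a: "u \<in> lists B" "r \<in> R" "v \<in> lists B" "g \<in> carrier G" "length u + length v + 2 \<le> n"
  then show "rmul_g h (lmul_w u (lmul (rl r) (bvec (v, g)))) \<in> J n"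
    by (simp add: rmul_lmul_w rmul_g_lmul rel_carrier bvec_MC rmul_g_bvec JG_gen)
qed

text \<open>The lower terms of a deformed relation do not reach top degree, so the undeformed
  relation appears there.\<close>

lemma lead_gen:
  assumes a: "u \<in> lists B" "r \<in> R" "v \<in> lists B" "g \<in> carrier G"
  shows "lead (length u + length v + 2) h (lmul_w u (lmul (rl r) (bvec (v, g))))
    = (if h = g then (bvec u \<otimes>\<^bsub>TV\<^esub> r) \<otimes>\<^bsub>TV\<^esub> bvec v else 0)"
proof -
  have m: "(bvec (v, g) :: ('k, 'v, 'g) word_mod) \<in> Mfilt (length v)" using a by (intro bvec_Mfilt) auto
  have r: "r \<in> tensor_power B 2" using a R_deg by blast
  have "lmul (low r) (bvec (v, g)) \<in> Mfilt (1 + length v)" by (rule lmul_Mfilt[OF low_filt[OF a(2)] m])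
  then have l: "lead (length v + 2) h (lmul (low r) (bvec (v, g))) = 0" by (rule lead_high) auto
  have "lead (length v + 2) h (lmul (iT r) (bvec (v, g))) = (if h = g then r \<otimes>\<^bsub>TV\<^esub> bvec v else 0)"
  proof (cases "h = g")
    case True
    then show ?thesis
      by simp (rule lin_map_eqI[where Z = "{w \<in> lists B. length w = 2}" and p = r],
        use r Mfilt_MC[OF m] in \<open>auto intro!: lin_intros simp: tensor_power_def carrier_monoid_alg lmul_iT_bvec
          lmul_w_bvec lead_bvec in_lists_conv_set subset_iff\<close>)
  next
    case False
    then show ?thesis
      by simp (rule lin_map_eqI[where Z = "{w \<in> lists B. length w = 2}" and p = r and T = "\<lambda>p. 0"],
        use r Mfilt_MC[OF m] in \<open>auto intro!: lin_intros simp: tensor_power_def carrier_monoid_alg lmul_iT_bvec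
          lmul_w_bvec lead_bvec in_lists_conv_set subset_iff\<close>)
  qed
  then have "lead (length v + 2) h (lmul (rl r) (bvec (v, g))) = (if h = g then r \<otimes>\<^bsub>TV\<^esub> bvec v else 0)"
    using l unfolding iT_eq_rel_low lin_map_add[OF lin_map_lmul_left] lin_map_add[OF lin_map_lead] by simp
  then show ?thesis
    using lead_lmul_w[OF a(1), of "length v + 2" h] a R_carrier[OF a(2)]
    by (simp add: FM.monoid_alg_assoc add.assoc in_lists_conv_set single_in_carrier)
qed

lemma lead_J:
  assumes "x \<in> JG n Q" "Q \<subseteq> carrier G"
  shows "lead n h x \<in> IT" "h \<notin> Q \<Longrightarrow> lead n h x = 0"
proof -
  have gen: "lead n h (lmul_w u (lmul (rl r) (bvec (v, g)))) \<in> IT \<and>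
      (h \<noteq> g \<longrightarrow> lead n h (lmul_w u (lmul (rl r) (bvec (v, g)))) = 0)"
    if a: "u \<in> lists B" "r \<in> R" "v \<in> lists B" "g \<in> carrier G" "length u + length v + 2 \<le> n" for u r v g
  proof (cases "length u + length v + 2 = n")
    case True
    have "(bvec u \<otimes>\<^bsub>TV\<^esub> r) \<otimes>\<^bsub>TV\<^esub> bvec v \<in> IT"
      using a R_subset_IT by (intro IT_mult(1)[OF IT_mult(2)] single_in_carrier) auto
    then show ?thesis
      using lead_gen[OF a(1-4), of h] pv.subspace_0[OF S.subspace] unfolding True by auto
  next
    case False
    have "lmul_w u (lmul (rl r) (bvec (v, g))) \<in> J (length u + length v + 2)"
      using a by (intro JG_gen) auto
    then have "lead n h (lmul_w u (lmul (rl r) (bvec (v, g)))) = 0"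
      using a(5) False by (intro lead_high[OF J_Mfilt]) auto
    then show ?thesis using pv.subspace_0[OF S.subspace] by simp
  qed
  show "lead n h x \<in> IT"
    by (rule JG_lin_map[OF lin_map_lead S.subspace assms(1)]) (use gen assms(2) in blast)
  assume "h \<notin> Q"
  then have "lead n h x \<in> {0}"
    by (intro JG_lin_map[OF lin_map_lead pv.subspace_single_0 assms(1)]) (use gen assms(2) in blast)
  then show "lead n h x = 0" by simp
qed

subsection \<open>Stripping the last letter\<close>

text \<open>Combinations of degree at most k + 1 in which a relation in top degree leaves the last
  letter untouched: b is appended to \<open>y b\<close>, and \<open>J k\<close> collects what has
  lower degree. Combinations of multiples ending in a relation are brought into this form by
  syzygies.\<close>

definition RJ :: "nat \<Rightarrow> ('k, 'v, 'g) word_mod set" where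
  "RJ k = {x. \<exists>j\<in>J k. \<exists>y. (\<forall>b. y b \<in> J1 k) \<and> x = j + (\<Sum>b\<in>B. rmul_b b (y b))}"

lemma subspace_RJ: "pv.subspace (RJ k)"
proof (rule pv.subspaceI)
  show "0 \<in> RJ k"
    unfolding RJ_def using pv.subspace_0[OF subspace_JG]
    by (auto intro!: bexI[of _ 0] exI[of _ "\<lambda>b. 0"] simp: lin_map_0[OF lin_map_rmul_b])
  show "x + x' \<in> RJ k" if xs: "x \<in> RJ k" "x' \<in> RJ k" for x x'
  proof -
    obtain j y where 1: "j \<in> J k" "\<forall>b. y b \<in> J1 k" "x = j + (\<Sum>b\<in>B. rmul_b b (y b))"
      using xs(1) unfolding RJ_def by blast
    obtain j' y' where 2: "j' \<in> J k" "\<forall>b. y' b \<in> J1 k" "x' = j' + (\<Sum>b\<in>B. rmul_b b (y' b))"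
      using xs(2) unfolding RJ_def by blast
    have "x + x' = (j + j') + (\<Sum>b\<in>B. rmul_b b (y b + y' b))"
      by (simp add: 1 2 lin_map_add[OF lin_map_rmul_b] sum.distrib)
    moreover have "j + j' \<in> J k" "\<forall>b. y b + y' b \<in> J1 k"
      using 1 2 by (auto intro: pv.subspace_add[OF subspace_JG])
    ultimately show ?thesis
      unfolding RJ_def by (intro CollectI bexI[of _ "j + j'"] exI[of _ "\<lambda>b. y b + y' b"] conjI)
  qed
  show "pscale c x \<in> RJ k" if x: "x \<in> RJ k" for c x
  proof -
    obtain j y where 1: "j \<in> J k" "\<forall>b. y b \<in> J1 k" "x = j + (\<Sum>b\<in>B. rmul_b b (y b))"
      using x unfolding RJ_def by blast
    have "pscale c x = pscale c j + (\<Sum>b\<in>B. rmul_b b (pscale c (y b)))"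
      by (simp add: 1 lin_map_pscale[OF lin_map_rmul_b] pv.scale_right_distrib pv.scale_sum_right)
    moreover have "pscale c j \<in> J k" "\<forall>b. pscale c (y b) \<in> J1 k"
      using 1 by (auto intro: pv.subspace_scale[OF subspace_JG])
    ultimately show ?thesis
      unfolding RJ_def by (intro CollectI bexI[of _ "pscale c j"] exI[of _ "\<lambda>b. pscale c (y b)"] conjI)
  qed
qed

lemma J_RJ: "x \<in> J k \<Longrightarrow> x \<in> RJ k"
  unfolding RJ_def using pv.subspace_0[OF subspace_JG]
  by (auto intro!: bexI[of _ x] exI[of _ "\<lambda>b. 0"] simp: lin_map_0[OF lin_map_rmul_b])

lemma rmul_b_RJ: "b \<in> B \<Longrightarrow> x \<in> J1 k \<Longrightarrow> rmul_b b x \<in> RJ k"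
proof -
  assume b: "b \<in> B" and x: "x \<in> J1 k"
  have "(\<Sum>a\<in>B. rmul_b a (if a = b then x else 0)) = (\<Sum>a\<in>B. if a = b then rmul_b b x else 0)"
    by (rule sum.cong) (auto simp: lin_map_0[OF lin_map_rmul_b])
  then have "rmul_b b x = 0 + (\<Sum>a\<in>B. rmul_b a (if a = b then x else 0))"
    using b V.finite_Basis by simp
  moreover have "0 \<in> J k" "\<forall>a. (if a = b then x else 0) \<in> J1 k"
    using x pv.subspace_0[OF subspace_JG] by auto
  ultimately show ?thesis
    unfolding RJ_def by (intro CollectI bexI[of _ 0] exI[of _ "\<lambda>a. if a = b then x else 0"] conjI)
qed

lemma lead_RJ:
  assumes "j \<in> J k" "\<And>b. y b \<in> J1 k"
  shows "lead (Suc k) \<one> (j + (\<Sum>b\<in>B. rmul_b b (y b))) = (\<Sum>b\<in>B. lead k \<one> (y b) \<otimes>\<^bsub>TV\<^esub> vT b)"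
proof -
  have "lead (Suc k) \<one> j = 0" by (rule lead_high[OF J_Mfilt[OF assms(1)]]) simp
  moreover have "lead (Suc k) \<one> (rmul_b b (y b)) = lead k \<one> (y b) \<otimes>\<^bsub>TV\<^esub> vT b" if "b \<in> B" for b
    using lead_rmul_b[OF that one_closed J_Mfilt[OF J1_J[OF assms(2)]]] by simp
  ultimately show ?thesis by (simp add: lin_map_add[OF lin_map_lead] lin_map_sum[OF lin_map_lead])
qed

lemma e0_Mfilt: "e0 \<in> Mfilt 0" and e0_MC: "e0 \<in> MC"
  by (auto intro: bvec_Mfilt bvec_MC)

lemma rmul_b_word: "b \<in> B \<Longrightarrow> rmul_b b (bvec (w, \<one>)) = bvec (w @ [b], \<one>)"
  using lmul_g_one[of "bvec ([b], \<one>)"] bvec_MC[of "[b]" \<one>] by (simp add: rmul_b_bvec lmul_w_bvec)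

text \<open>Two relations at disjoint places: either may be resolved first.\<close>

lemma disjoint_RJ:
  assumes u: "u \<in> lists B" and r: "r \<in> R" and v: "v \<in> lists B" and s: "s \<in> R"
  shows "lmul_w u (lmul (iT r) (lmul_w v (lmul (rl s) e0))) \<in> RJ (length u + length v + 3)"
proof -
  let ?k = "length u + length v + 3"
  \<comment> \<open>Replacing \<open>iT r\<close> by the deformed relation plus lower terms, and
    then the deformed relation of s by \<open>iT s\<close> minus lower terms, trades the relation at
    s for one at r. Only the term with \<open>iT s\<close> still has full degree.\<close>
  let ?T = "\<lambda>m. lmul_w u (lmul (rl r) (lmul_w v m))"
  have T: "lin_map ?T" by (intro lin_intros)
  have "lmul_w v (lmul (rl s) e0) \<in> J (length v + 2)"
    using v s by (intro lmul_rel_J[of _ _ _ 0] e0_Mfilt) auto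
  from J_lmul_w[OF u J_low[OF r this]] have 1: "lmul_w u (lmul (low r) (lmul_w v (lmul (rl s) e0))) \<in> RJ ?k"
    by (intro J_RJ) (simp add: add.assoc numeral_3_eq_3)
  have "lmul (low s) e0 \<in> Mfilt (1 + 0)" by (rule lmul_Mfilt[OF low_filt[OF s] e0_Mfilt])
  then have "lmul_w v (lmul (low s) e0) \<in> Mfilt (length v + (1 + 0))" using v by (intro lmul_w_Mfilt)
  then have 2: "?T (lmul (low s) e0) \<in> RJ ?k"
    using u r by (intro J_RJ lmul_rel_J[of _ _ _ "length v + (1 + 0)"]) auto
  \<comment> \<open>The tensor s ends in a letter, and this letter can be taken out on the right of
    the relation r.\<close>
  have "s \<in> tensor_power B (Suc 1)" using s R_deg by (auto simp: numeral_2_eq_2)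
  then obtain f where f: "\<And>b. b \<in> B \<Longrightarrow> f b \<in> tensor_power B 1" "s = (\<Sum>b\<in>B. f b \<otimes>\<^bsub>TV\<^esub> vT b)"
    by (rule tensor_power_last) auto
  have "?T (lmul (iT (f b \<otimes>\<^bsub>TV\<^esub> vT b)) e0) \<in> RJ ?k" if b: "b \<in> B" for b
  proof (rule lin_map_span_subset[OF _ subspace_RJ, of "\<lambda>p. ?T (lmul (iT (p \<otimes>\<^bsub>TV\<^esub> vT b)) e0)" "{bvec [a] | a. a \<in> B}"])
    show "lin_map (\<lambda>p. ?T (lmul (iT (p \<otimes>\<^bsub>TV\<^esub> vT b)) e0))"
      by (intro lin_map_comp[OF T]) (intro lin_intros)
    obtain x where "vT x = f b" using vT_surj[OF f(1)[OF b]] .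
    then have "f b = (\<Sum>a\<in>B. pscale (coord x a) (bvec [a]))" by (simp only: vT_expand)
    then show "f b \<in> pv.span {bvec [a] | a. a \<in> B}"
      by (simp only:) (intro pv.span_sum pv.span_scale pv.span_base, blast)
    fix p :: "'v list \<Rightarrow>\<^sub>0 'k" assume "p \<in> {bvec [a] | a. a \<in> B}"
    then obtain a where a: "a \<in> B" "p = bvec [a]" by blast
    have "lmul (iT (p \<otimes>\<^bsub>TV\<^esub> vT b)) e0 = bvec ([a, b], \<one>)"
      using a b lmul_iT_bvec[of "[a, b]" e0] e0_MC by (simp add: vT_Basis lmul_b_bvec)
    also have "\<dots> = rmul_b b (bvec ([a], \<one>))" using b by (simp add: rmul_b_word)
    finally have "?T (lmul (iT (p \<otimes>\<^bsub>TV\<^esub> vT b)) e0) = lmul_w u (lmul (rl r) (lmul_w v (rmul_b b (bvec ([a], \<one>)))))"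
      by simp
    also have "lmul_w v (rmul_b b (bvec ([a], \<one>))) = rmul_b b (bvec (v @ [a], \<one>))"
      by (simp add: rmul_lmul_w(2)[symmetric] lmul_w_bvec)
    also have "lmul_w u (lmul (rl r) (rmul_b b (bvec (v @ [a], \<one>)))) = rmul_b b (lmul_w u (lmul (rl r) (bvec (v @ [a], \<one>))))"
      using a v by (simp add: rmul_lmul_w(2) rmul_b_lmul[OF b rel_carrier[OF r]] bvec_MC)
    finally have "?T (lmul (iT (p \<otimes>\<^bsub>TV\<^esub> vT b)) e0) = rmul_b b (lmul_w u (lmul (rl r) (bvec (v @ [a], \<one>))))" .
    moreover have "lmul_w u (lmul (rl r) (bvec (v @ [a], \<one>))) \<in> J1 ?k"
      using u r v a by (intro JG_gen) auto
    ultimately show "?T (lmul (iT (p \<otimes>\<^bsub>TV\<^esub> vT b)) e0) \<in> RJ ?k"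
      using rmul_b_RJ[OF b] by simp
  qed
  then have 3: "?T (lmul (iT s) e0) \<in> RJ ?k"
    unfolding f(2) lin_map_sum[OF lin_map_iT] lin_map_sum[OF lin_map_lmul_left] lin_map_sum[OF T]
    by (intro pv.subspace_sum[OF subspace_RJ])
  have "lmul (rl s) e0 = lmul (iT s) e0 - lmul (low s) e0"
    unfolding iT_eq_rel_low by (simp add: lin_map_add[OF lin_map_lmul_left])
  then have "?T (lmul (rl s) e0) = ?T (lmul (iT s) e0) - ?T (lmul (low s) e0)"
    by (simp only: lin_map_diff[OF T])
  then have "?T (lmul (rl s) e0) \<in> RJ ?k" using 2 3 pv.subspace_diff[OF subspace_RJ] by simp
  then show ?thesis
    using 1 pv.subspace_add[OF subspace_RJ]
    by (simp add: iT_eq_rel_low lin_map_add[OF lin_map_lmul_left] lin_map_add[OF lin_map_lmul_w])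
qed

text \<open>An element of \<open>IT\<close> is a combination of tensors containing a relation; in
  front of the relation s each of them gives a pair of disjoint relations.\<close>

lemma ideal_RJ:
  assumes q: "q \<in> IT" "q \<in> tensor_power B l" and s: "s \<in> R"
  shows "lmul (iT q) (lmul (rl s) e0) \<in> RJ (Suc l)"
proof -
  \<comment> \<open>Cutting to degree l discards those members of an expression of q that have the
    wrong length and cancel in total.\<close>
  let ?T = "\<lambda>q. lmul (iT (hT l q)) (lmul (rl s) e0)"
  have m: "lmul (rl s) e0 \<in> MC" by (intro lmul_MC rel_carrier s e0_MC)
  have "?T q \<in> RJ (Suc l)"
  proof (rule lin_map_span_subset[OF _ subspace_RJ _ q(1)[unfolded IT_span]])
    show "lin_map ?T" by (intro lin_intros)
    fix z assume "z \<in> {(bvec u \<otimes>\<^bsub>TV\<^esub> r) \<otimes>\<^bsub>TV\<^esub> bvec w | u r w. u \<in> lists B \<and> r \<in> R \<and> w \<in> lists B}"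
    then obtain u r w where z: "z = (bvec u \<otimes>\<^bsub>TV\<^esub> r) \<otimes>\<^bsub>TV\<^esub> bvec w"
      and a: "u \<in> lists B" "r \<in> R" "w \<in> lists B" by blast
    have c: "(bvec u :: 'v list \<Rightarrow>\<^sub>0 'k) \<in> carrier TV" "(bvec w :: 'v list \<Rightarrow>\<^sub>0 'k) \<in> carrier TV"
      using a by (auto intro: single_in_carrier)
    show "?T z \<in> RJ (Suc l)"
    proof (cases "length u + 2 + length w = l")
      case True
      note i = iT_carrier[OF c(1)] iT_carrier[OF R_carrier[OF a(2)]] iT_carrier[OF c(2)]
      have "lmul (iT z) (lmul (rl s) e0) = lmul (iT (bvec u)) (lmul (iT r) (lmul (iT (bvec w)) (lmul (rl s) e0)))"
        unfolding z iT_mult lmul_mult[OF BM.monoid_alg_closed[OF i(1,2)] i(3) m]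
          lmul_mult[OF i(1,2) lmul_MC[OF i(3) m]] ..
      also have "\<dots> = lmul_w u (lmul (iT r) (lmul_w w (lmul (rl s) e0)))"
        unfolding lmul_iT_bvec[OF a(3) m, symmetric]
        by (rule lmul_iT_bvec[OF a(1) lmul_MC[OF i(2) lmul_MC[OF i(3) m]]])
      finally have iz: "lmul (iT z) (lmul (rl s) e0) = lmul_w u (lmul (iT r) (lmul_w w (lmul (rl s) e0)))" .
      have hz: "hT l z = z" using IT_gen_hom[OF a(2), of l u w] True by (simp add: z)
      have l: "Suc l = length u + length w + 3" using True by simp
      show ?thesis unfolding hz iz l by (rule disjoint_RJ[OF a s])
    next
      case False
      then have "hT l z = 0" using IT_gen_hom[OF a(2), of l u w] by (simp add: z)
      then show ?thesis
        by (simp add: lin_map_0[OF lin_map_iT] lin_map_0[OF lin_map_lmul_left] pv.subspace_0[OF subspace_RJ])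
    qed
  qed
  then show ?thesis using q(2) by (simp add: tensor_power_iff)
qed

text \<open>By \<open>lmul_rel_overlap\<close> the relations at the end become relations followed by
  one letter, with corrections coming from relations in degree lower by one.\<close>

lemma overlap_RJ:
  assumes y: "y \<in> tensor_power B l" and o: "overlap scale B R n r v p u s"
  shows "lmul (iT y) (\<Sum>j<p. lmul_v (u j) (lmul (rl (s j)) e0)) \<in> RJ (l + 2)"
proof -
  let ?d = "alpha_diff scale B act \<alpha> n r v p u s"
  let ?m = "\<Sum>j<p. lmul_v (u j) (lmul (rl (s j)) e0)"
  have r: "r i \<in> R" if "i < n" for i using o that by (simp add: overlap_def)
  have s: "s i \<in> R" if "i < p" for i using o that by (simp add: overlap_def)
  have m: "?m \<in> MC"
    using s by (intro pv.subspace_sum[OF subspace_MC] MC_closed lmul_MC rel_carrier e0_MC) auto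
  have word: "lmul_w w ?m \<in> RJ (l + 2)" if w: "w \<in> lists B" "length w = l" for w
  proof -
    have 1: "lmul_w w (lmul (rl (?d h)) (lmul_g h e0)) \<in> RJ (l + 2)" if h: "h \<in> carrier G" for h
      using w h lmul_rel_overlap(2)[OF o e0_MC h]
      by (intro J_RJ lmul_rel_J[of _ _ _ 0] lmul_g_Mfilt e0_Mfilt) auto
    have 2: "lmul_w w (lmul (rl (r i)) (lmul_v (v i) e0)) \<in> RJ (l + 2)" if i: "i < n" for i
    proof -
      have "lmul_v (v i) e0 = (\<Sum>b\<in>B. pscale (coord (v i) b) (rmul_b b e0))"
        unfolding lmul_v_def by (rule sum.cong) (auto simp: lmul_b_bvec rmul_b_word)
      then have "lmul_w w (lmul (rl (r i)) (lmul_v (v i) e0))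
        = (\<Sum>b\<in>B. pscale (coord (v i) b) (rmul_b b (lmul_w w (lmul (rl (r i)) e0))))"
        using r[OF i] e0_MC
        by (simp add: lin_map_sum[OF lin_map_lmul] lin_map_pscale[OF lin_map_lmul] lin_map_sum[OF lin_map_lmul_w]
            lin_map_pscale[OF lin_map_lmul_w] rmul_lmul_w rmul_b_lmul rel_carrier)
      moreover have "lmul_w w (lmul (rl (r i)) e0) \<in> J1 (l + 2)"
        using w r[OF i] by (intro JG_gen) auto
      ultimately show ?thesis
        by (auto intro!: pv.subspace_sum[OF subspace_RJ] pv.subspace_scale[OF subspace_RJ] rmul_b_RJ)
    qed
    show ?thesis
      unfolding lmul_rel_overlap(1)[OF o e0_MC] lin_map_add[OF lin_map_lmul_w] lin_map_sum[OF lin_map_lmul_w]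
      by (intro pv.subspace_add[OF subspace_RJ] pv.subspace_sum[OF subspace_RJ] 1 2) auto
  qed
  have "lin_map (\<lambda>y. lmul (iT y) ?m)" by (intro lin_intros)
  from lin_map_expand[OF this, of y] show ?thesis
    using y word m
    by (auto intro!: lin_ext_in_subspace[OF subspace_RJ]
        simp: tensor_power_def carrier_monoid_alg lmul_iT_bvec in_lists_conv_set subset_iff)
qed

section \<open>Relations at the right end of a word\<close>

lemma lookup_bvec_mult:
  assumes "length u' = length u"
  shows "Poly_Mapping.lookup (bvec u' \<otimes>\<^bsub>TV\<^esub> p) (u @ w) = (if u' = u then Poly_Mapping.lookup p w else 0)"
proof -
  have eq: "bvec u' \<otimes>\<^bsub>TV\<^esub> p = lin_ext (\<lambda>a. bvec (u' @ a)) p"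
    by (simp add: monoid_alg_mult)
  have "Poly_Mapping.lookup (bvec u' \<otimes>\<^bsub>TV\<^esub> p) (u @ w)
    = (\<Sum>a\<in>Poly_Mapping.keys p. if a = w then (if u' = u then Poly_Mapping.lookup p w else 0) else 0)"
    unfolding eq lin_ext_def lookup_sum
    by (rule sum.cong) (use assms in \<open>auto simp: lookup_single when_def\<close>)
  then show ?thesis by (simp add: sum.delta in_keys_iff)
qed

definition words :: "nat \<Rightarrow> 'v list set" where
  "words l = {u \<in> lists B. length u = l}"

lemma finite_words: "finite (words l)"
  using finite_lists_length_eq[OF V.finite_Basis, of l]
  by (simp add: words_def in_lists_conv_set subset_iff conj_commute Collect_conj_eq lists_eq_set Int_commute)

lemma tensor_power_expand:
  assumes "p \<in> tensor_power B l"
  shows "p = (\<Sum>u\<in>words l. pscale (Poly_Mapping.lookup p u) (bvec u))"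
proof -
  have "Poly_Mapping.keys p \<subseteq> words l"
    using assms by (auto simp: tensor_power_def carrier_monoid_alg words_def)
  from lin_ext_superset[OF finite_words this, of bvec] show ?thesis by simp
qed

text \<open>A generator of top degree l + 2 either has a letter after its relation, which
  \<open>rmul_b\<close> takes out, or ends in its relation and has a prefix of length l. The latter
  are collected by prefix into one relation for each word.\<close>

lemma J1_decomp:
  assumes "x \<in> J1 (Suc (Suc l))"
  shows "\<exists>a\<in>RJ (Suc l). \<exists>rr. (\<forall>u. rr u \<in> R) \<and> x = a + (\<Sum>u\<in>words l. lmul_w u (lmul (rl (rr u)) e0))"
proof -
  let ?S = "{x. \<exists>a\<in>RJ (Suc l). \<exists>rr. (\<forall>u. rr u \<in> R) \<and> x = a + (\<Sum>u\<in>words l. lmul_w u (lmul (rl (rr u)) e0))}"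
  have "pv.subspace ?S"
  proof (rule pv.subspaceI)
    have "0 \<in> RJ (Suc l)" "\<forall>u. (0 :: 'v list \<Rightarrow>\<^sub>0 'k) \<in> R"
      "0 = 0 + (\<Sum>u\<in>words l. lmul_w u (lmul (rl 0) e0))"
      using pv.subspace_0[OF subspace_RJ] pv.subspace_0[OF R_subspace]
      by (auto simp: rel_zero lin_map_0[OF lin_map_lmul_left] lin_map_0[OF lin_map_lmul_w])
    then show "0 \<in> ?S" by (intro CollectI bexI[of _ 0] exI[of _ "\<lambda>u. 0"] conjI)
    show "x + x' \<in> ?S" if xs: "x \<in> ?S" "x' \<in> ?S" for x x'
    proof -
      obtain a rr where 1: "a \<in> RJ (Suc l)" "\<forall>u. rr u \<in> R" "x = a + (\<Sum>u\<in>words l. lmul_w u (lmul (rl (rr u)) e0))"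
        using xs(1) by blast
      obtain a' rr' where 2: "a' \<in> RJ (Suc l)" "\<forall>u. rr' u \<in> R" "x' = a' + (\<Sum>u\<in>words l. lmul_w u (lmul (rl (rr' u)) e0))"
        using xs(2) by blast
      have "x + x' = (a + a') + (\<Sum>u\<in>words l. lmul_w u (lmul (rl (rr u + rr' u)) e0))"
        using 1(2) 2(2) by (simp add: 1(3) 2(3) rel_add lin_map_add[OF lin_map_lmul_left]
            lin_map_add[OF lin_map_lmul_w] sum.distrib)
      moreover have "a + a' \<in> RJ (Suc l)" "\<forall>u. rr u + rr' u \<in> R"
        using 1 2 by (auto intro: pv.subspace_add[OF subspace_RJ] pv.subspace_add[OF R_subspace])
      ultimately show ?thesis by (intro CollectI bexI[of _ "a + a'"] exI[of _ "\<lambda>u. rr u + rr' u"] conjI)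
    qed
    show "pscale c x \<in> ?S" if x: "x \<in> ?S" for c x
    proof -
      obtain a rr where 1: "a \<in> RJ (Suc l)" "\<forall>u. rr u \<in> R" "x = a + (\<Sum>u\<in>words l. lmul_w u (lmul (rl (rr u)) e0))"
        using x by blast
      have "pscale c x = pscale c a + (\<Sum>u\<in>words l. lmul_w u (lmul (rl (pscale c (rr u))) e0))"
        using 1(2) by (simp add: 1(3) rel_pscale lin_map_pscale[OF lin_map_lmul_left]
            lin_map_pscale[OF lin_map_lmul_w] pv.scale_right_distrib pv.scale_sum_right)
      moreover have "pscale c a \<in> RJ (Suc l)" "\<forall>u. pscale c (rr u) \<in> R"
        using 1 by (auto intro: pv.subspace_scale[OF subspace_RJ] pv.subspace_scale[OF R_subspace])
      ultimately show ?thesis by (intro CollectI bexI[of _ "pscale c a"] exI[of _ "\<lambda>u. pscale c (rr u)"] conjI)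
    qed
  qed
  have RJ_S: "a \<in> ?S" if "a \<in> RJ (Suc l)" for a
  proof -
    have "a = a + (\<Sum>u\<in>words l. lmul_w u (lmul (rl 0) e0))" "\<forall>u. (0 :: 'v list \<Rightarrow>\<^sub>0 'k) \<in> R"
      using pv.subspace_0[OF R_subspace]
      by (auto simp: rel_zero lin_map_0[OF lin_map_lmul_left] lin_map_0[OF lin_map_lmul_w])
    then show ?thesis using that by (intro CollectI bexI[of _ a] exI[of _ "\<lambda>u. 0"] conjI)
  qed
  have "x \<in> ?S"
  proof (rule JG_lin_map[OF lin_map_id \<open>pv.subspace ?S\<close> assms])
    fix u r v g assume a: "u \<in> lists B" "r \<in> R" "v \<in> lists B" "g \<in> {\<one>}" "length u + length v + 2 \<le> Suc (Suc l)"
    then have g: "g = \<one>" by simp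
    consider "length u + length v + 2 \<le> Suc l" | "v = []" "length u = l"
      | v' b where "v = v' @ [b]" "length u + length v' + 2 = Suc l"
      using a(5) by (cases v rule: rev_cases) force+
    then show "lmul_w u (lmul (rl r) (bvec (v, g))) \<in> ?S"
    proof cases
      case 1
      then have "lmul_w u (lmul (rl r) (bvec (v, g))) \<in> J (Suc l)"
        using a by (intro JG_gen) auto
      then show ?thesis by (intro RJ_S J_RJ)
    next
      case 2
      have "(\<Sum>w\<in>words l. lmul_w w (lmul (rl (if w = u then r else 0)) e0))
          = (\<Sum>w\<in>words l. if w = u then lmul_w u (lmul (rl r) e0) else 0)"
        by (rule sum.cong) (auto simp: rel_zero lin_map_0[OF lin_map_lmul_left] lin_map_0[OF lin_map_lmul_w])
      also have "\<dots> = lmul_w u (lmul (rl r) e0)"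
        using finite_words a(1) 2 by (simp add: words_def)
      finally have "lmul_w u (lmul (rl r) (bvec (v, g)))
          = 0 + (\<Sum>w\<in>words l. lmul_w w (lmul (rl (if w = u then r else 0)) e0))" using 2 g by simp
      moreover have "0 \<in> RJ (Suc l)" "\<forall>w. (if w = u then r else 0) \<in> R"
        using a(2) pv.subspace_0[OF R_subspace] pv.subspace_0[OF subspace_RJ] by auto
      ultimately show ?thesis
        by (intro CollectI bexI[of _ 0] exI[of _ "\<lambda>w. if w = u then r else 0"] conjI)
    next
      case 3
      then have b: "b \<in> B" "v' \<in> lists B" using a(3) by auto
      have "lmul_w u (lmul (rl r) (bvec (v, g))) = rmul_b b (lmul_w u (lmul (rl r) (bvec (v', \<one>))))"
        using a b by (simp add: 3 g rmul_lmul_w rmul_b_lmul rel_carrier bvec_MC rmul_b_word)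
      moreover have "lmul_w u (lmul (rl r) (bvec (v', \<one>))) \<in> J1 (Suc l)"
        using a b 3 by (intro JG_gen) auto
      ultimately show ?thesis using rmul_b_RJ[OF b(1)] by (intro RJ_S) simp
    qed
  qed
  then show ?thesis by blast
qed

text \<open>A combination of relations placed at the end of words whose leading term lies in \<open>I \<otimes> V\<close>
  is, by Koszulness, a consequence of overlaps and of pairs of disjoint relations.\<close>

lemma end_relations_RJ:
  assumes rr: "\<And>u. rr u \<in> R" and f: "\<And>b. b \<in> B \<Longrightarrow> f b \<in> IT"
    and eq: "(\<Sum>u\<in>words l. bvec u \<otimes>\<^bsub>TV\<^esub> rr u) = (\<Sum>b\<in>B. f b \<otimes>\<^bsub>TV\<^esub> vT b)"
  shows "(\<Sum>u\<in>words l. lmul_w u (lmul (rl (rr u)) e0)) \<in> RJ (Suc l)"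
proof (rule koszul_syzygies[OF koszul])
  fix p q :: nat and s :: "nat \<Rightarrow> 'v list \<Rightarrow>\<^sub>0 'k" and c :: "nat \<Rightarrow> nat \<Rightarrow> 'v"
  assume s: "\<And>i. i < p \<Longrightarrow> s i \<in> R"
    and ov: "\<And>l. l < q \<Longrightarrow> \<exists>n r v. overlap scale B R n r v p (c l) s"
    and syz: "\<And>k z f. z \<in> pv.span {a \<otimes>\<^bsub>TV\<^esub> r | a r. a \<in> tensor_power B k \<and> r \<in> R} \<Longrightarrow>
      z = (\<Sum>b\<in>B. f b \<otimes>\<^bsub>TV\<^esub> vT b) \<Longrightarrow> (\<And>b. b \<in> B \<Longrightarrow> f b \<in> IT) \<Longrightarrow>
      \<exists>x y. (\<forall>i<p. x i \<in> IT \<inter> tensor_power B k)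
        \<and> (\<forall>l<q. y l \<in> tensor_power B (k - 1) \<and> (k = 0 \<longrightarrow> y l = 0))
        \<and> z = (\<Sum>i<p. (x i + (\<Sum>l<q. y l \<otimes>\<^bsub>TV\<^esub> vT (c l i))) \<otimes>\<^bsub>TV\<^esub> s i)"
  let ?z = "\<Sum>u\<in>words l. bvec u \<otimes>\<^bsub>TV\<^esub> rr u"
  have words_power: "(bvec u :: 'v list \<Rightarrow>\<^sub>0 'k) \<in> tensor_power B l" if "u \<in> words l" for u
    using that by (auto simp: words_def tensor_power_def carrier_monoid_alg)
  have "?z \<in> pv.span {a \<otimes>\<^bsub>TV\<^esub> r | a r. a \<in> tensor_power B l \<and> r \<in> R}"
    using words_power rr by (intro pv.span_sum pv.span_base) blast
  from syz[OF this eq f] obtain x y where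
    x: "\<forall>i<p. x i \<in> IT \<inter> tensor_power B l"
    and y: "\<forall>i<q. y i \<in> tensor_power B (l - 1) \<and> (l = 0 \<longrightarrow> y i = 0)"
    and z: "?z = (\<Sum>i<p. (x i + (\<Sum>j<q. y j \<otimes>\<^bsub>TV\<^esub> vT (c j i))) \<otimes>\<^bsub>TV\<^esub> s i)" by blast
  define w where "w i = x i + (\<Sum>j<q. y j \<otimes>\<^bsub>TV\<^esub> vT (c j i))" for i
  have yv: "y j \<otimes>\<^bsub>TV\<^esub> vT v \<in> tensor_power B l" if "j < q" for j v
  proof (cases "l = 0")
    case True
    then show ?thesis using y that pv.subspace_0[OF tensor_power_subspace[of l]] by auto
  next
    case False
    then have "y j \<in> tensor_power B (l - 1)" using y that by blast
    then show ?thesis using False hT_mult_vT[of l "y j" v]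
      by (auto simp: tensor_power_iff FM.monoid_alg_closed)
  qed
  have w: "w i \<in> tensor_power B l" if "i < p" for i
    unfolding w_def using x yv that
    by (intro pv.subspace_add[OF tensor_power_subspace] pv.subspace_sum[OF tensor_power_subspace]) auto
  have wz: "?z = (\<Sum>u\<in>words l. bvec u \<otimes>\<^bsub>TV\<^esub> (\<Sum>i<p. pscale (Poly_Mapping.lookup (w i) u) (s i)))"
  proof -
    have "?z = (\<Sum>i<p. \<Sum>u\<in>words l. pscale (Poly_Mapping.lookup (w i) u) (bvec u \<otimes>\<^bsub>TV\<^esub> s i))"
      unfolding z w_def[symmetric]
    proof (rule sum.cong[OF refl])
      fix i assume "i \<in> {..<p}"
      then have "w i = (\<Sum>u\<in>words l. pscale (Poly_Mapping.lookup (w i) u) (bvec u))"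
        by (intro tensor_power_expand w) simp
      then have "w i \<otimes>\<^bsub>TV\<^esub> s i = (\<Sum>u\<in>words l. pscale (Poly_Mapping.lookup (w i) u) (bvec u)) \<otimes>\<^bsub>TV\<^esub> s i"
        by (rule arg_cong)
      then show "w i \<otimes>\<^bsub>TV\<^esub> s i = (\<Sum>u\<in>words l. pscale (Poly_Mapping.lookup (w i) u) (bvec u \<otimes>\<^bsub>TV\<^esub> s i))"
        by (simp only: mult_sums mult_pscales)
    qed
    then show ?thesis by (subst (asm) sum.swap) (simp only: mult_sums mult_pscales)
  qed
  \<comment> \<open>Tensors with different prefixes of the same length are independent, so equality
    of the sums gives equality for each prefix.\<close>
  have rr_eq: "rr u = (\<Sum>i<p. pscale (Poly_Mapping.lookup (w i) u) (s i))" if u: "u \<in> words l" for u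
  proof (rule poly_mapping_eqI)
    fix a
    have *: "Poly_Mapping.lookup (\<Sum>u\<in>words l. bvec u \<otimes>\<^bsub>TV\<^esub> g u) (u @ a) = Poly_Mapping.lookup (g u) a" for g
    proof -
      have "Poly_Mapping.lookup (\<Sum>u\<in>words l. bvec u \<otimes>\<^bsub>TV\<^esub> g u) (u @ a)
        = (\<Sum>v\<in>words l. if v = u then Poly_Mapping.lookup (g u) a else 0)"
        unfolding lookup_sum using u
        by (intro sum.cong refl) (subst lookup_bvec_mult, auto simp: words_def)
      then show ?thesis using u finite_words by simp
    qed
    show "Poly_Mapping.lookup (rr u) a = Poly_Mapping.lookup (\<Sum>i<p. pscale (Poly_Mapping.lookup (w i) u) (s i)) a"
      using wz *[of rr] *[of "\<lambda>u. \<Sum>i<p. pscale (Poly_Mapping.lookup (w i) u) (s i)"] by simp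
  qed
  have m: "lmul (rl (s i)) e0 \<in> MC" if "i < p" for i
    using s[OF that] by (intro lmul_MC rel_carrier e0_MC)
  have "(\<Sum>u\<in>words l. lmul_w u (lmul (rl (rr u)) e0))
      = (\<Sum>u\<in>words l. \<Sum>i<p. pscale (Poly_Mapping.lookup (w i) u) (lmul_w u (lmul (rl (s i)) e0)))"
  proof (rule sum.cong[OF refl])
    fix u assume u: "u \<in> words l"
    have "rl (rr u) = (\<Sum>i<p. pscale (Poly_Mapping.lookup (w i) u) (rl (s i)))"
      unfolding rr_eq[OF u] using s
      by (subst rel_sum) (auto simp: rel_pscale pv.subspace_scale[OF R_subspace])
    then show "lmul_w u (lmul (rl (rr u)) e0) = (\<Sum>i<p. pscale (Poly_Mapping.lookup (w i) u) (lmul_w u (lmul (rl (s i)) e0)))"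
      by (simp only: lin_map_sum[OF lin_map_lmul_left] lin_map_pscale[OF lin_map_lmul_left]
          lin_map_sum[OF lin_map_lmul_w] lin_map_pscale[OF lin_map_lmul_w])
  qed
  also have "\<dots> = (\<Sum>i<p. lmul (iT (w i)) (lmul (rl (s i)) e0))"
  proof (subst sum.swap, rule sum.cong[OF refl])
    fix i assume i: "i \<in> {..<p}"
    have "lmul (iT (\<Sum>u\<in>words l. pscale (Poly_Mapping.lookup (w i) u) (bvec u))) (lmul (rl (s i)) e0)
      = (\<Sum>u\<in>words l. pscale (Poly_Mapping.lookup (w i) u) (lmul (iT (bvec u)) (lmul (rl (s i)) e0)))"
      by (simp only: lin_map_sum[OF lin_map_iT] lin_map_pscale[OF lin_map_iT]
          lin_map_sum[OF lin_map_lmul_left] lin_map_pscale[OF lin_map_lmul_left])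
    also have "\<dots> = (\<Sum>u\<in>words l. pscale (Poly_Mapping.lookup (w i) u) (lmul_w u (lmul (rl (s i)) e0)))"
      using m i by (intro sum.cong) (auto simp: words_def lmul_iT_bvec in_lists_conv_set)
    finally show "(\<Sum>u\<in>words l. pscale (Poly_Mapping.lookup (w i) u) (lmul_w u (lmul (rl (s i)) e0)))
      = lmul (iT (w i)) (lmul (rl (s i)) e0)"
      using tensor_power_expand[OF w, of i] i by simp
  qed
  \<comment> \<open>The syzygy splits into its two kinds: the x i lie in \<open>IT\<close> and give
    disjoint relations, the y j stand in front of overlaps.\<close>
  also have "\<dots> = (\<Sum>i<p. lmul (iT (x i)) (lmul (rl (s i)) e0))
      + (\<Sum>j<q. lmul (iT (y j)) (\<Sum>i<p. lmul_v (c j i) (lmul (rl (s i)) e0)))"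
  proof -
    have "lmul (iT (w i)) (lmul (rl (s i)) e0) = lmul (iT (x i)) (lmul (rl (s i)) e0)
      + (\<Sum>j<q. lmul (iT (y j)) (lmul_v (c j i) (lmul (rl (s i)) e0)))" if i: "i < p" for i
    proof -
      have "lmul (iT (y j \<otimes>\<^bsub>TV\<^esub> vT (c j i))) (lmul (rl (s i)) e0) = lmul (iT (y j)) (lmul_v (c j i) (lmul (rl (s i)) e0))"
        if "j < q" for j
      proof -
        have "y j \<in> carrier TV" using y that by (simp add: tensor_power_def)
        then show ?thesis using m[OF i] by (simp add: iT_mult iT_vT lmul_mult lmul_trip_one)
      qed
      then show ?thesis
        by (simp add: w_def lin_map_add[OF lin_map_iT] lin_map_add[OF lin_map_lmul_left]
            lin_map_sum[OF lin_map_iT] lin_map_sum[OF lin_map_lmul_left])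
    qed
    then have "(\<Sum>i<p. lmul (iT (w i)) (lmul (rl (s i)) e0)) = (\<Sum>i<p. lmul (iT (x i)) (lmul (rl (s i)) e0))
      + (\<Sum>i<p. \<Sum>j<q. lmul (iT (y j)) (lmul_v (c j i) (lmul (rl (s i)) e0)))"
      by (simp add: sum.distrib)
    then show ?thesis by (subst (asm) sum.swap) (simp add: lin_map_sum[OF lin_map_lmul])
  qed
  also have "\<dots> \<in> RJ (Suc l)"
  proof (intro pv.subspace_add[OF subspace_RJ] pv.subspace_sum[OF subspace_RJ])
    show "lmul (iT (x i)) (lmul (rl (s i)) e0) \<in> RJ (Suc l)" if "i \<in> {..<p}" for i
      using x s that by (intro ideal_RJ) auto
    show "lmul (iT (y j)) (\<Sum>i<p. lmul_v (c j i) (lmul (rl (s i)) e0)) \<in> RJ (Suc l)" if j: "j \<in> {..<q}" for j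
    proof (cases l)
      case 0
      then show ?thesis using y j
        by (simp add: lin_map_0[OF lin_map_iT] lin_map_0[OF lin_map_lmul_left] pv.subspace_0[OF subspace_RJ])
    next
      case (Suc l')
      have "\<exists>n r v. overlap scale B R n r v p (c j) s" using ov j by simp
      then obtain n r v where "overlap scale B R n r v p (c j) s" by blast
      moreover have "y j \<in> tensor_power B l'" using y j Suc by simp
      ultimately show ?thesis using overlap_RJ[of "y j" l'] Suc by simp
    qed
  qed
  finally show ?thesis .
qed

text \<open>Induction on the degree. If the leading term vanishes, the leading terms of the
  relations at the ends of words add up to elements of \<open>IT\<close> followed by letters, and
  \<open>end_relations_RJ\<close> rewrites them. Afterwards only parts followed by a letter remain
  in top degree, and the induction hypothesis applies to each of them.\<close>

lemma J1_lead_zero: "x \<in> J1 n \<Longrightarrow> lead n \<one> x = 0 \<Longrightarrow> x \<in> J (n - 1)"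
proof (induction n arbitrary: x)
  case 0
  then show ?case using J1_J by simp
next
  case (Suc k)
  show ?case
  proof (cases k)
    case 0
    have "x \<in> {0}"
      by (rule JG_lin_map[OF lin_map_id pv.subspace_single_0 Suc.prems(1)]) (use 0 in auto)
    then show ?thesis using pv.subspace_0[OF subspace_JG] by simp
  next
    case (Suc l)
    obtain a rr where a: "a \<in> RJ k" and rr: "\<forall>u. rr u \<in> R"
      and x: "x = a + (\<Sum>u\<in>words l. lmul_w u (lmul (rl (rr u)) e0))"
      using J1_decomp[of x l] Suc.prems(1) Suc by blast
    obtain j y where j: "j \<in> J k" "\<forall>b. y b \<in> J1 k" "a = j + (\<Sum>b\<in>B. rmul_b b (y b))"
      using a unfolding RJ_def by blast
    have lw: "lead (Suc k) \<one> (lmul_w u (lmul (rl (rr u)) e0)) = bvec u \<otimes>\<^bsub>TV\<^esub> rr u" if "u \<in> words l" for u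
    proof -
      have u: "u \<in> lists B" "length u = l" using that by (auto simp: words_def)
      then have "bvec u \<otimes>\<^bsub>TV\<^esub> rr u \<in> carrier TV"
        using rr R_carrier by (intro FM.monoid_alg_closed single_in_carrier) auto
      then show ?thesis
        using lead_gen[of u "rr u" "[]" \<one> \<one>] u rr Suc FM.monoid_alg_one_right by simp
    qed
    have "(\<Sum>b\<in>B. lead k \<one> (y b) \<otimes>\<^bsub>TV\<^esub> vT b) + (\<Sum>u\<in>words l. bvec u \<otimes>\<^bsub>TV\<^esub> rr u) = 0"
      using Suc.prems(2) lead_RJ[of j k y] j
      by (simp add: x lin_map_add[OF lin_map_lead] lin_map_sum[OF lin_map_lead] lw)
    then have "(\<Sum>u\<in>words l. bvec u \<otimes>\<^bsub>TV\<^esub> rr u) = (\<Sum>b\<in>B. (- lead k \<one> (y b)) \<otimes>\<^bsub>TV\<^esub> vT b)"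
      by (simp add: mult_uminus sum_negf eq_neg_iff_add_eq_0 add.commute)
    then have "(\<Sum>u\<in>words l. lmul_w u (lmul (rl (rr u)) e0)) \<in> RJ (Suc l)"
      using rr lead_J(1)[of _ k "{\<one>}"] j(2)
      by (intro end_relations_RJ[of rr "\<lambda>b. - lead k \<one> (y b)"]) (auto intro: subspace_uminus[OF S.subspace])
    then have "x \<in> RJ k" using a Suc by (simp add: x pv.subspace_add[OF subspace_RJ])
    then obtain j y where j: "j \<in> J k" "\<forall>b. y b \<in> J1 k" "x = j + (\<Sum>b\<in>B. rmul_b b (y b))"
      unfolding RJ_def by blast
    \<comment> \<open>No cancellation is possible between words with different last letters, so each
      \<open>y b\<close> has leading term zero.\<close>
    then have z: "(\<Sum>b\<in>B. lead k \<one> (y b) \<otimes>\<^bsub>TV\<^esub> vT b) = 0"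
      using Suc.prems(2) lead_RJ[of j k y] by simp
    have "rmul_b b (y b) \<in> J k" if b: "b \<in> B" for b
    proof -
      have "lead k \<one> (y b) = 0"
      proof (rule poly_mapping_eqI)
        fix w
        have "Poly_Mapping.lookup (\<Sum>b\<in>B. lead k \<one> (y b) \<otimes>\<^bsub>TV\<^esub> vT b) (w @ [b])
          = (\<Sum>a\<in>B. if a = b then Poly_Mapping.lookup (lead k \<one> (y b)) w else 0)"
          unfolding lookup_sum lookup_mult_vT by (rule sum.cong) (auto simp: coord_Basis)
        then show "Poly_Mapping.lookup (lead k \<one> (y b)) w = Poly_Mapping.lookup 0 w"
          using z b V.finite_Basis by simp
      qed
      then have "y b \<in> J (k - 1)" using Suc.IH j(2) by blast
      then show ?thesis using J_rmul_b[OF b, of "y b" "k - 1"] Suc by simp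
    qed
    then show ?thesis
      using j(1) by (auto simp: j(3) intro!: pv.subspace_add[OF subspace_JG] pv.subspace_sum[OF subspace_JG])
  qed
qed

text \<open>Right multiplication by group elements splits x into parts whose leading terms sit at
  different group elements; each part reduces to the case where the final group element is
  1.\<close>

lemma J_lead_zero:
  assumes x: "x \<in> J n" and l: "\<And>h. h \<in> carrier G \<Longrightarrow> lead n h x = 0"
  shows "x \<in> J (n - 1)"
proof -
  let ?S = "{x. \<exists>y. (\<forall>g. y g \<in> J1 n) \<and> x = (\<Sum>g\<in>carrier G. rmul_g g (y g))}"
  have "pv.subspace ?S"
  proof (rule pv.subspaceI)
    show "0 \<in> ?S" using pv.subspace_0[OF subspace_JG]
      by (auto intro!: exI[of _ "\<lambda>g. 0"] simp: lin_map_0[OF lin_map_rmul_g])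
    show "x + x' \<in> ?S" if xs: "x \<in> ?S" "x' \<in> ?S" for x x'
    proof -
      obtain y where 1: "\<forall>g. y g \<in> J1 n" "x = (\<Sum>g\<in>carrier G. rmul_g g (y g))" using xs(1) by blast
      obtain y' where 2: "\<forall>g. y' g \<in> J1 n" "x' = (\<Sum>g\<in>carrier G. rmul_g g (y' g))" using xs(2) by blast
      have "x + x' = (\<Sum>g\<in>carrier G. rmul_g g (y g + y' g))"
        by (simp add: 1(2) 2(2) lin_map_add[OF lin_map_rmul_g] sum.distrib)
      moreover have "\<forall>g. y g + y' g \<in> J1 n" using 1 2 pv.subspace_add[OF subspace_JG] by blast
      ultimately show ?thesis by (intro CollectI exI[of _ "\<lambda>g. y g + y' g"] conjI)
    qed
    show "pscale c x \<in> ?S" if x: "x \<in> ?S" for c x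
    proof -
      obtain y where 1: "\<forall>g. y g \<in> J1 n" "x = (\<Sum>g\<in>carrier G. rmul_g g (y g))" using x by blast
      have "pscale c x = (\<Sum>g\<in>carrier G. rmul_g g (pscale c (y g)))"
        by (simp add: 1(2) lin_map_pscale[OF lin_map_rmul_g] pv.scale_sum_right)
      moreover have "\<forall>g. pscale c (y g) \<in> J1 n" using 1 pv.subspace_scale[OF subspace_JG] by blast
      ultimately show ?thesis by (intro CollectI exI[of _ "\<lambda>g. pscale c (y g)"] conjI)
    qed
  qed
  have "x \<in> ?S"
  proof (rule JG_lin_map[OF lin_map_id \<open>pv.subspace ?S\<close> x])
    fix u r v g assume a: "u \<in> lists B" "r \<in> R" "v \<in> lists B" "g \<in> carrier G" "length u + length v + 2 \<le> n"
    let ?y = "lmul_w u (lmul (rl r) (bvec (v, \<one>)))"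
    have y: "?y \<in> J1 n" using a by (intro JG_gen) auto
    have "(\<Sum>h\<in>carrier G. rmul_g h (if h = g then ?y else 0)) = (\<Sum>h\<in>carrier G. if h = g then rmul_g g ?y else 0)"
      by (rule sum.cong) (auto simp: lin_map_0[OF lin_map_rmul_g])
    also have "\<dots> = rmul_g g ?y" using a fin_G by simp
    also have "\<dots> = lmul_w u (lmul (rl r) (bvec (v, g)))"
      using a by (simp add: rmul_lmul_w rmul_g_lmul rel_carrier bvec_MC rmul_g_bvec)
    finally have "lmul_w u (lmul (rl r) (bvec (v, g))) = (\<Sum>h\<in>carrier G. rmul_g h (if h = g then ?y else 0))" ..
    moreover have "\<forall>h. (if h = g then ?y else 0) \<in> J1 n" using y pv.subspace_0[OF subspace_JG] by simp
    ultimately show "lmul_w u (lmul (rl r) (bvec (v, g))) \<in> ?S"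
      by (intro CollectI exI[of _ "\<lambda>h. if h = g then ?y else 0"] conjI)
  qed
  then obtain y where y: "\<forall>g. y g \<in> J1 n" "x = (\<Sum>g\<in>carrier G. rmul_g g (y g))" by blast
  have "y h \<in> J (n - 1)" if h: "h \<in> carrier G" for h
  proof -
    have "lead n h (rmul_g g (y g)) = (if g = h then lead n \<one> (y h) else 0)" if g: "g \<in> carrier G" for g
    proof -
      have "lead n h (rmul_g g (y g)) = lead n (h \<otimes> inv g) (y g)"
        using g h y J_MC[OF J1_J] by (intro lead_rmul_g) auto
      moreover have "h \<otimes> inv g = \<one> \<longleftrightarrow> g = h"
        using g h by (metis inv_equality inv_inv inv_closed r_inv)
      ultimately show ?thesis using lead_J(2)[of "y g" n "{\<one>}" "h \<otimes> inv g"] y(1) h by auto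
    qed
    then have "lead n h x = lead n \<one> (y h)"
      using h fin_G by (simp add: y(2) lin_map_sum[OF lin_map_lead])
    then show ?thesis using l[OF h] y(1) by (intro J1_lead_zero) auto
  qed
  then show ?thesis
    unfolding y(2) by (intro pv.subspace_sum[OF subspace_JG] J_rmul_g)
qed

text \<open>As long as the index exceeds the degree of x, the leading term at the index is zero, and
  the index can be lowered by one.\<close>

lemma J_strict: "x \<in> J N \<Longrightarrow> x \<in> Mfilt n \<Longrightarrow> x \<in> J n"
proof (induction N)
  case 0
  then show ?case by (rule_tac JG_mono) auto
next
  case (Suc N)
  show ?case
  proof (cases "Suc N \<le> n")
    case True
    then show ?thesis using Suc.prems(1) by (rule_tac JG_mono) auto
  next
    case False
    then have "x \<in> J (Suc N - 1)"
      using Suc.prems by (intro J_lead_zero lead_high[OF Suc.prems(2)]) auto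
    then show ?thesis using Suc by simp
  qed
qed

text \<open>The elements of T that send each vector of the module into some \<open>J k\<close> form
  an ideal containing the deformed relations. Applied to the generator \<open>e0\<close>, an element
  x of degree n therefore lands in \<open>J n\<close> by \<open>J_strict\<close>, and the leading
  term there is the normal form of the leading form of x.\<close>

lemma pbw:
  assumes x: "x \<in> Idl\<^bsub>TU\<^esub> (deform_rels scale B G act R \<alpha> \<beta> lam)" and n: "x \<in> bimod_filt G B n"
  shows "hU n x \<in> KU"
proof -
  define N where "N = {x \<in> carrier TU. \<forall>m\<in>MC. \<exists>k. lmul x m \<in> J k}"
  have J_add: "\<exists>k. a + b \<in> J k" if ab: "\<exists>k. a \<in> J k" "\<exists>k. b \<in> J k" for a b
  proof -
    obtain k l where kl: "a \<in> J k" "b \<in> J l" using ab by blast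
    have "a \<in> J (max k l)" "b \<in> J (max k l)"
      using JG_mono[OF kl(1), of "max k l"] JG_mono[OF kl(2), of "max k l"] by auto
    then show ?thesis using pv.subspace_add[OF subspace_JG] by blast
  qed
  have J_word: "\<exists>k. lmul (bvec (g, xs)) m \<in> J k" if "g \<in> carrier G" "xs \<in> lists (B \<times> carrier G)" "m \<in> J l" for g xs m l
    unfolding lmul_bvec using that(1,2)
  proof (induction xs arbitrary: g)
    case Nil
    then show ?case using J_lmul_g that(3) by auto
  next
    case (Cons y ys)
    then have y: "fst y \<in> B" "snd y \<in> carrier G" "ys \<in> lists (B \<times> carrier G)" by (auto simp: mem_Times_iff)
    then obtain k where "lmul_word ys (snd y) m \<in> J k" using Cons.IH by blast
    then show ?case using J_lmul_g[OF _ J_lmul_b[OF y(1)]] Cons.prems(1) by auto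
  qed
  have N: "ideal N TU"
  proof (rule BM.ideal_monoid_algI)
    show "pv.subspace N"
    proof (rule pv.subspaceI)
      show "0 \<in> N" by (auto simp: N_def lin_map_0[OF lin_map_lmul_left] pv.subspace_0[OF subspace_JG])
      show "a + b \<in> N" if "a \<in> N" "b \<in> N" for a b
        using that J_add by (auto simp: N_def lin_map_add[OF lin_map_lmul_left])
      show "pscale c a \<in> N" if "a \<in> N" for c a
        using that by (auto simp: N_def lin_map_pscale[OF lin_map_lmul_left]) (metis pv.subspace_scale subspace_JG)
    qed
    show "N \<subseteq> carrier TU" by (auto simp: N_def)
    fix w a assume w: "w \<in> carrier (bimod_words G B)" and a: "a \<in> N"
    have bw: "bvec w \<in> carrier TU" using w by (rule single_in_carrier)
    have ac: "a \<in> carrier TU" using a by (simp add: N_def)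
    have "\<exists>k. lmul (bvec w \<otimes>\<^bsub>TU\<^esub> a) m \<in> J k" if m: "m \<in> MC" for m
    proof -
      obtain k where "lmul a m \<in> J k" using a m by (auto simp: N_def)
      then show ?thesis using J_word[of "fst w" "snd w" "lmul a m" k] w lmul_mult[OF bw ac m] by (cases w) auto
    qed
    then show "bvec w \<otimes>\<^bsub>TU\<^esub> a \<in> N" using bw ac by (auto simp: N_def BM.monoid_alg_closed)
    have "\<exists>k. lmul (a \<otimes>\<^bsub>TU\<^esub> bvec w) m \<in> J k" if m: "m \<in> MC" for m
      using a lmul_MC[OF bw m] lmul_mult[OF ac bw m] by (auto simp: N_def)
    then show "a \<otimes>\<^bsub>TU\<^esub> bvec w \<in> N" using bw ac by (auto simp: N_def BM.monoid_alg_closed)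
  qed
  have "deform_rels scale B G act R \<alpha> \<beta> lam \<subseteq> N"
  proof
    fix a assume "a \<in> deform_rels scale B G act R \<alpha> \<beta> lam"
    then consider r where "r \<in> R" "a = rl r"
      | g v where "g \<in> carrier G" "a = trip g v \<one> - trip \<one> (act g v) g - iG (lam g v)"
      by (auto simp: deform_rels_def rel_def)
    then show "a \<in> N"
    proof cases
      case 1
      have "\<exists>k. lmul (rl r) m \<in> J k" if m: "m \<in> MC" for m
      proof -
        obtain l where "m \<in> Mfilt l" using MC_Mfilt[OF m] by blast
        then have "lmul_w [] (lmul (rl r) m) \<in> J (l + 2)" using 1 by (intro lmul_rel_J) auto
        then show ?thesis by auto
      qed
      then show ?thesis using 1 rel_carrier by (simp add: N_def)
    next
      case 2
      then have "a \<in> ann" using skew_in_ann by (simp add: skew_in_def)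
      then show ?thesis using pv.subspace_0[OF subspace_JG] by (auto simp: N_def ann_def)
    qed
  qed
  then have "x \<in> N" using x TUR.genideal_minimal[OF N] by blast
  then obtain k where "lmul x e0 \<in> J k" using e0_MC by (auto simp: N_def)
  then have "lmul x e0 \<in> J n" by (rule J_strict[OF _ lmul_one_lead(1)[OF n]])
  then have "nform h (hU n x) \<in> IT" for h
    using lead_J(1)[of "lmul x e0" n "carrier G" h] lmul_one_lead(2)[OF n, of h] by simp
  moreover have "x \<in> carrier TU" using n by (simp add: bimod_filt_def)
  ultimately show ?thesis by (auto simp: KU_def)
qed

end

section \<open>Leading terms of ideals and associated graded algebras\<close>

text \<open>A basis of S is extended to one of T, which is finite because it is independent in the
  span of the finite set Z.\<close>

lemma strict_subspace_dim:
  fixes S T :: "('a \<Rightarrow>\<^sub>0 'k::field) set"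
  assumes "pv.subspace S" "S \<subset> T" "T \<subseteq> pv.span Z" "finite Z"
  shows "pv.dim S < pv.dim T"
proof -
  obtain BS where BS: "BS \<subseteq> S" "pv.independent BS" "S \<subseteq> pv.span BS" "card BS = pv.dim S"
    by (rule pv.basis_exists)
  obtain BT where BT: "BS \<subseteq> BT" "BT \<subseteq> T" "pv.independent BT" "T \<subseteq> pv.span BT"
    using pv.maximal_independent_subset_extend[of BS T] BS assms(2) by blast
  have "finite BT" using pv.independent_span_bound[OF assms(4) BT(3)] BT(2) assms(3) by blast
  moreover have "BS \<noteq> BT"
  proof
    assume "BS = BT"
    then have "T \<subseteq> S" using BT(4) pv.span_minimal[OF BS(1) assms(1)] by blast
    then show False using assms(2) by blast
  qed
  ultimately have "card BS < card BT" using BT(1) by (intro psubset_card_mono) auto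
  moreover have "pv.dim T = card BT" using BT by (intro pv.dim_unique) auto
  ultimately show ?thesis using BS(4) by simp
qed

text \<open>In a strictly ascending chain the dimension would eventually exceed the number of
  elements of Z.\<close>

lemma ascending_subspaces_stabilize:
  fixes Y :: "nat \<Rightarrow> ('a \<Rightarrow>\<^sub>0 'k::field) set"
  assumes "\<And>m. pv.subspace (Y m)" "\<And>m. Y m \<subseteq> Y (Suc m)" "\<And>m. Y m \<subseteq> pv.span Z" "finite Z"
  shows "\<exists>m. Y (Suc m) = Y m"
proof (rule ccontr)
  assume neq: "\<not> ?thesis"
  have lt: "pv.dim (Y m) < pv.dim (Y (Suc m))" for m
  proof (rule strict_subspace_dim[OF assms(1) _ assms(3,4)])
    have "Y (Suc m) \<noteq> Y m" using neq by blast
    then show "Y m \<subset> Y (Suc m)" using assms(2)[of m] by blast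
  qed
  have *: "m \<le> pv.dim (Y m)" for m
  proof (induction m)
    case (Suc m)
    then show ?case using lt[of m] by linarith
  qed simp
  let ?Y = "Y (Suc (card Z))"
  obtain S where S: "S \<subseteq> ?Y" "pv.independent S" "?Y \<subseteq> pv.span S" "card S = pv.dim ?Y"
    by (rule pv.basis_exists)
  have "S \<subseteq> pv.span Z" using S(1) assms(3) by (rule order_trans)
  then have "card S \<le> card Z" using pv.independent_span_bound[OF assms(4) S(2)] by simp
  then show False using *[of "Suc (card Z)"] S(4) by simp
qed

text \<open>The maps take values in a bare type, so dimensions of their images are not available.  Instead one
  iterates the relation \<open>\<theta> x = \<pi> z\<close> from \<open>K\<close>: this gives an ascending chain of subspaces of \<open>Y\<close> with
  first terms \<open>K \<inter> Y\<close> and \<open>L \<inter> Y\<close>, it becomes stationary, and as the images agree two equal consecutive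
  terms force the preceding terms to be equal as well.\<close>

lemma same_image_same_kernel:
  fixes \<theta> \<pi> :: "('a \<Rightarrow>\<^sub>0 'k::field) \<Rightarrow> 'y"
  assumes sub: "pv.subspace Y" "Y \<subseteq> pv.span Z" "finite Z"
    and im: "\<theta> ` Y = \<pi> ` Y"
    and K\<pi>: "\<And>x y. x \<in> Y \<Longrightarrow> y \<in> Y \<Longrightarrow> \<pi> x = \<pi> y \<longleftrightarrow> x - y \<in> K"
    and K\<theta>: "\<And>x y. x \<in> Y \<Longrightarrow> y \<in> Y \<Longrightarrow> \<theta> x = \<theta> y \<longleftrightarrow> x - y \<in> L"
    and K: "pv.subspace K" "pv.subspace L" "K \<subseteq> L"
    and add: "\<And>x y z w. x \<in> Y \<Longrightarrow> y \<in> Y \<Longrightarrow> z \<in> Y \<Longrightarrow> w \<in> Y \<Longrightarrow> \<theta> x = \<pi> z \<Longrightarrow> \<theta> y = \<pi> w \<Longrightarrow> \<theta> (x + y) = \<pi> (z + w)"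
    and scale: "\<And>x z c. x \<in> Y \<Longrightarrow> z \<in> Y \<Longrightarrow> \<theta> x = \<pi> z \<Longrightarrow> \<theta> (pscale c x) = \<pi> (pscale c z)"
    and zero: "\<theta> 0 = \<pi> 0"
  shows "L \<inter> Y \<subseteq> K"
proof -
  define C where "C = rec_nat (K \<inter> Y) (\<lambda>_ Q. {x \<in> Y. \<exists>z\<in>Q. \<theta> x = \<pi> z})"
  have C0: "C 0 = K \<inter> Y" and CS: "C (Suc m) = {x \<in> Y. \<exists>z\<in>C m. \<theta> x = \<pi> z}" for m
    by (simp_all add: C_def)
  have CY: "C m \<subseteq> Y" for m by (cases m) (auto simp: C0 CS)
  note z = pv.subspace_0[OF sub(1)]
  have C: "pv.subspace (C m)" for m
  proof (induction m)
    case 0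
    then show ?case using sub(1) K(1) by (auto simp: C0 pv.subspace_def)
  next
    case (Suc m)
    show ?case
    proof (rule pv.subspaceI)
      show "0 \<in> C (Suc m)" using zero z pv.subspace_0[OF Suc] by (auto simp: CS)
      show "x + y \<in> C (Suc m)" if xy: "x \<in> C (Suc m)" "y \<in> C (Suc m)" for x y
      proof -
        obtain a b where "x \<in> Y" "y \<in> Y" "a \<in> C m" "\<theta> x = \<pi> a" "b \<in> C m" "\<theta> y = \<pi> b" using xy by (auto simp: CS)
        then show ?thesis
          using add[of x y a b] CY[of m] pv.subspace_add[OF Suc] pv.subspace_add[OF sub(1)] by (auto simp: CS)
      qed
      show "pscale c x \<in> C (Suc m)" if x: "x \<in> C (Suc m)" for c x
      proof -
        obtain a where "x \<in> Y" "a \<in> C m" "\<theta> x = \<pi> a" using x by (auto simp: CS)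
        then show ?thesis
          using scale[of x a c] CY[of m] pv.subspace_scale[OF Suc] pv.subspace_scale[OF sub(1)] by (auto simp: CS)
      qed
    qed
  qed
  have C1: "C (Suc 0) = L \<inter> Y"
  proof
    show "C (Suc 0) \<subseteq> L \<inter> Y"
    proof
      fix x assume "x \<in> C (Suc 0)"
      then obtain a where a: "x \<in> Y" "a \<in> Y" "a \<in> K" "\<theta> x = \<pi> a" by (auto simp: CS C0)
      then have "\<pi> a = \<pi> 0" using K\<pi>[of a 0] z by simp
      then have "\<theta> x = \<theta> 0" using a zero by simp
      then show "x \<in> L \<inter> Y" using K\<theta>[of x 0] a z by simp
    qed
    show "L \<inter> Y \<subseteq> C (Suc 0)"
      using K\<theta>[of _ 0] z zero pv.subspace_0[OF K(1)] by (auto simp: CS C0 intro!: bexI[of _ 0])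
  qed
  have mono: "C m \<subseteq> C (Suc m)" for m
  proof (induction m)
    case 0
    then show ?case using C0 C1 K(3) by auto
  next
    case (Suc m)
    show ?case
    proof
      fix x assume "x \<in> C (Suc m)"
      then obtain a where "x \<in> Y" "a \<in> C m" "\<theta> x = \<pi> a" by (auto simp: CS)
      then show "x \<in> C (Suc (Suc m))" using Suc unfolding CS[of "Suc m"] by blast
    qed
  qed
  obtain m where "C (Suc m) = C m"
    using ascending_subspaces_stabilize[of C Z] C mono CY sub by blast
  then have "C (Suc 0) = C 0"
  proof (induction m)
    case (Suc m)
    have "C (Suc m) \<subseteq> C m"
    proof
      fix x assume x: "x \<in> C (Suc m)"
      then have xY: "x \<in> Y" using CY by blast
      \<comment> \<open>As the images agree, \<pi> x is also a value of \<theta>. Its preimage y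
        lies two terms above \<open>C m\<close>, where the chain is already stationary; this
        provides an element of \<open>C m\<close> with the same \<pi>-value as x, hence equal to x
        up to K.\<close>
      then obtain y where y: "y \<in> Y" "\<theta> y = \<pi> x" using im by (metis imageE imageI)
      then have "y \<in> C (Suc (Suc m))" using x unfolding CS[of "Suc m"] by blast
      then have "y \<in> C (Suc m)" using Suc.prems by simp
      then obtain w where w: "w \<in> C m" "\<theta> y = \<pi> w" by (auto simp: CS[of m])
      have wY: "w \<in> Y" using w CY by blast
      have "x - w \<in> K" using y w K\<pi>[OF xY wY] by simp
      then have "x - w \<in> C 0" using xY wY pv.subspace_diff[OF sub(1)] by (simp add: C0)
      moreover have "C 0 \<subseteq> C m" using lift_Suc_mono_le[of C 0 m, OF mono] by simp
      ultimately show "x \<in> C m" using pv.subspace_add[OF C, of "x - w" m w] w by auto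
    qed
    then have "C (Suc m) = C m" using mono[of m] by blast
    then show ?case by (rule Suc.IH)
  qed
  then show ?thesis using C0 C1 by blast
qed

section \<open>The ideal of leading forms\<close>

context quad_setup
begin

text \<open>Each homogeneous component of x must be the degree n part of a member of I of degree at
  most n, zero being allowed. Treating the degrees separately makes this set closed under
  sums.\<close>

definition gr_ideal :: "('g \<times> ('v \<times> 'g) list \<Rightarrow>\<^sub>0 'k) set \<Rightarrow> ('g \<times> ('v \<times> 'g) list \<Rightarrow>\<^sub>0 'k) set" where
  "gr_ideal I = {x \<in> carrier TU. \<forall>n. \<exists>y\<in>I. y \<in> TUf n \<and> hU n y = hU n x}"

lemma ideal_gr_ideal:
  assumes I: "ideal I TU"
  shows "ideal (gr_ideal I) TU"
proof (rule BM.ideal_monoid_algI)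
  note sub = ideal_TU(1)[OF I]
  show "pv.subspace (gr_ideal I)"
  proof (rule pv.subspaceI)
    show "0 \<in> gr_ideal I"
      using pv.subspace_0[OF sub] pv.subspace_0[OF subspace_bimod_filt] by (auto simp: gr_ideal_def intro!: bexI[of _ 0])
    show "x + y \<in> gr_ideal I" if xy: "x \<in> gr_ideal I" "y \<in> gr_ideal I" for x y
      unfolding gr_ideal_def
    proof (intro CollectI conjI allI)
      show "x + y \<in> carrier TU" using xy by (auto simp: gr_ideal_def)
      fix n
      obtain a b where "a \<in> I" "a \<in> TUf n" "hU n a = hU n x" "b \<in> I" "b \<in> TUf n" "hU n b = hU n y"
        using xy unfolding gr_ideal_def by blast
      then show "\<exists>z\<in>I. z \<in> TUf n \<and> hU n z = hU n (x + y)"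
        using pv.subspace_add[OF sub] pv.subspace_add[OF subspace_bimod_filt]
        by (auto intro!: bexI[of _ "a + b"] simp: lin_map_add[OF lin_map_restr_supp])
    qed
    show "pscale c x \<in> gr_ideal I" if x: "x \<in> gr_ideal I" for c x
      unfolding gr_ideal_def
    proof (intro CollectI conjI allI)
      show "pscale c x \<in> carrier TU" using x by (auto simp: gr_ideal_def)
      fix n
      obtain a where "a \<in> I" "a \<in> TUf n" "hU n a = hU n x" using x unfolding gr_ideal_def by blast
      then show "\<exists>z\<in>I. z \<in> TUf n \<and> hU n z = hU n (pscale c x)"
        using pv.subspace_scale[OF sub] pv.subspace_scale[OF subspace_bimod_filt]
        by (auto intro!: bexI[of _ "pscale c a"] simp: lin_map_pscale[OF lin_map_restr_supp])
    qed
  qed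
  show "gr_ideal I \<subseteq> carrier TU" by (auto simp: gr_ideal_def)
  fix w x assume w: "w \<in> carrier (bimod_words G B)" and x: "x \<in> gr_ideal I"
  define m where "m = length (snd w)"
  have bw: "bvec w \<in> carrier TU" using w by (rule single_in_carrier)
  have xc: "x \<in> carrier TU" using x by (simp add: gr_ideal_def)
  have low: "\<exists>y\<in>I. y \<in> TUf n \<and> hU n y = 0" for n
    using pv.subspace_0[OF sub] pv.subspace_0[OF subspace_bimod_filt] lin_map_0[OF lin_map_restr_supp] by blast
  show "bvec w \<otimes>\<^bsub>TU\<^esub> x \<in> gr_ideal I"
    unfolding gr_ideal_def
  proof (intro CollectI conjI allI)
    show "bvec w \<otimes>\<^bsub>TU\<^esub> x \<in> carrier TU" using bw xc by (rule BM.monoid_alg_closed)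
    fix n
    show "\<exists>y\<in>I. y \<in> TUf n \<and> hU n y = hU n (bvec w \<otimes>\<^bsub>TU\<^esub> x)"
    proof (cases "m \<le> n")
      case True
      obtain a where a: "a \<in> I" "a \<in> TUf (n - m)" "hU (n - m) a = hU (n - m) x"
        using x unfolding gr_ideal_def by blast
      have "bvec w \<otimes>\<^bsub>TU\<^esub> a \<in> TUf n"
        using a(2) bw True
        by (auto simp: bimod_filt_iff BM.monoid_alg_closed hU_mult_bvec[OF m_def[symmetric]])
      then show ?thesis
        using a True ideal_TU(3)[OF I a(1) bw] hU_mult_bvec[OF m_def[symmetric]] by (intro bexI[of _ "bvec w \<otimes>\<^bsub>TU\<^esub> a"]) auto
    next
      case False
      then show ?thesis using low hU_mult_bvec(2)[OF m_def[symmetric], of n x] by simp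
    qed
  qed
  show "x \<otimes>\<^bsub>TU\<^esub> bvec w \<in> gr_ideal I"
    unfolding gr_ideal_def
  proof (intro CollectI conjI allI)
    show "x \<otimes>\<^bsub>TU\<^esub> bvec w \<in> carrier TU" using xc bw by (rule BM.monoid_alg_closed)
    fix n
    show "\<exists>y\<in>I. y \<in> TUf n \<and> hU n y = hU n (x \<otimes>\<^bsub>TU\<^esub> bvec w)"
    proof (cases "m \<le> n")
      case True
      obtain a where a: "a \<in> I" "a \<in> TUf (n - m)" "hU (n - m) a = hU (n - m) x"
        using x unfolding gr_ideal_def by blast
      have "a \<otimes>\<^bsub>TU\<^esub> bvec w \<in> TUf n"
        using a(2) bw True
        by (auto simp: bimod_filt_iff BM.monoid_alg_closed hU_mult_bvec[OF m_def[symmetric]])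
      then show ?thesis
        using a True ideal_TU(2)[OF I a(1) bw] hU_mult_bvec[OF m_def[symmetric]] by (intro bexI[of _ "a \<otimes>\<^bsub>TU\<^esub> bvec w"]) auto
    next
      case False
      then show ?thesis using low hU_mult_bvec(1)[OF m_def[symmetric], of n x] by simp
    qed
  qed
qed

lemma hU_in_gr_ideal:
  assumes I: "ideal I TU" and y: "y \<in> I" "y \<in> TUf n"
  shows "hU n y \<in> gr_ideal I"
  unfolding gr_ideal_def
proof (intro CollectI conjI allI)
  have yc: "y \<in> carrier TU" using y(2) by (rule bimod_filt_carrier)
  then show "hU n y \<in> carrier TU" by simp
  fix m
  show "\<exists>z\<in>I. z \<in> TUf m \<and> hU m z = hU m (hU n y)"
  proof (cases "m = n")
    case True
    then show ?thesis using y by (intro bexI[of _ y]) auto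
  next
    case False
    then show ?thesis
      using pv.subspace_0[OF ideal_TU(1)[OF I]] pv.subspace_0[OF subspace_bimod_filt]
      by (intro bexI[of _ 0]) (auto simp: lin_map_0[OF lin_map_restr_supp])
  qed
qed

lemma leading_comps_gr_ideal:
  assumes I: "ideal I TU" and P: "P \<subseteq> I"
  shows "leading_comps G B P \<subseteq> gr_ideal I"
proof
  fix z assume "z \<in> leading_comps G B P"
  then obtain p d where "p \<in> P" "z = hU d p" "p \<in> TUf d"
    by (auto simp: leading_comps_def hom_comp_eq has_filt_degree_def)
  then show "z \<in> gr_ideal I" using hU_in_gr_ideal[OF I] P by blast
qed

end

subsection \<open>Algebra maps with the same kernel\<close>

text \<open>Both algebras are images of one set T with operations, under maps that identify the same
  pairs. Applied to T_kG(U), this compares the associated graded algebra with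
  \<open>S \<rtimes> G\<close>.\<close>

lemma alg_iso_of_same_kernel:
  assumes T: "\<And>x y. x \<in> T \<Longrightarrow> y \<in> T \<Longrightarrow> mu x y \<in> T" "\<And>x y. x \<in> T \<Longrightarrow> y \<in> T \<Longrightarrow> ad x y \<in> T"
      "\<And>c x. x \<in> T \<Longrightarrow> sc c x \<in> T" "e \<in> T"
    and C: "carrier C = \<theta> ` T" "\<And>x y. x \<in> T \<Longrightarrow> y \<in> T \<Longrightarrow> \<theta> x \<otimes>\<^bsub>C\<^esub> \<theta> y = \<theta> (mu x y)"
      "\<And>x y. x \<in> T \<Longrightarrow> y \<in> T \<Longrightarrow> \<theta> x \<oplus>\<^bsub>C\<^esub> \<theta> y = \<theta> (ad x y)"
      "\<And>c x. x \<in> T \<Longrightarrow> c \<odot>\<^bsub>C\<^esub> \<theta> x = \<theta> (sc c x)" "\<one>\<^bsub>C\<^esub> = \<theta> e"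
    and D: "carrier D = \<pi> ` T" "\<And>x y. x \<in> T \<Longrightarrow> y \<in> T \<Longrightarrow> \<pi> x \<otimes>\<^bsub>D\<^esub> \<pi> y = \<pi> (mu x y)"
      "\<And>x y. x \<in> T \<Longrightarrow> y \<in> T \<Longrightarrow> \<pi> x \<oplus>\<^bsub>D\<^esub> \<pi> y = \<pi> (ad x y)"
      "\<And>c x. x \<in> T \<Longrightarrow> c \<odot>\<^bsub>D\<^esub> \<pi> x = \<pi> (sc c x)" "\<one>\<^bsub>D\<^esub> = \<pi> e"
    and ker: "\<And>x y. x \<in> T \<Longrightarrow> y \<in> T \<Longrightarrow> \<theta> x = \<theta> y \<longleftrightarrow> \<pi> x = \<pi> y"
  shows "\<exists>f\<in>alg_iso C D. \<forall>x\<in>T. f (\<theta> x) = \<pi> x"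
proof -
  define f where "f z = \<pi> (SOME x. x \<in> T \<and> \<theta> x = z)" for z
  have f: "f (\<theta> x) = \<pi> x" if x: "x \<in> T" for x
  proof -
    have "(SOME y. y \<in> T \<and> \<theta> y = \<theta> x) \<in> T \<and> \<theta> (SOME y. y \<in> T \<and> \<theta> y = \<theta> x) = \<theta> x"
      by (rule someI[of _ x]) (use x in simp)
    then show ?thesis unfolding f_def using ker[of "SOME y. y \<in> T \<and> \<theta> y = \<theta> x" x] x by simp
  qed
  have "f \<in> ring_hom C D"
    by (rule ring_hom_memI) (auto simp: C D f T)
  moreover have "inj_on f (carrier C)" by (rule inj_onI) (auto simp: C(1) f ker)
  moreover have "f ` carrier C = carrier D" by (auto simp: C(1) D(1) f image_image)
  ultimately have "f \<in> alg_iso C D"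
    by (auto simp: alg_iso_def ring_iso_def bij_betw_def C D f T)
  then show ?thesis using f by blast
qed

subsection \<open>The associated graded algebra of a filtered quotient of the tensor algebra\<close>

lemma k_subspace_coset:
  assumes "k_algebra A" "k_subspace A S" "x \<in> carrier A" "y \<in> carrier A"
  shows "y \<in> S +>\<^bsub>A\<^esub> x \<longleftrightarrow> y \<ominus>\<^bsub>A\<^esub> x \<in> S" "S +>\<^bsub>A\<^esub> x = S +>\<^bsub>A\<^esub> y \<longleftrightarrow> x \<ominus>\<^bsub>A\<^esub> y \<in> S" "x \<in> S +>\<^bsub>A\<^esub> x"
    "(S +>\<^bsub>A\<^esub> x) <+>\<^bsub>A\<^esub> (S +>\<^bsub>A\<^esub> y) = S +>\<^bsub>A\<^esub> (x \<oplus>\<^bsub>A\<^esub> y)" "S +>\<^bsub>A\<^esub> x \<subseteq> carrier A"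
proof -
  interpret k_algebra A by fact
  have S: "S \<subseteq> carrier A" "\<zero>\<^bsub>A\<^esub> \<in> S" "\<And>a b. a \<in> S \<Longrightarrow> b \<in> S \<Longrightarrow> a \<oplus>\<^bsub>A\<^esub> b \<in> S"
    using assms(2) by (auto simp: k_subspace_def)
  have S_inv: "\<ominus>\<^bsub>A\<^esub> a \<in> S" if a: "a \<in> S" for a
  proof -
    have ac: "a \<in> carrier A" using a S by blast
    have "(- 1) \<odot>\<^bsub>A\<^esub> a \<oplus>\<^bsub>A\<^esub> a = (- 1) \<odot>\<^bsub>A\<^esub> a \<oplus>\<^bsub>A\<^esub> 1 \<odot>\<^bsub>A\<^esub> a" using ac by (simp add: k_smult_one)
    also have "\<dots> = 0 \<odot>\<^bsub>A\<^esub> a" using k_smult_l_distr[OF ac, of "- 1" 1] by simp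
    also have "\<dots> = \<zero>\<^bsub>A\<^esub>"
      using k_smult_l_distr[OF ac, of 0 0] k_smult_closed[OF ac, of 0] by (simp add: l_zero add.l_cancel_one')
    finally have "\<ominus>\<^bsub>A\<^esub> a = (- 1) \<odot>\<^bsub>A\<^esub> a" using ac k_smult_closed by (intro minus_equality) auto
    then show ?thesis using assms(2) a by (simp add: k_subspace_def)
  qed
  interpret S: additive_subgroup S A
    by (rule additive_subgroup.intro, rule add.subgroupI) (use S S_inv in \<open>auto simp: a_inv_def\<close>)
  interpret S: abelian_subgroup S A
    by (rule abelian_subgroupI3) (unfold_locales)
  show mem: "y \<in> S +>\<^bsub>A\<^esub> x \<longleftrightarrow> y \<ominus>\<^bsub>A\<^esub> x \<in> S" by (rule S.a_rcos_module_minus[OF ring_axioms assms(3,4)])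
  show "x \<in> S +>\<^bsub>A\<^esub> x" by (rule S.a_rcos_self[OF assms(3)])
  show "(S +>\<^bsub>A\<^esub> x) <+>\<^bsub>A\<^esub> (S +>\<^bsub>A\<^esub> y) = S +>\<^bsub>A\<^esub> (x \<oplus>\<^bsub>A\<^esub> y)" by (rule S.a_rcos_sum[OF assms(3,4)])
  show "S +>\<^bsub>A\<^esub> x \<subseteq> carrier A" by (rule a_r_coset_subset_G[OF S(1) assms(3)])
  show "S +>\<^bsub>A\<^esub> x = S +>\<^bsub>A\<^esub> y \<longleftrightarrow> x \<ominus>\<^bsub>A\<^esub> y \<in> S"
  proof
    assume "S +>\<^bsub>A\<^esub> x = S +>\<^bsub>A\<^esub> y"
    then have "x \<in> S +>\<^bsub>A\<^esub> y" using S.a_rcos_self[OF assms(3)] by simp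
    then show "x \<ominus>\<^bsub>A\<^esub> y \<in> S" using S.a_rcos_module_minus[OF ring_axioms assms(4,3)] by simp
  next
    assume "x \<ominus>\<^bsub>A\<^esub> y \<in> S"
    then have "x \<in> S +>\<^bsub>A\<^esub> y" using S.a_rcos_module_minus[OF ring_axioms assms(4,3)] by simp
    then show "S +>\<^bsub>A\<^esub> x = S +>\<^bsub>A\<^esub> y" using a_repr_independence[OF _ assms(4) S.a_subgroup] by simp
  qed
qed

text \<open>A presentation of H is recorded as a map q from T that induces the filtration of H and
  has kernel I. This allows H to be an arbitrary algebra rather than an algebra of cosets.\<close>

locale filt_quot = quad_setup scale B G act R
  for scale :: "'k::field \<Rightarrow> 'v::ab_group_add \<Rightarrow> 'v" and B :: "'v set"
    and G :: "('g, 'z) monoid_scheme" (structure) and act :: "'g \<Rightarrow> 'v \<Rightarrow> 'v"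
    and R :: "('v list \<Rightarrow>\<^sub>0 'k) set" +
  fixes H :: "('k, 'h, 'm) module_scheme" and F :: "nat \<Rightarrow> 'h set"
    and q :: "('g \<times> ('v \<times> 'g) list \<Rightarrow>\<^sub>0 'k) \<Rightarrow> 'h" and I :: "('g \<times> ('v \<times> 'g) list \<Rightarrow>\<^sub>0 'k) set"
  assumes filt: "filtered_algebra H F"
    and q_carrier: "\<And>x. x \<in> carrier TU \<Longrightarrow> q x \<in> carrier H"
    and q_add: "\<And>x y. x \<in> carrier TU \<Longrightarrow> y \<in> carrier TU \<Longrightarrow> q (x + y) = q x \<oplus>\<^bsub>H\<^esub> q y"
    and q_mult: "\<And>x y. x \<in> carrier TU \<Longrightarrow> y \<in> carrier TU \<Longrightarrow> q (x \<otimes>\<^bsub>TU\<^esub> y) = q x \<otimes>\<^bsub>H\<^esub> q y"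
    and q_smult: "\<And>c x. x \<in> carrier TU \<Longrightarrow> q (pscale c x) = c \<odot>\<^bsub>H\<^esub> q x"
    and q_one: "q (bvec (\<one>, [])) = \<one>\<^bsub>H\<^esub>"
    and q_filt: "\<And>n. q ` TUf n = F n"
    and q_ker: "\<And>x. x \<in> carrier TU \<Longrightarrow> q x = \<zero>\<^bsub>H\<^esub> \<longleftrightarrow> x \<in> I"
    and ideal_I: "ideal I TU"
begin

lemma k_algebra_H: "k_algebra H" and F_sub: "k_subspace H (F n)" and F_mono: "F n \<subseteq> F (Suc n)"
  and F_mult: "x \<in> F i \<Longrightarrow> y \<in> F j \<Longrightarrow> x \<otimes>\<^bsub>H\<^esub> y \<in> F (i + j)"
  using filt by (auto simp: filtered_algebra_def)

sublocale HR: k_algebra H by (rule k_algebra_H)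

abbreviation "FB \<equiv> filt_below H F"

lemma smult_zero: "x \<in> carrier H \<Longrightarrow> c \<odot>\<^bsub>H\<^esub> \<zero>\<^bsub>H\<^esub> = \<zero>\<^bsub>H\<^esub>"
  using HR.k_smult_r_distr[of "\<zero>\<^bsub>H\<^esub>" "\<zero>\<^bsub>H\<^esub>" c] HR.k_smult_closed[of "\<zero>\<^bsub>H\<^esub>" c]
  by (simp add: HR.add.l_cancel_one')

lemma FB_sub: "k_subspace H (FB n)"
proof (cases n)
  case 0
  have "c \<odot>\<^bsub>H\<^esub> \<zero>\<^bsub>H\<^esub> = \<zero>\<^bsub>H\<^esub>" for c using smult_zero[of "\<zero>\<^bsub>H\<^esub>" c] by simp
  then show ?thesis using 0 by (simp add: k_subspace_def filt_below_def)
qed (simp add: filt_below_def F_sub)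

lemma FB_zero: "\<zero>\<^bsub>H\<^esub> \<in> FB n" and FB_carrier: "x \<in> FB n \<Longrightarrow> x \<in> carrier H"
  and FB_add: "x \<in> FB n \<Longrightarrow> y \<in> FB n \<Longrightarrow> x \<oplus>\<^bsub>H\<^esub> y \<in> FB n"
  and FB_smult: "x \<in> FB n \<Longrightarrow> c \<odot>\<^bsub>H\<^esub> x \<in> FB n"
  using FB_sub[of n] by (auto simp: k_subspace_def)

lemma F_carrier: "x \<in> F n \<Longrightarrow> x \<in> carrier H"
  using F_sub[of n] by (auto simp: k_subspace_def)

lemma FB_F: "x \<in> FB n \<Longrightarrow> x \<in> F n"
  using F_sub[of 0] F_mono by (cases n) (auto simp: filt_below_def k_subspace_def)

lemma FB_mult:
  shows "x \<in> FB i \<Longrightarrow> y \<in> F j \<Longrightarrow> x \<otimes>\<^bsub>H\<^esub> y \<in> FB (i + j)" "x \<in> F i \<Longrightarrow> y \<in> FB j \<Longrightarrow> x \<otimes>\<^bsub>H\<^esub> y \<in> FB (i + j)"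
proof -
  show "x \<otimes>\<^bsub>H\<^esub> y \<in> FB (i + j)" if "x \<in> FB i" "y \<in> F j"
  proof (cases i)
    case 0
    then show ?thesis using that F_carrier FB_zero by (simp add: filt_below_def)
  next
    case (Suc i')
    then show ?thesis using that F_mult[of x i' y j] by (simp add: filt_below_def)
  qed
  show "x \<otimes>\<^bsub>H\<^esub> y \<in> FB (i + j)" if "x \<in> F i" "y \<in> FB j"
  proof (cases j)
    case 0
    then show ?thesis using that F_carrier FB_zero[of i] by (simp add: filt_below_def)
  next
    case (Suc j')
    then show ?thesis using that F_mult[of x i y j'] by (simp add: filt_below_def)
  qed
qed

lemma q_zero: "q 0 = \<zero>\<^bsub>H\<^esub>"
  using q_ker[of 0] pv.subspace_0[OF ideal_TU(1)[OF ideal_I]] by simp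

lemma q_diff: "x \<in> carrier TU \<Longrightarrow> y \<in> carrier TU \<Longrightarrow> q (x - y) = q x \<ominus>\<^bsub>H\<^esub> q y"
proof -
  assume xy: "x \<in> carrier TU" "y \<in> carrier TU"
  have "q (- y) \<oplus>\<^bsub>H\<^esub> q y = \<zero>\<^bsub>H\<^esub>" using q_add[of "- y" y] xy q_zero by simp
  then have "\<ominus>\<^bsub>H\<^esub> q y = q (- y)" using xy q_carrier by (intro HR.minus_equality) auto
  then show ?thesis using q_add[of x "- y"] xy by (simp add: a_minus_def)
qed

lemma q_sum:
  assumes "\<And>i. i \<in> J \<Longrightarrow> f i \<in> carrier TU"
  shows "(\<Oplus>\<^bsub>H\<^esub>i\<in>J. q (f i)) = q (\<Sum>i\<in>J. f i)"
  using assms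
  by (induction J rule: infinite_finite_induct) (auto simp: HR.finsum_infinite q_zero q_add q_carrier)

lemma q_F: "x \<in> TUf n \<Longrightarrow> q x \<in> F n"
  using q_filt by blast

text \<open>The graded homomorphism from T onto the associated graded algebra, sending x to the
  classes of its homogeneous components.\<close>

definition symb :: "('g \<times> ('v \<times> 'g) list \<Rightarrow>\<^sub>0 'k) \<Rightarrow> nat \<Rightarrow> 'h set" where
  "symb x = (\<lambda>i. FB i +>\<^bsub>H\<^esub> q (hU i x))"

text \<open>A class in the n-th quotient is zero exactly if the component can be lowered in degree
  by subtracting a member of I. Degree zero is separate, because \<open>filt_below\<close> is the
  zero space there.\<close>

lemma q_hU_FB_iff:
  assumes x: "x \<in> carrier TU"
  shows "q (hU n x) \<in> FB n \<longleftrightarrow> (\<exists>y\<in>I. y \<in> TUf n \<and> hU n y = hU n x)"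
proof
  assume a: "q (hU n x) \<in> FB n"
  show "\<exists>y\<in>I. y \<in> TUf n \<and> hU n y = hU n x"
  proof (cases n)
    case 0
    then have "q (hU n x) = \<zero>\<^bsub>H\<^esub>" using a unfolding filt_below_def by (simp only: nat.case singleton_iff)
    then have "hU n x \<in> I" using q_ker[of "hU n x"] x by blast
    then show ?thesis using hU_filt[OF x, of n] hU_hU[of n n x] by (intro bexI[of _ "hU n x"] conjI) simp_all
  next
    case (Suc k)
    then have "q (hU n x) \<in> q ` TUf k" using a q_filt by (simp add: filt_below_def)
    then obtain z where z: "z \<in> TUf k" "q (hU n x) = q z" by blast
    have zc: "z \<in> carrier TU" using z(1) by (rule bimod_filt_carrier)
    have "q (hU n x - z) = \<zero>\<^bsub>H\<^esub>" using q_diff[of "hU n x" z] x zc z(2) q_carrier by (simp add: HR.r_neg a_minus_def)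
    then have "hU n x - z \<in> I" using q_ker[of "hU n x - z"] x zc by simp
    moreover have "hU n x - z \<in> TUf n"
      using hU_filt[OF x] bimod_filt_mono[OF z(1), of n] Suc
      by (intro pv.subspace_diff[OF subspace_bimod_filt]) auto
    moreover have "hU n (hU n x - z) = hU n x"
      using z(1) Suc by (simp add: lin_map_diff[OF lin_map_restr_supp] bimod_filt_iff)
    ultimately show ?thesis by blast
  qed
next
  assume "\<exists>y\<in>I. y \<in> TUf n \<and> hU n y = hU n x"
  then obtain y where y: "y \<in> I" "y \<in> TUf n" "hU n y = hU n x" by blast
  have yc: "y \<in> carrier TU" using y(2) by (rule bimod_filt_carrier)
  have "q (hU n x - y) = q (hU n x) \<ominus>\<^bsub>H\<^esub> \<zero>\<^bsub>H\<^esub>" using q_diff[of "hU n x" y] x yc q_ker[OF yc] y(1) by simp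
  then have eq: "q (hU n x - y) = q (hU n x)" using q_carrier x by (simp add: a_minus_def)
  show "q (hU n x) \<in> FB n"
  proof (cases n)
    case 0
    then have "hU n x - y = 0" using filt_zero_hU[of y] y by simp
    then show ?thesis using eq q_zero FB_zero by simp
  next
    case (Suc k)
    have "hU n x - y \<in> TUf n"
      using hU_filt[OF x] y(2) by (intro pv.subspace_diff[OF subspace_bimod_filt])
    then have "hU n x - y \<in> TUf k"
      unfolding Suc by (rule bimod_filt_Suc) (use y(3) Suc in \<open>simp add: lin_map_diff[OF lin_map_restr_supp]\<close>)
    then show ?thesis using q_F[of "hU n x - y" k] eq Suc by (simp add: filt_below_def)
  qed
qed

text \<open>This identifies Gr(T/I) with T/gr I: the kernel of \<open>symb\<close> is
  \<open>gr_ideal I\<close>.\<close>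

lemma symb_eq_iff:
  assumes "x \<in> carrier TU" "y \<in> carrier TU"
  shows "symb x = symb y \<longleftrightarrow> x - y \<in> gr_ideal I"
proof -
  have "symb x = symb y \<longleftrightarrow> (\<forall>i. q (hU i x) \<ominus>\<^bsub>H\<^esub> q (hU i y) \<in> FB i)"
    using assms k_subspace_coset(2)[OF k_algebra_H FB_sub] q_carrier by (simp add: symb_def fun_eq_iff)
  also have "\<dots> \<longleftrightarrow> (\<forall>i. q (hU i (x - y)) \<in> FB i)"
    using assms by (simp add: q_diff lin_map_diff[OF lin_map_restr_supp])
  also have "\<dots> \<longleftrightarrow> x - y \<in> gr_ideal I"
    using assms by (simp add: q_hU_FB_iff gr_ideal_def)
  finally show ?thesis .
qed

lemma coset_zero_FB: "FB n +>\<^bsub>H\<^esub> \<zero>\<^bsub>H\<^esub> = FB n"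
  by (rule HR.a_coset_add_zero) (auto intro: FB_carrier)

lemma symb_carrier: "x \<in> carrier TU \<Longrightarrow> symb x \<in> carrier (assoc_graded H F)"
proof -
  assume x: "x \<in> carrier TU"
  obtain n where n: "x \<in> TUf n" using bimod_filt_exists[OF x] by blast
  have "{i. symb x i \<noteq> FB i} \<subseteq> {..n}"
  proof (intro subsetI, rule ccontr)
    fix i assume i: "i \<in> {i. symb x i \<noteq> FB i}" "i \<notin> {..n}"
    then have "hU i x = 0" using n by (simp add: bimod_filt_iff)
    then show False using i by (simp add: symb_def q_zero coset_zero_FB)
  qed
  then have "finite {i. symb x i \<noteq> FB i}" by (rule finite_subset) simp
  moreover have "symb x i \<in> (\<lambda>a. FB i +>\<^bsub>H\<^esub> a) ` F i" for i
    using q_F[OF hU_filt[OF x]] by (auto simp: symb_def)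
  ultimately show ?thesis by (simp add: assoc_graded_def)
qed

text \<open>The last conclusion lets a homogeneous y be lifted to a homogeneous x, as
  \<open>assoc_graded_comp_eq\<close> requires.\<close>

lemma symb_surj_comp:
  assumes y: "y \<in> carrier (assoc_graded H F)"
  obtains x where "x \<in> carrier TU" "symb x = y" "\<And>i. y i = FB i \<Longrightarrow> hU i x = 0"
proof -
  have fin: "finite {i. y i \<noteq> FB i}" and yi: "\<And>i. y i \<in> (\<lambda>a. FB i +>\<^bsub>H\<^esub> a) ` F i"
    using y by (auto simp: assoc_graded_def)
  have "\<exists>x\<in>TUf i. y i = FB i +>\<^bsub>H\<^esub> q x \<and> (y i = FB i \<longrightarrow> x = 0)" for i
  proof (cases "y i = FB i")
    case True
    then show ?thesis using pv.subspace_0[OF subspace_bimod_filt]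
      by (intro bexI[of _ 0]) (auto simp: q_zero coset_zero_FB)
  next
    case False
    obtain a where a: "a \<in> F i" "y i = FB i +>\<^bsub>H\<^esub> a" using yi[of i] by blast
    then have "a \<in> q ` TUf i" using q_filt[of i] by simp
    then obtain z where "z \<in> TUf i" "q z = a" by blast
    then show ?thesis using a False by blast
  qed
  then obtain t where t: "\<And>i. t i \<in> TUf i" "\<And>i. y i = FB i +>\<^bsub>H\<^esub> q (t i)" "\<And>i. y i = FB i \<Longrightarrow> t i = 0"
    by metis
  have tc: "t i \<in> carrier TU" for i using t(1) by (rule bimod_filt_carrier)
  define x where "x = (\<Sum>i | y i \<noteq> FB i. hU i (t i))"
  have xc: "x \<in> carrier TU" using tc by (auto simp: x_def)
  have hx: "hU i x = hU i (t i)" for i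
  proof -
    have "hU i x = (\<Sum>j | y j \<noteq> FB j. if j = i then hU i (t i) else 0)"
      unfolding x_def lin_map_sum[OF lin_map_restr_supp] by (rule sum.cong) auto
    also have "\<dots> = hU i (t i)"
      using fin t(3)[of i] by (auto simp: lin_map_0[OF lin_map_restr_supp])
    finally show ?thesis .
  qed
  have "symb x i = y i" for i
  proof -
    have "q (hU i (t i)) \<ominus>\<^bsub>H\<^esub> q (t i) \<in> FB i"
    proof (cases i)
      case 0
      then have "hU i (t i) = t i" using filt_zero_hU t(1)[of i] by simp
      then show ?thesis using q_carrier[OF tc] FB_zero by (simp add: a_minus_def HR.r_neg)
    next
      case (Suc k)
      have "hU i (t i) - t i \<in> TUf i"
        using hU_filt[OF tc] t(1) by (intro pv.subspace_diff[OF subspace_bimod_filt])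
      then have "hU i (t i) - t i \<in> TUf k"
        unfolding Suc by (rule bimod_filt_Suc) (simp add: lin_map_diff[OF lin_map_restr_supp])
      then show ?thesis using q_F[of "hU i (t i) - t i" k] q_diff[OF hU_carrier[OF tc] tc] Suc
        by (simp add: filt_below_def)
    qed
    then show ?thesis
      unfolding symb_def hx t(2)
      using k_subspace_coset(2)[OF k_algebra_H FB_sub] q_carrier tc by simp
  qed
  moreover have "hU i x = 0" if "y i = FB i" for i
    using hx t(3)[OF that] by (simp add: lin_map_0[OF lin_map_restr_supp])
  ultimately show ?thesis using that xc by blast
qed

lemma carrier_assoc_graded: "carrier (assoc_graded H F) = symb ` carrier TU"
proof
  show "carrier (assoc_graded H F) \<subseteq> symb ` carrier TU"
  proof
    fix y assume "y \<in> carrier (assoc_graded H F)"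
    then show "y \<in> symb ` carrier TU" by (rule symb_surj_comp) blast
  qed
qed (auto simp: symb_carrier)

lemma assoc_graded_comp_eq: "assoc_graded_comp H F d = symb ` {x \<in> carrier TU. hU d x = x}"
proof
  show "assoc_graded_comp H F d \<subseteq> symb ` {x \<in> carrier TU. hU d x = x}"
  proof
    fix y assume "y \<in> assoc_graded_comp H F d"
    then have y: "y \<in> carrier (assoc_graded H F)" "\<And>i. i \<noteq> d \<Longrightarrow> y i = FB i" by (auto simp: assoc_graded_comp_def)
    obtain x where x: "x \<in> carrier TU" "symb x = y" "\<And>i. y i = FB i \<Longrightarrow> hU i x = 0"
      using symb_surj_comp[OF y(1)] by blast
    obtain n where n: "x \<in> TUf n" using bimod_filt_exists[OF x(1)] by blast
    have "x = (\<Sum>i\<le>max n d. hU i x)" using sum_hU[OF bimod_filt_mono[OF n, of "max n d"]] by simp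
    also have "\<dots> = (\<Sum>i\<le>max n d. if i = d then hU d x else 0)"
      using x(3) y(2) by (intro sum.cong) auto
    also have "\<dots> = hU d x" by simp
    finally show "y \<in> symb ` {x \<in> carrier TU. hU d x = x}" using x by auto
  qed
  show "symb ` {x \<in> carrier TU. hU d x = x} \<subseteq> assoc_graded_comp H F d"
  proof clarify
    fix x assume x: "x \<in> carrier TU" "hU d x = x"
    have "symb x i = FB i" if "i \<noteq> d" for i
    proof -
      have "hU i x = 0" using hU_hU[of i d x] x(2) that by simp
      then show ?thesis by (simp add: symb_def q_zero coset_zero_FB)
    qed
    then show "symb x \<in> assoc_graded_comp H F d" using symb_carrier[OF x(1)] by (simp add: assoc_graded_comp_def)
  qed
qed

lemma symb_add: "x \<in> carrier TU \<Longrightarrow> y \<in> carrier TU \<Longrightarrow> symb x \<oplus>\<^bsub>assoc_graded H F\<^esub> symb y = symb (x + y)"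
  using k_subspace_coset(4)[OF k_algebra_H FB_sub] q_carrier
  by (simp add: assoc_graded_def symb_def fun_eq_iff lin_map_add[OF lin_map_restr_supp] q_add)

lemma symb_one: "\<one>\<^bsub>assoc_graded H F\<^esub> = symb (bvec (\<one>, []))"
proof
  fix n
  have "{\<zero>\<^bsub>H\<^esub>} +>\<^bsub>H\<^esub> \<one>\<^bsub>H\<^esub> = {\<one>\<^bsub>H\<^esub>}" by (simp add: a_r_coset_def')
  then have "FB 0 +>\<^bsub>H\<^esub> \<one>\<^bsub>H\<^esub> = {\<one>\<^bsub>H\<^esub>}" by (simp add: filt_below_def)
  moreover have "hU n (bvec (\<one>, []) :: 'g \<times> ('v \<times> 'g) list \<Rightarrow>\<^sub>0 'k) = (if n = 0 then bvec (\<one>, []) else 0)"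
    by simp
  ultimately show "\<one>\<^bsub>assoc_graded H F\<^esub> n = symb (bvec (\<one>, [])) n"
    by (cases n) (simp_all add: assoc_graded_def symb_def q_one q_zero coset_zero_FB)
qed

lemma symb_smult: "x \<in> carrier TU \<Longrightarrow> c \<odot>\<^bsub>assoc_graded H F\<^esub> symb x = symb (pscale c x)"
proof
  fix n assume x: "x \<in> carrier TU"
  note cos = k_subspace_coset[OF k_algebra_H FB_sub]
  let ?a = "q (hU n x)"
  have a: "?a \<in> carrier H" using x q_carrier by simp
  have "FB n +>\<^bsub>H\<^esub> (c \<odot>\<^bsub>H\<^esub> b) = FB n +>\<^bsub>H\<^esub> (c \<odot>\<^bsub>H\<^esub> ?a)" if b: "b \<in> symb x n" for b
  proof -
    have bc: "b \<in> carrier H" using b cos(5)[OF a a] unfolding symb_def by blast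
    have "b \<ominus>\<^bsub>H\<^esub> ?a \<in> FB n" using b cos(1)[OF a bc] by (simp add: symb_def)
    then have d: "c \<odot>\<^bsub>H\<^esub> (b \<ominus>\<^bsub>H\<^esub> ?a) \<in> FB n" by (rule FB_smult)
    have "c \<odot>\<^bsub>H\<^esub> (b \<ominus>\<^bsub>H\<^esub> ?a) \<oplus>\<^bsub>H\<^esub> c \<odot>\<^bsub>H\<^esub> ?a = c \<odot>\<^bsub>H\<^esub> b"
      using a bc HR.k_smult_r_distr[of "b \<ominus>\<^bsub>H\<^esub> ?a" ?a c] by (simp add: a_minus_def HR.a_assoc HR.l_neg)
    then have "c \<odot>\<^bsub>H\<^esub> b \<ominus>\<^bsub>H\<^esub> c \<odot>\<^bsub>H\<^esub> ?a = c \<odot>\<^bsub>H\<^esub> (b \<ominus>\<^bsub>H\<^esub> ?a) \<oplus>\<^bsub>H\<^esub> c \<odot>\<^bsub>H\<^esub> ?a \<ominus>\<^bsub>H\<^esub> c \<odot>\<^bsub>H\<^esub> ?a"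
      by simp
    also have "\<dots> = c \<odot>\<^bsub>H\<^esub> (b \<ominus>\<^bsub>H\<^esub> ?a)"
      using a FB_carrier[OF d] HR.k_smult_closed[OF a, of c] by (simp add: a_minus_def HR.a_assoc HR.r_neg)
    finally have "c \<odot>\<^bsub>H\<^esub> b \<ominus>\<^bsub>H\<^esub> c \<odot>\<^bsub>H\<^esub> ?a = c \<odot>\<^bsub>H\<^esub> (b \<ominus>\<^bsub>H\<^esub> ?a)" .
    then show ?thesis using d a bc HR.k_smult_closed by (subst cos(2)) auto
  qed
  moreover have "?a \<in> symb x n" unfolding symb_def by (rule cos(3)[OF a a])
  ultimately have "(\<Union>b\<in>symb x n. FB n +>\<^bsub>H\<^esub> (c \<odot>\<^bsub>H\<^esub> b)) = FB n +>\<^bsub>H\<^esub> (c \<odot>\<^bsub>H\<^esub> ?a)" by blast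
  then show "(c \<odot>\<^bsub>assoc_graded H F\<^esub> symb x) n = symb (pscale c x) n"
    using x by (simp add: assoc_graded_def symb_def lin_map_pscale[OF lin_map_restr_supp] q_smult)
qed

lemma hU_mult:
  assumes x: "x \<in> carrier TU" and y: "y \<in> carrier TU"
  shows "hU n (x \<otimes>\<^bsub>TU\<^esub> y) = (\<Sum>i\<le>n. hU i x \<otimes>\<^bsub>TU\<^esub> hU (n - i) y)"
proof -
  obtain m where m: "y \<in> TUf m" using bimod_filt_exists[OF y] by blast
  let ?m = "max m n"
  have "hU n (x \<otimes>\<^bsub>TU\<^esub> y) = hU n (x \<otimes>\<^bsub>TU\<^esub> (\<Sum>j\<le>?m. hU j y))"
    using sum_hU[OF bimod_filt_mono[OF m, of ?m]] by simp
  also have "\<dots> = (\<Sum>j\<le>?m. if j \<le> n then hU (n - j) x \<otimes>\<^bsub>TU\<^esub> hU j y else 0)"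
    unfolding mult_sums lin_map_sum[OF lin_map_restr_supp] by (intro sum.cong refl hU_mult_right) simp
  also have "\<dots> = (\<Sum>j\<le>n. hU (n - j) x \<otimes>\<^bsub>TU\<^esub> hU j y)"
    by (rule sum.mono_neutral_cong_right) auto
  also have "\<dots> = (\<Sum>i\<le>n. hU i x \<otimes>\<^bsub>TU\<^esub> hU (n - i) y)"
    by (rule sum.reindex_bij_witness[of _ "\<lambda>i. n - i" "\<lambda>i. n - i"]) auto
  finally show ?thesis .
qed

lemma FB_finsum: "(\<And>i. i \<in> J \<Longrightarrow> f i \<in> FB n) \<Longrightarrow> (\<Oplus>\<^bsub>H\<^esub>i\<in>J. f i) \<in> FB n"
proof (induction J rule: infinite_finite_induct)
  case (insert j J)
  then have "(\<Oplus>\<^bsub>H\<^esub>i\<in>insert j J. f i) = f j \<oplus>\<^bsub>H\<^esub> (\<Oplus>\<^bsub>H\<^esub>i\<in>J. f i)"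
    using FB_carrier by (intro HR.finsum_insert) auto
  then show ?case using insert FB_add by simp
qed (simp_all add: HR.finsum_infinite FB_zero)

lemma finsum_diff:
  assumes "\<And>i. i \<in> J \<Longrightarrow> f i \<in> carrier H" "\<And>i. i \<in> J \<Longrightarrow> g i \<in> carrier H"
  shows "(\<Oplus>\<^bsub>H\<^esub>i\<in>J. f i) \<ominus>\<^bsub>H\<^esub> (\<Oplus>\<^bsub>H\<^esub>i\<in>J. g i) = (\<Oplus>\<^bsub>H\<^esub>i\<in>J. f i \<ominus>\<^bsub>H\<^esub> g i)"
proof -
  have "(\<Oplus>\<^bsub>H\<^esub>i\<in>J. f i \<ominus>\<^bsub>H\<^esub> g i) \<oplus>\<^bsub>H\<^esub> (\<Oplus>\<^bsub>H\<^esub>i\<in>J. g i) = (\<Oplus>\<^bsub>H\<^esub>i\<in>J. (f i \<ominus>\<^bsub>H\<^esub> g i) \<oplus>\<^bsub>H\<^esub> g i)"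
    using assms by (intro HR.finsum_addf[symmetric]) auto
  also have "\<dots> = (\<Oplus>\<^bsub>H\<^esub>i\<in>J. f i)"
    using assms by (intro HR.finsum_cong') (auto simp: a_minus_def HR.a_assoc HR.l_neg)
  finally have eq: "(\<Oplus>\<^bsub>H\<^esub>i\<in>J. f i) = (\<Oplus>\<^bsub>H\<^esub>i\<in>J. f i \<ominus>\<^bsub>H\<^esub> g i) \<oplus>\<^bsub>H\<^esub> (\<Oplus>\<^bsub>H\<^esub>i\<in>J. g i)" ..
  have c: "(\<Oplus>\<^bsub>H\<^esub>i\<in>J. f i \<ominus>\<^bsub>H\<^esub> g i) \<in> carrier H" "(\<Oplus>\<^bsub>H\<^esub>i\<in>J. g i) \<in> carrier H"
    using assms by (auto intro!: HR.finsum_closed)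
  show ?thesis unfolding eq using c by (simp add: a_minus_def HR.a_assoc HR.r_neg)
qed

text \<open>The product in \<open>assoc_graded\<close> is a union over all choices of
  representatives, so the point is that every choice gives the same coset.\<close>

lemma symb_mult:
  assumes x: "x \<in> carrier TU" and y: "y \<in> carrier TU"
  shows "symb x \<otimes>\<^bsub>assoc_graded H F\<^esub> symb y = symb (x \<otimes>\<^bsub>TU\<^esub> y)"
proof
  fix n
  note cos = k_subspace_coset[OF k_algebra_H FB_sub]
  let ?x = "\<lambda>i. q (hU i x)" and ?y = "\<lambda>i. q (hU i y)"
  have xF: "?x i \<in> F i" "?y i \<in> F i" for i using q_F[OF hU_filt[OF x]] q_F[OF hU_filt[OF y]] by auto
  have xc: "?x i \<in> carrier H" "?y i \<in> carrier H" for i using xF F_carrier by auto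
  have target: "symb (x \<otimes>\<^bsub>TU\<^esub> y) n = FB n +>\<^bsub>H\<^esub> (\<Oplus>\<^bsub>H\<^esub>i\<in>{..n}. ?x i \<otimes>\<^bsub>H\<^esub> ?y (n - i))"
    using x y by (simp add: symb_def hU_mult[OF x y] q_sum[symmetric] BM.monoid_alg_closed q_mult)
  have rep: "FB n +>\<^bsub>H\<^esub> (\<Oplus>\<^bsub>H\<^esub>i\<in>{..n}. a i \<otimes>\<^bsub>H\<^esub> b (n - i)) = FB n +>\<^bsub>H\<^esub> (\<Oplus>\<^bsub>H\<^esub>i\<in>{..n}. ?x i \<otimes>\<^bsub>H\<^esub> ?y (n - i))"
    if a: "\<forall>i\<le>n. a i \<in> symb x i" and b: "\<forall>i\<le>n. b i \<in> symb y i" for a b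
  proof -
    have ac: "a i \<in> carrier H" "b i \<in> carrier H" if "i \<le> n" for i
      using a b that cos(5)[OF xc(1) xc(1)] cos(5)[OF xc(2) xc(2)] unfolding symb_def by blast+
    have da: "a i \<ominus>\<^bsub>H\<^esub> ?x i \<in> FB i" if "i \<le> n" for i
      using a that cos(1)[OF xc(1) ac(1)] by (simp add: symb_def)
    have db: "b i \<ominus>\<^bsub>H\<^esub> ?y i \<in> FB i" if "i \<le> n" for i
      using b that cos(1)[OF xc(2) ac(2)] by (simp add: symb_def)
    have bF: "b i \<in> F i" if "i \<le> n" for i
    proof -
      have "(b i \<ominus>\<^bsub>H\<^esub> ?y i) \<oplus>\<^bsub>H\<^esub> ?y i \<in> F i"
        using F_sub[of i] FB_F[OF db[OF that]] xF(2)[of i] by (auto simp: k_subspace_def)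
      then show ?thesis using ac(2)[OF that] xc(2)[of i] by (simp add: a_minus_def HR.a_assoc HR.l_neg)
    qed
    \<comment> \<open>Uses a b - x y = (a - x) b + x (b - y), both summands being of lower
      degree.\<close>
    have d: "a i \<otimes>\<^bsub>H\<^esub> b (n - i) \<ominus>\<^bsub>H\<^esub> ?x i \<otimes>\<^bsub>H\<^esub> ?y (n - i) \<in> FB n" if i: "i \<le> n" for i
    proof -
      have "(a i \<ominus>\<^bsub>H\<^esub> ?x i) \<otimes>\<^bsub>H\<^esub> b (n - i) \<in> FB (i + (n - i))" "?x i \<otimes>\<^bsub>H\<^esub> (b (n - i) \<ominus>\<^bsub>H\<^esub> ?y (n - i)) \<in> FB (i + (n - i))"
        using i da db bF xF by (intro FB_mult; simp)+
      then have "(a i \<ominus>\<^bsub>H\<^esub> ?x i) \<otimes>\<^bsub>H\<^esub> b (n - i) \<oplus>\<^bsub>H\<^esub> ?x i \<otimes>\<^bsub>H\<^esub> (b (n - i) \<ominus>\<^bsub>H\<^esub> ?y (n - i)) \<in> FB n"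
        using i FB_add by simp
      also have "(a i \<ominus>\<^bsub>H\<^esub> ?x i) \<otimes>\<^bsub>H\<^esub> b (n - i) \<oplus>\<^bsub>H\<^esub> ?x i \<otimes>\<^bsub>H\<^esub> (b (n - i) \<ominus>\<^bsub>H\<^esub> ?y (n - i))
          = a i \<otimes>\<^bsub>H\<^esub> b (n - i) \<ominus>\<^bsub>H\<^esub> ?x i \<otimes>\<^bsub>H\<^esub> ?y (n - i)"
        using ac[OF i] ac[of "n - i"] xc[of i] xc[of "n - i"]
        by (simp add: a_minus_def HR.l_distr HR.r_distr HR.l_minus HR.r_minus HR.a_assoc HR.r_neg1)
      finally show ?thesis .
    qed
    have "(\<Oplus>\<^bsub>H\<^esub>i\<in>{..n}. a i \<otimes>\<^bsub>H\<^esub> b (n - i)) \<ominus>\<^bsub>H\<^esub> (\<Oplus>\<^bsub>H\<^esub>i\<in>{..n}. ?x i \<otimes>\<^bsub>H\<^esub> ?y (n - i)) \<in> FB n"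
      using ac xc d by (subst finsum_diff) (auto intro!: FB_finsum)
    then show ?thesis using ac xc by (subst cos(2)) (auto intro!: HR.finsum_closed)
  qed
  have x0: "\<forall>i\<le>n. ?x i \<in> symb x i" and y0: "\<forall>i\<le>n. ?y i \<in> symb y i"
    using cos(3)[OF xc(1) xc(1)] cos(3)[OF xc(2) xc(2)] by (auto simp: symb_def)
  have "(\<Union>a\<in>{a. \<forall>i\<le>n. a i \<in> symb x i}. \<Union>b\<in>{b. \<forall>i\<le>n. b i \<in> symb y i}.
      FB n +>\<^bsub>H\<^esub> (\<Oplus>\<^bsub>H\<^esub>i\<in>{..n}. a i \<otimes>\<^bsub>H\<^esub> b (n - i))) = symb (x \<otimes>\<^bsub>TU\<^esub> y) n" (is "?L = _")
  proof
    show "?L \<subseteq> symb (x \<otimes>\<^bsub>TU\<^esub> y) n" unfolding target using rep by blast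
    show "symb (x \<otimes>\<^bsub>TU\<^esub> y) n \<subseteq> ?L"
    proof
      fix z assume "z \<in> symb (x \<otimes>\<^bsub>TU\<^esub> y) n"
      then have "z \<in> FB n +>\<^bsub>H\<^esub> (\<Oplus>\<^bsub>H\<^esub>i\<in>{..n}. ?x i \<otimes>\<^bsub>H\<^esub> ?y (n - i))" unfolding target .
      then show "z \<in> ?L" using x0 y0 by (intro UN_I[of ?x] UN_I[of ?y]) auto
    qed
  qed
  then show "(symb x \<otimes>\<^bsub>assoc_graded H F\<^esub> symb y) n = symb (x \<otimes>\<^bsub>TU\<^esub> y) n"
    by (simp add: assoc_graded_def)
qed

lemma graded_iso_if_gr_ideal_KU:
  assumes "gr_ideal I = KU"
  shows "graded_isomorphic (assoc_graded H F) (assoc_graded_comp H F) AA (skew_quad_comp scale B G act R)"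
proof -
  have "\<exists>f\<in>alg_iso (assoc_graded H F) AA. \<forall>x\<in>carrier TU. f (symb x) = proj x"
  proof (rule alg_iso_of_same_kernel[where mu = "\<lambda>x y. x \<otimes>\<^bsub>TU\<^esub> y" and ad = "(+)" and sc = pscale and e = "bvec (\<one>, [])"])
    show "symb x = symb y \<longleftrightarrow> proj x = proj y" if "x \<in> carrier TU" "y \<in> carrier TU" for x y
      using that by (simp add: symb_eq_iff proj_eq_iff assms)
  qed (auto simp: BM.monoid_alg_closed carrier_assoc_graded symb_mult symb_add symb_smult symb_one
      carrier_AA proj_mult proj_add proj_smult proj_one)
  then obtain f where f: "f \<in> alg_iso (assoc_graded H F) AA" "\<And>x. x \<in> carrier TU \<Longrightarrow> f (symb x) = proj x" by blast
  have "f ` assoc_graded_comp H F d = skew_quad_comp scale B G act R d" for d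
    unfolding assoc_graded_comp_eq skew_quad_comp_eq image_image using f(2) by (intro image_cong) auto
  then show ?thesis unfolding graded_isomorphic_def using f(1) by blast
qed

end

section \<open>The two implications\<close>

context quad_setup
begin

text \<open>The leading forms of the deformed relations are the undeformed ones, and these generate
  \<open>KU\<close>. The converse inclusion is the substance of the PBW property.\<close>

lemma KU_subset_gr_ideal:
  assumes N: "skew_in N lam" and rel: "\<And>r. r \<in> R \<Longrightarrow> \<beta> r \<in> carrier kG \<and> rel \<alpha> \<beta> r \<in> N"
  shows "KU \<subseteq> gr_ideal N"
proof (rule KU_minimal)
  note I = skew_in_ideal[OF N]
  show "ideal (gr_ideal N) TU" by (rule ideal_gr_ideal[OF I])
  show "iT ` R \<subseteq> gr_ideal N"
  proof (rule image_subsetI)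
    fix r assume r: "r \<in> R"
    have "hU 2 (rel \<alpha> \<beta> r) \<in> gr_ideal N" using hU_in_gr_ideal[OF I] rel[OF r] rel_lead[OF r] by blast
    then show "iT r \<in> gr_ideal N" using rel[OF r] rel_lead[OF r] by simp
  qed
  show "skew_gens \<subseteq> gr_ideal N"
  proof
    fix x assume "x \<in> skew_gens"
    then obtain g v where x: "x = trip g v \<one> - trip \<one> (act g v) g" and g: "g \<in> carrier G" by (auto simp: skew_gens_def)
    have l: "lam g v \<in> carrier kG" "trip g v \<one> - trip \<one> (act g v) g - iG (lam g v) \<in> N"
      using N g by (auto simp: skew_in_def)
    have "hU 1 (trip g v \<one> - trip \<one> (act g v) g - iG (lam g v)) \<in> gr_ideal N"
      using hU_in_gr_ideal[OF I l(2)] skew_lead[OF g l(1)] by blast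
    then show "x \<in> gr_ideal N" using skew_lead[OF g l(1)] x by simp
  qed
qed

lemma in_KU_if_hU:
  assumes "x \<in> carrier TU" "\<And>n. hU n x \<in> KU"
  shows "x \<in> KU"
proof -
  obtain n where "x \<in> TUf n" using bimod_filt_exists[OF assms(1)] by blast
  then have "x = (\<Sum>i\<le>n. hU i x)" by (simp add: sum_hU)
  also have "\<dots> \<in> KU" by (intro pv.subspace_sum[OF ideal_TU(1)[OF ideal_KU]] assms(2))
  finally show ?thesis .
qed

lemma leading_compsI:
  assumes "p \<in> P" "p \<in> TUf d" "hU d p \<noteq> 0"
  shows "hU d p \<in> leading_comps G B P"
proof -
  have "p \<notin> filt_below TU TUf d"
  proof (cases d)
    case 0
    then show ?thesis using assms(3) lin_map_0[OF lin_map_restr_supp] by (auto simp: filt_below_def)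
  next
    case (Suc n)
    then show ?thesis using assms(3) by (auto simp: filt_below_def bimod_filt_iff)
  qed
  then show ?thesis using assms by (auto simp: leading_comps_def has_filt_degree_def hom_comp_eq)
qed

text \<open>The map q is the projection of T onto its quotient followed by the inverse of the given
  isomorphism.\<close>

lemma filt_quot_of_iso:
  assumes H: "filtered_algebra H F" and I: "ideal I TU"
    and iso: "filtered_isomorphic H F (alg_quot TU I) (quot_image TU I TUf)"
  shows "\<exists>q. filt_quot scale B G act R H F q I"
proof -
  interpret MI: monoid_alg_ideal "bimod_words G B" I
    by (intro monoid_alg_ideal.intro monoid_alg_ideal_axioms.intro I monoid_bimod_words)
  interpret HR: k_algebra H using H by (simp add: filtered_algebra_def)
  let ?Q = "alg_quot TU I"
  obtain f where f: "f \<in> alg_iso H ?Q" "\<And>n. f ` F n = quot_image TU I TUf n"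
    using iso unfolding filtered_isomorphic_def by blast
  have hom: "f \<in> ring_hom H ?Q" and bij: "bij_betw f (carrier H) (carrier ?Q)"
    and sm: "\<And>c x. x \<in> carrier H \<Longrightarrow> f (c \<odot>\<^bsub>H\<^esub> x) = c \<odot>\<^bsub>?Q\<^esub> f x"
    using f(1) by (auto simp: alg_iso_def ring_iso_def)
  define q where "q x = inv_into (carrier H) f (I +>\<^bsub>TU\<^esub> x)" for x
  have q: "q x \<in> carrier H" "f (q x) = I +>\<^bsub>TU\<^esub> x" if "x \<in> carrier TU" for x
  proof -
    have "I +>\<^bsub>TU\<^esub> x \<in> f ` carrier H" using bij that MI.carrier_alg_quot by (auto simp: bij_betw_def)
    then show "q x \<in> carrier H" "f (q x) = I +>\<^bsub>TU\<^esub> x"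
      unfolding q_def by (rule inv_into_into, rule f_inv_into_f)
  qed
  have inj: "a = b" if "a \<in> carrier H" "b \<in> carrier H" "f a = f b" for a b
    using bij that by (auto simp: bij_betw_def inj_on_def)
  have f0: "f \<zero>\<^bsub>H\<^esub> = I" using ring_hom_zero[OF hom HR.ring_axioms MI.alg_quot_ring] MI.alg_quot_one_zero by simp
  have F: "F n \<subseteq> carrier H" for n using H by (auto simp: filtered_algebra_def k_subspace_def)
  have "filt_quot_axioms B G H F q I"
  proof
    fix x y c assume x: "x \<in> carrier TU"
    show "q (pscale c x) = c \<odot>\<^bsub>H\<^esub> q x"
      using x by (intro inj) (auto simp: q HR.k_smult_closed sm MI.alg_quot_smult)
    show "q x = \<zero>\<^bsub>H\<^esub> \<longleftrightarrow> x \<in> I"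
      using inj[of "q x" "\<zero>\<^bsub>H\<^esub>"] q[OF x] f0 MI.coset_eq_zero_iff[OF x] by auto
    assume y: "y \<in> carrier TU"
    show "q (x + y) = q x \<oplus>\<^bsub>H\<^esub> q y"
      using x y by (intro inj) (auto simp: q ring_hom_add[OF hom] MI.alg_quot_ops)
    show "q (x \<otimes>\<^bsub>TU\<^esub> y) = q x \<otimes>\<^bsub>H\<^esub> q y"
      using x y by (intro inj) (auto simp: q ring_hom_mult[OF hom] MI.alg_quot_ops BM.monoid_alg_closed)
  next
    show "q (bvec (\<one>, [])) = \<one>\<^bsub>H\<^esub>"
      using MI.alg_quot_one_zero(1) by (intro inj) (auto simp: q ring_hom_one[OF hom])
  next
    fix n
    have "q ` TUf n \<subseteq> carrier H" using q(1) bimod_filt_carrier by blast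
    moreover have "f ` q ` TUf n = f ` F n"
      unfolding f(2) quot_image_def image_image using q(2) bimod_filt_carrier by (intro image_cong) auto
    ultimately show "q ` TUf n = F n" using inj_on_image_eq_iff[of f "carrier H"] bij F by (auto simp: bij_betw_def)
  qed (use H I q in auto)
  then show ?thesis using filt_quot.intro[OF quad_setup_axioms] by blast
qed

end

section \<open>The conditions imply the PBW property\<close>

context pbw_setup
begin

abbreviation "ND \<equiv> Idl\<^bsub>TU\<^esub> (deform_rels scale B G act R \<alpha> \<beta> lam)"

lemma deform_rels_carrier: "deform_rels scale B G act R \<alpha> \<beta> lam \<subseteq> carrier TU"
  by (auto simp: deform_rels_def R_carrier beta_kG lam_kG)

lemma skew_in_ND: "skew_in ND lam" and rel_ND: "r \<in> R \<Longrightarrow> rl r \<in> ND"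
proof -
  note N = BM.Idl_monoid_alg(1,2)[OF deform_rels_carrier]
  show "rl r \<in> ND" if "r \<in> R" using that by (intro subsetD[OF N(2)]) (auto simp: deform_rels_def rel_def)
  have "trip g v \<one> - trip \<one> (act g v) g - iG (lam g v) \<in> ND" if "g \<in> carrier G" for g v
    using that by (intro subsetD[OF N(2)]) (auto simp: deform_rels_def)
  then show "skew_in ND lam" using N(1) lam_kG by (auto simp: skew_in_def)
qed

lemma gr_ideal_ND: "gr_ideal ND = KU"
proof
  show "KU \<subseteq> gr_ideal ND" 
    by (rule KU_subset_gr_ideal[where \<alpha> = \<alpha> and \<beta> = \<beta>, OF skew_in_ND]) (simp add: rel_ND beta_kG)
  show "gr_ideal ND \<subseteq> KU"
  proof
    fix x assume x: "x \<in> gr_ideal ND"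
    have "hU n x \<in> KU" for n
    proof -
      obtain y where "y \<in> ND" "y \<in> TUf n" "hU n y = hU n x" using x unfolding gr_ideal_def by blast
      then show ?thesis using pbw[of y n] by simp
    qed
    moreover have "x \<in> carrier TU" using x by (simp add: gr_ideal_def)
    ultimately show "x \<in> KU" by (rule in_KU_if_hU[rotated])
  qed
qed

lemma Idl_leading_comps: "Idl\<^bsub>TU\<^esub> (leading_comps G B (deform_rels scale B G act R \<alpha> \<beta> lam)) = KU"
proof -
  let ?P = "deform_rels scale B G act R \<alpha> \<beta> lam"
  let ?L = "leading_comps G B ?P"
  have LK: "?L \<subseteq> KU"
    using leading_comps_gr_ideal[OF BM.Idl_monoid_alg(1,2)[OF deform_rels_carrier]] gr_ideal_ND by simp
  then have Lc: "?L \<subseteq> carrier TU" using ideal_TU(4)[OF ideal_KU] by blast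
  note N = BM.Idl_monoid_alg[OF Lc]
  \<comment> \<open>\<open>leading_comps\<close> lists p only in the degree of p itself; if d is
    larger than that degree, or p is zero, then \<open>hU d p\<close> is zero and lies in the ideal
    anyway.\<close>
  have LI: "hU d p \<in> Idl\<^bsub>TU\<^esub> ?L" if "p \<in> ?P" "p \<in> TUf d" for p d
    using leading_compsI[OF that] N(2) pv.subspace_0[OF N(3)] by (cases "hU d p = 0") auto
  have "KU \<subseteq> Idl\<^bsub>TU\<^esub> ?L"
  proof (rule KU_minimal[OF N(1)])
    show "iT ` R \<subseteq> Idl\<^bsub>TU\<^esub> ?L"
    proof (rule image_subsetI)
      fix r assume r: "r \<in> R"
      then have "rl r \<in> ?P" by (auto simp: deform_rels_def rel_def)
      then have "hU 2 (rl r) \<in> Idl\<^bsub>TU\<^esub> ?L" using rel_lead[of r \<beta> \<alpha>, OF r beta_kG[OF r]] by (intro LI) auto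
      then show "iT r \<in> Idl\<^bsub>TU\<^esub> ?L" using rel_lead[of r \<beta> \<alpha>, OF r beta_kG[OF r]] by simp
    qed
    show "skew_gens \<subseteq> Idl\<^bsub>TU\<^esub> ?L"
    proof
      fix x assume "x \<in> skew_gens"
      then obtain g v where x: "x = trip g v \<one> - trip \<one> (act g v) g" and g: "g \<in> carrier G" by (auto simp: skew_gens_def)
      have "trip g v \<one> - trip \<one> (act g v) g - iG (lam g v) \<in> ?P" using g by (auto simp: deform_rels_def)
      then have "hU 1 (trip g v \<one> - trip \<one> (act g v) g - iG (lam g v)) \<in> Idl\<^bsub>TU\<^esub> ?L"
        using skew_lead[OF g lam_kG[OF g]] by (intro LI) auto
      then show "x \<in> Idl\<^bsub>TU\<^esub> ?L" using skew_lead[OF g lam_kG[OF g]] x by simp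
    qed
  qed
  then show ?thesis using TUR.genideal_minimal[OF ideal_KU LK] by blast
qed

lemma pbw_deformation_if_iso:
  assumes H: "filtered_algebra H F"
    and iso: "filtered_isomorphic H F (deform_alg scale B G act R \<alpha> \<beta> lam) (deform_filt scale B G act R \<alpha> \<beta> lam)"
  shows "pbw_deformation scale B G act R H F"
proof -
  have iso': "filtered_isomorphic H F (alg_quot TU ND) (quot_image TU ND TUf)"
    using iso by (simp add: deform_alg_def deform_filt_def)
  obtain q where "filt_quot scale B G act R H F q ND"
    using filt_quot_of_iso[OF H BM.Idl_monoid_alg(1)[OF deform_rels_carrier] iso'] by blast
  then interpret Q: filt_quot scale B G act R H F q ND .
  show ?thesis
    unfolding pbw_deformation_def
    using Q.graded_iso_if_gr_ideal_KU[OF gr_ideal_ND] iso' Idl_leading_comps KU_eq_Idl deform_rels_carrier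
    by (intro exI[of _ "deform_rels scale B G act R \<alpha> \<beta> lam"]) simp
qed

end

section \<open>A graded isomorphism determines the ideal of leading forms\<close>

context filt_quot
begin

lemma hU_gr_ideal: "x \<in> gr_ideal I \<Longrightarrow> hU n x \<in> gr_ideal I"
proof -
  assume "x \<in> gr_ideal I"
  then obtain y where "y \<in> I" "y \<in> TUf n" "hU n y = hU n x" unfolding gr_ideal_def by blast
  then show ?thesis using hU_in_gr_ideal[OF ideal_I, of y n] by simp
qed

text \<open>The isomorphism need not carry the class of x to \<open>proj x\<close>, so kernels
  cannot be compared directly. In every degree, however, \<open>proj\<close> and the composite of
  \<open>symb\<close> with the isomorphism have the same image on a finite-dimensional space, and
  one kernel contains the other; \<open>same_image_same_kernel\<close> gives equality.\<close>

lemma gr_ideal_eq_KU: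
  assumes K: "KU \<subseteq> gr_ideal I"
    and iso: "graded_isomorphic (assoc_graded H F) (assoc_graded_comp H F) AA (skew_quad_comp scale B G act R)"
  shows "gr_ideal I = KU"
proof
  obtain f where f: "f \<in> alg_iso (assoc_graded H F) AA"
    "\<And>d. f ` assoc_graded_comp H F d = skew_quad_comp scale B G act R d"
    using iso unfolding graded_isomorphic_def by blast
  have hom: "f \<in> ring_hom (assoc_graded H F) AA" and bij: "bij_betw f (carrier (assoc_graded H F)) (carrier AA)"
    and sm: "\<And>c x. x \<in> carrier (assoc_graded H F) \<Longrightarrow> f (c \<odot>\<^bsub>assoc_graded H F\<^esub> x) = c \<odot>\<^bsub>AA\<^esub> f x"
    using f(1) by (auto simp: alg_iso_def ring_iso_def)
  define \<theta> where "\<theta> x = f (symb x)" for x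
  have \<theta>_add: "\<theta> (x + y) = \<theta> x \<oplus>\<^bsub>AA\<^esub> \<theta> y" if "x \<in> carrier TU" "y \<in> carrier TU" for x y
    using that by (simp add: \<theta>_def symb_add[symmetric] ring_hom_add[OF hom] symb_carrier)
  have \<theta>_smult: "\<theta> (pscale c x) = c \<odot>\<^bsub>AA\<^esub> \<theta> x" if "x \<in> carrier TU" for c x
    using that by (simp add: \<theta>_def symb_smult[symmetric] sm symb_carrier)
  have \<theta>_carrier: "\<theta> x \<in> carrier AA" if "x \<in> carrier TU" for x
    using that ring_hom_closed[OF hom] symb_carrier by (simp add: \<theta>_def)
  have \<theta>_zero: "\<theta> 0 = proj 0"
  proof -
    have "\<theta> 0 \<oplus>\<^bsub>AA\<^esub> \<theta> 0 = \<theta> 0" using \<theta>_add[of 0 0] by simp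
    then have "\<theta> 0 = \<zero>\<^bsub>AA\<^esub>" using \<theta>_carrier[of 0] AG.add.l_cancel_one[of "\<theta> 0" "\<theta> 0"] by simp
    then show ?thesis by (simp add: proj_zero)
  qed
  have \<theta>_eq: "\<theta> x = \<theta> y \<longleftrightarrow> x - y \<in> gr_ideal I" if "x \<in> carrier TU" "y \<in> carrier TU" for x y
    using that bij symb_carrier symb_eq_iff[OF that] by (auto simp: \<theta>_def bij_betw_def inj_on_def)
  show "gr_ideal I \<subseteq> KU"
  proof
    fix x assume x: "x \<in> gr_ideal I"
    then have xc: "x \<in> carrier TU" by (simp add: gr_ideal_def)
    have "hU d x \<in> KU" for d
    proof -
      let ?Y = "{x \<in> carrier TU. hU d x = x}" and ?Z = "bvec ` {w \<in> carrier (bimod_words G B). length (snd w) = d}"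
      have "finite {xs. set xs \<subseteq> B \<times> carrier G \<and> length xs = d}"
        using V.finite_Basis fin_G by (intro finite_lists_length_eq) simp
      then have "finite (carrier G \<times> {xs. set xs \<subseteq> B \<times> carrier G \<and> length xs = d})" using fin_G by simp
      then have fin: "finite ?Z" by (intro finite_imageI) (rule finite_subset[rotated], auto simp: in_lists_conv_set)
      have span: "?Y \<subseteq> pv.span ?Z"
      proof
        fix y assume y: "y \<in> ?Y"
        show "y \<in> pv.span ?Z"
        proof (rule in_subspace_if_bvecs[OF pv.subspace_span])
          fix w assume w: "w \<in> Poly_Mapping.keys y"
          then have "w \<in> Poly_Mapping.keys (hU d y)" using y by simp
          then have "length (snd w) = d" unfolding keys_restr_supp by simp
          moreover have "Poly_Mapping.keys y \<subseteq> carrier (bimod_words G B)" using y carrier_monoid_alg[of y "bimod_words G B"] by simp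
          then have "w \<in> carrier (bimod_words G B)" using w by (rule subsetD)
          ultimately have "w \<in> {w \<in> carrier (bimod_words G B). length (snd w) = d}" by blast
          then show "bvec w \<in> pv.span ?Z" by (intro pv.span_base imageI)
        qed
      qed
      have sub: "pv.subspace ?Y"
        by (rule pv.subspaceI) (auto simp: lin_map_0[OF lin_map_restr_supp] lin_map_add[OF lin_map_restr_supp]
            lin_map_pscale[OF lin_map_restr_supp])
      have im: "\<theta> ` ?Y = proj ` ?Y"
        using f(2)[of d] unfolding assoc_graded_comp_eq skew_quad_comp_eq \<theta>_def image_image .
      have "gr_ideal I \<inter> ?Y \<subseteq> KU"
      proof (rule same_image_same_kernel[OF sub span fin im _ _ _ _ K _ _ \<theta>_zero])
        show "pv.subspace KU" "pv.subspace (gr_ideal I)"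
          using ideal_TU(1)[OF ideal_KU] ideal_TU(1)[OF ideal_gr_ideal[OF ideal_I]] .
      qed (auto simp: proj_eq_iff \<theta>_eq \<theta>_add proj_add \<theta>_smult proj_smult)
      moreover have "hU d x \<in> ?Y" using xc by simp
      ultimately show ?thesis using hU_gr_ideal[OF x] by blast
    qed
    then show "x \<in> KU" by (rule in_KU_if_hU[OF xc])
  qed
qed (rule K)

end

section \<open>Parameters of a PBW deformation and the six conditions\<close>

locale graded_ideal = quad_setup scale B G act R
  for scale :: "'k::field \<Rightarrow> 'v::ab_group_add \<Rightarrow> 'v" and B :: "'v set"
    and G :: "('g, 'z) monoid_scheme" (structure) and act :: "'g \<Rightarrow> 'v \<Rightarrow> 'v"
    and R :: "('v list \<Rightarrow>\<^sub>0 'k) set" +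
  fixes I :: "('g \<times> ('v \<times> 'g) list \<Rightarrow>\<^sub>0 'k) set"
  assumes ideal_I: "ideal I TU" and gr_I: "gr_ideal I = KU"
begin

lemmas I_sub = ideal_TU(1)[OF ideal_I]

text \<open>Degree zero in the form left by the simplifier, which turns \<open>length xs = 0\<close>
  into \<open>xs = []\<close>.\<close>

lemma hU_0_iG: "restr_supp (\<lambda>u. snd u = []) (iG c) = (iG c :: 'g \<times> ('v \<times> 'g) list \<Rightarrow>\<^sub>0 'k)"
  using hU_iG[of 0 c] by simp

text \<open>The part in V \<otimes> kG would be a leading form, hence in \<open>KU\<close>, which
  meets V \<otimes> kG trivially. With it gone, the same argument applies to the part in kG.\<close>

lemma low_zero:
  assumes c: "c \<in> carrier kG" and mem: "iV f + iG c \<in> I"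
  shows "h \<in> carrier G \<Longrightarrow> f h = 0" "c = 0"
proof -
  have "iV f + iG c \<in> TUf 1"
    using c by (auto simp: bimod_filt_iff lin_map_add[OF lin_map_restr_supp] hU_iV hU_iG)
  from hU_in_gr_ideal[OF ideal_I mem this] have "iV f \<in> KU"
    by (simp add: gr_I lin_map_add[OF lin_map_restr_supp] hU_iV hU_iG)
  then have f: "\<And>h. h \<in> carrier G \<Longrightarrow> f h = 0" by (simp add: iV_KU_iff)
  then show "h \<in> carrier G \<Longrightarrow> f h = 0" .
  have "iV f = iV (\<lambda>h. 0)" using f by (rule iV_cong)
  then have memc: "iG c \<in> I" using mem by simp
  have "iG c \<in> TUf 0" using c by (auto simp: bimod_filt_iff hU_iG)
  from hU_in_gr_ideal[OF ideal_I memc this] have "iG c \<in> KU" by (simp add: gr_I hU_0_iG)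
  then show "c = 0" using c by (intro iG_KU)
qed

lemma low_unique:
  assumes "c \<in> carrier kG" "c' \<in> carrier kG" "x - iV f - iG c \<in> I" "x - iV f' - iG c' \<in> I"
  shows "h \<in> carrier G \<Longrightarrow> f h = f' h" "c = c'"
proof -
  have "(x - iV f' - iG c') - (x - iV f - iG c) \<in> I" by (rule pv.subspace_diff[OF I_sub assms(4,3)])
  also have "(x - iV f' - iG c') - (x - iV f - iG c) = iV (\<lambda>h. f h - f' h) + iG (c - c')"
    by (simp add: iV_diff lin_map_diff[OF lin_map_iG])
  finally have mem: "iV (\<lambda>h. f h - f' h) + iG (c - c') \<in> I" .
  have c: "c - c' \<in> carrier kG" using assms by simp
  show "c = c'" using low_zero(2)[OF c mem] by simp
  show "f h = f' h" if "h \<in> carrier G" using low_zero(1)[OF c mem that] by simp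
qed

lemma kG_unique:
  assumes "c \<in> carrier kG" "c' \<in> carrier kG" "x - iG c \<in> I" "x - iG c' \<in> I"
  shows "c = c'"
  using low_unique(2)[of c c' x "\<lambda>h. 0" "\<lambda>h. 0"] assms by simp

lemma filt_zero_iG:
  assumes z: "z \<in> TUf 0"
  shows "\<exists>c\<in>carrier kG. z = iG c"
proof
  let ?c = "lin_ext (\<lambda>u. bvec (fst u)) z"
  have k: "fst u \<in> carrier G \<and> snd u = []" if "u \<in> Poly_Mapping.keys z" for u
    using that z by (auto simp: bimod_filt_def carrier_monoid_alg)
  show "?c \<in> carrier kG"
    by (rule lin_ext_in_subspace[OF subspace_carrier_monoid_alg]) (use k in auto)
  have "iG ?c = lin_ext (\<lambda>u. iG (bvec (fst u))) z" by (rule lin_map_lin_ext_commute[OF lin_map_iG])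
  also have "\<dots> = lin_ext bvec z" 
  proof (rule lin_ext_cong)
    fix u assume "u \<in> Poly_Mapping.keys z"
    then show "iG (bvec (fst u)) = bvec u" using k[of u] by (cases u) simp
  qed
  finally show "z = iG ?c" by simp
qed

text \<open>The undeformed skew relation lies in \<open>KU\<close>, so it is the leading form of a
  member of I; their difference has degree zero and is therefore an element of kG.\<close>

lemma lam_exists:
  assumes g: "g \<in> carrier G"
  shows "\<exists>c. c \<in> carrier kG \<and> trip g v \<one> - trip \<one> (act g v) g - iG c \<in> I"
proof -
  let ?x = "trip g v \<one> - trip \<one> (act g v) g"
  have h: "hU n ?x = (if n = 1 then ?x else 0)" for n
    by (simp add: lin_map_diff[OF lin_map_restr_supp] hU_trip)
  have xc: "?x \<in> carrier TU" using g by simp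
  have "?x \<in> gr_ideal I" using skew_gens_KU g unfolding gr_I by (auto simp: skew_gens_def)
  then obtain y where y: "y \<in> I" "y \<in> TUf 1" "hU 1 y = hU 1 ?x" unfolding gr_ideal_def by blast
  have "?x \<in> TUf (Suc 0)" unfolding bimod_filt_iff using xc h by simp
  then have "?x - y \<in> TUf (Suc 0)"
    using y(2) unfolding One_nat_def by (rule pv.subspace_diff[OF subspace_bimod_filt])
  then have "?x - y \<in> TUf 0"
    by (rule bimod_filt_Suc) (use y(3) in \<open>simp add: lin_map_diff[OF lin_map_restr_supp]\<close>)
  then obtain c where "c \<in> carrier kG" "?x - y = iG c" using filt_zero_iG by blast
  moreover have "?x - (?x - y) \<in> I" using y(1) by simp
  ultimately show ?thesis by metis
qed

text \<open>The choice is unique by \<open>kG_unique\<close>; uniqueness is also what yields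
  linearity in v.\<close>

definition lamI :: "'g \<Rightarrow> 'v \<Rightarrow> ('g \<Rightarrow>\<^sub>0 'k)" where
  "lamI g v = (SOME c. c \<in> carrier kG \<and> trip g v \<one> - trip \<one> (act g v) g - iG c \<in> I)"

lemma lamI:
  assumes "g \<in> carrier G"
  shows "lamI g v \<in> carrier kG" "trip g v \<one> - trip \<one> (act g v) g - iG (lamI g v) \<in> I"
  using someI_ex[OF lam_exists[OF assms, of v]] by (simp_all add: lamI_def)

lemma skew_in_I: "skew_in I lamI"
  using lamI ideal_I by (auto simp: skew_in_def)

lemma is_lam_lamI: "is_lam scale G lamI"
  unfolding is_lam_def
proof (intro ballI conjI allI)
  fix g v w c assume g: "g \<in> carrier G"
  show "lamI g v \<in> carrier kG" by (rule lamI(1)[OF g])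
  show "lamI g (v + w) = lamI g v + lamI g w"
  proof (rule kG_unique[OF lamI(1)[OF g] _ lamI(2)[OF g]])
    show "lamI g v + lamI g w \<in> carrier kG" using lamI(1)[OF g] by blast
    have "trip g (v + w) \<one> - trip \<one> (act g (v + w)) g - iG (lamI g v + lamI g w)
      = (trip g v \<one> - trip \<one> (act g v) g - iG (lamI g v)) + (trip g w \<one> - trip \<one> (act g w) g - iG (lamI g w))"
      using g by (simp add: trip_add act_add lin_map_add[OF lin_map_iG])
    then show "trip g (v + w) \<one> - trip \<one> (act g (v + w)) g - iG (lamI g v + lamI g w) \<in> I"
      using pv.subspace_add[OF I_sub] lamI(2)[OF g] by simp
  qed
  show "lamI g (scale c v) = c \<odot>\<^bsub>monoid_alg G\<^esub> lamI g v"
    unfolding monoid_alg_simps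
  proof (rule kG_unique[OF lamI(1)[OF g] _ lamI(2)[OF g]])
    show "pscale c (lamI g v) \<in> carrier kG" using lamI(1)[OF g] by blast
    have "trip g (scale c v) \<one> - trip \<one> (act g (scale c v)) g - iG (pscale c (lamI g v))
      = pscale c (trip g v \<one> - trip \<one> (act g v) g - iG (lamI g v))"
      using g by (simp add: trip_scale act_scale lin_map_pscale[OF lin_map_iG] pv.scale_right_diff_distrib)
    then show "trip g (scale c v) \<one> - trip \<one> (act g (scale c v)) g - iG (pscale c (lamI g v)) \<in> I"
      using pv.subspace_scale[OF I_sub] lamI(2)[OF g] by simp
  qed
qed

lemma cond1_lamI: "cond1 G act lamI"
  unfolding cond1_def
proof (intro ballI allI)
  fix g h v assume g: "g \<in> carrier G" and h: "h \<in> carrier G"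
  let ?s = "\<lambda>g v. trip g v \<one> - trip \<one> (act g v) g - iG (lamI g v)"
  let ?c = "bvec g \<otimes>\<^bsub>kG\<^esub> lamI h v - lamI (g \<otimes> h) v + lamI g (act h v) \<otimes>\<^bsub>kG\<^esub> bvec h"
  have c: "?c \<in> carrier kG"
    by (intro monoid_alg_carrier_closed monoid_alg_closed lamI(1) single_in_carrier m_closed g h)
  have bg: "bvec (g, []) \<in> carrier TU" "bvec (h, []) \<in> carrier TU" using g h by auto
  \<comment> \<open>Moving g h past v at once or in two steps: the terms of degree one cancel, and
    the element of kG that remains lies in I.\<close>
  have "?s (g \<otimes> h) v - bvec (g, []) \<otimes>\<^bsub>TU\<^esub> ?s h v - ?s g (act h v) \<otimes>\<^bsub>TU\<^esub> bvec (h, []) \<in> I"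
    using g h by (intro pv.subspace_diff[OF I_sub] ideal_TU(2,3)[OF ideal_I] lamI(2) bg) auto
  also have "?s (g \<otimes> h) v - bvec (g, []) \<otimes>\<^bsub>TU\<^esub> ?s h v - ?s g (act h v) \<otimes>\<^bsub>TU\<^esub> bvec (h, []) = iV (\<lambda>a. 0) + iG ?c"
    using g h by (simp add: mult_distribs trip_factor act_mult lin_map_add[OF lin_map_iG] lin_map_diff[OF lin_map_iG] iG_mult)
  finally have "iV (\<lambda>a. 0) + iG ?c \<in> I" .
  from low_zero(2)[OF c this] show "Poly_Mapping.single g 1 \<otimes>\<^bsub>monoid_alg G\<^esub> lamI h v - lamI (g \<otimes> h) v
      + lamI g (act h v) \<otimes>\<^bsub>monoid_alg G\<^esub> Poly_Mapping.single h 1 = 0" .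
qed

text \<open>In degree at most one, a single skew relation multiplied by a group element on the right
  suffices to bring a word into the form V \<otimes> kG modulo I.\<close>

lemma low_form:
  assumes z: "z \<in> TUf 1"
  shows "\<exists>f. \<exists>c\<in>carrier kG. z - iV f - iG c \<in> I"
proof -
  let ?D = "{z. \<exists>f. \<exists>c\<in>carrier kG. z - iV f - iG c \<in> I}"
  have "pv.subspace ?D"
  proof (rule pv.subspaceI)
    show "0 \<in> ?D"
      using pv.subspace_0[OF I_sub]
      by (intro CollectI exI[of _ "\<lambda>a. 0"] bexI[of _ 0]) (simp_all add: lin_map_0[OF lin_map_iG])
    show "x + y \<in> ?D" if xy: "x \<in> ?D" "y \<in> ?D" for x y
    proof -
      obtain f c f' c' where a: "c \<in> carrier kG" "x - iV f - iG c \<in> I" "c' \<in> carrier kG" "y - iV f' - iG c' \<in> I"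
        using xy by blast
      have "(x - iV f - iG c) + (y - iV f' - iG c') \<in> I" by (rule pv.subspace_add[OF I_sub a(2,4)])
      also have "(x - iV f - iG c) + (y - iV f' - iG c') = x + y - iV (\<lambda>a. f a + f' a) - iG (c + c')"
        by (simp add: iV_add lin_map_add[OF lin_map_iG])
      finally have "x + y - iV (\<lambda>a. f a + f' a) - iG (c + c') \<in> I" .
      then show ?thesis using a by (intro CollectI exI[of _ "\<lambda>a. f a + f' a"] bexI[of _ "c + c'"]) auto
    qed
    show "pscale d x \<in> ?D" if x: "x \<in> ?D" for d x
    proof -
      obtain f c where a: "c \<in> carrier kG" "x - iV f - iG c \<in> I" using x by blast
      have "pscale d x - iV (\<lambda>a. scale d (f a)) - iG (pscale d c) = pscale d (x - iV f - iG c)"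
        by (simp add: iV_scale lin_map_pscale[OF lin_map_iG] pv.scale_right_diff_distrib)
      then have "pscale d x - iV (\<lambda>a. scale d (f a)) - iG (pscale d c) \<in> I" using pv.subspace_scale[OF I_sub] a by simp
      then show ?thesis using a by (intro CollectI exI[of _ "\<lambda>a. scale d (f a)"] bexI[of _ "pscale d c"]) auto
    qed
  qed
  moreover have "bvec u \<in> ?D" if u: "u \<in> Poly_Mapping.keys z" for u
  proof -
    obtain g xs where u': "u = (g, xs)" by (cases u)
    have gx: "g \<in> carrier G" "xs \<in> lists (B \<times> carrier G)" "length xs \<le> 1"
      using z u u' by (auto simp: bimod_filt_def carrier_monoid_alg)
    show ?thesis
    proof (cases xs)
      case Nil
      then show ?thesis using gx pv.subspace_0[OF I_sub] u'
        by (intro CollectI exI[of _ "\<lambda>a. 0"] bexI[of _ "bvec g"]) auto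
    next
      case (Cons p ys)
      then obtain b h where xs: "xs = [(b, h)]" and b: "b \<in> B" and h: "h \<in> carrier G" using gx by (cases p) auto
      let ?f = "\<lambda>a. if a = g \<otimes> h then act g b else 0" and ?c = "lamI g b \<otimes>\<^bsub>kG\<^esub> bvec h"
      have "(trip g b \<one> - trip \<one> (act g b) g - iG (lamI g b)) \<otimes>\<^bsub>TU\<^esub> bvec (h, []) \<in> I"
        using gx(1) h by (intro ideal_TU(2)[OF ideal_I] lamI(2)) auto
      also have "(trip g b \<one> - trip \<one> (act g b) g - iG (lamI g b)) \<otimes>\<^bsub>TU\<^esub> bvec (h, []) = bvec u - iV ?f - iG ?c"
        using gx(1) h b by (simp add: mult_distribs trip_factor iG_mult iV_single trip_Basis u' xs bimod_words_mult_Cons)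
      finally have "bvec u - iV ?f - iG ?c \<in> I" .
      moreover have "?c \<in> carrier kG" using gx(1) h by (intro monoid_alg_closed lamI(1)) auto
      ultimately show ?thesis by blast
    qed
  qed
  ultimately have "z \<in> ?D" by (rule in_subspace_if_bvecs)
  then show ?thesis by blast
qed

text \<open>The relation r is the leading form of a member of I. Subtracting that member leaves
  degree at most one, and \<open>low_form\<close> supplies the two lower parts.\<close>

lemma alpha_beta_exist:
  assumes r: "r \<in> R"
  shows "\<exists>p. snd p \<in> carrier kG \<and> iT r - iV (fst p) - iG (snd p) \<in> I"
proof -
  have h: "hU n (iT r) = (if n = 2 then iT r else 0)" for n
    by (simp add: hU_iT R_hT[OF r] lin_map_0[OF lin_map_iT])
  have xc: "iT r \<in> carrier TU" using r R_carrier by blast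
  have "iT r \<in> gr_ideal I" using iT_R_KU r unfolding gr_I by blast
  then obtain y where y: "y \<in> I" "y \<in> TUf 2" "hU 2 y = hU 2 (iT r)" unfolding gr_ideal_def by blast
  have "iT r - y \<in> TUf (Suc 1)"
    using y(2) xc h by (intro pv.subspace_diff[OF subspace_bimod_filt]) (auto simp: bimod_filt_iff numeral_2_eq_2)
  then have "iT r - y \<in> TUf 1"
    by (rule bimod_filt_Suc) (use y(3) in \<open>simp add: lin_map_diff[OF lin_map_restr_supp] numeral_2_eq_2\<close>)
  then obtain f c where c: "c \<in> carrier kG" "(iT r - y) - iV f - iG c \<in> I" using low_form by blast
  have "((iT r - y) - iV f - iG c) + y \<in> I" using pv.subspace_add[OF I_sub c(2) y(1)] .
  also have "((iT r - y) - iV f - iG c) + y = iT r - iV f - iG c" by simp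
  finally show ?thesis using c(1) by (intro exI[of _ "(f, c)"]) simp
qed

text \<open>The two values are chosen together because they correct the same relation. By
  \<open>low_unique\<close> the second is determined, and the first is determined on G.\<close>

definition abI :: "('v list \<Rightarrow>\<^sub>0 'k) \<Rightarrow> ('g \<Rightarrow> 'v) \<times> ('g \<Rightarrow>\<^sub>0 'k)" where
  "abI r = (SOME p. snd p \<in> carrier kG \<and> iT r - iV (fst p) - iG (snd p) \<in> I)"

abbreviation "alphaI r \<equiv> fst (abI r)"
abbreviation "betaI r \<equiv> snd (abI r)"

lemma abI:
  assumes "r \<in> R"
  shows "betaI r \<in> carrier kG" "iT r - iV (alphaI r) - iG (betaI r) \<in> I"
  using someI_ex[OF alpha_beta_exist[OF assms]] by (simp_all add: abI_def)

lemma rel_I: "r \<in> R \<Longrightarrow> rel alphaI betaI r \<in> I"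
  using abI(2) by (simp add: rel_def)

lemma abI_add:
  assumes r: "r \<in> R" and s: "s \<in> R"
  shows "g \<in> carrier G \<Longrightarrow> alphaI (r + s) g = alphaI r g + alphaI s g" "betaI (r + s) = betaI r + betaI s"
proof -
  have rs: "r + s \<in> R" using pv.subspace_add[OF R_subspace r s] .
  have "iT (r + s) - iV (\<lambda>g. alphaI r g + alphaI s g) - iG (betaI r + betaI s)
    = (iT r - iV (alphaI r) - iG (betaI r)) + (iT s - iV (alphaI s) - iG (betaI s))"
    by (simp add: iV_add lin_map_add[OF lin_map_iG] lin_map_add[OF lin_map_iT])
  then have mem: "iT (r + s) - iV (\<lambda>g. alphaI r g + alphaI s g) - iG (betaI r + betaI s) \<in> I"
    using pv.subspace_add[OF I_sub abI(2)[OF r] abI(2)[OF s]] by simp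
  have c: "betaI r + betaI s \<in> carrier kG" using abI(1) r s by blast
  show "betaI (r + s) = betaI r + betaI s" by (rule low_unique(2)[OF abI(1)[OF rs] c abI(2)[OF rs] mem])
  show "alphaI (r + s) g = alphaI r g + alphaI s g" if "g \<in> carrier G"
    by (rule low_unique(1)[OF abI(1)[OF rs] c abI(2)[OF rs] mem that])
qed

lemma abI_scale:
  assumes r: "r \<in> R"
  shows "g \<in> carrier G \<Longrightarrow> alphaI (pscale d r) g = scale d (alphaI r g)" "betaI (pscale d r) = pscale d (betaI r)"
proof -
  have rs: "pscale d r \<in> R" using pv.subspace_scale[OF R_subspace r] .
  have "iT (pscale d r) - iV (\<lambda>g. scale d (alphaI r g)) - iG (pscale d (betaI r))
    = pscale d (iT r - iV (alphaI r) - iG (betaI r))"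
    by (simp add: iV_scale lin_map_pscale[OF lin_map_iG] lin_map_pscale[OF lin_map_iT] pv.scale_right_diff_distrib)
  then have mem: "iT (pscale d r) - iV (\<lambda>g. scale d (alphaI r g)) - iG (pscale d (betaI r)) \<in> I"
    using pv.subspace_scale[OF I_sub abI(2)[OF r]] by simp
  have c: "pscale d (betaI r) \<in> carrier kG" using abI(1)[OF r] by blast
  show "betaI (pscale d r) = pscale d (betaI r)" by (rule low_unique(2)[OF abI(1)[OF rs] c abI(2)[OF rs] mem])
  show "alphaI (pscale d r) g = scale d (alphaI r g)" if "g \<in> carrier G"
    by (rule low_unique(1)[OF abI(1)[OF rs] c abI(2)[OF rs] mem that])
qed

lemma is_alpha_alphaI: "is_alpha scale B G R alphaI" and is_beta_betaI: "is_beta B G R betaI"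
  by (auto simp: is_alpha_def is_beta_def abI_add abI_scale abI(1))

lemmas params = is_alpha_alphaI is_beta_betaI is_lam_lamI

text \<open>Both g times the relation of r and the relation of \<open>aT g r\<close> times g lie in
  I, so the remainder of \<open>rel_group\<close> does too. It has degree at most one, and
  \<open>low_zero\<close> applies.\<close>

lemma group_coeffs_zero:
  assumes g: "g \<in> carrier G" and r: "tens2 scale B n v w \<in> R"
  shows "a \<in> carrier G \<Longrightarrow> coeff3 alphaI lamI g n v w a = 0"
    "(\<Sum>a\<in>carrier G. lamI g (alphaI (tens2 scale B n v w) a) \<otimes>\<^bsub>kG\<^esub> bvec a) - (\<Sum>i<n. lam_ext G lamI (lamI g (v i)) (w i))
      + bvec g \<otimes>\<^bsub>kG\<^esub> betaI (tens2 scale B n v w) - betaI (aT g (tens2 scale B n v w)) \<otimes>\<^bsub>kG\<^esub> bvec g = 0"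
proof -
  let ?r = "tens2 scale B n v w"
  let ?c = "(\<Sum>a\<in>carrier G. lamI g (alphaI ?r a) \<otimes>\<^bsub>kG\<^esub> bvec a) - (\<Sum>i<n. lam_ext G lamI (lamI g (v i)) (w i))
      + bvec g \<otimes>\<^bsub>kG\<^esub> betaI ?r - betaI (aT g ?r) \<otimes>\<^bsub>kG\<^esub> bvec g"
  have gr: "aT g ?r \<in> R" using R_act[OF g] r by blast
  have bg: "bvec (g, []) \<in> carrier TU" using g by auto
  have le: "lam_ext G lamI x y \<in> carrier kG" if "x \<in> carrier kG" for x y
    unfolding lam_ext_eq using that
    by (intro lin_ext_in_subspace[OF subspace_carrier_monoid_alg] lamI(1)) (auto simp: carrier_monoid_alg)
  have c: "?c \<in> carrier kG"
    by (intro monoid_alg_carrier_closed monoid_alg_sum_closed monoid_alg_closed lamI(1) le abI(1) single_in_carrier g gr r)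
  have "bvec (g, []) \<otimes>\<^bsub>TU\<^esub> rel alphaI betaI ?r - (rel alphaI betaI (aT g ?r) \<otimes>\<^bsub>TU\<^esub> bvec (g, [])
    - iV (coeff3 alphaI lamI g n v w) - iG ?c) \<in> I"
    using rel_group[OF params skew_in_I g refl, of n v w] unfolding cong_mod_def .
  moreover have "bvec (g, []) \<otimes>\<^bsub>TU\<^esub> rel alphaI betaI ?r \<in> I" and rg: "rel alphaI betaI (aT g ?r) \<otimes>\<^bsub>TU\<^esub> bvec (g, []) \<in> I"
    using rel_I[OF r] rel_I[OF gr] bg by (auto intro: ideal_TU(2,3)[OF ideal_I])
  ultimately have "rel alphaI betaI (aT g ?r) \<otimes>\<^bsub>TU\<^esub> bvec (g, []) - iV (coeff3 alphaI lamI g n v w) - iG ?c \<in> I"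
    using subspace_mem_diff_iff[OF I_sub] by blast
  from pv.subspace_diff[OF I_sub rg this]
  have "rel alphaI betaI (aT g ?r) \<otimes>\<^bsub>TU\<^esub> bvec (g, [])
    - (rel alphaI betaI (aT g ?r) \<otimes>\<^bsub>TU\<^esub> bvec (g, []) - iV (coeff3 alphaI lamI g n v w) - iG ?c) \<in> I" .
  also have "rel alphaI betaI (aT g ?r) \<otimes>\<^bsub>TU\<^esub> bvec (g, [])
    - (rel alphaI betaI (aT g ?r) \<otimes>\<^bsub>TU\<^esub> bvec (g, []) - iV (coeff3 alphaI lamI g n v w) - iG ?c)
    = iV (coeff3 alphaI lamI g n v w) + iG ?c"
    by simp
  finally have mem: "iV (coeff3 alphaI lamI g n v w) + iG ?c \<in> I" .
  show "a \<in> carrier G \<Longrightarrow> coeff3 alphaI lamI g n v w a = 0" by (rule low_zero(1)[OF c mem])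
  show "?c = 0" by (rule low_zero(2)[OF c mem])
qed

lemma cond2_I: "cond2 scale B G act R alphaI betaI lamI"
  using group_coeffs_zero(2) by (auto simp: cond2_def Let_def algebra_simps)

lemma cond3_I: "cond3 scale B G act R alphaI lamI"
  unfolding cond3_coeff[OF params] using group_coeffs_zero(1) by blast

lemma overlap_in_I:
  assumes o: "overlap scale B R n r v m u s"
  shows "(\<Sum>j<m. trip \<one> (u j) \<one> \<otimes>\<^bsub>TU\<^esub> rel alphaI betaI (s j)) - (\<Sum>i<n. rel alphaI betaI (r i) \<otimes>\<^bsub>TU\<^esub> trip \<one> (v i) \<one>) \<in> I"
  using overlap_R[OF params o]
  by (intro pv.subspace_diff[OF I_sub] pv.subspace_sum[OF I_sub] ideal_TU(2,3)[OF ideal_I] rel_I) auto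

text \<open>The two reductions of an overlap differ by a member of I of degree at most two with
  \<open>elt6\<close> in degree two, so \<open>elt6\<close> is a leading form. This precedes the
  fourth and fifth conditions, which use that \<open>alpha_diff\<close> lies in R.\<close>

lemma cond6_I: "cond6 scale B G act R alphaI"
  unfolding cond6_iff[OF params]
proof (intro allI impI)
  fix n r v m u s assume o: "overlap scale B R n r v m u s"
  note R = overlap_R[OF params o]
  let ?e = "elt6 alphaI n r v m u s"
  let ?w = "(\<Sum>i<n. iG (betaI (r i)) \<otimes>\<^bsub>TU\<^esub> trip \<one> (v i) \<one>) - (\<Sum>j<m. trip \<one> (u j) \<one> \<otimes>\<^bsub>TU\<^esub> iG (betaI (s j)))"
  have "(\<Sum>j<m. trip \<one> (u j) \<one> \<otimes>\<^bsub>TU\<^esub> iT (s j)) = iT (\<Sum>j<m. vT (u j) \<otimes>\<^bsub>TV\<^esub> s j)"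
    by (simp add: lin_map_sum[OF lin_map_iT] iT_mult iT_vT)
  also have "\<dots> = iT (\<Sum>i<n. r i \<otimes>\<^bsub>TV\<^esub> vT (v i))" using o by (simp add: overlap_def)
  also have "\<dots> = (\<Sum>i<n. iT (r i) \<otimes>\<^bsub>TU\<^esub> trip \<one> (v i) \<one>)"
    by (simp add: lin_map_sum[OF lin_map_iT] iT_mult iT_vT)
  finally have "(\<Sum>j<m. trip \<one> (u j) \<one> \<otimes>\<^bsub>TU\<^esub> rel alphaI betaI (s j)) - (\<Sum>i<n. rel alphaI betaI (r i) \<otimes>\<^bsub>TU\<^esub> trip \<one> (v i) \<one>)
    = ?e + ?w"
    by (simp add: rel_def elt6_def mult_distribs sum_subtractf)
  then have mem: "?e + ?w \<in> I" using overlap_in_I[OF o] by simp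
  have e: "hU i ?e = (if i = 2 then ?e else 0)" for i
  proof -
    have "hU i (iV f \<otimes>\<^bsub>TU\<^esub> trip \<one> x \<one>) = (if i = 2 then iV f \<otimes>\<^bsub>TU\<^esub> trip \<one> x \<one> else 0)" for f x
      by (subst hU_mult_right[of 1]) (auto simp: hU_trip hU_iV)
    moreover have "hU i (trip \<one> x \<one> \<otimes>\<^bsub>TU\<^esub> iV f) = (if i = 2 then trip \<one> x \<one> \<otimes>\<^bsub>TU\<^esub> iV f else 0)" for f x
      by (subst hU_mult_right[of 1]) (auto simp: hU_trip hU_iV)
    ultimately show ?thesis
      by (simp add: elt6_def lin_map_diff[OF lin_map_restr_supp] lin_map_sum[OF lin_map_restr_supp])
  qed
  have w: "hU i ?w = (if i = 1 then ?w else 0)" for i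
  proof -
    have "hU i (iG c \<otimes>\<^bsub>TU\<^esub> trip \<one> x \<one>) = (if i = 1 then iG c \<otimes>\<^bsub>TU\<^esub> trip \<one> x \<one> else 0)" for c x
      by (subst hU_mult_right[of 1]) (auto simp: hU_trip hU_iG hU_0_iG)
    moreover have "hU i (trip \<one> x \<one> \<otimes>\<^bsub>TU\<^esub> iG c) = (if i = 1 then trip \<one> x \<one> \<otimes>\<^bsub>TU\<^esub> iG c else 0)" for c x
      by (subst hU_mult_right[of 0]) (auto simp: hU_trip hU_iG hU_0_iG)
    ultimately show ?thesis
      by (simp add: lin_map_diff[OF lin_map_restr_supp] lin_map_sum[OF lin_map_restr_supp])
  qed
  have "?e + ?w \<in> TUf 2"
    using ideal_TU(4)[OF ideal_I mem] by (simp add: bimod_filt_iff lin_map_add[OF lin_map_restr_supp] e w)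
  from hU_in_gr_ideal[OF ideal_I mem this] show "?e \<in> KU"
    by (simp add: gr_I lin_map_add[OF lin_map_restr_supp] e w)
qed

text \<open>By \<open>cond6_I\<close> the relations for \<open>alpha_diff\<close> belong to I.
  Removing them from \<open>rel_overlap\<close> leaves a member of I in degree at most one, which is
  zero by \<open>low_zero\<close>.\<close>

lemma overlap_coeffs_zero:
  assumes o: "overlap scale B R n r v m u s"
  shows "a \<in> carrier G \<Longrightarrow> coeff4 alphaI betaI lamI n r v m u s a = 0"
    "(\<Sum>h\<in>carrier G. betaI (alpha_diff scale B act alphaI n r v m u s h) \<otimes>\<^bsub>kG\<^esub> bvec h)
       + (\<Sum>i<n. lam_ext G lamI (betaI (r i)) (v i)) = 0"
proof -
  let ?d = "alpha_diff scale B act alphaI n r v m u s"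
  let ?c = "(\<Sum>h\<in>carrier G. betaI (?d h) \<otimes>\<^bsub>kG\<^esub> bvec h) + (\<Sum>i<n. lam_ext G lamI (betaI (r i)) (v i))"
  let ?y = "(\<Sum>j<m. trip \<one> (u j) \<one> \<otimes>\<^bsub>TU\<^esub> rel alphaI betaI (s j)) - (\<Sum>i<n. rel alphaI betaI (r i) \<otimes>\<^bsub>TU\<^esub> trip \<one> (v i) \<one>)"
  let ?z = "\<Sum>h\<in>carrier G. rel alphaI betaI (?d h) \<otimes>\<^bsub>TU\<^esub> bvec (h, [])"
  have d: "?d h \<in> R" if "h \<in> carrier G" for h
    using cond6_I[unfolded cond6_coeff[OF params]] o that by blast
  have le: "lam_ext G lamI x y \<in> carrier kG" if "x \<in> carrier kG" for x y
    unfolding lam_ext_eq using that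
    by (intro lin_ext_in_subspace[OF subspace_carrier_monoid_alg] lamI(1)) (auto simp: carrier_monoid_alg)
  have c: "?c \<in> carrier kG"
    by (intro monoid_alg_carrier_closed monoid_alg_sum_closed monoid_alg_closed le abI(1) single_in_carrier d
        overlap_R(1)[OF params o]) auto
  have z: "?z \<in> I"
    by (intro pv.subspace_sum[OF I_sub] ideal_TU(2)[OF ideal_I] rel_I d) auto
  have "?y - (?z + iV (coeff4 alphaI betaI lamI n r v m u s) + iG ?c) \<in> I"
    using rel_overlap[OF params skew_in_I o] unfolding cong_mod_def .
  then have "?z + iV (coeff4 alphaI betaI lamI n r v m u s) + iG ?c \<in> I"
    using subspace_mem_diff_iff[OF I_sub] overlap_in_I[OF o] by blast
  from pv.subspace_diff[OF I_sub this z]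
  have "?z + iV (coeff4 alphaI betaI lamI n r v m u s) + iG ?c - ?z \<in> I" .
  also have "?z + iV (coeff4 alphaI betaI lamI n r v m u s) + iG ?c - ?z
    = iV (coeff4 alphaI betaI lamI n r v m u s) + iG ?c"
    by (simp only: add.assoc add_diff_cancel_left')
  finally have mem: "iV (coeff4 alphaI betaI lamI n r v m u s) + iG ?c \<in> I" .
  show "a \<in> carrier G \<Longrightarrow> coeff4 alphaI betaI lamI n r v m u s a = 0" by (rule low_zero(1)[OF c mem])
  show "?c = 0" by (rule low_zero(2)[OF c mem])
qed

lemma cond4_I: "cond4 scale B G act R alphaI betaI lamI"
  unfolding cond4_coeff[OF params] using overlap_coeffs_zero(1) by blast

lemma cond5_I: "cond5 scale B G act R alphaI betaI lamI"
  unfolding cond5_def by (intro allI impI) (rule eq_neg_iff_add_eq_0[THEN iffD2, OF overlap_coeffs_zero(2)])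

text \<open>The chosen relations already produce all leading forms of I, namely \<open>KU\<close>.
  Hence a member of I can be lowered in degree step by step by members of the ideal they
  generate.\<close>

lemma Idl_deform_rels: "Idl\<^bsub>TU\<^esub> (deform_rels scale B G act R alphaI betaI lamI) = I"
proof
  let ?P = "deform_rels scale B G act R alphaI betaI lamI"
  let ?N = "Idl\<^bsub>TU\<^esub> ?P"
  have P: "?P \<subseteq> I" using abI(2) lamI(2) by (auto simp: deform_rels_def)
  then have Pc: "?P \<subseteq> carrier TU" using ideal_TU(4)[OF ideal_I] by blast
  note N = BM.Idl_monoid_alg[OF Pc]
  show NI: "?N \<subseteq> I" by (rule TUR.genideal_minimal[OF ideal_I P])
  have "trip g v \<one> - trip \<one> (act g v) g - iG (lamI g v) \<in> ?N" if "g \<in> carrier G" for g v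
    using that by (intro subsetD[OF N(2)]) (auto simp: deform_rels_def)
  then have "skew_in ?N lamI" using N(1) lamI(1) by (auto simp: skew_in_def)
  moreover have "rel alphaI betaI r \<in> ?N" if "r \<in> R" for r
    using that by (intro subsetD[OF N(2)]) (auto simp: deform_rels_def rel_def)
  ultimately have K: "KU \<subseteq> gr_ideal ?N"
    using KU_subset_gr_ideal[of ?N lamI betaI alphaI] abI(1) by blast
  have "y \<in> ?N" if "y \<in> I" "y \<in> TUf n" for y n
    using that
  proof (induction n arbitrary: y)
    case (0 y)
    have "hU 0 y \<in> gr_ideal ?N" using hU_in_gr_ideal[OF ideal_I 0] K gr_I by blast
    then obtain z where z: "z \<in> ?N" "z \<in> TUf 0" "hU 0 z = hU 0 (hU 0 y)" unfolding gr_ideal_def by blast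
    then have "y = z" using filt_zero_hU[OF 0(2)] filt_zero_hU[OF z(2)] by simp
    then show ?case using z(1) by simp
  next
    case (Suc n y)
    have "hU (Suc n) y \<in> gr_ideal ?N" using hU_in_gr_ideal[OF ideal_I Suc.prems] K gr_I by blast
    then obtain z where z: "z \<in> ?N" "z \<in> TUf (Suc n)" "hU (Suc n) z = hU (Suc n) (hU (Suc n) y)"
      unfolding gr_ideal_def by blast
    have "y - z \<in> TUf (Suc n)" using Suc.prems(2) z(2) by (rule pv.subspace_diff[OF subspace_bimod_filt])
    then have "y - z \<in> TUf n"
      by (rule bimod_filt_Suc) (use z(3) in \<open>simp add: lin_map_diff[OF lin_map_restr_supp]\<close>)
    moreover have "y - z \<in> I" using Suc.prems(1) z(1) NI pv.subspace_diff[OF I_sub] by blast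
    ultimately have "y - z \<in> ?N" by (intro Suc.IH)
    then show ?case using pv.subspace_add[OF N(3) _ z(1), of "y - z"] by simp
  qed
  then show "I \<subseteq> ?N" using bimod_filt_exists ideal_TU(4)[OF ideal_I] by blast
qed

end

section \<open>Assembly of the equivalence\<close>

theorem (in quad_setup) pbw_deformation_iff:
  assumes koszul: "koszul (quad_alg B R) (quad_comp B R)" and H: "filtered_algebra H F"
  shows "pbw_deformation scale B G act R H F \<longleftrightarrow>
    (\<exists>\<alpha> \<beta> lam. is_alpha scale B G R \<alpha> \<and> is_beta B G R \<beta> \<and> is_lam scale G lam
       \<and> cond1 G act lam
       \<and> cond2 scale B G act R \<alpha> \<beta> lam
       \<and> cond3 scale B G act R \<alpha> lam
       \<and> cond4 scale B G act R \<alpha> \<beta> lam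
       \<and> cond5 scale B G act R \<alpha> \<beta> lam
       \<and> cond6 scale B G act R \<alpha>
       \<and> filtered_isomorphic H F
           (deform_alg scale B G act R \<alpha> \<beta> lam) (deform_filt scale B G act R \<alpha> \<beta> lam))"
proof
  assume "pbw_deformation scale B G act R H F"
  then obtain P where P: "P \<subseteq> carrier TU"
    and iso: "filtered_isomorphic H F (alg_quot TU (Idl\<^bsub>TU\<^esub> P)) (quot_image TU (Idl\<^bsub>TU\<^esub> P) TUf)"
    and lead: "Idl\<^bsub>TU\<^esub> (leading_comps G B P) = KU"
    and gr: "graded_isomorphic (assoc_graded H F) (assoc_graded_comp H F) AA (skew_quad_comp scale B G act R)"
    unfolding pbw_deformation_def by (auto simp: KU_eq_Idl)
  let ?I = "Idl\<^bsub>TU\<^esub> P"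
  note I = BM.Idl_monoid_alg(1,2)[OF P]
  obtain q where "filt_quot scale B G act R H F q ?I" using filt_quot_of_iso[OF H I(1) iso] by blast
  then interpret Q: filt_quot scale B G act R H F q ?I .
  \<comment> \<open>The given presentation P may be any; its leading components generate K, but the
    ideal can have further leading forms. The graded isomorphism excludes these.\<close>
  have "KU \<subseteq> gr_ideal ?I"
    unfolding lead[symmetric] by (rule TUR.genideal_minimal[OF ideal_gr_ideal[OF I(1)] leading_comps_gr_ideal[OF I]])
  then have "gr_ideal ?I = KU" by (rule Q.gr_ideal_eq_KU[OF _ gr])
  then interpret D: graded_ideal scale B G act R ?I 
    using I(1) by (intro graded_ideal.intro graded_ideal_axioms.intro quad_setup_axioms)
  have "filtered_isomorphic H F (deform_alg scale B G act R D.alphaI D.betaI D.lamI) (deform_filt scale B G act R D.alphaI D.betaI D.lamI)"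
    using iso by (simp add: deform_alg_def deform_filt_def D.Idl_deform_rels)
  then show "\<exists>\<alpha> \<beta> lam. is_alpha scale B G R \<alpha> \<and> is_beta B G R \<beta> \<and> is_lam scale G lam
       \<and> cond1 G act lam \<and> cond2 scale B G act R \<alpha> \<beta> lam \<and> cond3 scale B G act R \<alpha> lam
       \<and> cond4 scale B G act R \<alpha> \<beta> lam \<and> cond5 scale B G act R \<alpha> \<beta> lam \<and> cond6 scale B G act R \<alpha>
       \<and> filtered_isomorphic H F (deform_alg scale B G act R \<alpha> \<beta> lam) (deform_filt scale B G act R \<alpha> \<beta> lam)"
    by (intro exI conjI) (rule D.params D.cond1_lamI D.cond2_I D.cond3_I D.cond4_I D.cond5_I D.cond6_I | assumption)+
next
  assume "\<exists>\<alpha> \<beta> lam. is_alpha scale B G R \<alpha> \<and> is_beta B G R \<beta> \<and> is_lam scale G lam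
       \<and> cond1 G act lam \<and> cond2 scale B G act R \<alpha> \<beta> lam \<and> cond3 scale B G act R \<alpha> lam
       \<and> cond4 scale B G act R \<alpha> \<beta> lam \<and> cond5 scale B G act R \<alpha> \<beta> lam \<and> cond6 scale B G act R \<alpha>
       \<and> filtered_isomorphic H F (deform_alg scale B G act R \<alpha> \<beta> lam) (deform_filt scale B G act R \<alpha> \<beta> lam)"
  then obtain \<alpha> \<beta> lam where *: "is_alpha scale B G R \<alpha>" "is_beta B G R \<beta>" "is_lam scale G lam"
       "cond1 G act lam" "cond2 scale B G act R \<alpha> \<beta> lam" "cond3 scale B G act R \<alpha> lam"
       "cond4 scale B G act R \<alpha> \<beta> lam" "cond5 scale B G act R \<alpha> \<beta> lam" "cond6 scale B G act R \<alpha>"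
       "filtered_isomorphic H F (deform_alg scale B G act R \<alpha> \<beta> lam) (deform_filt scale B G act R \<alpha> \<beta> lam)"
    by blast
  interpret D: pbw_setup scale B G act R lam \<alpha> \<beta> using * koszul by unfold_locales
  show "pbw_deformation scale B G act R H F" by (rule D.pbw_deformation_if_iso[OF H *(10)])
qed

theorem theorem2p4:
  fixes scale :: "'k::field \<Rightarrow> 'v::ab_group_add \<Rightarrow> 'v"
    and B :: "'v set"
    and G :: "('g, 'z) monoid_scheme"
    and act :: "'g \<Rightarrow> 'v \<Rightarrow> 'v"
    and R :: "('v list \<Rightarrow>\<^sub>0 'k) set"
    and H :: "('k, 'h, 'm) module_scheme"
    and F :: "nat \<Rightarrow> 'h set"
  assumes "CHAR('k) \<noteq> 2"
    and "group G" and "finite (carrier G)"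
    and "finite_dimensional_vector_space scale B" and "is_rep scale G act"
    and "k_subspace (tensor_alg B) R" and "R \<subseteq> tensor_power B 2"
    and "\<forall>g\<in>carrier G. act_tensor scale B act g ` R \<subseteq> R"
    and "koszul (quad_alg B R) (quad_comp B R)"
    and "filtered_algebra H F"
  shows "pbw_deformation scale B G act R H F \<longleftrightarrow>
    (\<exists>\<alpha> \<beta> lam. is_alpha scale B G R \<alpha> \<and> is_beta B G R \<beta> \<and> is_lam scale G lam
       \<and> cond1 G act lam
       \<and> cond2 scale B G act R \<alpha> \<beta> lam
       \<and> cond3 scale B G act R \<alpha> lam
       \<and> cond4 scale B G act R \<alpha> \<beta> lam
       \<and> cond5 scale B G act R \<alpha> \<beta> lam
       \<and> cond6 scale B G act R \<alpha>
       \<and> filtered_isomorphic H F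
           (deform_alg scale B G act R \<alpha> \<beta> lam) (deform_filt scale B G act R \<alpha> \<beta> lam))"
proof -
  have "quad_setup scale B G act R"
    using assms(2-8)
    by (intro quad_setup.intro skew_setup.intro quad_setup_axioms.intro skew_setup_axioms.intro) (simp_all add: tensor_alg_def)
  then show ?thesis using assms(9,10) by (rule quad_setup.pbw_deformation_iff)
qed

end
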